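(* Let $k\in2\mathbb{N}$ be a positive even integer and let $\widehat{\mathbb{J}}_k:\mathbb{H}\to\mathbb{C}$ be the completed generating function of Joyce invariants defined in the context. For all $\left(\begin{smallmatrix} a&b\\c&d\end{smallmatrix}\right)\in \mathrm{SL}_2(\mathbb{Z})$ and all $\tau\in\mathbb{H}$, $$ \widehat{\mathbb J}_k\left(\frac{a\tau+b}{c\tau+d}\right) =(c\tau+d)^k\,\widehat{\mathbb J}_k(\tau). $$ Moreover, with $L=-2iv^2\frac{\partial}{\partial\overline{\tau}}$, we have $$ L\left(\widehat{\mathbb J}_k\right)(\tau)=-\frac{\delta_{k=2}}{8\pi}-\frac{i(k-1)}{8(2\pi i)^{k-1}} \sqrt{v} \left(\overline{\theta_1(2\tau)}\,\vartheta_{k-1, -1}(\tau)+\overline{\theta_3(2\tau)}\,\vartheta_{k-1, 0}(\tau)\right), $$ where, for $\ell\in\mathbb{N}$ and $\nu\in\{-1,0\}$, $$ \vartheta_{\ell, \nu}(\tau):=\left[\frac{\partial^{\ell-1}}{\partial z^{\ell-1}}\left(\vartheta\left(z+\nu\tau+\tfrac12; 2\tau\right)e^{\pi i\nu z} q^{\frac{\nu^2}{4}} e^{\frac{\pi z^2}{4v}}\right)\right]_{z=0} $$ is an almost holomorphic modular form of weight $\ell-\frac12$ on some congruence subgroup (with some multiplier).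
   Context: Notation: $\tau=u+iv\in\mathbb{H}$, $q=e^{2\pi i\tau}$ (and $q^\alpha=e^{2\pi i\alpha\tau}$), $\mathbb{N}=\{1,2,\dots\}$; $\delta_{k=2}$ is $1$ if $k=2$ and $0$ otherwise. $\frac{\partial}{\partial\tau},\frac{\partial}{\partial\overline\tau}$ are Wirtinger derivatives and $D=\frac{1}{2\pi i}\frac{\partial}{\partial\tau}$. For $k\in2\mathbb{N}$, $$\mathbb{J}_k(\tau)=\frac12\sum_{n\in\mathbb{Z}\setminus\{0\}}\frac{n^{k-1}q^{n^2}}{1-q^n}.$$ The Jacobi theta function is $\vartheta(z;\tau)=\sum_{n\in\frac12+\mathbb{Z}}e^{\pi i n^2\tau+2\pi i n\left(z+\frac12\right)}$. Set $\theta_1(\tau)=\sum_{n\in\mathbb{Z}}q^{\frac{n^2}{2}}$ and $\theta_3(\tau)=\sum_{n\in\mathbb{Z}}q^{\frac12\left(n+\frac12\right)^2}$. Let $\Gamma(\alpha,x)=\int_x^\infty e^{-t}t^{\alpha-1}dt$ be the incomplete Gamma function. For $\nu\in\{-1,0\}$ define $$\vartheta_\nu(\tau)=q^{\frac{\nu^2}{4}}\,\vartheta\left(\nu\tau+\tfrac12;2\tau\right),\qquad s_\nu(\tau)=\sqrt{\pi}\sum_{n\in\frac12+\mathbb{Z}}\left|n+\tfrac{\nu}{2}\right|\,\Gamma\left(-\tfrac12,4\pi\left(n+\tfrac{\nu}{2}\right)^2v\right)q^{-\left(n+\frac{\nu}{2}\right)^2},$$ where the term with $n+\frac{\nu}{2}=0$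 (occurring for $\nu=-1$) is understood as a limit, i.e. $\sqrt{\pi}\,|x|\,\Gamma(-\frac12,4\pi x^2v)$ at $x=0$ means $v^{-1/2}$. For $f_1,f_2$ of weights $k_1,k_2\in\frac12\mathbb{Z}$ and $\kappa\in\mathbb{N}_0$, the $\kappa$-th Rankin–Cohen bracket is $$[f_1,f_2]_\kappa=\sum_{j=0}^\kappa(-1)^j\binom{k_1+\kappa-1}{\kappa-j}\binom{k_2+\kappa-1}{j}D^j(f_1)\,D^{\kappa-j}(f_2),$$ with generalized binomial coefficients $\binom{x}{j}=\frac{x(x-1)\cdots(x-j+1)}{j!}$; here $f_2$ is allowed to be non-holomorphic. In the brackets below, $\vartheta_\nu$ is assigned weight $\frac12$ and $s_\nu$ is assigned weight $\frac32$. The completed function is $$\widehat{\mathbb{J}}_k=\mathbb{J}_k+\frac{\delta_{k=2}}{8\pi v}+\frac{(k-2)!\,(-1)^{\frac{k}{2}+1}}{\Gamma\left(\frac{k-1}{2}\right)^2\,2^{k+1}}\sum_{\nu\in\{-1,0\}}\left[\vartheta_\nu,s_\nu\right]_{\frac{k}{2}-1}.$$ An almost holomorphic modular form of weight $\kappa$ (on a subgroup $\Gamma\subset\mathrm{SL}_2(\mathbb{Z})$, with multiplier $\chi$) is a function on $\mathbb{H}$ that satisfies the usual modular transformation law $f\left(\frac{a\tau+b}{c\tau+d}\right)=\chi\left(\begin{smallmatrix}a&b\\c&d\end{smallmatrix}\right)(c\tau+d)^\kappa f(\tau)$ for $\left(\begin{smallmatrix}a&b\\c&d\end{smallmatrix}\right)\in\Gamma$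 and is a polynomial in $1/v$ with (weakly) holomorphic coefficients, i.e. coefficients holomorphic on $\mathbb{H}$ and at most meromorphic at the cusps. *)

theory Defs
  imports "HOL-Analysis.Analysis" "HOL-Algebra.Group" "HOL-Number_Theory.Cong"
begin

abbreviation upper_half_plane :: "complex set" where
  "upper_half_plane \<equiv> {\<tau>. Im \<tau> > 0}"

abbreviation half_integers :: "real set" where
  "half_integers \<equiv> range (\<lambda>m::int. 1 / 2 + of_int m)"

definition qpow :: "real \<Rightarrow> complex \<Rightarrow> complex" where
  "qpow \<alpha> \<tau> = exp (2 * of_real pi * \<i> * of_real \<alpha> * \<tau>)"


subsection \<open>Wirtinger derivatives\<close>

definition wirtinger_d :: "(complex \<Rightarrow> complex) \<Rightarrow> complex \<Rightarrow> complex" where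
  "wirtinger_d f \<tau> =
     (vector_derivative (\<lambda>t::real. f (\<tau> + of_real t)) (at 0)
       - \<i> * vector_derivative (\<lambda>t::real. f (\<tau> + \<i> * of_real t)) (at 0)) / 2"

definition wirtinger_dbar :: "(complex \<Rightarrow> complex) \<Rightarrow> complex \<Rightarrow> complex" where
  "wirtinger_dbar f \<tau> =
     (vector_derivative (\<lambda>t::real. f (\<tau> + of_real t)) (at 0)
       + \<i> * vector_derivative (\<lambda>t::real. f (\<tau> + \<i> * of_real t)) (at 0)) / 2"

definition D_op :: "(complex \<Rightarrow> complex) \<Rightarrow> complex \<Rightarrow> complex" where
  "D_op f \<tau> = 1 / (2 * of_real pi * \<i>) * wirtinger_d f \<tau>"

definition L_op :: "(complex \<Rightarrow> complex) \<Rightarrow> complex \<Rightarrow> complex" where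
  "L_op f \<tau> = - 2 * \<i> * of_real ((Im \<tau>)\<^sup>2) * wirtinger_dbar f \<tau>"

text \<open>The weights \<open>k1\<close>, \<open>k2\<close> are those assigned to \<open>f1\<close>, \<open>f2\<close>.\<close>

definition rankin_cohen ::
  "real \<Rightarrow> real \<Rightarrow> nat \<Rightarrow> (complex \<Rightarrow> complex) \<Rightarrow> (complex \<Rightarrow> complex) \<Rightarrow> complex \<Rightarrow> complex" where
  "rankin_cohen k1 k2 \<kappa> f1 f2 \<tau> =
     (\<Sum>j=0..\<kappa>. (- 1) ^ j
        * of_real ((k1 + real \<kappa> - 1) gchoose (\<kappa> - j))
        * of_real ((k2 + real \<kappa> - 1) gchoose j)
        * (D_op ^^ j) f1 \<tau> * (D_op ^^ (\<kappa> - j)) f2 \<tau>)"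


subsection \<open>Theta functions\<close>

definition jacobi_theta :: "complex \<Rightarrow> complex \<Rightarrow> complex" where
  "jacobi_theta z \<tau> =
     (\<Sum>\<^sub>\<infinity>n\<in>half_integers.
        exp (of_real pi * \<i> * (of_real n)\<^sup>2 * \<tau> + 2 * of_real pi * \<i> * of_real n * (z + 1 / 2)))"

definition theta1 :: "complex \<Rightarrow> complex" where
  "theta1 \<tau> = (\<Sum>\<^sub>\<infinity>n\<in>(UNIV :: int set). qpow ((of_int n)\<^sup>2 / 2) \<tau>)"

definition theta3 :: "complex \<Rightarrow> complex" where
  "theta3 \<tau> = (\<Sum>\<^sub>\<infinity>n\<in>(UNIV :: int set). qpow ((of_int n + 1 / 2)\<^sup>2 / 2) \<tau>)"

definition theta_nu :: "int \<Rightarrow> complex \<Rightarrow> complex" where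
  "theta_nu \<nu> \<tau> = qpow ((of_int \<nu>)\<^sup>2 / 4) \<tau> * jacobi_theta (of_int \<nu> * \<tau> + 1 / 2) (2 * \<tau>)"

definition theta_l_nu :: "nat \<Rightarrow> int \<Rightarrow> complex \<Rightarrow> complex" where
  "theta_l_nu l \<nu> \<tau> =
     (deriv ^^ (l - 1))
       (\<lambda>z. jacobi_theta (z + of_int \<nu> * \<tau> + 1 / 2) (2 * \<tau>) * exp (of_real pi * \<i> * of_int \<nu> * z)
             * qpow ((of_int \<nu>)\<^sup>2 / 4) \<tau> * exp (of_real pi * z\<^sup>2 / (4 * of_real (Im \<tau>))))
       0"

text \<open>Upper incomplete Gamma function.\<close>

definition incomplete_Gamma :: "real \<Rightarrow> real \<Rightarrow> real" where
  "incomplete_Gamma \<alpha> x = integral {x..} (\<lambda>t. exp (- t) * t powr (\<alpha> - 1))"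

text \<open>At \<open>x = 0\<close> the value is the limit of the generic expression for \<open>x \<longlongrightarrow> 0\<close>.\<close>

definition s_coeff :: "real \<Rightarrow> real \<Rightarrow> real" where
  "s_coeff v x =
     (if x = 0 then 1 / sqrt v
      else sqrt pi * \<bar>x\<bar> * incomplete_Gamma (- 1 / 2) (4 * pi * x\<^sup>2 * v))"

definition s_nu :: "int \<Rightarrow> complex \<Rightarrow> complex" where
  "s_nu \<nu> \<tau> =
     (\<Sum>\<^sub>\<infinity>n\<in>half_integers.
        of_real (s_coeff (Im \<tau>) (n + of_int \<nu> / 2)) * qpow (- ((n + of_int \<nu> / 2)\<^sup>2)) \<tau>)"


subsection \<open>Generating functions of Joyce invariants\<close>

definition JJ :: "nat \<Rightarrow> complex \<Rightarrow> complex" where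
  "JJ k \<tau> =
     1 / 2 * (\<Sum>\<^sub>\<infinity>n\<in>UNIV - {0::int}.
        of_int n ^ (k - 1) * qpow ((of_int n)\<^sup>2) \<tau> / (1 - qpow (of_int n) \<tau>))"

definition JJ_hat :: "nat \<Rightarrow> complex \<Rightarrow> complex" where
  "JJ_hat k \<tau> =
     JJ k \<tau> + of_bool (k = 2) / (8 * of_real pi * of_real (Im \<tau>))
     + fact (k - 2) * (- 1) ^ (k div 2 + 1) / (of_real ((Gamma ((real k - 1) / 2))\<^sup>2) * 2 ^ (k + 1))
       * (\<Sum>\<nu>\<in>{- 1, 0}. rankin_cohen (1 / 2) (3 / 2) (k div 2 - 1) (theta_nu \<nu>) (s_nu \<nu>) \<tau>)"


subsection \<open>Almost holomorphic modular forms\<close>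

definition SL2Z :: "(int ^ 2 ^ 2) monoid" where
  "SL2Z = \<lparr>carrier = {A. det A = 1}, monoid.mult = (**), one = mat 1\<rparr>"

lemma group_SL2Z: "group SL2Z"
proof (rule groupI)
  fix A :: "int ^ 2 ^ 2"
  assume "A \<in> carrier SL2Z"
  then have A: "A $ 1 $ 1 * A $ 2 $ 2 - A $ 1 $ 2 * A $ 2 $ 1 = 1"
    by (simp add: SL2Z_def det_2)
  define B :: "int ^ 2 ^ 2"
    where "B = vector [vector [A $ 2 $ 2, - A $ 1 $ 2], vector [- A $ 2 $ 1, A $ 1 $ 1]]"
  have "det B = 1" "B ** A = mat 1"
    using A by (simp_all add: B_def det_2 matrix_matrix_mult_def mat_def vec_eq_iff forall_2 sum_2
        algebra_simps)
  then show "\<exists>B\<in>carrier SL2Z. B \<otimes>\<^bsub>SL2Z\<^esub> A = \<one>\<^bsub>SL2Z\<^esub>"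
    by (auto simp: SL2Z_def)
qed (auto simp: SL2Z_def det_mul matrix_mul_assoc)

definition moebius :: "int ^ 2 ^ 2 \<Rightarrow> complex \<Rightarrow> complex" where
  "moebius A \<tau> = (of_int (A $ 1 $ 1) * \<tau> + of_int (A $ 1 $ 2)) / (of_int (A $ 2 $ 1) * \<tau> + of_int (A $ 2 $ 2))"

text \<open>The automorphy factor \<open>(c\<tau> + d)\<^sup>\<kappa>\<close>, with the principal branch of the power.\<close>

definition autom_factor :: "real \<Rightarrow> int ^ 2 ^ 2 \<Rightarrow> complex \<Rightarrow> complex" where
  "autom_factor \<kappa> A \<tau> = (of_int (A $ 2 $ 1) * \<tau> + of_int (A $ 2 $ 2)) powr of_real \<kappa>"

definition principal_congruence_subgroup :: "nat \<Rightarrow> (int ^ 2 ^ 2) set" where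
  "principal_congruence_subgroup N =
     {A \<in> carrier SL2Z. [A $ 1 $ 1 = 1] (mod int N) \<and> [A $ 1 $ 2 = 0] (mod int N)
        \<and> [A $ 2 $ 1 = 0] (mod int N) \<and> [A $ 2 $ 2 = 1] (mod int N)}"

definition congruence_subgroup :: "(int ^ 2 ^ 2) set \<Rightarrow> bool" where
  "congruence_subgroup G \<longleftrightarrow>
     subgroup G SL2Z \<and> (\<exists>N\<ge>1. principal_congruence_subgroup N \<subseteq> G)"

definition multiplier_system :: "(int ^ 2 ^ 2) set \<Rightarrow> real \<Rightarrow> (int ^ 2 ^ 2 \<Rightarrow> complex) \<Rightarrow> bool" where
  "multiplier_system G \<kappa> \<psi> \<longleftrightarrow>
     (\<forall>A\<in>G. norm (\<psi> A) = 1) \<and>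
     (\<forall>A\<in>G. \<forall>B\<in>G. \<forall>\<tau>\<in>upper_half_plane.
        \<psi> (A ** B) * autom_factor \<kappa> (A ** B) \<tau>
          = \<psi> A * \<psi> B * autom_factor \<kappa> A (moebius B \<tau>) * autom_factor \<kappa> B \<tau>)"

text \<open>
  A Fourier expansion in powers of \<open>q\<^bsup>1/N\<^esup>\<close> with finite principal part. The shift \<open>r\<close> accommodates
  a multiplier that is not trivial on the stabiliser of the cusp; since it may be negative, it also
  encodes the order of the pole.
\<close>

definition meromorphic_at_ii_inf :: "(complex \<Rightarrow> complex) \<Rightarrow> bool" where
  "meromorphic_at_ii_inf g \<longleftrightarrow>
     (\<exists>N\<ge>1::nat. \<exists>r::real. \<exists>a::nat \<Rightarrow> complex.
        \<forall>\<tau>\<in>upper_half_plane. (\<lambda>n. a n * qpow ((real n + r) / real N) \<tau>) sums g \<tau>)"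

text \<open>
  The coefficients of a polynomial in \<open>1/v\<close> are in general not modular themselves. Their behaviour
  at the cusp \<open>A \<infinity>\<close> is therefore read off from the coefficients \<open>g j\<close> of the polynomial
  \<open>f |\<^sub>\<kappa> A\<close> in \<open>1/v\<close>; for \<open>A = 1\<close> these are the coefficients of \<open>f\<close> itself.
\<close>

definition almost_holomorphic_modular_form ::
  "(int ^ 2 ^ 2) set \<Rightarrow> (int ^ 2 ^ 2 \<Rightarrow> complex) \<Rightarrow> real \<Rightarrow> (complex \<Rightarrow> complex) \<Rightarrow> bool" where
  "almost_holomorphic_modular_form G \<psi> \<kappa> f \<longleftrightarrow>
     multiplier_system G \<kappa> \<psi> \<and>
     (\<forall>A\<in>G. \<forall>\<tau>\<in>upper_half_plane. f (moebius A \<tau>) = \<psi> A * autom_factor \<kappa> A \<tau> * f \<tau>) \<and>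
     (\<forall>A\<in>carrier SL2Z. \<exists>(p::nat) g.
        (\<forall>j\<le>p. g j holomorphic_on upper_half_plane \<and> meromorphic_at_ii_inf (g j)) \<and>
        (\<forall>\<tau>\<in>upper_half_plane.
           f (moebius A \<tau>) / autom_factor \<kappa> A \<tau> = (\<Sum>j\<le>p. g j \<tau> / of_real (Im \<tau>) ^ j)))"

end

theory Submission
  imports Defs "HOL-Complex_Analysis.Complex_Analysis" "HOL-Probability.Probability" "HOL-Real_Asymp.Real_Asymp"
begin

text \<open>
  Up to the factor \<open>(2 i v)\<^bsup>1 - k\<^esup> / (4 \<pi> i)\<close>, the completed function equals the sum of
  \<open>cnj \<lambda> ^ (k - 1) / \<lambda> * exp (- \<pi> |\<lambda>|\<^sup>2 / v)\<close> over the nonzero points \<open>\<lambda>\<close> of the lattice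
  \<open>\<int> \<tau> + \<int>\<close>, from which the transformation law can be read off. The identity arises by taking Taylor
  coefficients at the origin of a two-variable identity in \<open>w\<close> and \<open>w'\<close>: an Appell function, corrected
  by products of theta functions with error-function partial theta series, is compared with a lattice sum.
  By Poisson summation their difference does not depend on \<open>w'\<close>, and for \<open>w' = cnj w\<close> it is
  doubly periodic, so it is constant by Liouville's theorem. The Rankin--Cohen brackets appear as the
  Leibniz expansions of the derivatives of these products.

  The formula for the lowering operator follows by differentiating the series of the Eichler integrals
  termwise. For the theta derivatives, the two theta functions completed by \<open>exp (\<pi> w\<^sup>2 / (4 v))\<close> span a
  representation of the modular group on which \<open>\<Gamma>(4)\<close> acts by scalars.
\<close>

subsection \<open>Normally convergent families\<close>

text \<open>The two independent variables are the device. Along the simultaneous shifts of (w, w')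
  by (1, 1) and (tau, cnj tau) the completed functions are periodic up to simple terms, while on the
  slice w' = 0 they are entire in w; independence of w' joins the two properties. Differentiating
  the error function in w' turns the partial theta series into a theta series at cnj tau, so this
  independence is an identity between a bilinear theta sum and a Gaussian lattice sum. The factor 1
  / lambda forces the lattice sum to omit the origin. The linear term w' - w repairs this, and its
  Taylor coefficient of order 1 gives the correction 1 / (8 pi v) for k = 2. The order of interest k
  - 1 is odd and the theta factors are even in w, so the error-function series are differentiated an
  odd number of times; these derivatives are, up to constants, the iterates of \<open>D_op\<close>
  on \<open>s_nu\<close>. The constant in front of the brackets converts their half-integral
  binomials into Leibniz coefficients. In half-integral weight the principal square root satisfies
  the cocycle rule only up to sign; continuity on the connected half plane makes that sign
  constant.\<close>

lemma summable_on_exp_abs_int: "(\<lambda>n::int. exp (- \<bar>real_of_int n\<bar>)) summable_on UNIV"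
proof -
  have *: "summable (\<lambda>n::nat. exp (- real n))"
    using summable_geometric[of "exp (-1::real)"] by (simp add: exp_of_nat_mult[symmetric])
  have 1: "(\<lambda>n::nat. exp (- real n)) summable_on UNIV"
    by (rule summable_nonneg_imp_summable_on[OF *]) simp
  have "(\<lambda>n::int. exp (- \<bar>real_of_int n\<bar>)) summable_on range int"
    using 1 by (subst summable_on_reindex) (auto simp: o_def)
  moreover have "(\<lambda>n::int. exp (- \<bar>real_of_int n\<bar>)) summable_on range (\<lambda>n. - int n)"
    using 1 by (subst summable_on_reindex) (auto simp: o_def inj_on_def)
  ultimately have "(\<lambda>n::int. exp (- \<bar>real_of_int n\<bar>)) summable_on (range int \<union> range (\<lambda>n. - int n))"
    by (rule summable_on_union)
  moreover have "range int \<union> range (\<lambda>n. - int n) = UNIV"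
    by (auto, metis int_cases2 rangeI)
  ultimately show ?thesis by simp
qed

text \<open>A Gaussian beats every polynomial and every linear exponent with enough to spare for exp
  (- |x|), which is summable over shifted integers. The parameter N serves derivatives of theta
  series, b serves a bounded elliptic variable.\<close>

lemma gaussian_decay:
  fixes c b :: real
  assumes "c > 0"
  obtains C where "C > 0" "\<And>x. \<bar>x\<bar> ^ N * exp (- c * x\<^sup>2 + b * \<bar>x\<bar>) \<le> C * exp (- \<bar>x\<bar>)"
proof -
  define g where "g = (\<lambda>x::real. x ^ N * exp (- c * x\<^sup>2 + b * x) * exp x)"
  have "(g \<longlongrightarrow> 0) at_top"
    unfolding g_def using assms by real_asymp
  then have "\<forall>\<^sub>F x in at_top. g x < 1"
    by (rule order_tendstoD) simp
  then obtain x0 where x0: "\<And>x. x \<ge> x0 \<Longrightarrow> g x < 1"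
    by (auto simp: eventually_at_top_linorder)
  have "compact (g ` {0..max x0 0})"
    unfolding g_def by (intro compact_continuous_image continuous_intros) auto
  then obtain B where B: "\<And>x. x \<in> {0..max x0 0} \<Longrightarrow> norm (g x) \<le> B"
    by (metis bounded_iff compact_imp_bounded imageI)
  have gb: "g x \<le> max 1 B" if "x \<ge> 0" for x
    using x0[of x] B[of x] that by (cases "x \<ge> x0") auto
  have "\<bar>x\<bar> ^ N * exp (- c * x\<^sup>2 + b * \<bar>x\<bar>) \<le> max 1 B * exp (- \<bar>x\<bar>)" for x
  proof -
    have "\<bar>x\<bar> ^ N * exp (- c * x\<^sup>2 + b * \<bar>x\<bar>) = g \<bar>x\<bar> * exp (- \<bar>x\<bar>)"
      by (simp add: g_def exp_minus)
    also have "\<dots> \<le> max 1 B * exp (- \<bar>x\<bar>)"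
      by (intro mult_right_mono gb) auto
    finally show ?thesis .
  qed
  then show ?thesis
    by (intro that[of "max 1 B"]) auto
qed

lemma gaussian_majorant:
  fixes c b h :: real
  assumes "c > 0"
  obtains M where "M summable_on (UNIV :: int set)"
    "\<And>n. \<bar>real_of_int n + h\<bar> ^ N * exp (- c * (real_of_int n + h)\<^sup>2 + b * \<bar>real_of_int n + h\<bar>) \<le> M n"
proof -
  obtain C where C: "C > 0" "\<And>x. \<bar>x\<bar> ^ N * exp (- c * x\<^sup>2 + b * \<bar>x\<bar>) \<le> C * exp (- \<bar>x\<bar>)"
    using gaussian_decay[OF assms] by blast
  define M where "M = (\<lambda>n::int. C * exp \<bar>h\<bar> * exp (- \<bar>real_of_int n\<bar>))"
  have "M summable_on UNIV"
    unfolding M_def by (intro summable_on_cmult_right summable_on_exp_abs_int)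
  moreover have "\<bar>real_of_int n + h\<bar> ^ N * exp (- c * (real_of_int n + h)\<^sup>2 + b * \<bar>real_of_int n + h\<bar>) \<le> M n" for n
  proof -
    have "\<bar>real_of_int n + h\<bar> ^ N * exp (- c * (real_of_int n + h)\<^sup>2 + b * \<bar>real_of_int n + h\<bar>)
        \<le> C * exp (- \<bar>real_of_int n + h\<bar>)" by (rule C)
    also have "\<dots> \<le> C * exp (\<bar>h\<bar> - \<bar>real_of_int n\<bar>)"
      using C(1) by (intro mult_left_mono) auto
    finally show ?thesis by (simp add: M_def exp_diff exp_minus field_simps)
  qed
  ultimately show ?thesis by (rule that)
qed

text \<open>The hypothesis of the Weierstrass M-test in local form: near each point one summable
  majorant serves a whole closed ball inside the set. Unordered summability treats the index sets
  \<open>int\<close> and \<open>int \<times> int\<close> alike, without an enumeration.\<close>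

definition normally_summable_on ::
  "('a \<Rightarrow> complex \<Rightarrow> complex) \<Rightarrow> 'a set \<Rightarrow> complex set \<Rightarrow> bool" where
  "normally_summable_on f I S \<longleftrightarrow> (\<forall>z\<in>S. \<exists>r>0. \<exists>M. cball z r \<subseteq> S \<and> M summable_on I
     \<and> (\<forall>i\<in>I. \<forall>w\<in>cball z r. norm (f i w) \<le> (M i :: real)))"

lemma normally_summable_onI:
  assumes "open S"
    and "\<And>z. z \<in> S \<Longrightarrow> \<exists>r>0. \<exists>M. M summable_on I
      \<and> (\<forall>i\<in>I. \<forall>w\<in>cball z r \<inter> S. norm (f i w) \<le> (M i :: real))"
  shows "normally_summable_on f I S"
  unfolding normally_summable_on_def
proof
  fix z assume z: "z \<in> S"
  obtain r1 where r1: "r1 > 0" "cball z r1 \<subseteq> S"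
    using z assms(1) open_contains_cball by blast
  obtain r2 M where r2: "r2 > 0" "M summable_on I"
      "\<forall>i\<in>I. \<forall>w\<in>cball z r2 \<inter> S. norm (f i w) \<le> (M i :: real)"
    using assms(2)[OF z] by blast
  have "\<forall>i\<in>I. \<forall>w\<in>cball z (min r1 r2). norm (f i w) \<le> M i"
    using r1 r2 by (auto simp: subset_iff)
  then show "\<exists>r>0. \<exists>M. cball z r \<subseteq> S \<and> M summable_on I \<and> (\<forall>i\<in>I. \<forall>w\<in>cball z r. norm (f i w) \<le> (M i :: real))"
    using r1 r2 by (intro exI[of _ "min r1 r2"] conjI exI[of _ M]) (auto simp: subset_iff)
qed

lemma summable_on_of_norm_le:
  fixes f :: "'a \<Rightarrow> complex"
  assumes "M summable_on I" "\<And>i. i \<in> I \<Longrightarrow> norm (f i) \<le> M i"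
  shows "(\<lambda>i. norm (f i)) summable_on I" "f summable_on I"
proof -
  show "(\<lambda>i. norm (f i)) summable_on I"
    by (rule summable_on_comparison_test[OF assms(1)]) (use assms(2) in auto)
  then show "f summable_on I" by (rule abs_summable_summable)
qed

lemma normally_summable_on_imp_abs_summable:
  assumes "normally_summable_on f I S" "z \<in> S"
  shows "(\<lambda>i. norm (f i z)) summable_on I"
proof -
  obtain r M where "r > 0" "M summable_on I" "\<forall>i\<in>I. \<forall>w\<in>cball z r. norm (f i w) \<le> (M i :: real)"
    using assms unfolding normally_summable_on_def by blast
  then show ?thesis
    by (intro summable_on_of_norm_le(1)[of M]) auto
qed

text \<open>Locally uniform limits of holomorphic functions are holomorphic and commute with all
  derivatives; the limit is taken along the filter of finite index sets.\<close>

lemma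
  assumes "open S" "normally_summable_on f I S" "\<And>i. i \<in> I \<Longrightarrow> f i holomorphic_on S"
  shows holomorphic_infsum: "(\<lambda>z. \<Sum>\<^sub>\<infinity>i\<in>I. f i z) holomorphic_on S"
    and has_sum_higher_deriv: "z \<in> S \<Longrightarrow>
      ((\<lambda>i. (deriv ^^ m) (f i) z) has_sum (deriv ^^ m) (\<lambda>z. \<Sum>\<^sub>\<infinity>i\<in>I. f i z) z) I"
proof -
  have *: "(\<lambda>z. \<Sum>\<^sub>\<infinity>i\<in>I. f i z) holomorphic_on ball z r"
    "uniform_limit (ball z r) (\<lambda>X y. \<Sum>i\<in>X. f i y) (\<lambda>y. \<Sum>\<^sub>\<infinity>i\<in>I. f i y) (finite_subsets_at_top I)"
    if "cball z r \<subseteq> S" "M summable_on I" "\<forall>i\<in>I. \<forall>w\<in>cball z r. norm (f i w) \<le> M i"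
    for z r and M :: "'a \<Rightarrow> real"
  proof -
    have ul: "uniform_limit (cball z r) (\<lambda>X y. \<Sum>i\<in>X. f i y) (\<lambda>y. \<Sum>\<^sub>\<infinity>i\<in>I. f i y) (finite_subsets_at_top I)"
      using that by (intro Weierstrass_m_test_general) auto
    then show "uniform_limit (ball z r) (\<lambda>X y. \<Sum>i\<in>X. f i y) (\<lambda>y. \<Sum>\<^sub>\<infinity>i\<in>I. f i y) (finite_subsets_at_top I)"
      by (rule uniform_limit_on_subset) auto
    have ev: "\<forall>\<^sub>F X in finite_subsets_at_top I. continuous_on (cball z r) (\<lambda>y. \<Sum>i\<in>X. f i y)
        \<and> (\<lambda>y. \<Sum>i\<in>X. f i y) holomorphic_on ball z r"
    proof (intro eventually_finite_subsets_at_top_weakI)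
      fix X assume "finite X" "X \<subseteq> I"
      then have "(\<lambda>y. \<Sum>i\<in>X. f i y) holomorphic_on cball z r"
        using assms(3) holomorphic_on_subset[OF _ that(1)] by (intro holomorphic_on_sum) blast
      then show "continuous_on (cball z r) (\<lambda>y. \<Sum>i\<in>X. f i y)
          \<and> (\<lambda>y. \<Sum>i\<in>X. f i y) holomorphic_on ball z r"
        using holomorphic_on_imp_continuous_on holomorphic_on_subset[OF _ ball_subset_cball] by blast
    qed
    show "(\<lambda>z. \<Sum>\<^sub>\<infinity>i\<in>I. f i z) holomorphic_on ball z r"
      by (rule holomorphic_uniform_limit[OF ev ul]) simp_all
  qed
  show "(\<lambda>z. \<Sum>\<^sub>\<infinity>i\<in>I. f i z) holomorphic_on S"
    unfolding holomorphic_on_open[OF assms(1)]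
  proof
    fix z assume "z \<in> S"
    then obtain r M where r: "r > 0" "cball z r \<subseteq> S" "M summable_on I" "\<forall>i\<in>I. \<forall>w\<in>cball z r. norm (f i w) \<le> (M i :: real)"
      using assms(2) unfolding normally_summable_on_def by blast
    then show "\<exists>f'. ((\<lambda>z. \<Sum>\<^sub>\<infinity>i\<in>I. f i z) has_field_derivative f') (at z)"
      using *(1)[OF r(2-4)] by (auto simp: holomorphic_on_open)
  qed
  show "((\<lambda>i. (deriv ^^ m) (f i) z) has_sum (deriv ^^ m) (\<lambda>z. \<Sum>\<^sub>\<infinity>i\<in>I. f i z) z) I" if "z \<in> S"
  proof -
    obtain r M where r: "r > 0" "cball z r \<subseteq> S" "M summable_on I" "\<forall>i\<in>I. \<forall>w\<in>cball z r. norm (f i w) \<le> (M i :: real)"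
      using assms(2) \<open>z \<in> S\<close> unfolding normally_summable_on_def by blast
    have hol: "f i holomorphic_on ball z r" if "i \<in> I" for i
      by (rule holomorphic_on_subset[OF assms(3)[OF that]]) (use r(2) ball_subset_cball[of z r] in blast)
    have "((\<lambda>X. (deriv ^^ m) (\<lambda>y. \<Sum>i\<in>X. f i y) z) \<longlongrightarrow> (deriv ^^ m) (\<lambda>z. \<Sum>\<^sub>\<infinity>i\<in>I. f i z) z) (finite_subsets_at_top I)"
      using r(1) hol
      by (intro higher_deriv_complex_uniform_limit[OF *(2)[OF r(2-4)]]
          eventually_finite_subsets_at_top_weakI holomorphic_on_sum) (auto simp: subset_iff)
    moreover have "\<forall>\<^sub>F X in finite_subsets_at_top I.
        (deriv ^^ m) (\<lambda>y. \<Sum>i\<in>X. f i y) z = (\<Sum>i\<in>X. (deriv ^^ m) (f i) z)"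
    proof (intro eventually_finite_subsets_at_top_weakI)
      fix X assume X: "finite X" "X \<subseteq> I"
      then show "(deriv ^^ m) (\<lambda>y. \<Sum>i\<in>X. f i y) z = (\<Sum>i\<in>X. (deriv ^^ m) (f i) z)"
      proof (induction X)
        case empty
        show ?case by simp
      next
        case (insert x F)
        have "(deriv ^^ m) (\<lambda>y. f x y + (\<Sum>i\<in>F. f i y)) z
            = (deriv ^^ m) (f x) z + (deriv ^^ m) (\<lambda>y. \<Sum>i\<in>F. f i y) z"
          using insert r(1) hol by (intro higher_deriv_add[of _ "ball z r"] holomorphic_on_sum) (auto simp: subset_iff)
        then show ?case using insert by simp
      qed
    qed
    ultimately show ?thesis
      unfolding has_sum_def by (rule Lim_transform_eventually)
  qed
qed

subsection \<open>Wirtinger derivatives\<close>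

text \<open>Real differentiability, with the derivative split into its complex linear and its
  conjugate linear part. \<open>wirtinger_d\<close> and \<open>wirtinger_dbar\<close> see only the
  two partial derivatives; total differentiability is what yields the sum and product rules.\<close>

definition has_wirtinger_derivs ::
  "(complex \<Rightarrow> complex) \<Rightarrow> complex \<Rightarrow> complex \<Rightarrow> complex \<Rightarrow> bool" where
  "has_wirtinger_derivs f p q z \<longleftrightarrow> (f has_derivative (\<lambda>h. p * h + q * cnj h)) (at z)"

lemma
  assumes "has_wirtinger_derivs f p q z"
  shows wirtinger_d_eq: "wirtinger_d f z = p"
    and wirtinger_dbar_eq: "wirtinger_dbar f z = q"
proof -
  have *: "vector_derivative (\<lambda>t::real. f (z + e * of_real t)) (at 0) = p * e + q * cnj e" for e
  proof (rule vector_derivative_at)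
    have "((\<lambda>t::real. z + e * of_real t) has_derivative (\<lambda>t. e * of_real t)) (at 0)"
      by (auto intro!: derivative_eq_intros)
    moreover have "(f has_derivative (\<lambda>h. p * h + q * cnj h)) (at (z + e * of_real 0))"
      using assms by (simp add: has_wirtinger_derivs_def)
    ultimately have "((\<lambda>t::real. f (z + e * of_real t)) has_derivative
        (\<lambda>t. p * (e * of_real t) + q * cnj (e * of_real t))) (at 0)"
      by (rule has_derivative_compose)
    moreover have "(\<lambda>t::real. p * (e * of_real t) + q * cnj (e * of_real t)) = (\<lambda>t. t *\<^sub>R (p * e + q * cnj e))"
      by (auto simp: scaleR_conv_of_real algebra_simps)
    ultimately show "((\<lambda>t::real. f (z + e * of_real t)) has_vector_derivative p * e + q * cnj e) (at 0)"
      by (simp add: has_vector_derivative_def)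
  qed
  show "wirtinger_d f z = p" "wirtinger_dbar f z = q"
    unfolding wirtinger_d_def wirtinger_dbar_def *[of 1, simplified] *[of \<i>]
    by (simp_all add: algebra_simps)
qed

lemma has_wirtinger_derivs_of_field_derivative:
  assumes "(f has_field_derivative p) (at z)"
  shows "has_wirtinger_derivs f p 0 z"
  using assms by (simp add: has_wirtinger_derivs_def has_field_derivative_def)

lemma has_wirtinger_derivs_cnj:
  assumes "(f has_field_derivative p) (at z)"
  shows "has_wirtinger_derivs (\<lambda>z. cnj (f z)) 0 (cnj p) z"
  using has_derivative_cnj[OF assms[unfolded has_field_derivative_def]]
  by (simp add: has_wirtinger_derivs_def)

text \<open>The factors - i / 2 and i / 2 come from Im z = (z - cnj z) / (2 i).\<close>

lemma has_wirtinger_derivs_Im: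
  assumes "(g has_real_derivative d) (at (Im z))"
  shows "has_wirtinger_derivs (\<lambda>z. of_real (g (Im z))) (- \<i> / 2 * of_real d) (\<i> / 2 * of_real d) z"
proof -
  have "((\<lambda>z. g (Im z)) has_derivative (\<lambda>h. d * Im h)) (at z)"
    using has_derivative_compose[OF has_derivative_Im[OF has_derivative_ident] assms[unfolded has_field_derivative_def]]
    by simp
  then have "((\<lambda>z. complex_of_real (g (Im z))) has_derivative (\<lambda>h. of_real (d * Im h))) (at z)"
    by (rule has_derivative_of_real)
  moreover have "(\<lambda>h. complex_of_real (d * Im h)) = (\<lambda>h. (- \<i> / 2 * of_real d) * h + (\<i> / 2 * of_real d) * cnj h)"
    by (auto simp: complex_eq_iff)
  ultimately show ?thesis by (simp add: has_wirtinger_derivs_def)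
qed

lemma has_wirtinger_derivs_add:
  assumes "has_wirtinger_derivs f p q z" "has_wirtinger_derivs g r s z"
  shows "has_wirtinger_derivs (\<lambda>z. f z + g z) (p + r) (q + s) z"
  using has_derivative_add[OF assms[unfolded has_wirtinger_derivs_def]]
  by (simp add: has_wirtinger_derivs_def algebra_simps)

lemma has_wirtinger_derivs_mult:
  assumes "has_wirtinger_derivs f p q z" "has_wirtinger_derivs g r s z"
  shows "has_wirtinger_derivs (\<lambda>z. f z * g z) (p * g z + f z * r) (q * g z + f z * s) z"
  using has_derivative_mult[OF assms[unfolded has_wirtinger_derivs_def]]
  by (simp add: has_wirtinger_derivs_def algebra_simps)

lemma has_wirtinger_derivs_cmult:
  assumes "has_wirtinger_derivs f p q z"
  shows "has_wirtinger_derivs (\<lambda>z. c * f z) (c * p) (c * q) z"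
  using has_wirtinger_derivs_mult[OF has_wirtinger_derivs_of_field_derivative[OF DERIV_const] assms]
  by simp

lemma has_wirtinger_derivs_sum:
  assumes "\<And>i. i \<in> I \<Longrightarrow> has_wirtinger_derivs (f i) (p i) (q i) z"
  shows "has_wirtinger_derivs (\<lambda>z. \<Sum>i\<in>I. f i z) (\<Sum>i\<in>I. p i) (\<Sum>i\<in>I. q i) z"
  using has_derivative_sum[of I f "\<lambda>i h. p i * h + q i * cnj h" "at z"] assms
  by (simp add: has_wirtinger_derivs_def sum.distrib sum_distrib_right)

lemma has_wirtinger_derivs_transform:
  assumes "has_wirtinger_derivs f p q z" "open S" "z \<in> S" "\<And>w. w \<in> S \<Longrightarrow> f w = g w"
  shows "has_wirtinger_derivs g p q z"
  using assms has_derivative_transform_within_open unfolding has_wirtinger_derivs_def by blast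

text \<open>The summands are not holomorphic, so convergence of the sum does not control its
  derivatives; the majorant must also bound both Wirtinger components.\<close>

lemma has_wirtinger_derivs_infsum:
  fixes f :: "int \<Rightarrow> complex \<Rightarrow> complex"
  assumes r: "r > 0" and M: "M summable_on UNIV"
    and der: "\<And>n z. z \<in> ball z0 r \<Longrightarrow> has_wirtinger_derivs (f n) (p n z) (q n z) z"
    and bounds: "\<And>n z. z \<in> ball z0 r \<Longrightarrow> norm (f n z) \<le> M n \<and> norm (p n z) \<le> M n \<and> norm (q n z) \<le> M n"
  shows "has_wirtinger_derivs (\<lambda>z. \<Sum>\<^sub>\<infinity>n. f n z) (\<Sum>\<^sub>\<infinity>n. p n z0) (\<Sum>\<^sub>\<infinity>n. q n z0) z0"
proof -
  \<comment> \<open>Termwise differentiation is available for sequences, hence this enumeration of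
    the integers; absolute convergence makes the order harmless.\<close>
  define e where "e = int_decode"
  have e: "bij_betw e UNIV UNIV" using bij_int_decode by (simp add: e_def)
  have inf_e: "(\<lambda>i. g (e i)) sums (\<Sum>\<^sub>\<infinity>n. g n)" if "\<And>n. norm (g n) \<le> M n" for g :: "int \<Rightarrow> complex"
  proof -
    have "(g has_sum (\<Sum>\<^sub>\<infinity>n. g n)) UNIV"
      by (rule has_sum_infsum, rule summable_on_of_norm_le(2)[OF M]) (rule that)
    then have "((\<lambda>i. g (e i)) has_sum (\<Sum>\<^sub>\<infinity>n. g n)) UNIV"
      using has_sum_reindex_bij_betw[OF e, of g] by simp
    then show ?thesis by (rule has_sum_imp_sums)
  qed
  have sumM: "summable (\<lambda>i. M (e i))"
    using M summable_on_reindex_bij_betw[OF e, of M] summable_on_imp_summable by blast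
  have unif: "uniform_limit (ball z0 r) (\<lambda>n z. \<Sum>i<n. g (e i) z) (\<lambda>z. \<Sum>\<^sub>\<infinity>n. g n z) sequentially"
    if "\<And>n z. z \<in> ball z0 r \<Longrightarrow> norm (g n z) \<le> M n" for g :: "int \<Rightarrow> complex \<Rightarrow> complex"
  proof -
    have "uniform_limit (ball z0 r) (\<lambda>n z. \<Sum>i<n. g (e i) z) (\<lambda>z. \<Sum>i. g (e i) z) sequentially"
      by (rule Weierstrass_m_test[OF _ sumM]) (use that in auto)
    moreover have "(\<Sum>i. g (e i) z) = (\<Sum>\<^sub>\<infinity>n. g n z)" if "z \<in> ball z0 r" for z
      using sums_unique[OF inf_e[of "\<lambda>n. g n z"]] \<open>\<And>n z. z \<in> ball z0 r \<Longrightarrow> norm (g n z) \<le> M n\<close> that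
      by simp
    ultimately show ?thesis
      by (subst uniform_limit_cong'[where g = "\<lambda>n z. \<Sum>i<n. g (e i) z" and i = "\<lambda>z. \<Sum>i. g (e i) z"]) auto
  qed
  define P where "P z = (\<Sum>\<^sub>\<infinity>n. p n z)" for z
  define Q where "Q z = (\<Sum>\<^sub>\<infinity>n. q n z)" for z
  have up: "uniform_limit (ball z0 r) (\<lambda>n z. \<Sum>i<n. p (e i) z) P sequentially"
    and uq: "uniform_limit (ball z0 r) (\<lambda>n z. \<Sum>i<n. q (e i) z) Q sequentially"
    using unif[of p] unif[of q] bounds by (auto simp: P_def[abs_def] Q_def[abs_def])
  have "\<exists>g. \<forall>x\<in>ball z0 r. (\<lambda>n. f (e n) x) sums g x \<and>
      (g has_derivative (\<lambda>h. P x * h + Q x * cnj h)) (at x within ball z0 r)"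
  proof (rule has_derivative_series[where x = z0])
    show "(f (e n) has_derivative (\<lambda>h. p (e n) x * h + q (e n) x * cnj h)) (at x within ball z0 r)"
      if "x \<in> ball z0 r" for n x
      using der[OF that] has_derivative_at_withinI unfolding has_wirtinger_derivs_def by blast
    show "(\<lambda>n. f (e n) z0) sums (\<Sum>\<^sub>\<infinity>n. f n z0)"
      using bounds r by (intro inf_e) auto
    fix \<epsilon> :: real assume \<epsilon>: "\<epsilon> > 0"
    then have "\<epsilon> / 2 > 0" by simp
    from uniform_limitD[OF up this] uniform_limitD[OF uq this]
    show "\<forall>\<^sub>F n in sequentially. \<forall>x\<in>ball z0 r. \<forall>h.
      norm ((\<Sum>i<n. p (e i) x * h + q (e i) x * cnj h) - (P x * h + Q x * cnj h)) \<le> \<epsilon> * norm h"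
    proof eventually_elim
      case (elim n)
      show ?case
      proof (intro ballI allI)
        fix x h assume x: "x \<in> ball z0 r"
        have "norm ((\<Sum>i<n. p (e i) x * h + q (e i) x * cnj h) - (P x * h + Q x * cnj h))
          = norm (((\<Sum>i<n. p (e i) x) - P x) * h + ((\<Sum>i<n. q (e i) x) - Q x) * cnj h)"
          by (simp add: sum.distrib sum_distrib_right left_diff_distrib add_diff_add)
        also have "\<dots> \<le> norm ((\<Sum>i<n. p (e i) x) - P x) * norm h + norm ((\<Sum>i<n. q (e i) x) - Q x) * norm h"
          by (rule norm_triangle_le) (simp add: norm_mult)
        also have "\<dots> \<le> \<epsilon> / 2 * norm h + \<epsilon> / 2 * norm h"
          using elim x by (intro add_mono mult_right_mono) (auto simp: dist_norm less_imp_le)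
        finally show "norm ((\<Sum>i<n. p (e i) x * h + q (e i) x * cnj h) - (P x * h + Q x * cnj h)) \<le> \<epsilon> * norm h"
          by simp
      qed
    qed
  qed (use r in auto)
  then obtain g where g: "\<And>x. x \<in> ball z0 r \<Longrightarrow> (\<lambda>n. f (e n) x) sums g x"
      "\<And>x. x \<in> ball z0 r \<Longrightarrow> (g has_derivative (\<lambda>h. P x * h + Q x * cnj h)) (at x within ball z0 r)"
    by blast
  have "has_wirtinger_derivs g (P z0) (Q z0) z0"
    using g(2)[of z0] r at_within_open[of z0 "ball z0 r"] by (simp add: has_wirtinger_derivs_def)
  then have "has_wirtinger_derivs (\<lambda>z. \<Sum>\<^sub>\<infinity>n. f n z) (P z0) (Q z0) z0"
  proof (rule has_wirtinger_derivs_transform[where S = "ball z0 r"])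
    show "g w = (\<Sum>\<^sub>\<infinity>n. f n w)" if "w \<in> ball z0 r" for w
      by (rule sums_unique2[OF g(1)[OF that]], rule inf_e) (use bounds that in blast)
  qed (use r in auto)
  then show ?thesis by (simp add: P_def Q_def)
qed

subsection \<open>Poisson summation for Gaussians\<close>

text \<open>Uniqueness of Fourier coefficients by a peak kernel. If D 0 were positive, the integrals
  of D against powers of a trigonometric polynomial that peaks above 1 near 0 would grow without
  bound, whereas all of them vanish.\<close>

lemma trig_moments_zero_imp_nonpos:
  fixes D :: "real \<Rightarrow> real"
  assumes cont: "continuous_on {-1/2..1/2} D"
    and mom: "\<And>M::int. ((\<lambda>x. of_real (D x) * cis (2 * pi * of_int M * x)) has_integral 0) {-1/2..1/2}"
  shows "D 0 \<le> 0"
proof (rule ccontr)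
  assume "\<not> D 0 \<le> 0"
  then have D0: "D 0 > 0" by simp
  obtain B where B: "\<And>x. x \<in> {-1/2..1/2} \<Longrightarrow> \<bar>D x\<bar> \<le> B"
  proof -
    have "compact (D ` {-1/2..1/2})"
      by (intro compact_continuous_image cont) simp
    then show ?thesis
      using that by (metis bounded_iff compact_imp_bounded imageI real_norm_def)
  qed
  obtain d0 where d0: "d0 > 0" "\<And>x. x \<in> {-1/2..1/2} \<Longrightarrow> \<bar>x\<bar> < d0 \<Longrightarrow> \<bar>D x - D 0\<bar> < D 0 / 2"
    using cont[unfolded continuous_on_iff, rule_format, of 0 "D 0 / 2"] D0
    by (auto simp: dist_real_def)
  define \<delta> where "\<delta> = min (d0 / 2) (1 / 4)"
  have \<delta>: "0 < \<delta>" "\<delta> \<le> 1 / 4" "\<delta> < d0"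
    using d0(1) by (auto simp: \<delta>_def)
  \<comment> \<open>The peak kernel: at least 1 + eta for |x| <= delta / 2, nonnegative for |x| <=
    delta, and of absolute value at most 1 on the rest of the interval.\<close>
  define t where "t = (\<lambda>x. 1 + cos (2 * pi * x) - cos (2 * pi * \<delta>))"
  define \<eta> where "\<eta> = cos (pi * \<delta>) - cos (2 * pi * \<delta>)"
  have "cos (2 * pi * \<delta>) < cos (pi * \<delta>)"
    using \<delta> by (intro cos_monotone_0_pi) auto
  then have \<eta>: "\<eta> > 0" by (simp add: \<eta>_def)
  \<comment> \<open>Multiplication by \<open>t\<close> combines the moments M, M + 1 and M - 1 with
    constant weights, so the vanishing passes from N to N + 1 for all M at once.\<close>
  have zero: "((\<lambda>x. of_real (D x * t x ^ N) * cis (2 * pi * of_int M * x)) has_integral 0) {-1/2..1/2}" for N M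
  proof (induction N arbitrary: M)
    case 0
    then show ?case using mom by simp
  next
    case (Suc N)
    have "((\<lambda>x. of_real (1 - cos (2 * pi * \<delta>)) * (of_real (D x * t x ^ N) * cis (2 * pi * of_int M * x))
        + (1 / 2) * (of_real (D x * t x ^ N) * cis (2 * pi * of_int (M + 1) * x))
        + (1 / 2) * (of_real (D x * t x ^ N) * cis (2 * pi * of_int (M - 1) * x)))
        has_integral of_real (1 - cos (2 * pi * \<delta>)) * 0 + (1 / 2) * 0 + (1 / 2) * 0) {-1/2..1/2}"
      by (intro has_integral_add has_integral_mult_right Suc)
    moreover have "of_real (1 - cos (2 * pi * \<delta>)) * (of_real (D x * t x ^ N) * cis (2 * pi * of_int M * x))
        + (1 / 2) * (of_real (D x * t x ^ N) * cis (2 * pi * of_int (M + 1) * x))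
        + (1 / 2) * (of_real (D x * t x ^ N) * cis (2 * pi * of_int (M - 1) * x))
        = of_real (D x * t x ^ Suc N) * cis (2 * pi * of_int M * x)" for x
    proof -
      have 1: "cis (2 * pi * of_int (M + 1) * x) + cis (2 * pi * of_int (M - 1) * x)
          = 2 * of_real (cos (2 * pi * x)) * cis (2 * pi * of_int M * x)"
      proof -
        have "2 * pi * of_int (M + 1) * x = 2 * pi * of_int M * x + 2 * pi * x"
          "2 * pi * of_int (M - 1) * x = 2 * pi * of_int M * x - 2 * pi * x"
          by (simp_all add: algebra_simps)
        then show ?thesis
          by (simp add: complex_eq_iff cos_add cos_diff sin_add sin_diff)
      qed
      have "of_real (1 - cos (2 * pi * \<delta>)) * (of_real (D x * t x ^ N) * cis (2 * pi * of_int M * x))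
        + (1 / 2) * (of_real (D x * t x ^ N) * cis (2 * pi * of_int (M + 1) * x))
        + (1 / 2) * (of_real (D x * t x ^ N) * cis (2 * pi * of_int (M - 1) * x))
        = of_real (D x * t x ^ N) * (of_real (1 - cos (2 * pi * \<delta>)) * cis (2 * pi * of_int M * x)
          + (1 / 2) * (cis (2 * pi * of_int (M + 1) * x) + cis (2 * pi * of_int (M - 1) * x)))"
        by (simp add: algebra_simps)
      also have "\<dots> = of_real (D x * t x ^ Suc N) * cis (2 * pi * of_int M * x)"
        unfolding 1 by (simp add: t_def algebra_simps)
      finally show ?thesis .
    qed
    ultimately show ?case by simp
  qed
  have key: "\<delta> * (D 0 / 2 * (1 + \<eta>) ^ N) \<le> B" for N
  proof -
    define c where "c = D 0 / 2 * (1 + \<eta>) ^ N"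
    have ig: "((\<lambda>x. D x * t x ^ N) has_integral 0) {-1/2..1/2}"
      using has_integral_linear[OF zero[of N 0] bounded_linear_Re] by (simp add: o_def)
    \<comment> \<open>A pointwise minorant of D * t^N: the constant c on the inner interval of
      length delta, lowered everywhere by B to cover the outer region, where the integrand may be
      negative.\<close>
    have il: "((\<lambda>x. (if x \<in> {-\<delta>/2..\<delta>/2} then c else 0) - B) has_integral (\<delta> * c - B)) {-1/2..1/2}"
    proof (rule has_integral_diff)
      have "((\<lambda>x. c) has_integral (\<delta> * c)) {-\<delta>/2..\<delta>/2}"
        using has_integral_const_real[of c "-\<delta>/2" "\<delta>/2"] \<delta> by simp
      then show "((\<lambda>x. if x \<in> {-\<delta>/2..\<delta>/2} then c else 0) has_integral (\<delta> * c)) {-1/2..1/2}"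
        by (subst has_integral_restrict) (use \<delta> in auto)
      show "((\<lambda>x::real. B) has_integral B) {-1/2..1/2}"
        using has_integral_const_real[of B "-1/2" "1/2"] by simp
    qed
    have le: "(if x \<in> {-\<delta>/2..\<delta>/2} then c else 0) - B \<le> D x * t x ^ N" if x: "x \<in> {-1/2..1/2}" for x
    proof -
      have B0: "B \<ge> 0" using B[OF x] by simp
      have cosabs: "cos (2 * pi * x) = cos (2 * pi * \<bar>x\<bar>)" by (simp add: abs_if)
      consider "\<bar>x\<bar> \<le> \<delta> / 2" | "\<delta> / 2 < \<bar>x\<bar>" "\<bar>x\<bar> \<le> \<delta>" | "\<bar>x\<bar> > \<delta>" by linarith
      then show ?thesis
      proof cases
        case 1
        have "D x \<ge> D 0 / 2" using d0(2)[OF x] 1 \<delta> by (auto simp: abs_if split: if_splits)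
        moreover have "cos (pi * \<delta>) \<le> cos (2 * pi * x)"
          unfolding cosabs using 1 x \<delta> by (intro cos_monotone_0_pi_le) auto
        then have "t x \<ge> 1 + \<eta>" by (simp add: t_def \<eta>_def)
        then have "t x ^ N \<ge> (1 + \<eta>) ^ N" using \<eta> by (intro power_mono) auto
        ultimately have "D x * t x ^ N \<ge> c"
          unfolding c_def using D0 \<eta> by (intro mult_mono) auto
        then show ?thesis using 1 B0 by auto
      next
        case 2
        have "D x \<ge> 0" using d0(2)[OF x] 2 \<delta> D0 by (auto simp: abs_if split: if_splits)
        moreover have "cos (2 * pi * \<delta>) \<le> cos (2 * pi * x)"
          unfolding cosabs using 2 x \<delta> by (intro cos_monotone_0_pi_le) auto
        then have "t x \<ge> 0" by (simp add: t_def)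
        ultimately have "D x * t x ^ N \<ge> 0" by simp
        then show ?thesis using 2 B0 by auto
      next
        case 3
        have "cos (2 * pi * x) \<le> cos (2 * pi * \<delta>)"
          unfolding cosabs using 3 x \<delta> by (intro cos_monotone_0_pi_le) auto
        moreover have "cos (2 * pi * \<delta>) \<ge> 0"
        proof (rule cos_ge_zero)
          have "0 \<le> 2 * pi * \<delta>" using \<delta> by simp
          then show "- (pi / 2) \<le> 2 * pi * \<delta>" using pi_gt_zero by linarith
        qed (use \<delta> in auto)
        ultimately have "\<bar>t x\<bar> \<le> 1"
          unfolding t_def using cos_ge_minus_one[of "2 * pi * x"] cos_le_one[of "2 * pi * \<delta>"] by linarith
        then have "\<bar>t x ^ N\<bar> \<le> 1" by (simp add: power_abs power_le_one)
        then have "\<bar>D x * t x ^ N\<bar> \<le> B * 1"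
          unfolding abs_mult using B[OF x] B0 by (intro mult_mono) auto
        then show ?thesis using 3 \<delta> by auto
      qed
    qed
    have "\<delta> * c - B \<le> 0"
      by (rule has_integral_le[OF il ig le])
    then show ?thesis by (simp add: c_def)
  qed
  obtain N where "(1 + \<eta>) ^ N > B / (\<delta> * D 0 / 2)"
    using real_arch_pow[of "1 + \<eta>"] \<eta> by auto
  then have "\<delta> * (D 0 / 2 * (1 + \<eta>) ^ N) > B"
    using \<delta> D0 by (simp add: field_simps)
  then show False using key[of N] by simp
qed

text \<open>The real lemma is applied to Re D, - Re D, Im D and - Im D. Their moments vanish because
  conjugating a moment of D replaces M by - M.\<close>

lemma trig_moments_zero:
  fixes D :: "real \<Rightarrow> complex"
  assumes cont: "continuous_on {-1/2..1/2} D"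
    and mom: "\<And>M::int. ((\<lambda>x. D x * cis (2 * pi * of_int M * x)) has_integral 0) {-1/2..1/2}"
  shows "D 0 = 0"
proof -
  have mom': "((\<lambda>x. cnj (D x) * cis (2 * pi * of_int M * x)) has_integral 0) {-1/2..1/2}" for M :: int
    using has_integral_linear[OF mom[of "-M"] bounded_linear_cnj] by (simp add: o_def cis_cnj)
  have lin: "((\<lambda>x. (a * D x + b * cnj (D x)) * cis (2 * pi * of_int M * x)) has_integral 0) {-1/2..1/2}" for a b and M :: int
    using has_integral_add[OF has_integral_mult_right[OF mom[of M], of a] has_integral_mult_right[OF mom'[of M], of b]]
    by (simp add: algebra_simps)
  have eqs: "of_real (Re z) = 1 / 2 * z + 1 / 2 * cnj z"
    "of_real (- Re z) = - 1 / 2 * z + - 1 / 2 * cnj z"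
    "of_real (Im z) = - \<i> / 2 * z + \<i> / 2 * cnj z"
    "of_real (- Im z) = \<i> / 2 * z + - \<i> / 2 * cnj z" for z
    by (simp_all add: complex_eq_iff)
  have "Re (D 0) \<le> 0" "- Re (D 0) \<le> 0" "Im (D 0) \<le> 0" "- Im (D 0) \<le> 0"
    by (rule trig_moments_zero_imp_nonpos[of "\<lambda>x. Re (D x)"]
             trig_moments_zero_imp_nonpos[of "\<lambda>x. - Re (D x)"]
             trig_moments_zero_imp_nonpos[of "\<lambda>x. Im (D x)"]
             trig_moments_zero_imp_nonpos[of "\<lambda>x. - Im (D x)"];
        (intro continuous_intros cont)?; unfold eqs; rule lin)+
  then show ?thesis by (simp add: complex_eq_iff)
qed

text \<open>This is the characteristic function of the standard normal distribution at K sqrt (2 pi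
  v), transported by x -> c (x + y) with c = sqrt (2 pi / v). The Jacobian 1 / c and the
  normalisation 1 / sqrt (2 pi) of the density combine to the factor sqrt v.\<close>

lemma gaussian_fourier:
  fixes v K y :: real
  assumes v: "v > 0"
  shows "((\<lambda>x. of_real (exp (- pi * (x + y)\<^sup>2 / v)) * cis (2 * pi * K * (x + y)))
      has_integral of_real (sqrt v * exp (- pi * v * K\<^sup>2))) UNIV"
proof -
  define f where "f = (\<lambda>x. of_real (std_normal_density x) * cis (K * sqrt (2 * pi * v) * x))"
  have [measurable]: "(\<lambda>x. cis (a * x)) \<in> borel_measurable borel" for a
    by (intro borel_measurable_continuous_onI continuous_intros)
  have int: "integrable lborel f"
  proof -
    have "integrable lborel std_normal_density" by simp
    then have "integrable lborel (\<lambda>x. complex_of_real (std_normal_density x))" by simp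
    then show ?thesis
      unfolding f_def
      by (rule Bochner_Integration.integrable_bound) (auto simp: norm_mult)
  qed
  have "integral\<^sup>L lborel f = char std_normal_distribution (K * sqrt (2 * pi * v))"
    unfolding char_def f_def
    by (subst integral_density) (auto simp: scaleR_conv_of_real cis_conv_exp mult_ac)
  also have "\<dots> = of_real (exp (- pi * v * K\<^sup>2))"
    using v by (simp add: char_std_normal_distribution power_mult_distrib algebra_simps)
  finally have val: "integral\<^sup>L lborel f = of_real (exp (- pi * v * K\<^sup>2))" .
  define c where "c = sqrt (2 * pi / v)"
  have c: "c > 0" "c\<^sup>2 = 2 * pi / v" using v by (auto simp: c_def)
  have "(2 * pi * v) * (2 * pi / v) = (2 * pi)\<^sup>2"
    using v by (simp add: power2_eq_square)
  then have "sqrt (2 * pi * v) * c = 2 * pi"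
    unfolding c_def real_sqrt_mult[symmetric] by (simp only: real_sqrt_abs) simp
  then have K: "K * sqrt (2 * pi * v) * (c * x) = 2 * pi * K * x" for x
    by (metis mult.assoc mult.commute)
  have cy: "c * y + c * x = c * (x + y)" for x by (simp add: algebra_simps)
  have fc: "f (c * y + c * x) = of_real (1 / sqrt (2 * pi)) * (of_real (exp (- pi * (x + y)\<^sup>2 / v)) * cis (2 * pi * K * (x + y)))" for x
    unfolding f_def std_normal_density_def cy K using c(2) by (simp add: power_mult_distrib)
  have "((\<lambda>x. f (c * y + c * x)) has_integral (integral\<^sup>L lborel (\<lambda>x. f (c * y + c * x)))) UNIV"
    using lborel_integrable_real_affine[OF int, of c "c * y"] c by (intro has_integral_integral_lborel) simp
  moreover have "integral\<^sup>L lborel (\<lambda>x. f (c * y + c * x)) = of_real (exp (- pi * v * K\<^sup>2) / c)"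
    using lborel_integral_real_affine[of c f "c * y"] c val by (simp add: scaleR_conv_of_real field_simps)
  ultimately have "((\<lambda>x. of_real (1 / sqrt (2 * pi)) * (of_real (exp (- pi * (x + y)\<^sup>2 / v)) * cis (2 * pi * K * (x + y))))
      has_integral of_real (exp (- pi * v * K\<^sup>2) / c)) UNIV"
    unfolding fc by simp
  from has_integral_mult_right[OF this, of "of_real (sqrt (2 * pi))"]
  have "((\<lambda>x. of_real (exp (- pi * (x + y)\<^sup>2 / v)) * cis (2 * pi * K * (x + y)))
      has_integral of_real (sqrt (2 * pi) * exp (- pi * v * K\<^sup>2) / c)) UNIV"
    by (simp add: field_simps)
  also have "sqrt (2 * pi) / c = sqrt v"
    using v by (simp add: c_def real_sqrt_divide)
  then have "sqrt (2 * pi) * exp (- pi * v * K\<^sup>2) / c = sqrt v * exp (- pi * v * K\<^sup>2)"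
    by (metis times_divide_eq_left)
  finally show ?thesis .
qed


section \<open>Termwise integration, periodization and the Poisson formula\<close>

lemma has_sum_integral_interval:
  fixes f :: "int \<Rightarrow> real \<Rightarrow> complex"
  assumes cont: "\<And>n. continuous_on {a..b} (f n)"
    and M: "M summable_on UNIV" "\<And>n x. x \<in> {a..b} \<Longrightarrow> norm (f n x) \<le> M n"
  obtains J where "((\<lambda>n. integral {a..b} (f n)) has_sum J) UNIV"
    "((\<lambda>x. \<Sum>\<^sub>\<infinity>n. f n x) has_integral J) {a..b}"
    "continuous_on {a..b} (\<lambda>x. \<Sum>\<^sub>\<infinity>n. f n x)"
proof -
  have ul: "uniform_limit {a..b} (\<lambda>X x. \<Sum>n\<in>X. f n x) (\<lambda>x. \<Sum>\<^sub>\<infinity>n. f n x) (finite_subsets_at_top UNIV)"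
    by (rule Weierstrass_m_test_general[OF _ M(1)]) (rule M(2))
  have c: "continuous_on {a..b} (\<lambda>x. \<Sum>n\<in>X. f n x)" for X
    by (intro continuous_intros cont)
  obtain I J where IJ: "\<And>X. ((\<lambda>x. \<Sum>n\<in>X. f n x) has_integral I X) {a..b}"
    "((\<lambda>x. \<Sum>\<^sub>\<infinity>n. f n x) has_integral J) {a..b}" "(I \<longlongrightarrow> J) (finite_subsets_at_top UNIV)"
    using uniform_limit_integral[OF ul c] by (metis finite_subsets_at_top_neq_bot)
  have "I X = (\<Sum>n\<in>X. integral {a..b} (f n))" if "finite X" for X
    using IJ(1)[of X] that
    by (intro has_integral_unique[OF IJ(1)] has_integral_sum) (auto intro!: integrable_integral integrable_continuous_real cont)
  then have "((\<lambda>n. integral {a..b} (f n)) has_sum J) UNIV"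
    unfolding has_sum_def
    by (intro Lim_transform_eventually[OF IJ(3)] eventually_finite_subsets_at_top_weakI) auto
  moreover have "continuous_on {a..b} (\<lambda>x. \<Sum>\<^sub>\<infinity>n. f n x)"
    by (rule uniform_limit_theorem[OF _ ul]) (use c in auto)
  ultimately show ?thesis using that IJ(2) by blast
qed

lemma has_integral_periodization:
  fixes F :: "real \<Rightarrow> complex"
  assumes cont: "continuous_on UNIV F" and int: "(F has_integral I) UNIV"
    and M: "M summable_on UNIV" "\<And>n x. x \<in> {-1/2..1/2} \<Longrightarrow> norm (F (of_int n + x)) \<le> M n"
  shows "((\<lambda>x. \<Sum>\<^sub>\<infinity>n. F (of_int n + x)) has_integral I) {-1/2..1/2}"
    and "continuous_on {-1/2..1/2} (\<lambda>x. \<Sum>\<^sub>\<infinity>n. F (of_int n + x))"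
proof -
  have c: "continuous_on S F" for S using cont continuous_on_subset by blast
  have c': "continuous_on {-1/2..1/2} (\<lambda>x. F (of_int n + x))" for n
    by (rule continuous_on_compose2[OF cont]) (auto intro!: continuous_intros)
  obtain J where J: "((\<lambda>n. integral {-1/2..1/2} (\<lambda>x. F (of_int n + x))) has_sum J) UNIV"
    "((\<lambda>x. \<Sum>\<^sub>\<infinity>n. F (of_int n + x)) has_integral J) {-1/2..1/2}"
    "continuous_on {-1/2..1/2} (\<lambda>x. \<Sum>\<^sub>\<infinity>n. F (of_int n + x))"
    using has_sum_integral_interval[OF c' M] by blast
  have shift: "integral {-1/2..1/2} (\<lambda>x. F (of_int n + x)) = integral {of_int n - 1/2..of_int n + 1/2} F" for n :: int
    using integral_shift[where f = F and a = "-1/2" and b = "1/2" and c = "of_int n"] c by (simp add: add.commute o_def)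
  have partial: "(\<Sum>n\<in>{-int N..int N}. integral {-1/2..1/2} (\<lambda>x. F (of_int n + x)))
      = integral {- real N - 1/2..real N + 1/2} F" for N
  proof (induction N)
    case 0
    then show ?case by simp
  next
    case (Suc N)
    have eq: "{-int (Suc N)..int (Suc N)} = insert (- int (Suc N)) (insert (int (Suc N)) {-int N..int N})"
      by auto
    have "(\<Sum>n\<in>{-int (Suc N)..int (Suc N)}. integral {-1/2..1/2} (\<lambda>x. F (of_int n + x)))
      = integral {- real (Suc N) - 1/2..- real N - 1/2} F
        + (integral {real N + 1/2..real (Suc N) + 1/2} F + integral {- real N - 1/2..real N + 1/2} F)"
    proof -
      define J where "J = (\<lambda>n::int. integral {-1/2..1/2} (\<lambda>x. F (of_int n + x)))"
      have "J (- int (Suc N)) = integral {- real (Suc N) - 1/2..- real N - 1/2} F"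
        "J (int (Suc N)) = integral {real N + 1/2..real (Suc N) + 1/2} F"
      proof -
        have e: "real_of_int (- int (Suc N)) - 1 / 2 = - real (Suc N) - 1/2"
          "real_of_int (- int (Suc N)) + 1 / 2 = - real N - 1/2"
          "real_of_int (int (Suc N)) - 1 / 2 = real N + 1/2"
          "real_of_int (int (Suc N)) + 1 / 2 = real (Suc N) + 1/2"
          by simp_all
        show "J (- int (Suc N)) = integral {- real (Suc N) - 1/2..- real N - 1/2} F"
          "J (int (Suc N)) = integral {real N + 1/2..real (Suc N) + 1/2} F"
          unfolding J_def shift e by (rule refl)+
      qed
      then show ?thesis
        unfolding eq J_def[symmetric] Suc[folded J_def, symmetric]
        by (subst sum.insert; simp)
    qed
    also have "integral {real N + 1/2..real (Suc N) + 1/2} F + integral {- real N - 1/2..real N + 1/2} F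
        = integral {- real N - 1/2..real (Suc N) + 1/2} F"
      by (subst add.commute, rule Henstock_Kurzweil_Integration.integral_combine)
        (auto intro!: integrable_continuous_real c)
    also have "integral {- real (Suc N) - 1/2..- real N - 1/2} F + \<dots> = integral {- real (Suc N) - 1/2..real (Suc N) + 1/2} F"
      by (rule Henstock_Kurzweil_Integration.integral_combine) (auto intro!: integrable_continuous_real c)
    finally show ?case .
  qed
  \<comment> \<open>I and J are limits of the same integrals over symmetric intervals: I by the
    definition of the integral over the line, J by restricting the unordered sum to the sets {-
    N..N}.\<close>
  have "(\<lambda>N. integral {- real N - 1/2..real N + 1/2} F) \<longlonglongrightarrow> I"
  proof (rule LIMSEQ_I)
    fix e :: real assume "e > 0"
    then obtain B where B: "B > 0" "\<And>a b. ball 0 B \<subseteq> cbox a b \<Longrightarrow> norm (integral (cbox a b) F - I) < e"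
      using int[unfolded has_integral_alt'] by auto
    obtain N0 where N0: "real N0 > B" using reals_Archimedean2 by blast
    have "norm (integral {- real N - 1/2..real N + 1/2} F - I) < e" if "N \<ge> N0" for N
    proof -
      have "real N \<ge> real N0" using that by simp
      then have "ball 0 B \<subseteq> cbox (- real N - 1/2) (real N + 1/2)"
        using N0 by (auto simp: dist_real_def)
      from B(2)[OF this] show ?thesis by simp
    qed
    then show "\<exists>N0. \<forall>N\<ge>N0. norm (integral {- real N - 1/2..real N + 1/2} F - I) < e" by blast
  qed
  moreover have "(\<lambda>N. integral {- real N - 1/2..real N + 1/2} F) \<longlonglongrightarrow> J"
  proof -
    have "filterlim (\<lambda>N. {-int N..int N}) (finite_subsets_at_top UNIV) sequentially"
      unfolding filterlim_finite_subsets_at_top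
    proof (intro allI impI)
      fix X :: "int set" assume "finite X \<and> X \<subseteq> UNIV"
      then have X: "finite X" by simp
      obtain K where K: "\<And>n. n \<in> X \<Longrightarrow> \<bar>n\<bar> \<le> K"
        using that[of "Max (abs ` X)"] X by simp
      show "\<forall>\<^sub>F N in sequentially. finite {-int N..int N} \<and> X \<subseteq> {-int N..int N} \<and> {-int N..int N} \<subseteq> UNIV"
        using eventually_ge_at_top[of "nat K"] by eventually_elim (use K in fastforce)
    qed
    from filterlim_compose[OF J(1)[unfolded has_sum_def] this] show ?thesis
      unfolding partial .
  qed
  ultimately have "I = J" by (rule LIMSEQ_unique)
  then show "((\<lambda>x. \<Sum>\<^sub>\<infinity>n. F (of_int n + x)) has_integral I) {-1/2..1/2}"
    and "continuous_on {-1/2..1/2} (\<lambda>x. \<Sum>\<^sub>\<infinity>n. F (of_int n + x))"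
    using J by simp_all
qed

text \<open>Both sides are extended to functions of x, the periodized Gaussian \<open>G\<close> and
  the Fourier series \<open>H\<close>. Their moments against all characters agree, so the difference
  vanishes at x = 0.\<close>

lemma poisson_gaussian_real:
  fixes v y :: real
  assumes v: "v > 0"
  shows "(\<Sum>\<^sub>\<infinity>n::int. complex_of_real (exp (- pi * (of_int n + y)\<^sup>2 / v)))
       = of_real (sqrt v) * (\<Sum>\<^sub>\<infinity>n::int. of_real (exp (- pi * v * (of_int n)\<^sup>2)) * cis (2 * pi * of_int n * y))"
proof -
  define G where "G = (\<lambda>x. \<Sum>\<^sub>\<infinity>n::int. complex_of_real (exp (- pi * (of_int n + x + y)\<^sup>2 / v)))"
  define f where "f = (\<lambda>n::int. \<lambda>x. of_real (sqrt v * exp (- pi * v * (of_int n)\<^sup>2)) * cis (2 * pi * of_int n * (x + y)))"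
  define H where "H = (\<lambda>x. \<Sum>\<^sub>\<infinity>n. f n x)"
  \<comment> \<open>For |x| <= 1/2 the cross term 2 n (x + y) of the square is at most 2 |n| (|y| +
    1/2) in absolute value, which fixes the linear coefficient.\<close>
  obtain M1 where M1: "M1 summable_on (UNIV :: int set)"
    "\<And>n. exp (- (pi / v) * (of_int n)\<^sup>2 + (2 * (pi / v) * (\<bar>y\<bar> + 1 / 2)) * \<bar>real_of_int n\<bar>) \<le> M1 n"
    using gaussian_majorant[of "pi / v" 0 0 "2 * (pi / v) * (\<bar>y\<bar> + 1 / 2)"] v by auto
  obtain M2 where M2: "M2 summable_on (UNIV :: int set)"
    "\<And>n. exp (- (pi * v) * (real_of_int n)\<^sup>2) \<le> M2 n"
    using gaussian_majorant[of "pi * v" 0 0 0] v by auto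
  have G: "((\<lambda>x. G x * cis (2 * pi * of_int K * x)) has_integral
        cis (- 2 * pi * of_int K * y) * of_real (sqrt v * exp (- pi * v * (of_int K)\<^sup>2))) {-1/2..1/2}"
    and Gc: "continuous_on {-1/2..1/2} (\<lambda>x. G x * cis (2 * pi * of_int K * x))" for K :: int
  proof -
    \<comment> \<open>The constant cis (- 2 pi K y) turns the character in x + y, as
      \<open>gaussian_fourier\<close> has it, into the character cis (2 pi K x), which is invariant
      under integer shifts of x.\<close>
    define F where "F = (\<lambda>x. cis (- 2 * pi * of_int K * y) * (complex_of_real (exp (- pi * (x + y)\<^sup>2 / v)) * cis (2 * pi * of_int K * (x + y))))"
    have F1: "F x = of_real (exp (- pi * (x + y)\<^sup>2 / v)) * cis (2 * pi * of_int K * x)" for x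
    proof -
      have "cis (- 2 * pi * of_int K * y) * cis (2 * pi * of_int K * (x + y)) = cis (2 * pi * of_int K * x)"
        by (simp add: cis_mult algebra_simps)
      then show ?thesis unfolding F_def by (metis mult.left_commute)
    qed
    have F2: "F (of_int n + x) = of_real (exp (- pi * (of_int n + x + y)\<^sup>2 / v)) * cis (2 * pi * of_int K * x)" for n :: int and x
    proof -
      have "2 * pi * of_int K * (of_int n + x) = 2 * pi * of_int (K * n) + 2 * pi * of_int K * x"
        by (simp add: algebra_simps)
      moreover have "cis (2 * pi * of_int (K * n)) = 1"
        by (rule cis_multiple_2pi) simp
      ultimately show ?thesis
        unfolding F1 by (simp add: cis_mult[symmetric] del: of_int_mult)
    qed
    have sum: "(\<Sum>\<^sub>\<infinity>n::int. F (of_int n + x)) = G x * cis (2 * pi * of_int K * x)" for x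
      unfolding F2 G_def by (rule infsum_cmult_left')
    have bnd: "norm (F (of_int n + x)) \<le> M1 n" if x: "x \<in> {-1/2..1/2}" for n x
    proof -
      have xy: "\<bar>x + y\<bar> \<le> \<bar>y\<bar> + 1 / 2" using x by (auto simp: abs_if split: if_splits)
      have "- (of_int n + x + y)\<^sup>2 \<le> - (of_int n)\<^sup>2 + 2 * \<bar>real_of_int n\<bar> * (\<bar>y\<bar> + 1 / 2)"
      proof -
        have "- (2 * of_int n * (x + y)) \<le> \<bar>2 * of_int n * (x + y)\<bar>" by linarith
        also have "\<dots> = 2 * \<bar>real_of_int n\<bar> * \<bar>x + y\<bar>" by (simp add: abs_mult)
        also have "\<dots> \<le> 2 * \<bar>real_of_int n\<bar> * (\<bar>y\<bar> + 1 / 2)"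
          using xy by (intro mult_left_mono) auto
        finally have "- (2 * of_int n * (x + y)) \<le> 2 * \<bar>real_of_int n\<bar> * (\<bar>y\<bar> + 1 / 2)" .
        moreover have "- (of_int n + x + y)\<^sup>2 = - (of_int n)\<^sup>2 - 2 * of_int n * (x + y) - (x + y)\<^sup>2"
          by (simp add: power2_eq_square algebra_simps)
        moreover have "(x + y)\<^sup>2 \<ge> 0" by simp
        ultimately show ?thesis by linarith
      qed
      then have "(pi / v) * - (of_int n + x + y)\<^sup>2 \<le> (pi / v) * (- (of_int n)\<^sup>2 + 2 * \<bar>real_of_int n\<bar> * (\<bar>y\<bar> + 1 / 2))"
        using v by (intro mult_left_mono) auto
      then have "exp (- pi * (of_int n + x + y)\<^sup>2 / v)
          \<le> exp (- (pi / v) * (of_int n)\<^sup>2 + (2 * (pi / v) * (\<bar>y\<bar> + 1 / 2)) * \<bar>real_of_int n\<bar>)"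
        unfolding exp_le_cancel_iff by (simp add: algebra_simps)
      then show ?thesis
        unfolding F2 using order.trans[OF _ M1(2)[of n]] by (simp add: norm_mult)
    qed
    have cF: "continuous_on UNIV F"
      unfolding F_def using v by (intro continuous_intros) auto
    have iF: "(F has_integral cis (- 2 * pi * of_int K * y) * of_real (sqrt v * exp (- pi * v * (of_int K)\<^sup>2))) UNIV"
      unfolding F_def by (intro has_integral_mult_right gaussian_fourier v)
    from has_integral_periodization[OF cF iF M1(1) bnd]
    show "((\<lambda>x. G x * cis (2 * pi * of_int K * x)) has_integral
        cis (- 2 * pi * of_int K * y) * of_real (sqrt v * exp (- pi * v * (of_int K)\<^sup>2))) {-1/2..1/2}"
      and "continuous_on {-1/2..1/2} (\<lambda>x. G x * cis (2 * pi * of_int K * x))"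
      unfolding sum by blast+
  qed
  have cis_int: "((\<lambda>x. cis (2 * pi * of_int j * x)) has_integral of_bool (j = 0)) {-1/2..1/2}" for j :: int
  proof (cases "j = 0")
    case True
    then show ?thesis using has_integral_const_real[of "1::complex" "-1/2" "1/2"] by simp
  next
    case False
    define F where "F = (\<lambda>x::real. cis (2 * pi * of_int j * x) / (2 * pi * \<i> * of_int j))"
    have "((\<lambda>x. cis (2 * pi * of_int j * x)) has_integral (F (1/2) - F (-1/2))) {-1/2..1/2}"
      unfolding F_def
    proof (rule fundamental_theorem_of_calculus)
      fix x :: real
      have "((\<lambda>z. exp (\<i> * (2 * pi * of_int j * z)) / (2 * pi * \<i> * of_int j)) has_field_derivative
          exp (\<i> * (2 * pi * of_int j * of_real x))) (at (of_real x))"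
        using False by (auto intro!: derivative_eq_intros)
      from has_vector_derivative_real_field[OF this, of "{-1/2..1/2}"]
      show "((\<lambda>x. cis (2 * pi * of_int j * x) / (2 * pi * \<i> * of_int j)) has_vector_derivative
          cis (2 * pi * of_int j * x)) (at x within {-1/2..1/2})"
        by (simp add: cis_conv_exp)
    qed simp
    moreover have "cis (pi * of_int j) = cis (- (pi * of_int j))"
    proof -
      have "cis (pi * of_int j) = cis (2 * pi * of_int j) * cis (- (pi * of_int j))"
        by (simp only: cis_mult) (simp add: algebra_simps)
      then show ?thesis using cis_multiple_2pi[of "of_int j"] by simp
    qed
    then have "F (1/2) = F (-1/2)" by (simp add: F_def)
    ultimately show ?thesis using False by simp
  qed
  have H: "((\<lambda>x. H x * cis (2 * pi * of_int K * x)) has_integral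
        cis (- 2 * pi * of_int K * y) * of_real (sqrt v * exp (- pi * v * (of_int K)\<^sup>2))) {-1/2..1/2}"
    and Hc: "continuous_on {-1/2..1/2} (\<lambda>x. H x * cis (2 * pi * of_int K * x))" for K :: int
  proof -
    have b: "norm (f n x * cis (2 * pi * of_int K * x)) \<le> sqrt v * M2 n" for n x
      using M2(2)[of n] v by (auto simp: f_def norm_mult)
    have c: "continuous_on {-1/2..1/2} (\<lambda>x. f n x * cis (2 * pi * of_int K * x))" for n
      unfolding f_def by (intro continuous_intros)
    have sM: "(\<lambda>n. sqrt v * M2 n) summable_on UNIV"
      by (intro summable_on_cmult_right M2)
    obtain J where J: "((\<lambda>n. integral {-1/2..1/2} (\<lambda>x. f n x * cis (2 * pi * of_int K * x))) has_sum J) UNIV"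
      "((\<lambda>x. \<Sum>\<^sub>\<infinity>n. f n x * cis (2 * pi * of_int K * x)) has_integral J) {-1/2..1/2}"
      "continuous_on {-1/2..1/2} (\<lambda>x. \<Sum>\<^sub>\<infinity>n. f n x * cis (2 * pi * of_int K * x))"
      using has_sum_integral_interval[OF c sM b] by blast
    have sum: "(\<Sum>\<^sub>\<infinity>n. f n x * cis (2 * pi * of_int K * x)) = H x * cis (2 * pi * of_int K * x)" for x
      unfolding H_def by (rule infsum_cmult_left')
    \<comment> \<open>Orthogonality leaves n = - K rather than n = K, since the test character
      enters without conjugation.\<close>
    have trm: "integral {-1/2..1/2} (\<lambda>x. f n x * cis (2 * pi * of_int K * x))
      = of_real (sqrt v * exp (- pi * v * (of_int n)\<^sup>2)) * cis (2 * pi * of_int n * y) * of_bool (n = - K)" for n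
    proof -
      have eq: "f n x * cis (2 * pi * of_int K * x) = of_real (sqrt v * exp (- pi * v * (of_int n)\<^sup>2)) * cis (2 * pi * of_int n * y)
          * cis (2 * pi * of_int (n + K) * x)" for x
        unfolding f_def by (simp add: cis_mult mult.assoc) (simp add: algebra_simps)
      have "((\<lambda>x. f n x * cis (2 * pi * of_int K * x)) has_integral
         of_real (sqrt v * exp (- pi * v * (of_int n)\<^sup>2)) * cis (2 * pi * of_int n * y) * of_bool (n + K = 0)) {-1/2..1/2}"
        unfolding eq by (intro has_integral_mult_right cis_int)
      then show ?thesis by (simp add: integral_unique add_eq_0_iff2)
    qed
    have "((\<lambda>n. integral {-1/2..1/2} (\<lambda>x. f n x * cis (2 * pi * of_int K * x)))
       has_sum (cis (- 2 * pi * of_int K * y) * of_real (sqrt v * exp (- pi * v * (of_int K)\<^sup>2)))) UNIV"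
      unfolding trm
      by (rule has_sum_finite_neutralI[of "{- K}"]) auto
    then have "J = cis (- 2 * pi * of_int K * y) * of_real (sqrt v * exp (- pi * v * (of_int K)\<^sup>2))"
      using J(1) has_sum_unique by blast
    with J sum show "((\<lambda>x. H x * cis (2 * pi * of_int K * x)) has_integral
        cis (- 2 * pi * of_int K * y) * of_real (sqrt v * exp (- pi * v * (of_int K)\<^sup>2))) {-1/2..1/2}"
      and "continuous_on {-1/2..1/2} (\<lambda>x. H x * cis (2 * pi * of_int K * x))"
      by simp_all
  qed
  have "G 0 - H 0 = 0"
  proof (rule trig_moments_zero[of "\<lambda>x. G x - H x"])
    show "continuous_on {-1/2..1/2} (\<lambda>x. G x - H x)"
      using Gc[of 0] Hc[of 0] by (auto intro: continuous_on_diff)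
    show "((\<lambda>x. (G x - H x) * cis (2 * pi * of_int M * x)) has_integral 0) {-1/2..1/2}" for M
      using has_integral_diff[OF G[of M] H[of M]] by (simp add: algebra_simps)
  qed
  moreover have "H 0 = of_real (sqrt v) * (\<Sum>\<^sub>\<infinity>n::int. of_real (exp (- pi * v * (of_int n)\<^sup>2)) * cis (2 * pi * of_int n * y))"
    unfolding H_def f_def by (subst infsum_cmult_right'[symmetric]) (simp add: mult.assoc)
  ultimately show ?thesis by (simp add: G_def)
qed


subsection \<open>Gaussian theta series\<close>

text \<open>The factor x^N records derivatives: each one in beta raises N by 1, each one in alpha
  raises it by 2. The parameter alpha stays free because the series is used at tau, at cnj tau and
  in Poisson summation.\<close>

definition gauss_term :: "nat \<Rightarrow> real \<Rightarrow> complex \<Rightarrow> complex \<Rightarrow> complex" where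
  "gauss_term N x \<alpha> \<beta> = of_real x ^ N * exp (- \<alpha> * (of_real x)\<^sup>2 + \<beta> * of_real x)"

definition gauss_theta :: "nat \<Rightarrow> real \<Rightarrow> complex \<Rightarrow> complex \<Rightarrow> complex" where
  "gauss_theta N h \<alpha> \<beta> = (\<Sum>\<^sub>\<infinity>n::int. gauss_term N (of_int n + h) \<alpha> \<beta>)"

lemma norm_gauss_term_le:
  assumes "c \<le> Re \<alpha>" "norm \<beta> \<le> b"
  shows "norm (gauss_term N x \<alpha> \<beta>) \<le> \<bar>x\<bar> ^ N * exp (- c * x\<^sup>2 + b * \<bar>x\<bar>)"
proof -
  have "Re \<beta> * x \<le> \<bar>Re \<beta>\<bar> * \<bar>x\<bar>" by (metis abs_ge_self abs_mult)
  also have "\<dots> \<le> b * \<bar>x\<bar>"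
    using assms(2) abs_Re_le_cmod[of \<beta>] by (intro mult_right_mono) auto
  finally have "Re \<beta> * x \<le> b * \<bar>x\<bar>" .
  moreover have "c * x\<^sup>2 \<le> Re \<alpha> * x\<^sup>2" using assms(1) by (intro mult_right_mono) auto
  ultimately have "Re (- \<alpha> * (of_real x)\<^sup>2 + \<beta> * of_real x) \<le> - c * x\<^sup>2 + b * \<bar>x\<bar>"
    by (simp flip: of_real_power)
  then show ?thesis
    unfolding gauss_term_def by (auto simp: norm_mult norm_power intro!: mult_left_mono)
qed

lemma normally_summable_gauss_term:
  assumes "open S" "continuous_on S A" "continuous_on S B" "\<And>z. z \<in> S \<Longrightarrow> Re (A z) > 0"
  shows "normally_summable_on (\<lambda>(n::int) z. gauss_term N (of_int n + h) (A z) (B z)) UNIV S"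
  unfolding normally_summable_on_def
proof
  fix z assume "z \<in> S"
  then obtain r where r: "r > 0" "cball z r \<subseteq> S"
    using assms(1) open_contains_cball by blast
  have "compact ((\<lambda>w. Re (A w)) ` cball z r)" "compact (B ` cball z r)"
    using r(2) by (auto intro!: compact_continuous_image continuous_intros
        intro: continuous_on_subset[OF assms(2)] continuous_on_subset[OF assms(3)])
  moreover have "(\<lambda>w. Re (A w)) ` cball z r \<noteq> {}" using r by auto
  ultimately obtain w0 where w0: "w0 \<in> cball z r" "\<And>w. w \<in> cball z r \<Longrightarrow> Re (A w0) \<le> Re (A w)"
    using compact_attains_inf[of "(\<lambda>w. Re (A w)) ` cball z r"] by (metis (no_types, lifting) imageE imageI)
  obtain b where b: "\<And>w. w \<in> cball z r \<Longrightarrow> norm (B w) \<le> b"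
    using compact_imp_bounded[OF \<open>compact (B ` cball z r)\<close>] unfolding bounded_iff by blast
  have "Re (A w0) > 0" using w0 r assms(4) by auto
  from gaussian_majorant[OF this, of h N b] obtain M where M: "M summable_on (UNIV :: int set)"
    "\<And>n. \<bar>real_of_int n + h\<bar> ^ N * exp (- Re (A w0) * (real_of_int n + h)\<^sup>2 + b * \<bar>real_of_int n + h\<bar>) \<le> M n"
    by auto
  have "norm (gauss_term N (of_int n + h) (A w) (B w)) \<le> M n" if "w \<in> cball z r" for n :: int and w
    using norm_gauss_term_le[OF w0(2)[OF that] b[OF that]] M(2) by (rule order.trans)
  then show "\<exists>r>0. \<exists>M. cball z r \<subseteq> S \<and> M summable_on UNIV \<and>
      (\<forall>i\<in>UNIV. \<forall>w\<in>cball z r. norm (gauss_term N (of_int i + h) (A w) (B w)) \<le> M i)"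
    using r M(1) by blast
qed

lemma gauss_term_abs_summable:
  assumes "Re \<alpha> > 0"
  shows "(\<lambda>n::int. norm (gauss_term N (of_int n + h) \<alpha> \<beta>)) summable_on UNIV"
  using normally_summable_on_imp_abs_summable[OF normally_summable_gauss_term[of UNIV "\<lambda>_. \<alpha>" "\<lambda>_. \<beta>" N h], of 0]
    assms by simp

lemma gauss_theta_has_sum:
  assumes "Re \<alpha> > 0"
  shows "((\<lambda>n::int. gauss_term N (of_int n + h) \<alpha> \<beta>) has_sum gauss_theta N h \<alpha> \<beta>) UNIV"
  unfolding gauss_theta_def by (rule has_sum_infsum, rule abs_summable_summable, rule gauss_term_abs_summable[OF assms])

lemma holomorphic_on_gauss_theta:
  assumes "open S" "A holomorphic_on S" "B holomorphic_on S" "\<And>z. z \<in> S \<Longrightarrow> Re (A z) > 0"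
  shows "(\<lambda>z. gauss_theta N h (A z) (B z)) holomorphic_on S"
  unfolding gauss_theta_def
  using assms
  by (intro holomorphic_infsum normally_summable_gauss_term holomorphic_on_imp_continuous_on)
    (auto simp: gauss_term_def intro!: holomorphic_intros)

lemma higher_deriv_exp_linear: "(deriv ^^ m) (\<lambda>w::complex. exp (a + c * w)) = (\<lambda>w. c ^ m * exp (a + c * w))"
proof (induction m)
  case (Suc m)
  have "deriv (\<lambda>w. c ^ m * exp (a + c * w)) w = c ^ Suc m * exp (a + c * w)" for w
    by (rule DERIV_imp_deriv) (auto intro!: derivative_eq_intros)
  with Suc show ?case by auto
qed simp

lemma higher_deriv_gauss_theta:
  assumes "Re \<alpha> > 0"
  shows "(deriv ^^ m) (\<lambda>w. gauss_theta N h \<alpha> (c * w)) w = c ^ m * gauss_theta (N + m) h \<alpha> (c * w)"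
proof -
  have d: "(deriv ^^ m) (\<lambda>w. gauss_term N x \<alpha> (c * w)) w = c ^ m * gauss_term (N + m) x \<alpha> (c * w)" for x
  proof -
    have "(\<lambda>w. gauss_term N x \<alpha> (c * w)) = (\<lambda>w. of_real x ^ N * exp (- \<alpha> * (of_real x)\<^sup>2 + (c * of_real x) * w))"
      by (simp add: gauss_term_def mult_ac)
    moreover have "(deriv ^^ m) (\<lambda>w. of_real x ^ N * exp (- \<alpha> * (of_real x)\<^sup>2 + (c * of_real x) * w)) w
       = of_real x ^ N * (deriv ^^ m) (\<lambda>w. exp (- \<alpha> * (of_real x)\<^sup>2 + (c * of_real x) * w)) w"
      by (rule higher_deriv_cmult[of _ UNIV]) (auto intro!: holomorphic_intros)
    ultimately show ?thesis
      unfolding higher_deriv_exp_linear by (simp add: gauss_term_def power_add power_mult_distrib mult_ac)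
  qed
  have "((\<lambda>n::int. (deriv ^^ m) (\<lambda>w. gauss_term N (of_int n + h) \<alpha> (c * w)) w) has_sum
      (deriv ^^ m) (\<lambda>w. gauss_theta N h \<alpha> (c * w)) w) UNIV"
    unfolding gauss_theta_def using assms
    by (intro has_sum_higher_deriv[of UNIV] normally_summable_gauss_term)
      (auto simp: gauss_term_def intro!: holomorphic_intros continuous_intros)
  moreover have "((\<lambda>n::int. c ^ m * gauss_term (N + m) (of_int n + h) \<alpha> (c * w)) has_sum
      c ^ m * gauss_theta (N + m) h \<alpha> (c * w)) UNIV"
    using assms by (intro has_sum_cmult_right gauss_theta_has_sum)
  ultimately show ?thesis
    unfolding d by (rule has_sum_unique)
qed

lemma gauss_theta_has_field_derivative_param:
  assumes "Re (c * z) > 0"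
  shows "((\<lambda>z. gauss_theta N h (c * z) \<beta>) has_field_derivative - c * gauss_theta (N + 2) h (c * z) \<beta>) (at z)"
proof -
  define S where "S = {z. Re (c * z) > 0}"
  have S: "open S" "z \<in> S" unfolding S_def using assms
    by (auto intro!: open_Collect_less continuous_intros)
  have hol: "(\<lambda>z. gauss_theta N h (c * z) \<beta>) holomorphic_on S"
    using S by (intro holomorphic_on_gauss_theta) (auto simp: S_def intro!: holomorphic_intros)
  have d: "deriv (\<lambda>z. gauss_term N x (c * z) \<beta>) z = - c * gauss_term (N + 2) x (c * z) \<beta>" for x
    unfolding gauss_term_def
    by (rule DERIV_imp_deriv) (auto intro!: derivative_eq_intros simp: power_add power2_eq_square mult_ac)
  have "((\<lambda>n::int. (deriv ^^ 1) (\<lambda>z. gauss_term N (of_int n + h) (c * z) \<beta>) z) has_sum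
      (deriv ^^ 1) (\<lambda>z. gauss_theta N h (c * z) \<beta>) z) UNIV"
    unfolding gauss_theta_def using S
    by (intro has_sum_higher_deriv[of S] normally_summable_gauss_term)
      (auto simp: gauss_term_def S_def intro!: holomorphic_intros continuous_intros)
  moreover have "((\<lambda>n::int. - c * gauss_term (N + 2) (of_int n + h) (c * z) \<beta>) has_sum
      - c * gauss_theta (N + 2) h (c * z) \<beta>) UNIV"
    using assms by (intro has_sum_cmult_right gauss_theta_has_sum)
  ultimately have "deriv (\<lambda>z. gauss_theta N h (c * z) \<beta>) z = - c * gauss_theta (N + 2) h (c * z) \<beta>"
    using has_sum_unique by (simp add: d) blast
  then show ?thesis
    using holomorphic_derivI[OF hol S] by simp
qed

text \<open>Reindexing by n -> - n - 2 h negates n + h; this is a map of the integers for h = 0 and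
  h = 1/2.\<close>

lemma gauss_theta_minus:
  assumes "h \<in> {0, 1/2}"
  shows "gauss_theta N h \<alpha> (- \<beta>) = (- 1) ^ N * gauss_theta N h \<alpha> \<beta>"
proof -
  define g :: "int \<Rightarrow> int" where "g = (\<lambda>n. - n - (if h = 0 then 0 else 1))"
  have g: "bij g" by (rule involuntory_imp_bij) (simp add: g_def)
  have "gauss_term N (of_int (g n) + h) \<alpha> (- \<beta>) = (- 1) ^ N * gauss_term N (of_int n + h) \<alpha> \<beta>" for n
  proof -
    have "real_of_int (g n) + h = - (of_int n + h)" using assms by (auto simp: g_def)
    moreover have "gauss_term N (- x) \<alpha> (- \<beta>) = (- 1) ^ N * gauss_term N x \<alpha> \<beta>" for x
      by (simp add: gauss_term_def power_minus[of "of_real x"])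
    ultimately show ?thesis by (simp only:)
  qed
  then show ?thesis
    unfolding gauss_theta_def
    using infsum_reindex_bij_betw[OF g, of "\<lambda>n. gauss_term N (of_int n + h) \<alpha> (- \<beta>)"]
    by (simp add: infsum_cmult_right')
qed

lemma gauss_theta_add_int: "gauss_theta N (h + of_int k) \<alpha> \<beta> = gauss_theta N h \<alpha> \<beta>"
  unfolding gauss_theta_def
  using infsum_reindex_bij_betw[OF bij_plus_right[of k], of "\<lambda>n. gauss_term N (of_int n + h) \<alpha> \<beta>"]
  by (simp add: algebra_simps)

lemma islimpt_of_real_image:
  assumes "x islimpt S"
  shows "complex_of_real x islimpt of_real ` S"
proof -
  obtain f where "\<And>n::nat. f n \<in> S - {x}" "f \<longlonglongrightarrow> x"
    using assms unfolding islimpt_sequential by blast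
  then have "\<forall>n. complex_of_real (f n) \<in> of_real ` S - {of_real x}" "(\<lambda>n. complex_of_real (f n)) \<longlonglongrightarrow> of_real x"
    using tendsto_of_real[of f x sequentially] by auto
  then show ?thesis
    unfolding islimpt_sequential by (intro exI[of _ "\<lambda>n. of_real (f n)"] conjI)
qed

text \<open>The real Poisson formula is continued twice by the identity theorem: first in s from the
  positive axis to the right half plane with z real, then in z from the real axis to the plane. On
  Re s > 0 the principal root is holomorphic and agrees with \<open>sqrt\<close> on the positive
  axis, which fixes the branch.\<close>

theorem gauss_theta_inversion:
  fixes s z :: complex
  assumes "Re s > 0"
  shows "gauss_theta 0 0 (pi * s) (2 * pi * \<i> * z)
    = exp (- pi * z\<^sup>2 / s) / csqrt s * gauss_theta 0 0 (pi / s) (- 2 * pi * z / s)"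
proof -
  define f where "f = (\<lambda>(s::complex) (z::complex). gauss_theta 0 0 (pi * s) (2 * pi * \<i> * z)
    - exp (- pi * z\<^sup>2 / s) / csqrt s * gauss_theta 0 0 (pi / s) (- 2 * pi * z / s))"
  have Re_inv: "Re (pi / s) > 0" if "Re s > 0" for s :: complex
    using that by (simp add: Re_divide cmod_def sum_power2_gt_zero_iff) 
  have 1: "f (complex_of_real v) (complex_of_real y) = 0" if v: "v > 0" for v y :: real
  proof -
    have a: "gauss_theta 0 0 (pi * complex_of_real v) (2 * pi * \<i> * complex_of_real y)
        = (\<Sum>\<^sub>\<infinity>n::int. of_real (exp (- pi * v * (of_int n)\<^sup>2)) * cis (2 * pi * of_int n * y))"
      unfolding gauss_theta_def gauss_term_def
      by (intro infsum_cong) (simp add: cis_conv_exp exp_add[symmetric] exp_of_real[symmetric] mult_ac)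
    have "exp (- pi * (complex_of_real y)\<^sup>2 / complex_of_real v) * gauss_term 0 (of_int n + 0) (pi / complex_of_real v) (- 2 * pi * complex_of_real y / complex_of_real v)
       = of_real (exp (- pi * (of_int n + y)\<^sup>2 / v))" for n :: int
    proof -
      have "- pi * (complex_of_real y)\<^sup>2 / complex_of_real v + (- (pi / complex_of_real v) * (of_int n)\<^sup>2 + - 2 * pi * complex_of_real y / complex_of_real v * of_int n)
        = complex_of_real (- pi * (of_int n + y)\<^sup>2 / v)"
        by (simp add: power2_eq_square algebra_simps add_divide_distrib diff_divide_distrib)
      then show ?thesis
        unfolding gauss_term_def exp_of_real[symmetric] by (simp add: exp_add[symmetric])
    qed
    then have "exp (- pi * (complex_of_real y)\<^sup>2 / complex_of_real v) * gauss_theta 0 0 (pi / complex_of_real v) (- 2 * pi * complex_of_real y / complex_of_real v)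
       = (\<Sum>\<^sub>\<infinity>n::int. complex_of_real (exp (- pi * (of_int n + y)\<^sup>2 / v)))"
      unfolding gauss_theta_def by (subst infsum_cmult_right'[symmetric]) simp
    also have "\<dots> = of_real (sqrt v) * gauss_theta 0 0 (pi * complex_of_real v) (2 * pi * \<i> * complex_of_real y)"
      unfolding a by (rule poisson_gaussian_real[OF v])
    finally have eq: "exp (- pi * (complex_of_real y)\<^sup>2 / complex_of_real v) * gauss_theta 0 0 (pi / complex_of_real v) (- 2 * pi * complex_of_real y / complex_of_real v)
      = of_real (sqrt v) * gauss_theta 0 0 (pi * complex_of_real v) (2 * pi * \<i> * complex_of_real y)" .
    have csq: "csqrt (complex_of_real v) = of_real (sqrt v)"
      by (rule of_real_sqrt[symmetric]) (use v in simp)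
    show ?thesis
      using arg_cong[OF eq, of "\<lambda>t. t / of_real (sqrt v)"] v by (simp add: f_def csq)
  qed
  have 2: "f s (of_real y) = 0" if "Re s > 0" for s and y :: real
  proof (rule analytic_continuation[of "\<lambda>s. f s (of_real y)" "{s. Re s > 0}" "of_real ` {0<..}" 1])
    show "(\<lambda>s. f s (of_real y)) holomorphic_on {s. 0 < Re s}"
      unfolding f_def
      using Re_inv by (intro holomorphic_intros holomorphic_on_gauss_theta) (auto simp: open_halfspace_Re_gt complex_nonpos_Reals_iff)
    show "connected {s. 0 < Re s}" by (intro convex_connected convex_halfspace_Re_gt)
    have "(1::real) islimpt {0<..}" by (intro open_imp_islimpt) auto
    from islimpt_of_real_image[OF this] show "(1::complex) islimpt of_real ` {0<..}" by simp
  qed (use 1 that in \<open>auto simp: open_halfspace_Re_gt\<close>)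
  have "f s z = 0"
  proof (rule analytic_continuation[of "f s" UNIV "of_real ` UNIV" 0])
    show "f s holomorphic_on UNIV"
      unfolding f_def
      using Re_inv[OF assms] assms by (intro holomorphic_intros holomorphic_on_gauss_theta) auto
    have "(0::real) islimpt UNIV" by (intro open_imp_islimpt) auto
    from islimpt_of_real_image[OF this] show "(0::complex) islimpt range of_real" by simp
  qed (use 2 assms in auto)
  then show ?thesis by (simp add: f_def)
qed

subsection \<open>The complex error function\<close>

text \<open>The error function as an entire function: the primitive of 2 / sqrt pi * exp (- z^2)
  that vanishes at 0. Complex arguments arise because w and w' vary independently.\<close>

definition cerf :: "complex \<Rightarrow> complex" where
  "cerf = (SOME E. E 0 = 0 \<and> (\<forall>z. (E has_field_derivative of_real (2 / sqrt pi) * exp (- z\<^sup>2)) (at z)))"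

lemma cerf: "cerf 0 = 0" "(cerf has_field_derivative of_real (2 / sqrt pi) * exp (- z\<^sup>2)) (at z)"
proof -
  obtain g where g: "\<And>z::complex. (g has_field_derivative of_real (2 / sqrt pi) * exp (- z\<^sup>2)) (at z)"
  proof (rule holomorphic_convex_primitive'[of UNIV "\<lambda>z. of_real (2 / sqrt pi) * exp (- z\<^sup>2)"])
    show "(\<lambda>z::complex. of_real (2 / sqrt pi) * exp (- z\<^sup>2)) holomorphic_on UNIV"
      by (intro holomorphic_intros)
  qed auto
  have "\<exists>E::complex \<Rightarrow> complex. E 0 = 0 \<and> (\<forall>z. (E has_field_derivative of_real (2 / sqrt pi) * exp (- z\<^sup>2)) (at z))"
    by (rule exI[of _ "\<lambda>z. g z - g 0"]) (auto intro!: derivative_eq_intros g)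
  from someI_ex[OF this] show "cerf 0 = 0" "(cerf has_field_derivative of_real (2 / sqrt pi) * exp (- z\<^sup>2)) (at z)"
    unfolding cerf_def by blast+
qed

lemma cerf_derivative [derivative_intros]:
  "(f has_field_derivative f') (at z within S) \<Longrightarrow>
    ((\<lambda>z. cerf (f z)) has_field_derivative of_real (2 / sqrt pi) * exp (- (f z)\<^sup>2) * f') (at z within S)"
  using DERIV_chain2[OF cerf(2)] by blast

lemma holomorphic_on_cerf [holomorphic_intros]:
  "f holomorphic_on S \<Longrightarrow> (\<lambda>z. cerf (f z)) holomorphic_on S"
proof -
  assume "f holomorphic_on S"
  moreover have "cerf holomorphic_on UNIV"
    using cerf(2) by (auto simp: holomorphic_on_open)
  ultimately show ?thesis
    using holomorphic_on_compose_gen[of f S cerf UNIV] by (simp add: o_def)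
qed

lemma cerf_minus [simp]: "cerf (- z) = - cerf z"
proof -
  have "((\<lambda>z. cerf (- z) + cerf z) has_field_derivative 0) (at z within UNIV)" for z
    by (auto intro!: derivative_eq_intros)
  from has_field_derivative_zero_constant[OF convex_UNIV this]
  obtain c where c: "\<And>z. cerf (- z) + cerf z = c" by auto
  from c[of z] c[of 0] show ?thesis
    by (simp add: cerf(1) add_eq_0_iff2)
qed

definition rerf :: "real \<Rightarrow> real" where "rerf t = Re (cerf (of_real t))"

lemma
  shows cerf_of_real: "cerf (of_real t) = of_real (rerf t)"
    and rerf_derivative: "(rerf has_real_derivative 2 / sqrt pi * exp (- t\<^sup>2)) (at t)"
    and rerf_0 [simp]: "rerf 0 = 0"
proof -
  have d: "((\<lambda>t. cerf (of_real t)) has_vector_derivative of_real (2 / sqrt pi * exp (- t\<^sup>2))) (at t)" for t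
    using has_vector_derivative_real_field[OF cerf(2)[of "of_real t"], of UNIV] by (simp flip: exp_of_real)
  have "((\<lambda>t. Re (cerf (of_real t))) has_vector_derivative 2 / sqrt pi * exp (- t\<^sup>2)) (at t)" for t
    using bounded_linear.has_vector_derivative[OF bounded_linear_Re d[of t]] by simp
  then show "(rerf has_real_derivative 2 / sqrt pi * exp (- t\<^sup>2)) (at t)"
    unfolding rerf_def[abs_def] has_real_derivative_iff_has_vector_derivative .
  have "((\<lambda>t. Im (cerf (of_real t))) has_vector_derivative 0) (at t within UNIV)" for t
    using bounded_linear.has_vector_derivative[OF bounded_linear_Im d[of t]] by simp
  then have "\<exists>c. \<forall>t\<in>UNIV. Im (cerf (of_real t)) = c"
    using has_vector_derivative_zero_constant[of "UNIV :: real set"] by (metis convex_UNIV)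
  then have "Im (cerf (of_real t)) = Im (cerf (of_real 0))" by (metis UNIV_I)
  then show "cerf (of_real t) = of_real (rerf t)"
    by (simp add: rerf_def complex_eq_iff cerf(1))
  show "rerf 0 = 0" by (simp add: rerf_def cerf(1))
qed

lemma rerf_mono: "s \<le> t \<Longrightarrow> rerf s \<le> rerf t"
  by (rule DERIV_nonneg_imp_nondecreasing[of s t rerf]) (auto intro!: exI rerf_derivative)

lemma rerf_tendsto_1: "(rerf \<longlongrightarrow> 1) at_top"
proof -
  have i: "integrable lborel (\<lambda>x. indicator {0..} x *\<^sub>R exp (- x\<^sup>2) :: real)"
    and v: "(\<integral>x. indicator {0..} (x::real) *\<^sub>R exp (- x\<^sup>2) \<partial>lborel) = sqrt pi / 2"
    using gaussian_moment_0 by (auto simp: has_bochner_integral_iff)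
  have "((\<lambda>y. \<integral>x. indicator {..y} (x::real) *\<^sub>R (indicator {0..} x *\<^sub>R exp (- x\<^sup>2)) \<partial>lborel) \<longlongrightarrow> sqrt pi / 2) at_top"
    using tendsto_integral_at_top[OF sets_lborel i] unfolding v .
  moreover have "\<forall>\<^sub>F y in at_top. (\<integral>x. indicator {..y} (x::real) *\<^sub>R (indicator {0..} x *\<^sub>R exp (- x\<^sup>2)) \<partial>lborel)
      = sqrt pi / 2 * rerf y"
    using eventually_ge_at_top[of 0]
  proof eventually_elim
    case (elim y)
    have "(\<integral>x. indicator {..y} (x::real) *\<^sub>R (indicator {0..} x *\<^sub>R exp (- x\<^sup>2)) \<partial>lborel)
        = (\<integral>x. indicator {0..y} x *\<^sub>R exp (- x\<^sup>2) \<partial>lborel)"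
      by (intro Bochner_Integration.integral_cong) (auto simp: indicator_def)
    also have "\<dots> = sqrt pi / 2 * rerf y - sqrt pi / 2 * rerf 0"
    proof (rule integral_FTC_atLeastAtMost[OF elim])
      show "((\<lambda>y. sqrt pi / 2 * rerf y) has_vector_derivative exp (- x\<^sup>2)) (at x within {0..y})" for x
        unfolding has_real_derivative_iff_has_vector_derivative[symmetric]
        by (rule has_field_derivative_at_within) (auto intro!: derivative_eq_intros rerf_derivative)
    qed (intro continuous_intros)
    finally show ?case by simp
  qed
  ultimately have "((\<lambda>y. sqrt pi / 2 * rerf y) \<longlongrightarrow> sqrt pi / 2) at_top"
    by (rule Lim_transform_eventually)
  from tendsto_mult_left[OF this, of "2 / sqrt pi"] show ?thesis by simp
qed

lemma rerf_le_1: "rerf t \<le> 1"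
  using tendsto_lowerbound[OF rerf_tendsto_1, of "rerf t"]
  by (auto intro!: eventually_mono[OF eventually_ge_at_top[of t]] rerf_mono)

text \<open>For y >= 1 the function exp (- y^2) + rerf y decreases to its limit 1, so there even the
  constant 1 would do. The constant 3 covers y < 1, where exp (- y^2) is at least exp (- 1).\<close>

lemma one_minus_rerf_le:
  assumes "y \<ge> 0"
  shows "1 - rerf y \<le> 3 * exp (- y\<^sup>2)"
proof (cases "y \<ge> 1")
  case True
  define \<phi> where "\<phi> = (\<lambda>y. exp (- y\<^sup>2) + rerf y)"
  have anti: "\<phi> t \<le> \<phi> s" if "1 \<le> s" "s \<le> t" for s t
  proof (rule DERIV_nonpos_imp_nonincreasing[OF that(2)])
    fix x assume x: "s \<le> x" "x \<le> t"
    have "(\<phi> has_real_derivative exp (- x\<^sup>2) * (- (2 * x)) + 2 / sqrt pi * exp (- x\<^sup>2)) (at x)"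
      unfolding \<phi>_def by (auto intro!: derivative_eq_intros rerf_derivative)
    moreover have "2 / sqrt pi \<le> 2 * x"
    proof -
      have "1 \<le> sqrt pi" using pi_ge_two by (intro real_le_rsqrt) auto
      then have "2 / sqrt pi \<le> 2" by (simp add: field_simps)
      then show ?thesis using x that by linarith
    qed
    then have "exp (- x\<^sup>2) * (- (2 * x)) + 2 / sqrt pi * exp (- x\<^sup>2) \<le> 0"
      using mult_right_mono[of "2 / sqrt pi" "2 * x" "exp (- x\<^sup>2)"] by (simp add: algebra_simps)
    ultimately show "\<exists>D. (\<phi> has_real_derivative D) (at x) \<and> D \<le> 0" by blast
  qed
  have "((\<lambda>y::real. exp (- y\<^sup>2)) \<longlongrightarrow> 0) at_top" by real_asymp
  from tendsto_add[OF this rerf_tendsto_1] have "(\<phi> \<longlongrightarrow> 1) at_top"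
    by (simp add: \<phi>_def)
  then have "1 \<le> \<phi> y"
    using tendsto_upperbound[of \<phi> 1 at_top "\<phi> y"]
    by (auto intro!: eventually_mono[OF eventually_ge_at_top[of y]] anti True)
  then show ?thesis
    unfolding \<phi>_def using exp_gt_zero[of "- y\<^sup>2"] by linarith
next
  case False
  have "y\<^sup>2 \<le> 1" using False assms by (simp add: power_le_one)
  then have "exp (- 1) \<le> exp (- y\<^sup>2)" by simp
  moreover have "1 \<le> 3 * exp (-1::real)"
    using exp_le by (simp add: exp_minus field_simps)
  moreover have "0 \<le> rerf y" using rerf_mono[of 0 y] assms by simp
  ultimately show ?thesis by linarith
qed

text \<open>The real tail bound is carried to a complex perturbation: on the disc of radius rho
  around y the derivative of \<open>cerf\<close> is at most 2 exp (- y^2 + 2 rho y + rho^2). The new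
  linear term is harmless beside the Gaussian.\<close>

lemma norm_one_minus_cerf_le:
  assumes "y \<ge> 0" "norm \<delta> \<le> \<rho>"
  shows "norm (1 - cerf (of_real y + \<delta>)) \<le> (3 + 2 * \<rho>) * exp (- y\<^sup>2 + 2 * \<rho> * y + \<rho>\<^sup>2)"
proof -
  have \<rho>: "\<rho> \<ge> 0" using assms(2) norm_ge_zero order_trans by blast
  have "norm (1 - cerf (of_real y)) = 1 - rerf y"
  proof -
    have "1 - cerf (of_real y) = of_real (1 - rerf y)" by (simp add: cerf_of_real)
    then show ?thesis using rerf_le_1[of y] by (simp only: norm_of_real)
  qed
  also have "\<dots> \<le> 3 * exp (- y\<^sup>2)" by (rule one_minus_rerf_le[OF assms(1)])
  also have "\<dots> \<le> 3 * exp (- y\<^sup>2 + 2 * \<rho> * y + \<rho>\<^sup>2)" using assms \<rho> by simp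
  finally have 1: "norm (1 - cerf (of_real y)) \<le> 3 * exp (- y\<^sup>2 + 2 * \<rho> * y + \<rho>\<^sup>2)" .
  have "norm (cerf (of_real y + \<delta>) - cerf (of_real y)) \<le> (2 * exp (- y\<^sup>2 + 2 * \<rho> * y + \<rho>\<^sup>2)) * norm (of_real y + \<delta> - of_real y)"
  proof (rule field_differentiable_bound[of "cball (of_real y) \<rho>"])
    show "(cerf has_field_derivative of_real (2 / sqrt pi) * exp (- z\<^sup>2)) (at z within cball (of_real y) \<rho>)" for z
      by (rule has_field_derivative_at_within[OF cerf(2)])
    fix z assume z: "z \<in> cball (complex_of_real y) \<rho>"
    define \<eta> where "\<eta> = z - of_real y"
    have \<eta>: "norm \<eta> \<le> \<rho>" using z by (simp add: \<eta>_def dist_norm norm_minus_commute)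
    have "(Im \<eta>)\<^sup>2 \<le> \<rho>\<^sup>2"
      using abs_Im_le_cmod[of \<eta>] \<eta> \<rho> by (simp add: abs_le_square_iff[symmetric])
    moreover have "- (2 * y * Re \<eta>) \<le> 2 * y * \<rho>"
      using abs_Re_le_cmod[of \<eta>] \<eta> assms(1) mult_left_mono[of "- Re \<eta>" \<rho> "2 * y"] by simp
    moreover have "Re (- z\<^sup>2) = - y\<^sup>2 - 2 * y * Re \<eta> - (Re \<eta>)\<^sup>2 + (Im \<eta>)\<^sup>2"
      by (simp add: \<eta>_def power2_eq_square algebra_simps)
    ultimately have "Re (- z\<^sup>2) \<le> - y\<^sup>2 + 2 * \<rho> * y + \<rho>\<^sup>2"
      using zero_le_power2[of "Re \<eta>"] by (simp only: mult_ac)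
    moreover have "2 / sqrt pi \<le> 2"
    proof -
      have "1 \<le> sqrt pi" using pi_ge_two by (intro real_le_rsqrt) auto
      then show ?thesis by (simp add: field_simps)
    qed
    ultimately show "norm (of_real (2 / sqrt pi) * exp (- z\<^sup>2)) \<le> 2 * exp (- y\<^sup>2 + 2 * \<rho> * y + \<rho>\<^sup>2)"
      unfolding norm_mult norm_exp_eq_Re norm_of_real by (intro mult_mono) auto
  qed (use assms \<rho> in \<open>auto simp: dist_norm\<close>)
  also have "\<dots> \<le> (2 * exp (- y\<^sup>2 + 2 * \<rho> * y + \<rho>\<^sup>2)) * \<rho>"
    using assms(2) by (intro mult_left_mono) auto
  finally have 2: "norm (cerf (of_real y + \<delta>) - cerf (of_real y)) \<le> 2 * \<rho> * exp (- y\<^sup>2 + 2 * \<rho> * y + \<rho>\<^sup>2)"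
    by (simp add: mult_ac)
  have "norm (1 - cerf (of_real y + \<delta>)) \<le> norm (1 - cerf (of_real y)) + norm (cerf (of_real y + \<delta>) - cerf (of_real y))"
    using norm_triangle_ineq4[of "1 - cerf (of_real y)" "cerf (of_real y + \<delta>) - cerf (of_real y)"] by simp
  with 1 2 show ?thesis by (simp add: distrib_right)
qed

text \<open>Since \<open>cerf\<close> is odd, both signs of x reduce to the tail at c |x|.\<close>

lemma norm_sgn_minus_cerf_le:
  assumes "x \<noteq> 0" "c > 0" "norm \<delta> \<le> \<rho>"
  shows "norm (of_real (sgn x) - cerf (of_real (c * x) + \<delta>)) \<le> (3 + 2 * \<rho>) * exp (- c\<^sup>2 * x\<^sup>2 + 2 * \<rho> * c * \<bar>x\<bar> + \<rho>\<^sup>2)"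
proof (cases "x > 0")
  case True
  then show ?thesis
    using norm_one_minus_cerf_le[of "c * x" \<delta> \<rho>] assms by (simp add: power_mult_distrib mult_ac)
next
  case False
  then have x: "x < 0" using assms by simp
  have "of_real (c * x) + \<delta> = - (of_real (c * \<bar>x\<bar>) + (- \<delta>))"
    using x by simp
  then have "of_real (sgn x) - cerf (of_real (c * x) + \<delta>) = - (1 - cerf (of_real (c * \<bar>x\<bar>) + (- \<delta>)))"
    using x by (simp only: cerf_minus) simp
  then have "norm (of_real (sgn x) - cerf (of_real (c * x) + \<delta>)) = norm (1 - cerf (of_real (c * \<bar>x\<bar>) + (- \<delta>)))"
    by (simp only: norm_minus_cancel)
  also have "\<dots> \<le> (3 + 2 * \<rho>) * exp (- (c * \<bar>x\<bar>)\<^sup>2 + 2 * \<rho> * (c * \<bar>x\<bar>) + \<rho>\<^sup>2)"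
    using assms by (intro norm_one_minus_cerf_le) auto
  finally show ?thesis by (simp add: power_mult_distrib mult_ac)
qed

section \<open>The incomplete Gamma function at - 1/2 and the coefficients of the Eichler
  integrals\<close>

lemma sqrt_mult_sqrt_mult: "t \<ge> 0 \<Longrightarrow> sqrt t * (sqrt t * z) = t * z"
  by (simp flip: mult.assoc)

lemma incomplete_Gamma_neg_half:
  assumes "y > 0"
  shows "incomplete_Gamma (- 1 / 2) (y\<^sup>2) = 2 * exp (- y\<^sup>2) / y - 2 * sqrt pi * (1 - rerf y)"
proof -
  \<comment> \<open>Integrating exp (- t) t^(- 3/2) by parts once leaves the boundary term - 2 exp
    (- t) / sqrt t and an error function in sqrt t.\<close>
  define F where "F = (\<lambda>t. - 2 * exp (- t) / sqrt t - 2 * sqrt pi * rerf (sqrt t))"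
  define f where "f = (\<lambda>t::real. exp (- t) * t powr (- 1 / 2 - 1))"
  have dF: "(F has_real_derivative f t) (at t)" if "t > 0" for t
  proof -
    have "t powr (- 1 / 2 - 1) = 1 / (t * sqrt t)"
      using that powr_add[of t "-1" "-1/2"] by (simp add: powr_minus powr_half_sqrt field_simps)
    then have f: "f t = exp (- t) / (t * sqrt t)" by (simp add: f_def)
    show ?thesis
      unfolding F_def f
      using that
      by (auto intro!: derivative_eq_intros DERIV_chain2[OF rerf_derivative])
        (simp add: field_simps power2_eq_square sqrt_mult_sqrt_mult)
  qed
  have int: "(f has_integral (F z - F (y\<^sup>2))) {y\<^sup>2..z}" if "y\<^sup>2 \<le> z" for z
  proof (rule fundamental_theorem_of_calculus[OF that])
    fix x assume "x \<in> {y\<^sup>2..z}"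
    then have "x > 0" using assms by (auto intro: less_le_trans[of _ "y\<^sup>2"])
    then show "(F has_vector_derivative f x) (at x within {y\<^sup>2..z})"
      using dF has_field_derivative_at_within has_real_derivative_iff_has_vector_derivative by blast
  qed
  have "((\<lambda>z. F z - F (y\<^sup>2)) \<longlongrightarrow> (0 - 2 * sqrt pi * 1) - F (y\<^sup>2)) at_top"
    unfolding F_def
  proof (intro tendsto_diff tendsto_mult tendsto_const)
    show "((\<lambda>t::real. - 2 * exp (- t) / sqrt t) \<longlongrightarrow> 0) at_top" by real_asymp
    show "((\<lambda>t. rerf (sqrt t)) \<longlongrightarrow> 1) at_top"
      by (rule filterlim_compose[OF rerf_tendsto_1 sqrt_at_top])
  qed
  then have "((\<lambda>z. integral {y\<^sup>2..z} f) \<longlongrightarrow> (0 - 2 * sqrt pi * 1) - F (y\<^sup>2)) at_top"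
    by (rule Lim_transform_eventually)
      (use int in \<open>auto intro!: eventually_mono[OF eventually_ge_at_top[of "y\<^sup>2"]] integral_unique[symmetric]\<close>)
  then have "(f has_integral ((0 - 2 * sqrt pi * 1) - F (y\<^sup>2))) {y\<^sup>2..}"
  proof (rule has_integral_to_inf[rotated])
    show "f integrable_on {y\<^sup>2..z}" for z
      using int[of z] by (cases "y\<^sup>2 \<le> z") (auto simp: integrable_on_def intro: exI[of _ 0])
  qed (simp add: f_def)
  then have "integral {y\<^sup>2..} f = - 2 * sqrt pi - F (y\<^sup>2)"
    by (simp add: integral_unique)
  then show ?thesis
    using assms by (simp add: incomplete_Gamma_def f_def F_def algebra_simps)
qed

text \<open>One closed formula for all x. At x = 0 it gives 1 / sqrt v, so the prescribed limit
  value merges with the generic case from here on.\<close>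

lemma s_coeff_eq:
  assumes v: "v > 0"
  shows "s_coeff v x = exp (- (4 * pi * x\<^sup>2 * v)) / sqrt v - 2 * pi * \<bar>x\<bar> * (1 - rerf (sqrt (4 * pi * v) * \<bar>x\<bar>))"
proof (cases "x = 0")
  case False
  define y where "y = sqrt (4 * pi * v) * \<bar>x\<bar>"
  have y: "y > 0" using v False by (simp add: y_def)
  have y2: "4 * pi * x\<^sup>2 * v = y\<^sup>2" using v by (simp add: y_def power_mult_distrib)
  have "s_coeff v x = sqrt pi * \<bar>x\<bar> * (2 * exp (- y\<^sup>2) / y - 2 * sqrt pi * (1 - rerf y))"
    using False incomplete_Gamma_neg_half[OF y] unfolding s_coeff_def y2 by simp
  also have "\<dots> = sqrt pi * \<bar>x\<bar> * (2 * exp (- y\<^sup>2) / y) - 2 * pi * \<bar>x\<bar> * (1 - rerf y)"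
    by (simp add: algebra_simps sqrt_mult_sqrt_mult)
  also have "sqrt pi * \<bar>x\<bar> * (2 * exp (- y\<^sup>2) / y) = exp (- y\<^sup>2) / sqrt v"
    using False v by (simp add: y_def real_sqrt_mult)
  finally show ?thesis unfolding y2 y_def .
qed (simp add: s_coeff_def)

text \<open>The derivative of the error function cancels the derivative of the Gaussian in its
  exponent, so only the derivative of 1 / sqrt v remains. Multiplied by q^(- x^2), the surviving
  Gaussian becomes cnj (q^(x^2)); this is how conjugate theta functions arise under the lowering
  operator.\<close>

lemma s_coeff_derivative:
  assumes v: "v > 0"
  shows "((\<lambda>v. s_coeff v x) has_real_derivative - exp (- (4 * pi * x\<^sup>2 * v)) / (2 * (sqrt v * v))) (at v)"
proof -
  define y where "y = sqrt (4 * pi * v) * \<bar>x\<bar>"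
  have y2: "y\<^sup>2 = 4 * pi * x\<^sup>2 * v" using v by (simp add: y_def power_mult_distrib)
  define y' where "y' = sqrt pi * \<bar>x\<bar> / sqrt v"
  have "((\<lambda>v. 2 * sqrt pi * sqrt v * \<bar>x\<bar>) has_real_derivative 2 * sqrt pi * (inverse (sqrt v) / 2) * \<bar>x\<bar>) (at v)"
    using v by (intro DERIV_cmult_right DERIV_cmult DERIV_real_sqrt)
  then have dy: "((\<lambda>v. sqrt (4 * pi * v) * \<bar>x\<bar>) has_real_derivative y') (at v)"
  proof -
    have "(\<lambda>v. sqrt (4 * pi * v) * \<bar>x\<bar>) = (\<lambda>v. 2 * sqrt pi * sqrt v * \<bar>x\<bar>)"
      by (simp add: real_sqrt_mult)
    moreover have "2 * sqrt pi * (inverse (sqrt v) / 2) * \<bar>x\<bar> = y'"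
      using v by (simp add: y'_def field_simps)
    ultimately show ?thesis using \<open>((\<lambda>v. 2 * sqrt pi * sqrt v * \<bar>x\<bar>) has_real_derivative _) (at v)\<close> by simp
  qed
  have "((\<lambda>v. exp (- (4 * pi * x\<^sup>2 * v)) / sqrt v) has_real_derivative
      - (4 * pi * x\<^sup>2) * exp (- (4 * pi * x\<^sup>2 * v)) / sqrt v - exp (- (4 * pi * x\<^sup>2 * v)) / (2 * (sqrt v * v))) (at v)"
    using v by (auto intro!: derivative_eq_intros) (simp add: field_simps)
  moreover have "((\<lambda>v. 2 * pi * \<bar>x\<bar> * (1 - rerf (sqrt (4 * pi * v) * \<bar>x\<bar>))) has_real_derivative
      2 * pi * \<bar>x\<bar> * (0 - 2 / sqrt pi * exp (- y\<^sup>2) * y')) (at v)"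
    by (intro DERIV_cmult DERIV_diff DERIV_const)
      (use DERIV_chain2[OF rerf_derivative dy] in \<open>simp add: y_def\<close>)
  moreover have "2 * pi * \<bar>x\<bar> * (0 - 2 / sqrt pi * exp (- y\<^sup>2) * y') = - (4 * pi * x\<^sup>2) * exp (- (4 * pi * x\<^sup>2 * v)) / sqrt v"
    unfolding y2 y'_def by (simp add: power2_eq_square)
  ultimately have "((\<lambda>v. exp (- (4 * pi * x\<^sup>2 * v)) / sqrt v - 2 * pi * \<bar>x\<bar> * (1 - rerf (sqrt (4 * pi * v) * \<bar>x\<bar>)))
     has_real_derivative - exp (- (4 * pi * x\<^sup>2 * v)) / (2 * (sqrt v * v))) (at v)"
    using DERIV_diff by fastforce
  then show ?thesis
    by (rule has_field_derivative_transform_within_open[of _ _ _ "{0<..}"]) (use v in \<open>auto simp: s_coeff_eq\<close>)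
qed

lemma abs_s_coeff_le:
  assumes v: "v > 0"
  shows "\<bar>s_coeff v x\<bar> \<le> (1 / sqrt v + 6 * pi * \<bar>x\<bar>) * exp (- (4 * pi * x\<^sup>2 * v))"
proof -
  have "0 \<le> 1 - rerf (sqrt (4 * pi * v) * \<bar>x\<bar>)" using rerf_le_1 by simp
  moreover have "1 - rerf (sqrt (4 * pi * v) * \<bar>x\<bar>) \<le> 3 * exp (- (4 * pi * x\<^sup>2 * v))"
    using one_minus_rerf_le[of "sqrt (4 * pi * v) * \<bar>x\<bar>"] v by (simp add: power_mult_distrib mult_ac)
  ultimately have "2 * pi * \<bar>x\<bar> * \<bar>1 - rerf (sqrt (4 * pi * v) * \<bar>x\<bar>)\<bar> \<le> 2 * pi * \<bar>x\<bar> * (3 * exp (- (4 * pi * x\<^sup>2 * v)))"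
    by (intro mult_left_mono) auto
  then have "\<bar>2 * pi * \<bar>x\<bar> * (1 - rerf (sqrt (4 * pi * v) * \<bar>x\<bar>))\<bar> \<le> 6 * pi * \<bar>x\<bar> * exp (- (4 * pi * x\<^sup>2 * v))"
    by (simp add: abs_mult)
  moreover have "\<bar>exp (- (4 * pi * x\<^sup>2 * v)) / sqrt v\<bar> = 1 / sqrt v * exp (- (4 * pi * x\<^sup>2 * v))"
    using v by simp
  ultimately show ?thesis
    unfolding s_coeff_eq[OF v] distrib_right by linarith
qed

subsection \<open>The theta functions as Gaussian theta series\<close>

text \<open>For half-integers n, the number n + nu / 2 runs through the integers if nu = - 1 and
  through the half-integers if nu = 0.\<close>

definition coset_shift :: "int \<Rightarrow> real" where
  "coset_shift \<nu> = (of_int \<nu> + 1) / 2"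

abbreviation theta_exponent :: "complex \<Rightarrow> complex" where
  "theta_exponent \<tau> \<equiv> - (2 * of_real pi * \<i> * \<tau>)"

lemma infsum_half_integers: "(\<Sum>\<^sub>\<infinity>n\<in>half_integers. f n) = (\<Sum>\<^sub>\<infinity>m::int. f (1 / 2 + of_int m))"
  by (subst infsum_reindex) (auto simp: inj_on_def o_def)

lemma exp_half_integer: "exp (2 * of_real pi * \<i> * of_real (1 / 2 + of_int m)) = - 1"
proof -
  have "2 * of_real pi * \<i> * of_real (1 / 2 + of_int m) = \<i> * of_real pi + 2 * of_int m * of_real pi * \<i>"
    by (simp add: algebra_simps)
  moreover have "exp (2 * of_int m * of_real pi * \<i>) = 1"
    using exp_integer_2pi[of "of_int m"] by simp
  ultimately show ?thesis by (simp add: exp_add)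
qed

text \<open>The prefactors complete the square in n + nu / 2. The two shifts by 1/2 of the elliptic
  variable, one from \<open>jacobi_theta\<close> and one from its argument, add up to 1, so every
  term carries exp (2 pi i n) = - 1; hence the minus sign in all later formulas.\<close>

lemma jacobi_theta_shifted:
  "jacobi_theta (z + of_int \<nu> * \<tau> + 1 / 2) (2 * \<tau>) * exp (of_real pi * \<i> * of_int \<nu> * z) * qpow ((of_int \<nu>)\<^sup>2 / 4) \<tau>
    = - gauss_theta 0 (coset_shift \<nu>) (theta_exponent \<tau>) (2 * of_real pi * \<i> * z)"
proof -
  define T where "T = (\<lambda>n::real. exp (of_real pi * \<i> * (of_real n)\<^sup>2 * (2 * \<tau>)
    + 2 * of_real pi * \<i> * of_real n * (z + of_int \<nu> * \<tau> + 1 / 2 + 1 / 2)))"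
  have T: "T (1 / 2 + of_int m) * (exp (of_real pi * \<i> * of_int \<nu> * z) * qpow ((of_int \<nu>)\<^sup>2 / 4) \<tau>)
      = - gauss_term 0 (of_int m + coset_shift \<nu>) (theta_exponent \<tau>) (2 * of_real pi * \<i> * z)" for m :: int
  proof -
    define n where "n = 1 / 2 + real_of_int m"
    have x: "of_int m + coset_shift \<nu> = n + of_int \<nu> / 2"
      by (simp add: n_def coset_shift_def field_simps)
    have "of_real pi * \<i> * (of_real n)\<^sup>2 * (2 * \<tau>)
        + 2 * of_real pi * \<i> * of_real n * (z + of_int \<nu> * \<tau> + 1 / 2 + 1 / 2)
        + of_real pi * \<i> * of_int \<nu> * z + 2 * of_real pi * \<i> * of_real ((of_int \<nu>)\<^sup>2 / 4) * \<tau>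
      = 2 * of_real pi * \<i> * of_real n
        + (- theta_exponent \<tau> * (of_real (n + of_int \<nu> / 2))\<^sup>2 + 2 * of_real pi * \<i> * z * of_real (n + of_int \<nu> / 2))"
      by (simp add: power2_eq_square algebra_simps add_divide_distrib)
    then have "T n * (exp (of_real pi * \<i> * of_int \<nu> * z) * qpow ((of_int \<nu>)\<^sup>2 / 4) \<tau>)
        = exp (2 * of_real pi * \<i> * of_real n) * gauss_term 0 (n + of_int \<nu> / 2) (theta_exponent \<tau>) (2 * of_real pi * \<i> * z)"
      unfolding T_def qpow_def gauss_term_def exp_add[symmetric] power_0 mult_1
      by (simp only: add.assoc)
    then show ?thesis
      unfolding x n_def exp_half_integer by simp
  qed
  have "jacobi_theta (z + of_int \<nu> * \<tau> + 1 / 2) (2 * \<tau>) = (\<Sum>\<^sub>\<infinity>m::int. T (1 / 2 + of_int m))"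
    unfolding jacobi_theta_def T_def by (rule infsum_half_integers)
  then show ?thesis
    unfolding gauss_theta_def mult.assoc
    by (simp only: infsum_cmult_left'[symmetric] T[unfolded mult.assoc] infsum_uminus)
qed

lemma theta_nu_eq: "theta_nu \<nu> \<tau> = - gauss_theta 0 (coset_shift \<nu>) (theta_exponent \<tau>) 0"
  using jacobi_theta_shifted[of 0 \<nu> \<tau>] by (simp add: theta_nu_def mult.commute)

lemma theta_l_nu_eq:
  "theta_l_nu l \<nu> \<tau> = (deriv ^^ (l - 1)) (\<lambda>z. - gauss_theta 0 (coset_shift \<nu>) (theta_exponent \<tau>) (2 * of_real pi * \<i> * z)
     * exp (of_real pi / (4 * of_real (Im \<tau>)) * z\<^sup>2)) 0"
  unfolding theta_l_nu_def jacobi_theta_shifted by simp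

lemma theta1_eq: "theta1 (2 * \<tau>) = gauss_theta 0 0 (theta_exponent \<tau>) 0"
  unfolding theta1_def gauss_theta_def gauss_term_def qpow_def
  by (intro infsum_cong) (simp add: mult_ac)

lemma theta3_eq: "theta3 (2 * \<tau>) = gauss_theta 0 (1 / 2) (theta_exponent \<tau>) 0"
  unfolding theta3_def gauss_theta_def gauss_term_def qpow_def
  by (intro infsum_cong) (simp add: mult_ac)

lemma open_upper_half_plane: "open upper_half_plane"
  by (rule open_halfspace_Im_gt)

lemma D_op_funpow_Suc: "(D_op ^^ Suc j) f \<tau> = wirtinger_d ((D_op ^^ j) f) \<tau> / (2 * of_real pi * \<i>)"
  unfolding funpow.simps o_apply by (simp only: D_op_def) simp

text \<open>On q^(x^2) the operator \<open>D_op\<close> is multiplication by x^2, so each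
  application raises the index of the theta series by 2.\<close>

lemma D_op_iterate_theta_nu:
  assumes "Im \<tau> > 0"
  shows "(D_op ^^ j) (theta_nu \<nu>) \<tau> = - gauss_theta (2 * j) (coset_shift \<nu>) (theta_exponent \<tau>) 0"
    and "has_wirtinger_derivs ((D_op ^^ j) (theta_nu \<nu>))
      (- (2 * of_real pi * \<i> * gauss_theta (2 * Suc j) (coset_shift \<nu>) (theta_exponent \<tau>) 0)) 0 \<tau>"
proof -
  define g where "g = (\<lambda>j \<tau>. - gauss_theta (2 * j) (coset_shift \<nu>) (theta_exponent \<tau>) 0)"
  have d: "has_wirtinger_derivs (g j) (2 * of_real pi * \<i> * g (Suc j) \<tau>) 0 \<tau>" if "Im \<tau> > 0" for j \<tau>
  proof (rule has_wirtinger_derivs_of_field_derivative)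
    have "((\<lambda>z. gauss_theta (2 * j) (coset_shift \<nu>) (- (2 * of_real pi * \<i>) * z) 0) has_field_derivative
        - (- (2 * of_real pi * \<i>)) * gauss_theta (2 * j + 2) (coset_shift \<nu>) (- (2 * of_real pi * \<i>) * \<tau>) 0) (at \<tau>)"
      using that by (intro gauss_theta_has_field_derivative_param) simp
    from DERIV_minus[OF this] show "(g j has_field_derivative 2 * of_real pi * \<i> * g (Suc j) \<tau>) (at \<tau>)"
      by (simp add: g_def)
  qed
  have eq: "(D_op ^^ j) (theta_nu \<nu>) \<tau> = g j \<tau>" if "Im \<tau> > 0" for j \<tau>
    using that
  proof (induction j arbitrary: \<tau>)
    case 0
    then show ?case by (simp add: g_def theta_nu_eq)
  next
    case (Suc j)
    have "has_wirtinger_derivs ((D_op ^^ j) (theta_nu \<nu>)) (2 * of_real pi * \<i> * g (Suc j) \<tau>) 0 \<tau>"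
      by (rule has_wirtinger_derivs_transform[OF d[OF Suc.prems] open_upper_half_plane]) (use Suc in auto)
    from wirtinger_d_eq[OF this] show ?case unfolding D_op_funpow_Suc by simp
  qed
  show "(D_op ^^ j) (theta_nu \<nu>) \<tau> = - gauss_theta (2 * j) (coset_shift \<nu>) (theta_exponent \<tau>) 0"
    using eq[OF assms] by (simp add: g_def)
  have "has_wirtinger_derivs ((D_op ^^ j) (theta_nu \<nu>)) (2 * of_real pi * \<i> * g (Suc j) \<tau>) 0 \<tau>"
    by (rule has_wirtinger_derivs_transform[OF d[OF assms] open_upper_half_plane]) (use eq assms in auto)
  then show "has_wirtinger_derivs ((D_op ^^ j) (theta_nu \<nu>))
      (- (2 * of_real pi * \<i> * gauss_theta (2 * Suc j) (coset_shift \<nu>) (theta_exponent \<tau>) 0)) 0 \<tau>"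
    by (simp add: g_def)
qed

subsection \<open>Iterated derivatives of the nonholomorphic Eichler integrals\<close>

text \<open>\<open>D_op\<close> acts on functions of v alone as - 1 / (4 pi) times d/dv. Starting
  from 1 / (8 pi), these constants therefore acquire the factor (s + 3/2) / (4 pi) at each stage.
  The factorial form anticipates the even Taylor coefficients of exp (pi w^2 / (4 v)).\<close>

definition s_const :: "nat \<Rightarrow> real" where
  "s_const s = fact (2 * s + 2) / (fact (s + 1) * (16 * pi) ^ (s + 1))"

text \<open>The recursion is the action of \<open>D_op\<close> on the summands of
  \<open>s_nu\<close>: q^(- x^2) yields the factor - x^2, while cnj (q^(x^2)) is annihilated and
  only its power of v is differentiated.\<close>

primrec s_term :: "nat \<Rightarrow> real \<Rightarrow> complex \<Rightarrow> complex" where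
  "s_term 0 x \<tau> = of_real (s_coeff (Im \<tau>) x) * qpow (- (x\<^sup>2)) \<tau>"
| "s_term (Suc s) x \<tau> = - of_real (x\<^sup>2) * s_term s x \<tau>
     + of_real (s_const s / (sqrt (Im \<tau>) * Im \<tau> ^ (s + 1))) * cnj (qpow (x\<^sup>2) \<tau>)"

lemma s_const_Suc: "s_const (Suc s) = s_const s * (real s + 3 / 2) / (4 * pi)"
proof -
  have "fact (2 * Suc s + 2) = (2 * real s + 4) * (2 * real s + 3) * fact (2 * s + 2)"
    by (simp add: algebra_simps)
  moreover have "fact (Suc s + 1) = (real s + 2) * fact (s + 1)" by simp
  ultimately show ?thesis unfolding s_const_def
    by (simp del: fact_Suc add: divide_simps) (simp add: algebra_simps)
qed

lemma qpow_has_field_derivative: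
  "(qpow a has_field_derivative 2 * of_real pi * \<i> * of_real a * qpow a \<tau>) (at \<tau>)"
  unfolding qpow_def by (auto intro!: derivative_eq_intros)

lemma norm_qpow: "norm (qpow a \<tau>) = exp (- (2 * pi * a * Im \<tau>))"
  by (simp add: qpow_def)

lemma qpow_minus_mult_exp: "qpow (- a) \<tau> * exp (- of_real (4 * pi * a * Im \<tau>)) = cnj (qpow a \<tau>)"
  unfolding qpow_def exp_cnj exp_add[symmetric]
  by (rule arg_cong[of _ _ exp]) (simp add: complex_eq_iff)

lemma DERIV_inverse_sqrt_mult_power:
  assumes "v > 0"
  shows "((\<lambda>v. 1 / (sqrt v * v ^ n)) has_real_derivative - ((real n + 1 / 2) / (sqrt v * v ^ (n + 1)))) (at v)"
proof (induction n)
  case 0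
  have "sqrt v * (sqrt v * z) = v * z" for z using assms by (simp flip: mult.assoc)
  then show ?case
    using assms by (auto intro!: derivative_eq_intros simp: field_simps)
next
  case (Suc n)
  have "((\<lambda>v. 1 / (sqrt v * v ^ n) * (1 / v)) has_real_derivative
      - ((real n + 1 / 2) / (sqrt v * v ^ (n + 1))) * (1 / v) + - (1 / v\<^sup>2) * (1 / (sqrt v * v ^ n))) (at v)"
    using assms by (intro DERIV_mult Suc) (auto intro!: derivative_eq_intros simp: power2_eq_square)
  moreover have "- ((real n + 1 / 2) / (sqrt v * v ^ (n + 1))) * (1 / v) + - (1 / v\<^sup>2) * (1 / (sqrt v * v ^ n))
      = - ((real (Suc n) + 1 / 2) / (sqrt v * v ^ (Suc n + 1)))"
    using assms by (simp add: divide_simps power2_eq_square)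
  ultimately show ?case by (simp add: mult_ac)
qed

text \<open>The conjugate derivative stays a single monomial at every stage: the x^2 term inherited
  from the previous stage cancels the one from differentiating cnj (q^(x^2)), and only the
  derivative of the power of v survives.\<close>

lemma has_wirtinger_derivs_s_term:
  assumes "Im \<tau> > 0"
  shows "has_wirtinger_derivs (s_term s x) (2 * of_real pi * \<i> * s_term (Suc s) x \<tau>)
    (- 2 * of_real pi * \<i> * of_real (s_const s / (sqrt (Im \<tau>) * Im \<tau> ^ (s + 1))) * cnj (qpow (x\<^sup>2) \<tau>)) \<tau>"
  using assms
proof (induction s)
  case 0
  define v where "v = Im \<tau>"
  have v: "v > 0" using 0 by (simp add: v_def)
  define d where "d = - exp (- (4 * pi * x\<^sup>2 * v)) / (2 * (sqrt v * v))"
  have Q: "of_real (exp (- (4 * pi * x\<^sup>2 * v))) * qpow (- (x\<^sup>2)) \<tau> = cnj (qpow (x\<^sup>2) \<tau>)"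
    using qpow_minus_mult_exp[of "x\<^sup>2" \<tau>] by (simp add: v_def exp_of_real[symmetric] mult.commute)
  have s0: "s_const 0 = 1 / (8 * pi)" by (simp add: s_const_def)
  have dq: "of_real d * qpow (- (x\<^sup>2)) \<tau> = - cnj (qpow (x\<^sup>2) \<tau>) / of_real (2 * (sqrt v * v))"
    unfolding d_def Q[symmetric] by simp
  have "has_wirtinger_derivs (s_term 0 x)
      ((- \<i> / 2 * of_real d) * qpow (- (x\<^sup>2)) \<tau> + of_real (s_coeff (Im \<tau>) x) * (2 * of_real pi * \<i> * of_real (- (x\<^sup>2)) * qpow (- (x\<^sup>2)) \<tau>))
      ((\<i> / 2 * of_real d) * qpow (- (x\<^sup>2)) \<tau> + of_real (s_coeff (Im \<tau>) x) * 0) \<tau>"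
    unfolding s_term.simps d_def v_def using 0
    by (intro has_wirtinger_derivs_mult has_wirtinger_derivs_Im s_coeff_derivative
        has_wirtinger_derivs_of_field_derivative qpow_has_field_derivative)
  moreover have "(- \<i> / 2 * of_real d) * qpow (- (x\<^sup>2)) \<tau> = \<i> / 4 * cnj (qpow (x\<^sup>2) \<tau>) / of_real (sqrt v * v)"
    unfolding mult.assoc dq by simp
  moreover have "(\<i> / 2 * of_real d) * qpow (- (x\<^sup>2)) \<tau> = - \<i> / 4 * cnj (qpow (x\<^sup>2) \<tau>) / of_real (sqrt v * v)"
    unfolding mult.assoc dq by simp
  moreover have "\<i> / 4 * cnj (qpow (x\<^sup>2) \<tau>) / of_real (sqrt v * v)
      + of_real (s_coeff (Im \<tau>) x) * (2 * of_real pi * \<i> * of_real (- (x\<^sup>2)) * qpow (- (x\<^sup>2)) \<tau>)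
      = 2 * of_real pi * \<i> * s_term (Suc 0) x \<tau>"
    by (simp add: s0 v_def[symmetric] algebra_simps)
  moreover have "- \<i> / 4 * cnj (qpow (x\<^sup>2) \<tau>) / of_real (sqrt v * v) + of_real (s_coeff (Im \<tau>) x) * 0
     = - 2 * of_real pi * \<i> * of_real (s_const 0 / (sqrt (Im \<tau>) * Im \<tau> ^ (0 + 1))) * cnj (qpow (x\<^sup>2) \<tau>)"
    by (simp add: s0 v_def[symmetric])
  ultimately show ?case by (simp only:)
next
  case (Suc s)
  define v where "v = Im \<tau>"
  have v: "v > 0" using Suc.prems by (simp add: v_def)
  define c where "c = s_const s"
  define Q where "Q = cnj (qpow (x\<^sup>2) \<tau>)"
  define d where "d = - ((real s + 3 / 2) * c / (sqrt v * v ^ (s + 2)))"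
  have dg: "((\<lambda>v. c / (sqrt v * v ^ (s + 1))) has_real_derivative d) (at (Im \<tau>))"
    using DERIV_cmult[OF DERIV_inverse_sqrt_mult_power[OF Suc.prems], of c "s + 1"]
    by (simp add: d_def v_def algebra_simps)
  have c': "s_const (Suc s) = c * (real s + 3 / 2) / (4 * pi)" unfolding c_def by (rule s_const_Suc)
  have cd: "s_const (Suc s) / (sqrt (Im \<tau>) * Im \<tau> ^ (Suc s + 1)) = - d / (4 * pi)"
    unfolding c' d_def v_def by (simp add: mult_ac)
  have "has_wirtinger_derivs (s_term (Suc s) x)
     (- of_real (x\<^sup>2) * (2 * of_real pi * \<i> * s_term (Suc s) x \<tau>)
       + ((- \<i> / 2 * of_real d) * cnj (qpow (x\<^sup>2) \<tau>) + of_real (c / (sqrt (Im \<tau>) * Im \<tau> ^ (s + 1))) * 0))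
     (- of_real (x\<^sup>2) * (- 2 * of_real pi * \<i> * of_real (c / (sqrt (Im \<tau>) * Im \<tau> ^ (s + 1))) * cnj (qpow (x\<^sup>2) \<tau>))
       + ((\<i> / 2 * of_real d) * cnj (qpow (x\<^sup>2) \<tau>) + of_real (c / (sqrt (Im \<tau>) * Im \<tau> ^ (s + 1)))
           * cnj (2 * of_real pi * \<i> * of_real (x\<^sup>2) * qpow (x\<^sup>2) \<tau>))) \<tau>"
    unfolding s_term.simps(2)[abs_def, of s] c_def[symmetric]
    using Suc.IH[OF Suc.prems, folded c_def]
    by (intro has_wirtinger_derivs_add has_wirtinger_derivs_cmult has_wirtinger_derivs_mult
        has_wirtinger_derivs_Im[OF dg] has_wirtinger_derivs_cnj qpow_has_field_derivative)
      (simp add: c_def)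
  moreover have "- of_real (x\<^sup>2) * (2 * of_real pi * \<i> * s_term (Suc s) x \<tau>)
       + ((- \<i> / 2 * of_real d) * cnj (qpow (x\<^sup>2) \<tau>) + of_real (c / (sqrt (Im \<tau>) * Im \<tau> ^ (s + 1))) * 0)
     = 2 * of_real pi * \<i> * s_term (Suc (Suc s)) x \<tau>"
    unfolding s_term.simps(2)[of "Suc s"] Q_def[symmetric] cd
    by (simp add: algebra_simps del: s_term.simps)
  moreover have "- of_real (x\<^sup>2) * (- 2 * of_real pi * \<i> * of_real (c / (sqrt (Im \<tau>) * Im \<tau> ^ (s + 1))) * cnj (qpow (x\<^sup>2) \<tau>))
       + ((\<i> / 2 * of_real d) * cnj (qpow (x\<^sup>2) \<tau>) + of_real (c / (sqrt (Im \<tau>) * Im \<tau> ^ (s + 1)))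
           * cnj (2 * of_real pi * \<i> * of_real (x\<^sup>2) * qpow (x\<^sup>2) \<tau>))
     = - 2 * of_real pi * \<i> * of_real (s_const (Suc s) / (sqrt (Im \<tau>) * Im \<tau> ^ (Suc s + 1))) * cnj (qpow (x\<^sup>2) \<tau>)"
    unfolding cd complex_cnj_mult Q_def[symmetric]
    by (simp add: algebra_simps)
  ultimately show ?case by (simp only:)
qed

text \<open>The growth exp (2 pi x^2 v) of q^(- x^2) is overcome by the factor exp (- 4 pi x^2 v)
  bounding \<open>s_coeff\<close>; each application of \<open>D_op\<close> costs one more power of 1
  + x^2. Termwise differentiation relies on the uniformity in Im tau >= v0.\<close>

lemma norm_s_term_le:
  assumes "v0 > 0"
  obtains C where "C \<ge> 0" "\<And>x \<tau>. Im \<tau> \<ge> v0 \<Longrightarrow> norm (s_term s x \<tau>) \<le> C * ((1 + x\<^sup>2) ^ (s + 1) * exp (- (2 * pi * v0 * x\<^sup>2)))"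
proof (induction s arbitrary: thesis)
  case 0
  have "norm (s_term 0 x \<tau>) \<le> (1 / sqrt v0 + 6 * pi) * ((1 + x\<^sup>2) ^ (0 + 1) * exp (- (2 * pi * v0 * x\<^sup>2)))" if "Im \<tau> \<ge> v0" for x \<tau>
  proof -
    define v where "v = Im \<tau>"
    have v: "v \<ge> v0" "v > 0" using that assms by (auto simp: v_def)
    have "\<bar>x\<bar> \<le> 1 + x\<^sup>2"
      using zero_le_power2[of "\<bar>x\<bar> - 1"] zero_le_power2[of x] by (simp add: power2_eq_square algebra_simps)
    moreover have "1 / sqrt v \<le> 1 / sqrt v0 * (1 + x\<^sup>2)"
    proof -
      have "1 / sqrt v \<le> 1 / sqrt v0" using v assms by (intro divide_left_mono) auto
      also have "\<dots> \<le> 1 / sqrt v0 * (1 + x\<^sup>2)" using assms by (simp add: distrib_left)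
      finally show ?thesis .
    qed
    ultimately have A: "1 / sqrt v + 6 * pi * \<bar>x\<bar> \<le> (1 / sqrt v0 + 6 * pi) * (1 + x\<^sup>2)"
      unfolding distrib_right by (intro add_mono mult_left_mono) auto
    have "norm (s_term 0 x \<tau>) = \<bar>s_coeff v x\<bar> * exp (2 * pi * x\<^sup>2 * v)"
      by (simp add: norm_mult norm_qpow v_def)
    also have "\<dots> \<le> ((1 / sqrt v + 6 * pi * \<bar>x\<bar>) * exp (- (4 * pi * x\<^sup>2 * v))) * exp (2 * pi * x\<^sup>2 * v)"
      using abs_s_coeff_le[OF v(2)] by (intro mult_right_mono) auto
    also have "\<dots> = (1 / sqrt v + 6 * pi * \<bar>x\<bar>) * exp (- (2 * pi * v * x\<^sup>2))"
    proof -
      have "exp (- (4 * pi * x\<^sup>2 * v)) * exp (2 * pi * x\<^sup>2 * v) = exp (- (2 * pi * v * x\<^sup>2))"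
        unfolding exp_add[symmetric] by (rule arg_cong[of _ _ exp]) (simp add: algebra_simps)
      then show ?thesis by (simp only: mult.assoc)
    qed
    also have "\<dots> \<le> ((1 / sqrt v0 + 6 * pi) * (1 + x\<^sup>2)) * exp (- (2 * pi * v0 * x\<^sup>2))"
      using A v assms by (intro mult_mono) (auto intro!: mult_right_mono mult_left_mono)
    finally show ?thesis by (simp add: mult.assoc)
  qed
  then show ?case using assms by (intro 0[of "1 / sqrt v0 + 6 * pi"]) auto
next
  case (Suc s)
  obtain C where C: "C \<ge> 0" "\<And>x \<tau>. Im \<tau> \<ge> v0 \<Longrightarrow> norm (s_term s x \<tau>) \<le> C * ((1 + x\<^sup>2) ^ (s + 1) * exp (- (2 * pi * v0 * x\<^sup>2)))"
    using Suc.IH by blast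
  define K where "K = s_const s / (sqrt v0 * v0 ^ (s + 1))"
  have s0: "s_const s \<ge> 0" by (simp add: s_const_def)
  have K: "K \<ge> 0" unfolding K_def using assms s0 by simp
  have "norm (s_term (Suc s) x \<tau>) \<le> (C + K) * ((1 + x\<^sup>2) ^ (Suc s + 1) * exp (- (2 * pi * v0 * x\<^sup>2)))" if \<tau>: "Im \<tau> \<ge> v0" for x \<tau>
  proof -
    define E where "E = exp (- (2 * pi * v0 * x\<^sup>2))"
    have "norm (of_real (x\<^sup>2) * s_term s x \<tau>) \<le> x\<^sup>2 * (C * ((1 + x\<^sup>2) ^ (s + 1) * E))"
    proof -
      have "norm (of_real (x\<^sup>2) * s_term s x \<tau>) = x\<^sup>2 * norm (s_term s x \<tau>)"
        by (simp add: norm_mult norm_power)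
      then show ?thesis
        using mult_left_mono[OF C(2)[OF \<tau>, of x] zero_le_power2[of x]] by (simp only: E_def)
    qed
    also have "\<dots> \<le> (1 + x\<^sup>2) * (C * ((1 + x\<^sup>2) ^ (s + 1) * E))"
      using C(1) by (intro mult_right_mono) (auto simp: E_def)
    finally have 1: "norm (of_real (x\<^sup>2) * s_term s x \<tau>) \<le> C * ((1 + x\<^sup>2) ^ (Suc s + 1) * E)"
      by (simp add: mult_ac)
    have "s_const s / (sqrt (Im \<tau>) * Im \<tau> ^ (s + 1)) \<le> K"
      unfolding K_def using \<tau> assms s0
      by (intro divide_left_mono mult_mono power_mono mult_pos_pos) auto
    moreover have "norm (cnj (qpow (x\<^sup>2) \<tau>)) \<le> E"
      using \<tau> by (simp add: norm_qpow E_def mult_ac mult_right_mono)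
    ultimately have "norm (of_real (s_const s / (sqrt (Im \<tau>) * Im \<tau> ^ (s + 1))) * cnj (qpow (x\<^sup>2) \<tau>)) \<le> K * E"
      unfolding norm_mult norm_of_real using \<tau> assms s0 K by (intro mult_mono) auto
    also have "K * E \<le> K * ((1 + x\<^sup>2) ^ (Suc s + 1) * E)"
      using K one_le_power[of "1 + x\<^sup>2" "Suc s + 1"] by (intro mult_left_mono) (auto simp: E_def)
    finally have 2: "norm (of_real (s_const s / (sqrt (Im \<tau>) * Im \<tau> ^ (s + 1))) * cnj (qpow (x\<^sup>2) \<tau>))
        \<le> K * ((1 + x\<^sup>2) ^ (Suc s + 1) * E)" .
    show ?thesis
      unfolding s_term.simps E_def[symmetric] distrib_right
      by (rule norm_triangle_le, rule add_mono) (use 1 2 in auto)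
  qed
  then show ?case using C K by (intro Suc.prems[of "C + K"]) auto
qed

lemma polynomial_gaussian_majorant:
  assumes "c > 0"
  obtains M where "M summable_on (UNIV :: int set)" "\<And>n. (1 + (of_int n + h)\<^sup>2) ^ N * exp (- (c * (of_int n + h)\<^sup>2)) \<le> (M n :: real)"
proof -
  obtain M1 where M1: "M1 summable_on (UNIV :: int set)" "\<And>n. exp (- c * (real_of_int n + h)\<^sup>2) \<le> M1 n"
    using gaussian_majorant[OF assms, of h 0 0] by auto
  obtain M2 where M2: "M2 summable_on (UNIV :: int set)" "\<And>n. \<bar>real_of_int n + h\<bar> ^ (2 * N) * exp (- c * (real_of_int n + h)\<^sup>2) \<le> M2 n"
    using gaussian_majorant[OF assms, of h "2 * N" 0] by auto
  have p: "(1 + x\<^sup>2) ^ N \<le> 2 ^ N * (1 + \<bar>x\<bar> ^ (2 * N))" for x :: real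
  proof (cases "\<bar>x\<bar> \<le> 1")
    case True
    then have "x\<^sup>2 \<le> 1" by (simp add: abs_square_le_1)
    then have "(1 + x\<^sup>2) ^ N \<le> 2 ^ N" by (intro power_mono) auto
    also have "\<dots> \<le> 2 ^ N * (1 + \<bar>x\<bar> ^ (2 * N))" by simp
    finally show ?thesis .
  next
    case False
    then have "1 \<le> x\<^sup>2" by (simp add: abs_square_le_1 flip: not_less) (metis abs_square_less_1 not_less le_cases)
    then have "(1 + x\<^sup>2) ^ N \<le> (2 * x\<^sup>2) ^ N" by (intro power_mono) auto
    also have "\<dots> = 2 ^ N * \<bar>x\<bar> ^ (2 * N)" by (simp add: power_mult_distrib power_mult)
    also have "\<dots> \<le> 2 ^ N * (1 + \<bar>x\<bar> ^ (2 * N))" by simp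
    finally show ?thesis .
  qed
  have "(1 + (of_int n + h)\<^sup>2) ^ N * exp (- (c * (of_int n + h)\<^sup>2)) \<le> 2 ^ N * (M1 n + M2 n)" for n
  proof -
    define x where "x = of_int n + h"
    have "(1 + x\<^sup>2) ^ N * exp (- (c * x\<^sup>2)) \<le> 2 ^ N * (1 + \<bar>x\<bar> ^ (2 * N)) * exp (- (c * x\<^sup>2))"
      by (intro mult_right_mono p) simp
    also have "\<dots> = 2 ^ N * (exp (- c * x\<^sup>2) + \<bar>x\<bar> ^ (2 * N) * exp (- c * x\<^sup>2))"
      by (simp add: algebra_simps)
    also have "\<dots> \<le> 2 ^ N * (M1 n + M2 n)"
      unfolding x_def by (intro mult_left_mono add_mono M1 M2) simp
    finally show ?thesis by (simp only: x_def)
  qed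
  moreover have "(\<lambda>n. 2 ^ N * (M1 n + M2 n)) summable_on UNIV"
    by (intro summable_on_cmult_right summable_on_add M1 M2)
  ultimately show ?thesis using that by blast
qed

text \<open>The conjugate derivatives of the summands are a common power of v times cnj (q^(x^2)),
  and these sum to a conjugate theta constant. The next derivative can be taken only once the series
  formula is known near tau, so the induction on s runs over all tau simultaneously.\<close>

lemma
  assumes "Im \<tau> > 0"
  shows D_op_iterate_s_nu: "(D_op ^^ s) (s_nu \<nu>) \<tau> = (\<Sum>\<^sub>\<infinity>n::int. s_term s (of_int n + coset_shift \<nu>) \<tau>)"
    and has_wirtinger_derivs_D_op_iterate_s_nu: "has_wirtinger_derivs ((D_op ^^ s) (s_nu \<nu>))
      (2 * of_real pi * \<i> * (\<Sum>\<^sub>\<infinity>n::int. s_term (Suc s) (of_int n + coset_shift \<nu>) \<tau>))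
      (- 2 * of_real pi * \<i> * of_real (s_const s / (sqrt (Im \<tau>) * Im \<tau> ^ (s + 1)))
        * cnj (gauss_theta 0 (coset_shift \<nu>) (theta_exponent \<tau>) 0)) \<tau>"
    and s_term_abs_summable: "(\<lambda>n::int. norm (s_term s (of_int n + h) \<tau>)) summable_on UNIV"
proof -
  define g where "g = (\<lambda>s \<tau>. \<Sum>\<^sub>\<infinity>n::int. s_term s (of_int n + coset_shift \<nu>) \<tau>)"
  have bd: "\<exists>M. M summable_on (UNIV :: int set) \<and> (\<forall>n \<tau>. Im \<tau> \<ge> v0 \<longrightarrow> norm (s_term s (of_int n + h) \<tau>) \<le> M n)"
    if v0: "v0 > 0" for v0 s h
  proof -
    obtain C where C: "C \<ge> 0" "\<And>x \<tau>. Im \<tau> \<ge> v0 \<Longrightarrow> norm (s_term s x \<tau>) \<le> C * ((1 + x\<^sup>2) ^ (s + 1) * exp (- (2 * pi * v0 * x\<^sup>2)))"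
      using norm_s_term_le[OF v0] by blast
    obtain M where M: "M summable_on (UNIV :: int set)"
      "\<And>n. (1 + (of_int n + h)\<^sup>2) ^ (s + 1) * exp (- (2 * pi * v0 * (of_int n + h)\<^sup>2)) \<le> (M n :: real)"
      using polynomial_gaussian_majorant[of "2 * pi * v0" h "s + 1"] v0 by (metis mult_pos_pos pi_gt_zero zero_less_numeral)
    have "norm (s_term s (of_int n + h) \<tau>) \<le> C * M n" if "Im \<tau> \<ge> v0" for n \<tau>
      using C(2)[OF that, of "of_int n + h"] mult_left_mono[OF M(2)[of n] C(1)] by linarith
    then show ?thesis
      using M(1) by (intro exI[of _ "\<lambda>n. C * M n"]) (auto intro: summable_on_cmult_right)
  qed
  show "(\<lambda>n::int. norm (s_term s (of_int n + h) \<tau>)) summable_on UNIV"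
  proof -
    obtain M where "M summable_on (UNIV :: int set)" "\<And>n. norm (s_term s (of_int n + h) \<tau>) \<le> M n"
      using bd[OF assms, of s h] by auto
    then show ?thesis by (rule summable_on_of_norm_le(1))
  qed
  have d: "has_wirtinger_derivs (g s) (2 * of_real pi * \<i> * g (Suc s) \<tau>)
     (- 2 * of_real pi * \<i> * of_real (s_const s / (sqrt (Im \<tau>) * Im \<tau> ^ (s + 1)))
        * cnj (gauss_theta 0 (coset_shift \<nu>) (theta_exponent \<tau>) 0)) \<tau>" if \<tau>: "Im \<tau> > 0" for s \<tau>
  proof -
    \<comment> \<open>A ball of this radius around tau stays in the region Im z >= v0, where the
      uniform majorants apply.\<close>
    define v0 where "v0 = Im \<tau> / 2"
    have v0: "v0 > 0" using \<tau> by (simp add: v0_def)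
    have ball: "Im z \<ge> v0" if "z \<in> ball \<tau> v0" for z
      using that abs_Im_le_cmod[of "\<tau> - z"] by (simp add: v0_def dist_norm)
    obtain M1 where M1: "M1 summable_on (UNIV :: int set)" "\<And>n \<tau>. Im \<tau> \<ge> v0 \<Longrightarrow> norm (s_term s (of_int n + coset_shift \<nu>) \<tau>) \<le> M1 n"
      using bd[OF v0, of s "coset_shift \<nu>"] by blast
    obtain M2 where M2: "M2 summable_on (UNIV :: int set)" "\<And>n \<tau>. Im \<tau> \<ge> v0 \<Longrightarrow> norm (s_term (Suc s) (of_int n + coset_shift \<nu>) \<tau>) \<le> M2 n"
      using bd[OF v0, of "Suc s" "coset_shift \<nu>"] by blast
    obtain M3 where M3: "M3 summable_on (UNIV :: int set)" "\<And>n. exp (- (2 * pi * v0) * (real_of_int n + coset_shift \<nu>)\<^sup>2) \<le> M3 n"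
      using gaussian_majorant[of "2 * pi * v0" "coset_shift \<nu>" 0 0] v0 by auto
    define K where "K = 2 * pi * s_const s / (sqrt v0 * v0 ^ (s + 1))"
    have s0: "s_const s \<ge> 0" by (simp add: s_const_def)
    define M where "M = (\<lambda>n. M1 n + 2 * pi * M2 n + K * M3 n)"
    define q where "q = (\<lambda>(n::int) z. - 2 * of_real pi * \<i> * of_real (s_const s / (sqrt (Im z) * Im z ^ (s + 1)))
        * cnj (qpow ((of_int n + coset_shift \<nu>)\<^sup>2) z))"
    have Mpos: "0 \<le> M1 n" "0 \<le> M2 n" "0 \<le> K * M3 n" for n
    proof -
      show "0 \<le> M1 n" "0 \<le> M2 n"
        using order.trans[OF norm_ge_zero M1(2)[of "\<i> * of_real v0"]] order.trans[OF norm_ge_zero M2(2)[of "\<i> * of_real v0"]]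
        by (auto simp del: s_term.simps)
      have "0 \<le> M3 n" using M3(2)[of n] exp_ge_zero order_trans by blast
      then show "0 \<le> K * M3 n" using v0 s0 by (simp add: K_def)
    qed
    have qb: "norm (q n z) \<le> K * M3 n" if "Im z \<ge> v0" for n z
    proof -
      have "2 * pi * (s_const s / (sqrt (Im z) * Im z ^ (s + 1))) \<le> K"
        unfolding K_def times_divide_eq_right using that v0 s0
        by (intro divide_left_mono mult_mono power_mono mult_pos_pos mult_nonneg_nonneg) auto
      moreover have "exp (- (2 * pi * (of_int n + coset_shift \<nu>)\<^sup>2 * Im z)) \<le> M3 n"
      proof -
        have "(2 * pi * (of_int n + coset_shift \<nu>)\<^sup>2) * v0 \<le> (2 * pi * (of_int n + coset_shift \<nu>)\<^sup>2) * Im z"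
          using that by (intro mult_left_mono) auto
        then show ?thesis using M3(2)[of n] by (intro order.trans[OF _ M3(2)]) (simp add: mult_ac)
      qed
      moreover have "norm (q n z) = 2 * pi * (s_const s / (sqrt (Im z) * Im z ^ (s + 1))) * exp (- (2 * pi * (of_int n + coset_shift \<nu>)\<^sup>2 * Im z))"
        using that v0 s0 unfolding q_def norm_mult complex_mod_cnj norm_qpow norm_of_real by simp
      moreover have "0 \<le> K" unfolding K_def using v0 s0 by simp
      ultimately show ?thesis by (simp only:) (rule mult_mono; simp)
    qed
    have Ms: "M summable_on UNIV"
      unfolding M_def by (intro summable_on_add summable_on_cmult_right M1 M2 M3)
    have "has_wirtinger_derivs (\<lambda>z. \<Sum>\<^sub>\<infinity>n::int. s_term s (of_int n + coset_shift \<nu>) z)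
      (\<Sum>\<^sub>\<infinity>n::int. 2 * of_real pi * \<i> * s_term (Suc s) (of_int n + coset_shift \<nu>) \<tau>) (\<Sum>\<^sub>\<infinity>n. q n \<tau>) \<tau>"
    proof (rule has_wirtinger_derivs_infsum[OF v0 Ms])
      fix n :: int and z assume "z \<in> ball \<tau> v0"
      then have z: "Im z \<ge> v0" "Im z > 0" using ball v0 by force+
      show "has_wirtinger_derivs (s_term s (of_int n + coset_shift \<nu>))
        (2 * of_real pi * \<i> * s_term (Suc s) (of_int n + coset_shift \<nu>) z) (q n z) z"
        unfolding q_def by (rule has_wirtinger_derivs_s_term[OF z(2)])
      have "norm (2 * of_real pi * \<i> * s_term (Suc s) (of_int n + coset_shift \<nu>) z) \<le> 2 * pi * M2 n"
        unfolding norm_mult using M2(2)[OF z(1), of n] by (simp del: s_term.simps)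
      moreover have "0 \<le> 2 * pi * M2 n" using Mpos by simp
      ultimately show "norm (s_term s (of_int n + coset_shift \<nu>) z) \<le> M n
          \<and> norm (2 * of_real pi * \<i> * s_term (Suc s) (of_int n + coset_shift \<nu>) z) \<le> M n \<and> norm (q n z) \<le> M n"
        using M1(2)[OF z(1), of n] qb[OF z(1), of n] Mpos[of n] unfolding M_def by linarith
    qed
    moreover have "(\<Sum>\<^sub>\<infinity>n. q n \<tau>) = - 2 * of_real pi * \<i> * of_real (s_const s / (sqrt (Im \<tau>) * Im \<tau> ^ (s + 1)))
        * cnj (gauss_theta 0 (coset_shift \<nu>) (theta_exponent \<tau>) 0)"
      unfolding q_def gauss_theta_def infsum_cnj[symmetric] infsum_cmult_right'[symmetric]
      by (intro infsum_cong) (simp add: gauss_term_def qpow_def mult_ac)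
    ultimately show ?thesis
      unfolding g_def by (simp only: infsum_cmult_right')
  qed
  have eq: "(D_op ^^ s) (s_nu \<nu>) \<tau> = g s \<tau>" if "Im \<tau> > 0" for s \<tau>
    using that
  proof (induction s arbitrary: \<tau>)
    case 0
    have e: "1 / 2 + real_of_int m + of_int \<nu> / 2 = of_int m + coset_shift \<nu>" for m
      by (simp add: coset_shift_def field_simps)
    show ?case by (simp add: g_def s_nu_def infsum_half_integers e)
  next
    case (Suc s)
    from has_wirtinger_derivs_transform[OF d[OF Suc.prems] open_upper_half_plane, of s "(D_op ^^ s) (s_nu \<nu>)"]
    have "wirtinger_d ((D_op ^^ s) (s_nu \<nu>)) \<tau> = 2 * of_real pi * \<i> * g (Suc s) \<tau>"
      using Suc by (intro wirtinger_d_eq) auto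
    then show ?case unfolding D_op_funpow_Suc by simp
  qed
  show "(D_op ^^ s) (s_nu \<nu>) \<tau> = (\<Sum>\<^sub>\<infinity>n::int. s_term s (of_int n + coset_shift \<nu>) \<tau>)"
    using eq[OF assms] by (simp add: g_def)
  show "has_wirtinger_derivs ((D_op ^^ s) (s_nu \<nu>))
      (2 * of_real pi * \<i> * (\<Sum>\<^sub>\<infinity>n::int. s_term (Suc s) (of_int n + coset_shift \<nu>) \<tau>))
      (- 2 * of_real pi * \<i> * of_real (s_const s / (sqrt (Im \<tau>) * Im \<tau> ^ (s + 1)))
        * cnj (gauss_theta 0 (coset_shift \<nu>) (theta_exponent \<tau>) 0)) \<tau>"
    using has_wirtinger_derivs_transform[OF d[OF assms] open_upper_half_plane, of s "(D_op ^^ s) (s_nu \<nu>)"] eq assms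
    unfolding g_def by auto
qed

subsection \<open>Lattice sums\<close>

lemma
  fixes f :: "'a \<Rightarrow> complex" and g :: "'b \<Rightarrow> complex"
  assumes f: "(\<lambda>x. norm (f x)) summable_on A" and g: "(\<lambda>y. norm (g y)) summable_on B"
  shows summable_on_norm_product: "(\<lambda>(x, y). norm (f x * g y)) summable_on A \<times> B"
    and infsum_product: "(\<Sum>\<^sub>\<infinity>(x, y)\<in>A \<times> B. f x * g y) = (\<Sum>\<^sub>\<infinity>x\<in>A. f x) * (\<Sum>\<^sub>\<infinity>y\<in>B. g y)"
proof -
  have s: "(\<lambda>p. norm (f (fst p)) * norm (g (snd p))) summable_on A \<times> B"
  proof (rule summable_on_SigmaI)
    show "((\<lambda>y. norm (f (fst (x, y))) * norm (g (snd (x, y)))) has_sum norm (f x) * (\<Sum>\<^sub>\<infinity>y\<in>B. norm (g y))) B" for x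
      using has_sum_cmult_right[OF has_sum_infsum[OF g], of "norm (f x)"] by simp
    show "(\<lambda>x. norm (f x) * (\<Sum>\<^sub>\<infinity>y\<in>B. norm (g y))) summable_on A"
      by (intro summable_on_cmult_left f)
  qed auto
  then show s': "(\<lambda>(x, y). norm (f x * g y)) summable_on A \<times> B"
    by (simp add: case_prod_unfold norm_mult)
  then have "(\<lambda>p. norm ((\<lambda>(x, y). f x * g y) p)) summable_on A \<times> B"
    by (simp add: case_prod_unfold)
  then have "(\<lambda>(x, y). f x * g y) summable_on A \<times> B"
    by (rule abs_summable_summable)
  from infsum_Sigma_banach[OF this]
  show "(\<Sum>\<^sub>\<infinity>(x, y)\<in>A \<times> B. f x * g y) = (\<Sum>\<^sub>\<infinity>x\<in>A. f x) * (\<Sum>\<^sub>\<infinity>y\<in>B. g y)"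
    by (simp add: infsum_cmult_right' infsum_cmult_left')
qed

definition lattice_point :: "complex \<Rightarrow> int \<times> int \<Rightarrow> complex" where
  "lattice_point \<tau> p = of_int (fst p) * \<tau> + of_int (snd p)"

text \<open>For w' = cnj w the number lambda w' - cnj lambda w is purely imaginary and its
  exponential is a unitary character in lambda. With w and w' independent the term is entire in each
  of them; at w = w' = 0 it is exp (- pi |lambda|^2 / v).\<close>

definition lattice_term :: "complex \<Rightarrow> complex \<Rightarrow> complex \<Rightarrow> int \<times> int \<Rightarrow> complex" where
  "lattice_term \<tau> w w' p = exp (of_real (pi / Im \<tau>)
     * (lattice_point \<tau> p * w' - cnj (lattice_point \<tau> p) * w - lattice_point \<tau> p * cnj (lattice_point \<tau> p)))"

lemma lattice_point_bound:
  assumes "Im \<tau> > 0"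
  obtains K where "K > 0" "\<And>p. \<bar>real_of_int (fst p)\<bar> + \<bar>real_of_int (snd p)\<bar> \<le> K * norm (lattice_point \<tau> p)"
proof
  define K where "K = 1 / Im \<tau> + (1 + \<bar>Re \<tau>\<bar> / Im \<tau>)"
  show "K > 0" unfolding K_def using assms by (intro add_pos_pos add_pos_nonneg) auto
  fix p
  define l where "l = lattice_point \<tau> p"
  have "\<bar>real_of_int (fst p)\<bar> = \<bar>Im l\<bar> / Im \<tau>"
    using assms by (simp add: l_def lattice_point_def abs_mult)
  also have "\<dots> \<le> norm l / Im \<tau>"
    using assms abs_Im_le_cmod by (intro divide_right_mono) auto
  finally have m: "\<bar>real_of_int (fst p)\<bar> \<le> norm l / Im \<tau>" .
  have "real_of_int (snd p) = Re l - of_int (fst p) * Re \<tau>"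
    by (simp add: l_def lattice_point_def)
  then have "\<bar>real_of_int (snd p)\<bar> \<le> \<bar>Re l\<bar> + \<bar>real_of_int (fst p)\<bar> * \<bar>Re \<tau>\<bar>"
    by (metis abs_mult abs_triangle_ineq4)
  also have "\<dots> \<le> norm l + norm l / Im \<tau> * \<bar>Re \<tau>\<bar>"
    using m abs_Re_le_cmod by (intro add_mono mult_right_mono) auto
  finally show "\<bar>real_of_int (fst p)\<bar> + \<bar>real_of_int (snd p)\<bar> \<le> K * norm (lattice_point \<tau> p)"
    using m by (simp add: K_def l_def[symmetric] algebra_simps)
qed

lemma norm_lattice_point_lower_bound:
  assumes "Im \<tau> > 0"
  obtains K where "K > 0" "\<And>p. p \<noteq> (0, 0) \<Longrightarrow> 1 / norm (lattice_point \<tau> p) \<le> K" "\<And>p. p \<noteq> (0, 0) \<Longrightarrow> lattice_point \<tau> p \<noteq> 0"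
proof -
  obtain K where K: "K > 0" "\<And>p. \<bar>real_of_int (fst p)\<bar> + \<bar>real_of_int (snd p)\<bar> \<le> K * norm (lattice_point \<tau> p)"
    using lattice_point_bound[OF assms] by blast
  have *: "1 \<le> K * norm (lattice_point \<tau> p)" if "p \<noteq> (0, 0)" for p
  proof -
    obtain m n where p: "p = (m, n)" by (cases p)
    have "1 \<le> \<bar>m\<bar> + \<bar>n\<bar>" using that p by auto
    then have "1 \<le> \<bar>real_of_int (fst p)\<bar> + \<bar>real_of_int (snd p)\<bar>"
      unfolding p fst_conv snd_conv by linarith
    then show ?thesis using K(2)[of p] by linarith
  qed
  have nz: "lattice_point \<tau> p \<noteq> 0" if "p \<noteq> (0, 0)" for p using *[OF that] by auto
  have "1 / norm (lattice_point \<tau> p) \<le> K" if "p \<noteq> (0, 0)" for p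
    using *[OF that] nz[OF that] by (simp add: field_simps)
  then show ?thesis using that K(1) nz by blast
qed

lemma lattice_majorant:
  assumes "Im \<tau> > 0"
  obtains M where "M summable_on (UNIV :: (int \<times> int) set)"
    "\<And>p. norm (lattice_point \<tau> p) ^ N * exp (- (pi / Im \<tau>) * (norm (lattice_point \<tau> p))\<^sup>2 + b * norm (lattice_point \<tau> p)) \<le> (M p :: real)"
proof -
  obtain K where K: "K > 0" "\<And>p. \<bar>real_of_int (fst p)\<bar> + \<bar>real_of_int (snd p)\<bar> \<le> K * norm (lattice_point \<tau> p)"
    using lattice_point_bound[OF assms] by blast
  \<comment> \<open>The linear coefficient is raised by K to gain a spare factor exp (- K |lambda|),
    which is at most exp (- |m| - |n|); the majorant is then a product over the two
    coordinates.\<close>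
  have "pi / Im \<tau> > 0" using assms by simp
  then obtain C where C: "C > 0" "\<And>x. \<bar>x\<bar> ^ N * exp (- (pi / Im \<tau>) * x\<^sup>2 + (b + K) * \<bar>x\<bar>) \<le> C * exp (- \<bar>x\<bar>)"
    using gaussian_decay by blast
  define M where "M = (\<lambda>p::int \<times> int. C * (exp (- \<bar>real_of_int (fst p)\<bar>) * exp (- \<bar>real_of_int (snd p)\<bar>)))"
  have "norm (lattice_point \<tau> p) ^ N * exp (- (pi / Im \<tau>) * (norm (lattice_point \<tau> p))\<^sup>2 + b * norm (lattice_point \<tau> p)) \<le> M p" for p
  proof -
    define x where "x = norm (lattice_point \<tau> p)"
    have x: "x \<ge> 0" by (simp add: x_def)
    have "x ^ N * exp (- (pi / Im \<tau>) * x\<^sup>2 + b * x) = (\<bar>x\<bar> ^ N * exp (- (pi / Im \<tau>) * x\<^sup>2 + (b + K) * \<bar>x\<bar>)) * exp (- (K * x))"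
      using x by (simp add: exp_add[symmetric] algebra_simps)
    also have "\<dots> \<le> (C * exp (- \<bar>x\<bar>)) * exp (- (K * x))"
      by (intro mult_right_mono C) simp
    also have "\<dots> \<le> (C * 1) * exp (- (\<bar>real_of_int (fst p)\<bar> + \<bar>real_of_int (snd p)\<bar>))"
      using C(1) K(2)[of p] x by (intro mult_mono) (auto simp: x_def)
    also have "\<dots> = M p" by (simp add: M_def exp_diff exp_minus field_simps)
    finally show ?thesis by (simp add: x_def)
  qed
  moreover have "M summable_on UNIV"
  proof -
    have e: "(\<lambda>n::int. norm (complex_of_real (exp (- \<bar>real_of_int n\<bar>)))) summable_on UNIV"
      using summable_on_exp_abs_int by simp
    have "(\<lambda>p. norm (complex_of_real (exp (- \<bar>real_of_int (fst p)\<bar>)) * complex_of_real (exp (- \<bar>real_of_int (snd p)\<bar>)))) summable_on UNIV"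
      using summable_on_norm_product[OF e e] by (simp add: case_prod_unfold)
    then show ?thesis unfolding M_def by (intro summable_on_cmult_right) (simp add: norm_mult)
  qed
  ultimately show ?thesis using that by blast
qed

lemma norm_lattice_term_le:
  assumes "Im \<tau> > 0" "norm w + norm w' \<le> b"
  shows "norm (lattice_term \<tau> w w' p) \<le> exp (- (pi / Im \<tau>) * (norm (lattice_point \<tau> p))\<^sup>2 + pi / Im \<tau> * b * norm (lattice_point \<tau> p))"
proof -
  define l where "l = lattice_point \<tau> p"
  have "Re (l * w') - Re (cnj l * w) \<le> norm (l * w') + norm (cnj l * w)"
    using complex_Re_le_cmod[of "l * w'"] abs_Re_le_cmod[of "cnj l * w"] by linarith
  also have "\<dots> = (norm w + norm w') * norm l" by (simp add: norm_mult algebra_simps)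
  also have "\<dots> \<le> b * norm l" using assms(2) by (intro mult_right_mono) auto
  finally have "Re (l * w') - Re (cnj l * w) \<le> b * norm l" .
  moreover have "Re (l * cnj l) = (norm l)\<^sup>2" using cmod_power2[of l] by (simp add: power2_eq_square)
  ultimately have "Re (l * w' - cnj l * w - l * cnj l) \<le> b * norm l - (norm l)\<^sup>2"
    by simp
  then have "pi / Im \<tau> * Re (l * w' - cnj l * w - l * cnj l) \<le> pi / Im \<tau> * (b * norm l - (norm l)\<^sup>2)"
    using assms(1) by (intro mult_left_mono) auto
  then show ?thesis
    unfolding lattice_term_def l_def[symmetric] norm_exp_eq_Re
    by (simp only: exp_le_cancel_iff Re_complex_of_real Im_complex_of_real times_complex.sel) (simp add: algebra_simps)
qed

text \<open>With x = a + h and y = b + h, put m = x - y and M = x + y. The cosets h = 0 and h = 1/2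
  give the pairs with M - m even and odd, so together they fill \<open>int \<times> int\<close>. For
  fixed m the sum over M is a theta series with real exponent pi v M^2, and Poisson summation in M
  alone produces the lattice sum.\<close>

lemma theta_product_eq_lattice_sum:
  assumes tau: "Im \<tau> > 0"
  shows "exp (of_real pi * (w - w')\<^sup>2 / (4 * of_real (Im \<tau>)))
      * (\<Sum>h\<in>{0, 1/2}. gauss_theta 0 h (theta_exponent \<tau>) (2 * of_real pi * \<i> * w)
           * gauss_theta 0 h (2 * of_real pi * \<i> * cnj \<tau>) (- (2 * of_real pi * \<i> * w')))
    = (\<Sum>\<^sub>\<infinity>p. lattice_term \<tau> w w' p) / of_real (sqrt (Im \<tau>))"
proof -
  define v where "v = Im \<tau>"
  define u where "u = Re \<tau>"
  have v: "v > 0" using tau by (simp add: v_def)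
  have \<tau>: "\<tau> = of_real u + \<i> * of_real v" by (simp add: u_def v_def complex_eq_iff)
  define E where "E = (\<lambda>m M::complex. exp (2 * of_real pi * \<i> * of_real u * m * M
     - of_real pi * of_real v * (m\<^sup>2 + M\<^sup>2) + of_real pi * \<i> * (M * (w - w') + m * (w + w'))))"
  define t where "t = (\<lambda>(m, M). E (of_int m) (of_int M))"
  define G where "G = (\<lambda>h. \<lambda>(a::int, b::int). gauss_term 0 (of_int a + h) (theta_exponent \<tau>) (2 * of_real pi * \<i> * w)
       * gauss_term 0 (of_int b + h) (2 * of_real pi * \<i> * cnj \<tau>) (- (2 * of_real pi * \<i> * w')))"
  \<comment> \<open>Here j = 2 h, and the image of \<open>\<phi> j\<close> consists of the pairs
    whose difference has the parity of j.\<close>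
  define \<phi> where "\<phi> = (\<lambda>j::int. \<lambda>(a::int, b::int). (a - b, a + b + j))"
  have G: "G (of_int j / 2) p = t (\<phi> j p)" for j p
  proof -
    obtain a b where p: "p = (a, b)" by (cases p)
    define x y where "x = complex_of_int a + of_int j / 2" and "y = complex_of_int b + of_int j / 2"
    have "G (of_int j / 2) p = exp (- theta_exponent \<tau> * x\<^sup>2 + 2 * of_real pi * \<i> * w * x
        + (- (2 * of_real pi * \<i> * cnj \<tau>) * y\<^sup>2 + - (2 * of_real pi * \<i> * w') * y))"
      by (simp add: G_def p gauss_term_def exp_add x_def y_def)
    also have "\<dots> = E (x - y) (x + y)"
      unfolding E_def by (rule arg_cong[of _ _ exp]) (simp add: \<tau> power2_eq_square algebra_simps)
    also have "x - y = of_int (a - b)" by (simp add: x_def y_def)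
    also have "x + y = of_int (a + b + j)" by (simp add: x_def y_def)
    finally show ?thesis by (simp add: t_def \<phi>_def p)
  qed
  have inj: "inj_on (\<phi> j) UNIV" for j by (auto simp: inj_on_def \<phi>_def)
  have un: "range (\<phi> 0) \<union> range (\<phi> 1) = UNIV" and dis: "range (\<phi> 0) \<inter> range (\<phi> 1) = {}"
  proof -
    have r: "range (\<phi> j) = {(m, M). even (M - m - j)}" for j
    proof (safe, goal_cases)
      case (1 m M a b)
      then show ?case by (auto simp: \<phi>_def)
    next
      case (2 m M)
      then obtain c where "M - m - j = 2 * c" by (elim evenE)
      then show ?case by (intro image_eqI[of _ _ "(m + c, c)"]) (auto simp: \<phi>_def)
    qed
    show "range (\<phi> 0) \<union> range (\<phi> 1) = UNIV" "range (\<phi> 0) \<inter> range (\<phi> 1) = {}"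
      unfolding r by auto
  qed
  have Re1: "Re (theta_exponent \<tau>) > 0" and Re2: "Re (2 * of_real pi * \<i> * cnj \<tau>) > 0"
    using tau by simp_all
  have Gs: "(\<lambda>p. norm (G h p)) summable_on UNIV"
    and Gi: "(\<Sum>\<^sub>\<infinity>p. G h p) = gauss_theta 0 h (theta_exponent \<tau>) (2 * of_real pi * \<i> * w)
           * gauss_theta 0 h (2 * of_real pi * \<i> * cnj \<tau>) (- (2 * of_real pi * \<i> * w'))" for h
    using summable_on_norm_product[OF gauss_term_abs_summable[OF Re1, of 0 h "2 * of_real pi * \<i> * w"]
        gauss_term_abs_summable[OF Re2, of 0 h "- (2 * of_real pi * \<i> * w')"]]
      infsum_product[OF gauss_term_abs_summable[OF Re1, of 0 h "2 * of_real pi * \<i> * w"]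
        gauss_term_abs_summable[OF Re2, of 0 h "- (2 * of_real pi * \<i> * w')"]]
    by (simp_all add: G_def gauss_theta_def case_prod_unfold)
  have ts: "t summable_on range (\<phi> j)" and ti: "infsum t (range (\<phi> j)) = (\<Sum>\<^sub>\<infinity>p. G (of_int j / 2) p)" for j
  proof -
    have "G (of_int j / 2) summable_on UNIV" using Gs by (rule abs_summable_summable)
    moreover have e: "G (of_int j / 2) = t \<circ> \<phi> j" by (rule ext) (simp add: G)
    ultimately show "t summable_on range (\<phi> j)"
      unfolding summable_on_reindex[OF inj] by simp
    show "infsum t (range (\<phi> j)) = (\<Sum>\<^sub>\<infinity>p. G (of_int j / 2) p)"
      unfolding infsum_reindex[OF inj] e ..
  qed
  have sum_t: "t summable_on UNIV" and "infsum t UNIV = (\<Sum>\<^sub>\<infinity>p. G 0 p) + (\<Sum>\<^sub>\<infinity>p. G (1/2) p)"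
    using summable_on_Un_disjoint[OF ts ts dis] infsum_Un_disjoint[OF ts ts dis] ti[of 0] ti[of 1] un by simp_all
  then have lhs: "(\<Sum>h\<in>{0, 1/2}. gauss_theta 0 h (theta_exponent \<tau>) (2 * of_real pi * \<i> * w)
           * gauss_theta 0 h (2 * of_real pi * \<i> * cnj \<tau>) (- (2 * of_real pi * \<i> * w'))) = infsum t UNIV"
    by (simp add: Gi)
  \<comment> \<open>The part of exp (- pi z^2 / v) / sqrt v that is free of m. It cancels the
    exponential prefactor in the statement and leaves 1 / sqrt v.\<close>
  define A where "A = exp (- of_real pi * (w - w')\<^sup>2 / (4 * of_real v)) / of_real (sqrt v)"
  have inner: "(\<Sum>\<^sub>\<infinity>M. t (m, M)) = A * (\<Sum>\<^sub>\<infinity>n. lattice_term \<tau> w w' (m, n))" for m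
  proof -
    define z where "z = of_real u * of_int m + (w - w') / 2"
    define c where "c = exp (- of_real pi * of_real v * (of_int m)\<^sup>2 + of_real pi * \<i> * of_int m * (w + w'))"
    have csq: "csqrt (of_real v) = of_real (sqrt v)"
      by (rule of_real_sqrt[symmetric]) (use v in simp)
    have "t (m, M) = c * gauss_term 0 (of_int M + 0) (of_real pi * of_real v) (2 * of_real pi * \<i> * z)" for M
      unfolding t_def prod.case E_def c_def gauss_term_def z_def power_0 mult_1 exp_add[symmetric]
      by (rule arg_cong[of _ _ exp]) (simp add: algebra_simps diff_divide_distrib)
    then have "(\<Sum>\<^sub>\<infinity>M. t (m, M)) = c * gauss_theta 0 0 (of_real pi * of_real v) (2 * of_real pi * \<i> * z)"
      by (simp add: gauss_theta_def infsum_cmult_right')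
    also have "\<dots> = c * (exp (- of_real pi * z\<^sup>2 / of_real v) / of_real (sqrt v)
        * gauss_theta 0 0 (of_real pi / of_real v) (- 2 * of_real pi * z / of_real v))"
      using gauss_theta_inversion[of "of_real v" z] v by (simp add: csq)
    also have "\<dots> = (\<Sum>\<^sub>\<infinity>n::int. c * (exp (- of_real pi * z\<^sup>2 / of_real v) / of_real (sqrt v)
        * gauss_term 0 (of_int n + 0) (of_real pi / of_real v) (- 2 * of_real pi * z / of_real v)))"
      unfolding gauss_theta_def infsum_cmult_right' ..
    also have "\<dots> = (\<Sum>\<^sub>\<infinity>n::int. A * lattice_term \<tau> w w' (m, n))"
    proof (rule infsum_cong)
      fix n :: int
      have V: "complex_of_real v \<noteq> 0" using v by simp
      have "- of_real pi * of_real v * (of_int m)\<^sup>2 + of_real pi * \<i> * of_int m * (w + w')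
          + (- of_real pi * z\<^sup>2 / of_real v
          + (- (of_real pi / of_real v) * (of_int n)\<^sup>2 + - 2 * of_real pi * z / of_real v * of_int n))
        = - of_real pi * (w - w')\<^sup>2 / (4 * of_real v)
          + of_real pi / of_real v * ((of_int m * \<tau> + of_int n) * w' - (of_int m * cnj \<tau> + of_int n) * w
              - (of_int m * \<tau> + of_int n) * (of_int m * cnj \<tau> + of_int n))"
        unfolding z_def \<tau> using V
        by (simp add: field_simps power2_eq_square)
      note this = arg_cong[OF this, of exp]
      moreover have lt: "lattice_term \<tau> w w' (m, n) = exp (of_real pi / of_real v
          * ((of_int m * \<tau> + of_int n) * w' - (of_int m * cnj \<tau> + of_int n) * w
              - (of_int m * \<tau> + of_int n) * (of_int m * cnj \<tau> + of_int n)))"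
        by (simp add: lattice_term_def lattice_point_def v_def)
      ultimately
      have "c * (exp (- of_real pi * z\<^sup>2 / of_real v)
          * gauss_term 0 (of_int n + 0) (of_real pi / of_real v) (- 2 * of_real pi * z / of_real v))
        = exp (- of_real pi * (w - w')\<^sup>2 / (4 * of_real v)) * lattice_term \<tau> w w' (m, n)"
        unfolding lt c_def gauss_term_def power_0 mult_1 exp_add[symmetric] by simp
      then show "c * (exp (- of_real pi * z\<^sup>2 / of_real v) / of_real (sqrt v)
          * gauss_term 0 (of_int n + 0) (of_real pi / of_real v) (- 2 * of_real pi * z / of_real v))
        = A * lattice_term \<tau> w w' (m, n)"
        by (simp add: A_def)
    qed
    also have "\<dots> = A * (\<Sum>\<^sub>\<infinity>n. lattice_term \<tau> w w' (m, n))"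
      by (rule infsum_cmult_right')
    finally show ?thesis .
  qed
  have "lattice_term \<tau> w w' summable_on UNIV"
  proof -
    obtain M where M: "M summable_on (UNIV :: (int \<times> int) set)"
      "\<And>p. norm (lattice_point \<tau> p) ^ 0 * exp (- (pi / Im \<tau>) * (norm (lattice_point \<tau> p))\<^sup>2 + pi / Im \<tau> * (norm w + norm w') * norm (lattice_point \<tau> p)) \<le> (M p :: real)"
      using lattice_majorant[OF tau] by blast
    show ?thesis
      by (rule summable_on_of_norm_le(2)[OF M(1)],
          rule order.trans[OF norm_lattice_term_le[OF tau order.refl] M(2)[unfolded power_0 mult_1]])
  qed
  then have "(\<Sum>\<^sub>\<infinity>p. lattice_term \<tau> w w' p) = (\<Sum>\<^sub>\<infinity>m. \<Sum>\<^sub>\<infinity>n. lattice_term \<tau> w w' (m, n))"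
    using infsum_Sigma_banach[of "lattice_term \<tau> w w'" UNIV "\<lambda>_. UNIV"] by simp
  moreover have "infsum t UNIV = (\<Sum>\<^sub>\<infinity>m. \<Sum>\<^sub>\<infinity>M. t (m, M))"
    using infsum_Sigma_banach[of t UNIV "\<lambda>_. UNIV"] sum_t by simp
  ultimately have "infsum t UNIV = A * (\<Sum>\<^sub>\<infinity>p. lattice_term \<tau> w w' p)"
    unfolding inner by (simp add: infsum_cmult_right')
  moreover have "exp (of_real pi * (w - w')\<^sup>2 / (4 * of_real v)) * A = 1 / of_real (sqrt v)"
    unfolding A_def by (simp add: exp_minus)
  ultimately show ?thesis
    unfolding lhs v_def[symmetric] mult.assoc[symmetric] by (metis mult.assoc mult.commute times_divide_eq_right mult_1_right)
qed

subsection \<open>The nonholomorphic completion\<close>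

text \<open>The summand of Zwegers' nonholomorphic completion, with cnj w replaced by a variable w':
  for w' = cnj w the shift (w - w') / (4 i v) is the real number Im w / (2 v). As q^(- x^2) grows,
  convergence comes from the difference of the sign and the error function. At x = 0 the sign is
  0.\<close>

definition err_term :: "complex \<Rightarrow> real \<Rightarrow> complex \<Rightarrow> complex \<Rightarrow> complex" where
  "err_term \<tau> x w w' = exp (theta_exponent \<tau> * (of_real x)\<^sup>2 - 2 * of_real pi * \<i> * of_real x * w)
     * (of_real (sgn x) - cerf (of_real (sqrt (4 * pi * Im \<tau>)) * (of_real x + (w - w') / (4 * \<i> * of_real (Im \<tau>)))))"

definition err_theta :: "complex \<Rightarrow> real \<Rightarrow> complex \<Rightarrow> complex \<Rightarrow> complex" where
  "err_theta \<tau> h w w' = (\<Sum>\<^sub>\<infinity>n::int. err_term \<tau> (of_int n + h) w w')"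

text \<open>The exponents 2 pi v x^2 and - 4 pi v x^2 leave Gaussian decay. The term x = 0 has no
  sign to compare with and is bounded by compactness; this accounts for the summand |K| in the
  constant.\<close>

lemma norm_err_term_le:
  assumes v: "Im \<tau> > 0"
  obtains C b where "\<And>x w w'. norm w \<le> \<rho> \<Longrightarrow> norm w' \<le> \<rho> \<Longrightarrow>
    norm (err_term \<tau> x w w') \<le> C * exp (- (2 * pi * Im \<tau>) * x\<^sup>2 + b * \<bar>x\<bar>)" "C \<ge> 0"
proof -
  define v where "v = Im \<tau>"
  have v: "v > 0" using assms by (simp add: v_def)
  define c where "c = sqrt (4 * pi * v)"
  have c: "c > 0" "c\<^sup>2 = 4 * pi * v" using v by (simp_all add: c_def)
  define \<rho>' where "\<rho>' = c * \<bar>\<rho>\<bar> / (2 * v)"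
  have \<rho>': "\<rho>' \<ge> 0" using c v by (simp add: \<rho>'_def)
  have "compact (cerf ` cball 0 \<rho>')"
    by (intro compact_continuous_image holomorphic_on_imp_continuous_on holomorphic_intros) auto
  then have "bounded (cerf ` cball 0 \<rho>')" by (rule compact_imp_bounded)
  then obtain K where K: "\<And>z. z \<in> cball 0 \<rho>' \<Longrightarrow> norm (cerf z) \<le> K"
    unfolding bounded_iff by blast
  define C where "C = (3 + 2 * \<rho>') * exp (\<rho>'\<^sup>2) + \<bar>K\<bar>"
  define b where "b = 2 * \<rho>' * c + 2 * pi * \<bar>\<rho>\<bar>"
  have "norm (err_term \<tau> x w w') \<le> C * exp (- (2 * pi * Im \<tau>) * x\<^sup>2 + b * \<bar>x\<bar>)" if w: "norm w \<le> \<rho>" "norm w' \<le> \<rho>" for x w w'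
  proof -
    define \<delta> where "\<delta> = of_real c * ((w - w') / (4 * \<i> * of_real v))"
    have "norm (w - w') \<le> 2 * \<bar>\<rho>\<bar>" using norm_triangle_ineq4[of w w'] w by linarith
    moreover have "norm \<delta> = c / (4 * v) * norm (w - w')"
      using c v by (simp add: \<delta>_def norm_mult norm_divide)
    ultimately have "norm \<delta> \<le> c / (4 * v) * (2 * \<bar>\<rho>\<bar>)"
      using c v by (simp only:) (intro mult_left_mono, auto)
    then have \<delta>: "norm \<delta> \<le> \<rho>'" by (simp add: \<rho>'_def)
    have e: "err_term \<tau> x w w' = exp (theta_exponent \<tau> * (of_real x)\<^sup>2 - 2 * of_real pi * \<i> * of_real x * w)
        * (of_real (sgn x) - cerf (of_real (c * x) + \<delta>))"
      by (simp add: err_term_def \<delta>_def c_def v_def distrib_left)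
    show ?thesis
    proof (cases "x = 0")
      case True
      have "norm (err_term \<tau> x w w') \<le> \<bar>K\<bar>"
        using K[of \<delta>] \<delta> unfolding e by (simp add: True)
      also have "\<dots> \<le> C * exp (- (2 * pi * Im \<tau>) * x\<^sup>2 + b * \<bar>x\<bar>)"
        using True \<rho>' by (simp add: C_def)
      finally show ?thesis .
    next
      case False
      have "x * Im w \<le> \<bar>x\<bar> * \<bar>\<rho>\<bar>"
      proof -
        have "x * Im w \<le> \<bar>x\<bar> * \<bar>Im w\<bar>" by (metis abs_ge_self abs_mult)
        also have "\<dots> \<le> \<bar>x\<bar> * \<bar>\<rho>\<bar>" using w abs_Im_le_cmod[of w] by (intro mult_left_mono) auto
        finally show ?thesis .
      qed
      then have xw: "2 * pi * (x * Im w) \<le> 2 * pi * (\<bar>x\<bar> * \<bar>\<rho>\<bar>)" by (intro mult_left_mono) auto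
      have Re_eq: "Re (theta_exponent \<tau> * (of_real x)\<^sup>2 - 2 * of_real pi * \<i> * of_real x * w) = 2 * pi * v * x\<^sup>2 + 2 * pi * (x * Im w)"
        by (simp add: v_def flip: of_real_power)
      then have 1: "norm (exp (theta_exponent \<tau> * (of_real x)\<^sup>2 - 2 * of_real pi * \<i> * of_real x * w)) \<le> exp (2 * pi * v * x\<^sup>2 + 2 * pi * (\<bar>x\<bar> * \<bar>\<rho>\<bar>))"
        unfolding norm_exp_eq_Re Re_eq using xw by simp
      have 2: "norm (of_real (sgn x) - cerf (of_real (c * x) + \<delta>)) \<le> (3 + 2 * \<rho>') * exp (- c\<^sup>2 * x\<^sup>2 + 2 * \<rho>' * c * \<bar>x\<bar> + \<rho>'\<^sup>2)"
        by (rule norm_sgn_minus_cerf_le[OF False c(1) \<delta>])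
      have "norm (err_term \<tau> x w w') \<le> exp (2 * pi * v * x\<^sup>2 + 2 * pi * (\<bar>x\<bar> * \<bar>\<rho>\<bar>)) * ((3 + 2 * \<rho>') * exp (- c\<^sup>2 * x\<^sup>2 + 2 * \<rho>' * c * \<bar>x\<bar> + \<rho>'\<^sup>2))"
        unfolding e norm_mult by (rule mult_mono[OF 1 2]) auto
      also have "\<dots> = ((3 + 2 * \<rho>') * exp (\<rho>'\<^sup>2)) * exp (- (2 * pi * v) * x\<^sup>2 + b * \<bar>x\<bar>)"
      proof -
        have "(2 * pi * v * x\<^sup>2 + 2 * pi * (\<bar>x\<bar> * \<bar>\<rho>\<bar>)) + (- c\<^sup>2 * x\<^sup>2 + 2 * \<rho>' * c * \<bar>x\<bar> + \<rho>'\<^sup>2)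
          = \<rho>'\<^sup>2 + (- (2 * pi * v) * x\<^sup>2 + b * \<bar>x\<bar>)"
          unfolding c(2) b_def by (simp add: algebra_simps)
        from arg_cong[OF this, of exp] show ?thesis
          unfolding exp_add[of "2 * pi * v * x\<^sup>2 + 2 * pi * (\<bar>x\<bar> * \<bar>\<rho>\<bar>)"] exp_add[of "\<rho>'\<^sup>2"] by (simp only: mult.left_commute mult.assoc)
      qed
      also have "\<dots> \<le> C * exp (- (2 * pi * v) * x\<^sup>2 + b * \<bar>x\<bar>)"
        by (intro mult_right_mono) (auto simp: C_def)
      finally show ?thesis by (simp add: v_def)
    qed
  qed
  moreover have "C \<ge> 0" using \<rho>' by (simp add: C_def)
  ultimately show ?thesis using that by blast
qed

lemma normally_summable_err_term:
  assumes "Im \<tau> > 0" "continuous_on UNIV f" "continuous_on UNIV g"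
  shows "normally_summable_on (\<lambda>(n::int) z. err_term \<tau> (of_int n + h) (f z) (g z)) UNIV UNIV"
  unfolding normally_summable_on_def
proof
  fix z :: complex
  have "compact (f ` cball z 1)" "compact (g ` cball z 1)"
    by (auto intro!: compact_continuous_image intro: continuous_on_subset[OF assms(2)] continuous_on_subset[OF assms(3)])
  then have "bounded (f ` cball z 1)" "bounded (g ` cball z 1)" by (auto intro: compact_imp_bounded)
  then obtain a b where ab: "\<And>w. w \<in> cball z 1 \<Longrightarrow> norm (f w) \<le> a" "\<And>w. w \<in> cball z 1 \<Longrightarrow> norm (g w) \<le> b"
    unfolding bounded_iff by blast
  define \<rho> where "\<rho> = max a b"
  obtain C d where C: "\<And>x w w'. norm w \<le> \<rho> \<Longrightarrow> norm w' \<le> \<rho> \<Longrightarrow>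
    norm (err_term \<tau> x w w') \<le> C * exp (- (2 * pi * Im \<tau>) * x\<^sup>2 + d * \<bar>x\<bar>)" "C \<ge> 0"
    using norm_err_term_le[OF assms(1), of \<rho>] by metis
  have "2 * pi * Im \<tau> > 0" using assms(1) by simp
  from gaussian_majorant[OF this, of h 0 d]
  obtain M where M: "M summable_on (UNIV :: int set)" "\<And>n. exp (- (2 * pi * Im \<tau>) * (of_int n + h)\<^sup>2 + d * \<bar>of_int n + h\<bar>) \<le> (M n :: real)"
    by auto
  have "norm (err_term \<tau> (of_int n + h) (f w) (g w)) \<le> C * M n" if "w \<in> cball z 1" for n :: int and w
  proof -
    have "norm (err_term \<tau> (of_int n + h) (f w) (g w)) \<le> C * exp (- (2 * pi * Im \<tau>) * (of_int n + h)\<^sup>2 + d * \<bar>of_int n + h\<bar>)"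
      using ab[OF that] by (intro C) (auto simp: \<rho>_def)
    also have "\<dots> \<le> C * M n" by (intro mult_left_mono M C)
    finally show ?thesis .
  qed
  then show "\<exists>r>0. \<exists>M. cball z r \<subseteq> UNIV \<and> M summable_on UNIV
      \<and> (\<forall>i\<in>UNIV. \<forall>w\<in>cball z r. norm (err_term \<tau> (of_int i + h) (f w) (g w)) \<le> (M i :: real))"
    using summable_on_cmult_right[OF M(1), of C] by (intro exI[of _ 1] conjI exI[of _ "\<lambda>n. C * M n"]) auto
qed

lemma err_term_abs_summable:
  assumes "Im \<tau> > 0"
  shows "(\<lambda>n::int. norm (err_term \<tau> (of_int n + h) w w')) summable_on UNIV"
  using normally_summable_on_imp_abs_summable[OF normally_summable_err_term[OF assms, of "\<lambda>_. w" "\<lambda>_. w'" h], of 0]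
  by simp

lemma err_theta_has_sum:
  assumes "Im \<tau> > 0"
  shows "((\<lambda>n::int. err_term \<tau> (of_int n + h) w w') has_sum err_theta \<tau> h w w') UNIV"
  unfolding err_theta_def by (rule has_sum_infsum, rule abs_summable_summable, rule err_term_abs_summable[OF assms])

text \<open>The Gaussian that appears when \<open>cerf\<close> is differentiated replaces tau by cnj
  tau and w by w' in the exponent, up to a factor free of x. Hence the w'-derivative of the
  error-function series is a theta series at cnj tau.\<close>

lemma err_term_exponent:
  fixes x :: real and w w' :: complex
  assumes "Im \<tau> > 0"
  shows "theta_exponent \<tau> * (of_real x)\<^sup>2 - 2 * of_real pi * \<i> * of_real x * w
     - (of_real (sqrt (4 * pi * Im \<tau>)) * (of_real x + (w - w') / (4 * \<i> * of_real (Im \<tau>))))\<^sup>2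
    = of_real pi * (w - w')\<^sup>2 / (4 * of_real (Im \<tau>)) + (- (2 * of_real pi * \<i> * cnj \<tau>) * (of_real x)\<^sup>2 + - (2 * of_real pi * \<i> * w') * of_real x)"
proof -
  define v where "v = Im \<tau>"
  have v: "v > 0" using assms by (simp add: v_def)
  define u where "u = Re \<tau>"
  have \<tau>: "\<tau> = of_real u + \<i> * of_real v" "cnj \<tau> = of_real u - \<i> * of_real v"
    by (simp_all add: u_def v_def complex_eq_iff)
  have "(of_real (sqrt (4 * pi * v)) * (of_real x + (w - w') / (4 * \<i> * of_real v)))\<^sup>2
    = of_real (4 * pi * v) * (of_real x + (w - w') / (4 * \<i> * of_real v))\<^sup>2"
    unfolding power_mult_distrib of_real_power[symmetric] using v by simp
  also have "\<dots> = of_real (4 * pi * v) * (of_real x)\<^sup>2 - 2 * of_real pi * \<i> * of_real x * (w - w') - of_real pi * (w - w')\<^sup>2 / (4 * of_real v)"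
  proof -
    define d where "d = (w - w') / (4 * \<i> * of_real v)"
    have vd: "of_real v * d = - \<i> * (w - w') / 4" using v by (simp add: d_def field_simps)
    have "of_real (4 * pi * v) * (of_real x + d)\<^sup>2
      = of_real (4 * pi * v) * (of_real x)\<^sup>2 + 8 * of_real pi * of_real x * (of_real v * d) + 4 * of_real pi * (of_real v * d) * d"
      by (simp add: power2_eq_square algebra_simps)
    also have "4 * of_real pi * (of_real v * d) * d = - of_real pi * (w - w')\<^sup>2 / (4 * of_real v)"
      unfolding vd d_def by (simp add: power2_eq_square mult_ac)
    also have "8 * of_real pi * of_real x * (of_real v * d) = - (2 * of_real pi * \<i> * of_real x * (w - w'))"
      unfolding vd by simp
    finally show ?thesis
      unfolding d_def[symmetric] by simp
  qed
  finally show ?thesis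
    unfolding v_def[symmetric] \<tau> by (simp add: algebra_simps)
qed

text \<open>The first formula feeds the independence of w'. The second is a first-order linear
  differential equation on the slice w' = 0, from which the Taylor coefficients are computed
  recursively.\<close>

lemma
  assumes tau: "Im \<tau> > 0"
  shows err_term_derivative_snd: "((\<lambda>w'. err_term \<tau> x w w') has_field_derivative
      1 / (\<i> * of_real (sqrt (Im \<tau>))) * exp (of_real pi * (w - w')\<^sup>2 / (4 * of_real (Im \<tau>)))
        * gauss_term 0 x (2 * of_real pi * \<i> * cnj \<tau>) (- (2 * of_real pi * \<i> * w'))) (at w')"
    and err_term_derivative_fst: "((\<lambda>w. err_term \<tau> x w 0) has_field_derivative
      - 2 * of_real pi * \<i> * of_real x * err_term \<tau> x w 0
        + \<i> / of_real (sqrt (Im \<tau>)) * cnj (qpow (x\<^sup>2) \<tau>) * exp (of_real pi / (4 * of_real (Im \<tau>)) * w\<^sup>2)) (at w)"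
proof -
  define v where "v = Im \<tau>"
  have v: "v > 0" using tau by (simp add: v_def)
  define c where "c = sqrt (4 * pi * v)"
  define A where "A = (\<lambda>w. theta_exponent \<tau> * (of_real x)\<^sup>2 - 2 * of_real pi * \<i> * of_real x * w)"
  define z where "z = (\<lambda>w w'. of_real c * (of_real x + (w - w') / (4 * \<i> * of_real v)))"
  have c': "of_real (2 / sqrt pi) * (of_real c / (4 * \<i> * of_real v)) = 1 / (\<i> * of_real (sqrt v))"
  proof -
    have "2 / sqrt pi * (c / (4 * v)) = 1 / sqrt v"
      using v by (simp add: c_def real_sqrt_mult field_simps)
    moreover have "of_real (2 / sqrt pi) * (of_real c / (4 * \<i> * of_real v)) = of_real (2 / sqrt pi * (c / (4 * v))) / \<i>"
    proof -
      have "a * (b / (4 * \<i> * V)) = a * (b / (4 * V)) / \<i>" for a b V :: complex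
        by (cases "V = 0") (simp_all add: field_simps)
      then show ?thesis by (simp only: of_real_mult of_real_divide of_real_numeral)
    qed
    ultimately have "of_real (2 / sqrt pi) * (of_real c / (4 * \<i> * of_real v)) = of_real (1 / sqrt v) / \<i>"
      by (simp only:)
    also have "complex_of_real (1 / sqrt v) / \<i> = 1 / (\<i> * of_real (sqrt v))"
      by (simp only: of_real_divide of_real_1 divide_divide_eq_left mult.commute)
    finally show ?thesis .
  qed
  have Az: "exp (A w) * exp (- (z w w')\<^sup>2) = exp (of_real pi * (w - w')\<^sup>2 / (4 * of_real v))
      * exp (- (2 * of_real pi * \<i> * cnj \<tau>) * (of_real x)\<^sup>2 + - (2 * of_real pi * \<i> * w') * of_real x)" for w w'
    using err_term_exponent[OF tau, of x w w'] unfolding exp_add[symmetric] A_def z_def c_def v_def by simp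
  have err: "err_term \<tau> x w w' = exp (A w) * (of_real (sgn x) - cerf (z w w'))" for w w'
    by (simp add: err_term_def A_def z_def c_def v_def)
  have "((\<lambda>w'. err_term \<tau> x w w') has_field_derivative exp (A w) * (0 - of_real (2 / sqrt pi) * exp (- (z w w')\<^sup>2) * - (of_real c / (4 * \<i> * of_real v)))) (at w')"
    unfolding err
    by (intro DERIV_cmult DERIV_diff DERIV_const cerf_derivative) (use v in \<open>auto simp: z_def intro!: derivative_eq_intros\<close>)
  also have "exp (A w) * (0 - of_real (2 / sqrt pi) * exp (- (z w w')\<^sup>2) * - (of_real c / (4 * \<i> * of_real v)))
     = (of_real (2 / sqrt pi) * (of_real c / (4 * \<i> * of_real v))) * (exp (A w) * exp (- (z w w')\<^sup>2))"
    by simp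
  finally show "((\<lambda>w'. err_term \<tau> x w w') has_field_derivative
      1 / (\<i> * of_real (sqrt (Im \<tau>))) * exp (of_real pi * (w - w')\<^sup>2 / (4 * of_real (Im \<tau>)))
        * gauss_term 0 x (2 * of_real pi * \<i> * cnj \<tau>) (- (2 * of_real pi * \<i> * w'))) (at w')"
    unfolding c' Az by (simp add: gauss_term_def v_def mult.assoc)
  have "((\<lambda>w. err_term \<tau> x w 0) has_field_derivative exp (A w) * (- 2 * of_real pi * \<i> * of_real x) * (of_real (sgn x) - cerf (z w 0))
     + (0 - of_real (2 / sqrt pi) * exp (- (z w 0)\<^sup>2) * (of_real c / (4 * \<i> * of_real v))) * exp (A w)) (at w)"
    unfolding err
    by (intro DERIV_mult DERIV_diff DERIV_const cerf_derivative) (use v in \<open>auto simp: z_def A_def intro!: derivative_eq_intros\<close>)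
  also have "exp (A w) * (- 2 * of_real pi * \<i> * of_real x) * (of_real (sgn x) - cerf (z w 0))
     + (0 - of_real (2 / sqrt pi) * exp (- (z w 0)\<^sup>2) * (of_real c / (4 * \<i> * of_real v))) * exp (A w)
     = - 2 * of_real pi * \<i> * of_real x * err_term \<tau> x w 0 - (of_real (2 / sqrt pi) * (of_real c / (4 * \<i> * of_real v))) * (exp (A w) * exp (- (z w 0)\<^sup>2))"
    unfolding err by (simp add: algebra_simps)
  also have "\<dots> = - 2 * of_real pi * \<i> * of_real x * err_term \<tau> x w 0
        + \<i> / of_real (sqrt (Im \<tau>)) * cnj (qpow (x\<^sup>2) \<tau>) * exp (of_real pi / (4 * of_real (Im \<tau>)) * w\<^sup>2)"
  proof -
    have i: "1 / (\<i> * z) = - (\<i> / z)" for z by (simp add: divide_inverse)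
    show ?thesis
      unfolding c' Az i by (simp add: qpow_def exp_cnj v_def mult_ac)
  qed
  finally show "((\<lambda>w. err_term \<tau> x w 0) has_field_derivative
      - 2 * of_real pi * \<i> * of_real x * err_term \<tau> x w 0
        + \<i> / of_real (sqrt (Im \<tau>)) * cnj (qpow (x\<^sup>2) \<tau>) * exp (of_real pi / (4 * of_real (Im \<tau>)) * w\<^sup>2)) (at w)" .
qed

lemma holomorphic_on_err_term:
  assumes "Im \<tau> > 0"
  shows "(\<lambda>w. err_term \<tau> x w 0) holomorphic_on UNIV" "(\<lambda>w'. err_term \<tau> x w w') holomorphic_on UNIV"
  using err_term_derivative_fst[OF assms] err_term_derivative_snd[OF assms]
  by (auto simp: holomorphic_on_open intro!: exI)

lemma holomorphic_on_err_theta: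
  assumes "Im \<tau> > 0"
  shows "(\<lambda>w. err_theta \<tau> h w 0) holomorphic_on UNIV"
  unfolding err_theta_def
  using assms by (intro holomorphic_infsum normally_summable_err_term holomorphic_on_err_term) auto

lemma err_theta_derivative_snd:
  assumes "Im \<tau> > 0"
  shows "((\<lambda>w'. err_theta \<tau> h w w') has_field_derivative
      1 / (\<i> * of_real (sqrt (Im \<tau>))) * exp (of_real pi * (w - w')\<^sup>2 / (4 * of_real (Im \<tau>)))
        * gauss_theta 0 h (2 * of_real pi * \<i> * cnj \<tau>) (- (2 * of_real pi * \<i> * w'))) (at w')"
proof -
  define c where "c = 1 / (\<i> * of_real (sqrt (Im \<tau>))) * exp (of_real pi * (w - w')\<^sup>2 / (4 * of_real (Im \<tau>)))"
  have ns: "normally_summable_on (\<lambda>(n::int) w'. err_term \<tau> (of_int n + h) w w') UNIV UNIV"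
    using assms by (intro normally_summable_err_term) auto
  have hol: "(\<lambda>w'. err_theta \<tau> h w w') holomorphic_on UNIV"
    unfolding err_theta_def by (intro holomorphic_infsum ns holomorphic_on_err_term assms) auto
  have "((\<lambda>n::int. (deriv ^^ 1) (\<lambda>w'. err_term \<tau> (of_int n + h) w w') w') has_sum
      (deriv ^^ 1) (\<lambda>w'. err_theta \<tau> h w w') w') UNIV"
    unfolding err_theta_def by (intro has_sum_higher_deriv[of UNIV] ns holomorphic_on_err_term assms) auto
  moreover have "deriv (\<lambda>w'. err_term \<tau> x w w') w' = c * gauss_term 0 x (2 * of_real pi * \<i> * cnj \<tau>) (- (2 * of_real pi * \<i> * w'))" for x
    unfolding c_def by (rule DERIV_imp_deriv[OF err_term_derivative_snd[OF assms]])
  moreover have "((\<lambda>n::int. c * gauss_term 0 (of_int n + h) (2 * of_real pi * \<i> * cnj \<tau>) (- (2 * of_real pi * \<i> * w'))) has_sum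
      c * gauss_theta 0 h (2 * of_real pi * \<i> * cnj \<tau>) (- (2 * of_real pi * \<i> * w'))) UNIV"
    using assms by (intro has_sum_cmult_right gauss_theta_has_sum) simp
  ultimately have "deriv (\<lambda>w'. err_theta \<tau> h w w') w' = c * gauss_theta 0 h (2 * of_real pi * \<i> * cnj \<tau>) (- (2 * of_real pi * \<i> * w'))"
    using has_sum_unique by fastforce
  then show ?thesis
    using holomorphic_derivI[OF hol, of w'] by (simp add: c_def)
qed

section \<open>Quasi-periods of the error-function series and of the theta series\<close>

lemma err_term_shift_1: "err_term \<tau> x (w + 1) (w' + 1) = exp (- (2 * of_real pi * \<i> * of_real x)) * err_term \<tau> x w w'"
proof -
  have "theta_exponent \<tau> * (of_real x)\<^sup>2 - 2 * of_real pi * \<i> * of_real x * (w + 1)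
    = - (2 * of_real pi * \<i> * of_real x) + (theta_exponent \<tau> * (of_real x)\<^sup>2 - 2 * of_real pi * \<i> * of_real x * w)"
    by (simp add: algebra_simps)
  then show ?thesis unfolding err_term_def by (simp only: exp_add mult.assoc) simp
qed

text \<open>Because tau - cnj tau = 2 i v, the simultaneous shift moves the argument of
  \<open>cerf\<close> as x -> x + 1/2 does. The sign does not follow, and its defect is the explicit
  correction.\<close>

lemma err_term_shift_tau:
  assumes "Im \<tau> > 0"
  shows "err_term \<tau> x (w + \<tau>) (w' + cnj \<tau>) = exp (of_real pi * \<i> * (\<tau> / 2 + w))
    * (err_term \<tau> (x + 1/2) w w' + of_real (sgn x - sgn (x + 1/2))
        * exp (theta_exponent \<tau> * (of_real (x + 1/2))\<^sup>2 - 2 * of_real pi * \<i> * of_real (x + 1/2) * w))"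
proof -
  have \<tau>: "(w + \<tau> - (w' + cnj \<tau>)) / (4 * \<i> * of_real (Im \<tau>)) = 1/2 + (w - w') / (4 * \<i> * of_real (Im \<tau>))"
  proof -
    have "\<tau> - cnj \<tau> = 2 * \<i> * of_real (Im \<tau>)" by (simp add: complex_eq_iff)
    then have q: "w + \<tau> - (w' + cnj \<tau>) = 2 * \<i> * of_real (Im \<tau>) + (w - w')" by (simp add: algebra_simps)
    show ?thesis unfolding q using assms by (simp add: add_divide_distrib)
  qed
  have "theta_exponent \<tau> * (of_real x)\<^sup>2 - 2 * of_real pi * \<i> * of_real x * (w + \<tau>)
    = of_real pi * \<i> * (\<tau> / 2 + w) + (theta_exponent \<tau> * (of_real (x + 1/2))\<^sup>2 - 2 * of_real pi * \<i> * of_real (x + 1/2) * w)"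
    by (simp add: algebra_simps power2_eq_square)
  then have e: "exp (theta_exponent \<tau> * (of_real x)\<^sup>2 - 2 * of_real pi * \<i> * of_real x * (w + \<tau>))
    = exp (of_real pi * \<i> * (\<tau> / 2 + w)) * exp (theta_exponent \<tau> * (of_real (x + 1/2))\<^sup>2 - 2 * of_real pi * \<i> * of_real (x + 1/2) * w)"
    by (simp only: exp_add)
  show ?thesis
    unfolding err_term_def \<tau> e by (simp add: algebra_simps)
qed

lemma exp_coset:
  assumes "h \<in> {0, 1/2}"
  shows "exp (2 * of_real pi * \<i> * of_real (of_int n + h)) = (if h = 0 then 1 else - 1)"
    "exp (- (2 * of_real pi * \<i> * of_real (of_int n + h))) = (if h = 0 then 1 else - 1)"
proof -
  show *: "exp (2 * of_real pi * \<i> * of_real (of_int n + h)) = (if h = 0 then 1 else - 1)"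
  proof (cases "h = 0")
    case True
    then show ?thesis using exp_integer_2pi[of "of_int n"] by (simp add: mult_ac)
  next
    case False
    then have h: "of_int n + h = 1 / 2 + of_int n" using assms by simp
    show ?thesis using False unfolding h exp_half_integer by simp
  qed
  show "exp (- (2 * of_real pi * \<i> * of_real (of_int n + h))) = (if h = 0 then 1 else - 1)"
    unfolding exp_minus * by simp
qed

lemma err_theta_shift_1:
  assumes "h \<in> {0, 1/2}"
  shows "err_theta \<tau> h (w + 1) (w' + 1) = (if h = 0 then 1 else - 1) * err_theta \<tau> h w w'"
  unfolding err_theta_def err_term_shift_1 exp_coset[OF assms] infsum_cmult_right' ..

text \<open>The defect sgn x - sgn (x + 1/2) is nonzero only at x = 0 and at x = - 1/2, one index in
  each coset, and equals - 1 both times. So each series gains a single extra term.\<close>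

lemma err_theta_shift_tau:
  assumes "Im \<tau> > 0"
  shows "err_theta \<tau> 0 (w + \<tau>) (w' + cnj \<tau>) = exp (of_real pi * \<i> * (\<tau> / 2 + w)) * err_theta \<tau> (1/2) w w' - 1"
    and "err_theta \<tau> (1/2) (w + \<tau>) (w' + cnj \<tau>) = exp (of_real pi * \<i> * (\<tau> / 2 + w)) * (err_theta \<tau> 0 w w' - 1)"
proof -
  define c where "c = exp (of_real pi * \<i> * (\<tau> / 2 + w))"
  define g where "g = (\<lambda>x::real. of_real (sgn x - sgn (x + 1/2))
        * exp (theta_exponent \<tau> * (of_real (x + 1/2))\<^sup>2 - 2 * of_real pi * \<i> * of_real (x + 1/2) * w))"
  have main: "err_theta \<tau> h (w + \<tau>) (w' + cnj \<tau>) = c * (err_theta \<tau> (h + 1/2) w w' + G)"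
    if "((\<lambda>n::int. g (of_int n + h)) has_sum G) UNIV" for h G
  proof -
    have "((\<lambda>n::int. c * (err_term \<tau> (of_int n + (h + 1/2)) w w' + g (of_int n + h))) has_sum c * (err_theta \<tau> (h + 1/2) w w' + G)) UNIV"
      by (intro has_sum_cmult_right has_sum_add that err_theta_has_sum assms)
    then show ?thesis
      unfolding err_theta_def[of \<tau> h "w + \<tau>"] err_term_shift_tau[OF assms] g_def c_def
      by (intro infsumI) (simp add: add.assoc)
  qed
  define X where "X = exp (- (of_real pi * \<i> * (\<tau> / 2 + w)))"
  have cinv: "c * X = 1"
    by (simp add: c_def X_def exp_minus)
  have "((\<lambda>n::int. g (of_int n + 0)) has_sum - X) UNIV"
  proof (rule has_sum_finite_neutralI[of "{0}"])
    fix n :: int assume n: "n \<in> UNIV - {0}"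
    then have "n \<ge> 1 \<or> n \<le> - 1" by auto
    then have "real_of_int n > 0 \<and> real_of_int n + 1/2 > 0 \<or> real_of_int n < 0 \<and> real_of_int n + 1/2 < 0"
      by linarith
    then have "sgn (real_of_int n) = sgn (real_of_int n + 1/2)" by (elim disjE conjE) (simp_all only: sgn_pos sgn_neg)
    then show "g (of_int n + 0) = 0" by (simp add: g_def)
  next
    show "- X = (\<Sum>n\<in>{0::int}. g (of_int n + 0))"
    proof -
      have "theta_exponent \<tau> * (of_real (0 + 1/2))\<^sup>2 - 2 * of_real pi * \<i> * of_real (0 + 1/2) * w = - (of_real pi * \<i> * (\<tau> / 2 + w))"
        by (simp add: power2_eq_square algebra_simps)
      then have "g 0 = of_real (sgn 0 - sgn (0 + 1/2)) * X"
        unfolding g_def X_def by (simp only:)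
      then show ?thesis by simp
    qed
  qed auto
  from main[OF this] have "err_theta \<tau> 0 (w + \<tau>) (w' + cnj \<tau>) = c * err_theta \<tau> (1/2) w w' - c * X"
    by (simp add: right_diff_distrib)
  then show "err_theta \<tau> 0 (w + \<tau>) (w' + cnj \<tau>) = exp (of_real pi * \<i> * (\<tau> / 2 + w)) * err_theta \<tau> (1/2) w w' - 1"
    unfolding cinv by (simp only: c_def)
  have "((\<lambda>n::int. g (of_int n + 1/2)) has_sum - 1) UNIV"
  proof (rule has_sum_finite_neutralI[of "{- 1}"])
    fix n :: int assume n: "n \<in> UNIV - {- 1}"
    then have "n \<ge> 0 \<or> n \<le> - 2" by auto
    then have "real_of_int n + 1/2 > 0 \<and> real_of_int n + 1/2 + 1/2 > 0 \<or> real_of_int n + 1/2 < 0 \<and> real_of_int n + 1/2 + 1/2 < 0"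
      by linarith
    then have "sgn (real_of_int n + 1/2) = sgn (real_of_int n + 1/2 + 1/2)" by (elim disjE conjE) (simp_all only: sgn_pos sgn_neg)
    then show "g (of_int n + 1/2) = 0" by (simp add: g_def)
  next
    show "- 1 = (\<Sum>n\<in>{- 1::int}. g (of_int n + 1/2))"
      by (simp add: g_def)
  qed auto
  from main[OF this] have "err_theta \<tau> (1/2) (w + \<tau>) (w' + cnj \<tau>) = c * (err_theta \<tau> 1 w w' - 1)" by simp
  moreover have "err_theta \<tau> 1 w w' = err_theta \<tau> 0 w w'"
    unfolding err_theta_def
    using infsum_reindex_bij_betw[OF bij_plus_right[of "1::int"], of "\<lambda>n. err_term \<tau> (of_int n + 0) w w'"] by simp
  ultimately show "err_theta \<tau> (1/2) (w + \<tau>) (w' + cnj \<tau>) = exp (of_real pi * \<i> * (\<tau> / 2 + w)) * (err_theta \<tau> 0 w w' - 1)"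
    by (simp add: c_def)
qed

lemma gauss_theta_shift_1:
  assumes "h \<in> {0, 1/2}"
  shows "gauss_theta 0 h \<alpha> (2 * of_real pi * \<i> * (w + 1)) = (if h = 0 then 1 else - 1) * gauss_theta 0 h \<alpha> (2 * of_real pi * \<i> * w)"
proof -
  have "gauss_term 0 x \<alpha> (2 * of_real pi * \<i> * (w + 1)) = exp (2 * of_real pi * \<i> * of_real x) * gauss_term 0 x \<alpha> (2 * of_real pi * \<i> * w)" for x
    unfolding gauss_term_def power_0 mult_1 exp_add[symmetric]
    by (rule arg_cong[of _ _ exp]) (simp add: algebra_simps)
  then show ?thesis
    unfolding gauss_theta_def by (simp only: exp_coset[OF assms] infsum_cmult_right')
qed

lemma gauss_theta_shift_tau:
  "gauss_theta 0 h (theta_exponent \<tau>) (2 * of_real pi * \<i> * (w + \<tau>))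
    = exp (- (of_real pi * \<i> * (\<tau> / 2 + w))) * gauss_theta 0 (h + 1/2) (theta_exponent \<tau>) (2 * of_real pi * \<i> * w)"
proof -
  have "gauss_term 0 x (theta_exponent \<tau>) (2 * of_real pi * \<i> * (w + \<tau>))
      = exp (- (of_real pi * \<i> * (\<tau> / 2 + w))) * gauss_term 0 (x + 1/2) (theta_exponent \<tau>) (2 * of_real pi * \<i> * w)" for x
    unfolding gauss_term_def power_0 mult_1 exp_add[symmetric]
    by (rule arg_cong[of _ _ exp]) (simp add: algebra_simps power2_eq_square)
  then show ?thesis
    unfolding gauss_theta_def by (simp only: add.assoc infsum_cmult_right')
qed

subsection \<open>The holomorphic part\<close>

text \<open>For n < 0 the modulus of q^n is at least E = exp (2 pi v0), and the bound valid for n >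
  0 carries over because E + 1 / E >= 2.\<close>

lemma norm_one_minus_qpow_ge:
  assumes "n \<noteq> 0" "Im \<tau> \<ge> v0" "v0 > 0"
  shows "1 - exp (- (2 * pi * v0)) \<le> norm (1 - qpow (of_int n) \<tau>)"
proof (cases "n > 0")
  case True
  have "v0 \<le> real_of_int n * Im \<tau>"
    using True assms mult_mono[of 1 "real_of_int n" v0 "Im \<tau>"] by simp
  then have "norm (qpow (of_int n) \<tau>) \<le> exp (- (2 * pi * v0))"
    by (simp add: norm_qpow mult.assoc)
  moreover have "1 - norm (qpow (of_int n) \<tau>) \<le> norm (1 - qpow (of_int n) \<tau>)"
    using norm_triangle_ineq2[of 1 "qpow (of_int n) \<tau>"] by simp
  ultimately show ?thesis by linarith
next
  case False
  then have n: "real_of_int (- n) \<ge> 1" using assms(1) by simp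
  have "v0 \<le> real_of_int (- n) * Im \<tau>"
    using n assms mult_mono[of 1 "real_of_int (- n)" v0 "Im \<tau>"] by simp
  then have "2 * pi * v0 \<le> - (2 * pi * (real_of_int n * Im \<tau>))"
    using mult_left_mono[OF \<open>v0 \<le> real_of_int (- n) * Im \<tau>\<close>, of "2 * pi"] by simp
  then have "exp (2 * pi * v0) \<le> norm (qpow (of_int n) \<tau>)"
    by (simp add: norm_qpow mult.assoc)
  moreover have "norm (qpow (of_int n) \<tau>) - 1 \<le> norm (1 - qpow (of_int n) \<tau>)"
    using norm_triangle_ineq2[of "qpow (of_int n) \<tau>" 1] by (simp add: norm_minus_commute)
  moreover have "1 - exp (- (2 * pi * v0)) \<le> exp (2 * pi * v0) - 1"
    using exp_ge_add_one_self[of "2 * pi * v0"] exp_ge_add_one_self[of "- (2 * pi * v0)"] by linarith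
  ultimately show ?thesis by linarith
qed

lemma qpow_neq_1:
  assumes "Im \<tau> > 0" "n \<noteq> 0"
  shows "qpow (of_int n) \<tau> \<noteq> 1"
proof
  assume "qpow (of_int n) \<tau> = 1"
  moreover have "exp (- (2 * pi * Im \<tau>)) < 1" using assms by simp
  ultimately show False
    using norm_one_minus_qpow_ge[OF assms(2) order.refl assms(1)] by simp
qed

text \<open>Consequently the conjugate derivative of the completed function comes only from its
  correction terms.\<close>

lemma JJ_holomorphic: "JJ k holomorphic_on upper_half_plane"
proof -
  define f where "f = (\<lambda>(n::int) \<tau>. of_int n ^ (k - 1) * qpow ((of_int n)\<^sup>2) \<tau> / (1 - qpow (of_int n) \<tau>))"
  have "(\<lambda>\<tau>. \<Sum>\<^sub>\<infinity>n\<in>UNIV - {0}. f n \<tau>) holomorphic_on upper_half_plane"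
  proof (rule holomorphic_infsum[OF open_upper_half_plane])
    show "f n holomorphic_on upper_half_plane" if "n \<in> UNIV - {0}" for n
      unfolding f_def using qpow_neq_1[of _ n] that by (auto simp: qpow_def intro!: holomorphic_intros)
    show "normally_summable_on f (UNIV - {0}) upper_half_plane"
    proof (rule normally_summable_onI[OF open_upper_half_plane])
      fix z assume "z \<in> upper_half_plane"
      define v0 where "v0 = Im z / 2"
      have v0: "v0 > 0" using \<open>z \<in> upper_half_plane\<close> by (simp add: v0_def)
      define K where "K = 1 - exp (- (2 * pi * v0))"
      have K: "K > 0" using v0 by (simp add: K_def)
      obtain M where M: "M summable_on (UNIV :: int set)" "\<And>n. \<bar>real_of_int n\<bar> ^ (k - 1) * exp (- (2 * pi * v0) * (real_of_int n)\<^sup>2) \<le> M n"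
        using gaussian_majorant[of "2 * pi * v0" 0 "k - 1" 0] v0 by auto
      have "norm (f n w) \<le> M n / K" if "n \<noteq> 0" "w \<in> cball z v0" for n w
      proof -
        have w: "Im w \<ge> v0"
          using that(2) abs_Im_le_cmod[of "z - w"] by (simp add: v0_def dist_norm)
        have "norm (qpow ((of_int n)\<^sup>2) w) \<le> exp (- (2 * pi * v0) * (of_int n)\<^sup>2)"
          using w by (simp add: norm_qpow mult_ac mult_right_mono)
        then have "\<bar>real_of_int n\<bar> ^ (k - 1) * norm (qpow ((of_int n)\<^sup>2) w) \<le> M n"
          by (intro order.trans[OF mult_left_mono M(2)]) auto
        moreover have "K \<le> norm (1 - qpow (of_int n) w)"
          unfolding K_def by (rule norm_one_minus_qpow_ge[OF that(1) w v0])
        moreover have "norm (f n w) = \<bar>real_of_int n\<bar> ^ (k - 1) * norm (qpow ((of_int n)\<^sup>2) w) / norm (1 - qpow (of_int n) w)"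
          by (simp add: f_def norm_mult norm_divide norm_power)
        moreover have "0 \<le> \<bar>real_of_int n\<bar> ^ (k - 1) * norm (qpow ((of_int n)\<^sup>2) w)" by simp
        ultimately show ?thesis
          using K by (simp only:) (intro frac_le, linarith+)
      qed
      then show "\<exists>r>0. \<exists>M. M summable_on (UNIV - {0})
          \<and> (\<forall>i\<in>UNIV - {0}. \<forall>w\<in>cball z r \<inter> upper_half_plane. norm (f i w) \<le> (M i :: real))"
        using v0 summable_on_subset_banach[OF summable_on_cmult_left[OF M(1), of "1 / K"], of "UNIV - {0}"]
        by (intro exI[of _ v0] conjI exI[of _ "\<lambda>n. M n / K"]) auto
    qed
  qed
  then have "(\<lambda>\<tau>. 1 / 2 * (\<Sum>\<^sub>\<infinity>n\<in>UNIV - {0}. f n \<tau>)) holomorphic_on upper_half_plane"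
    by (intro holomorphic_intros)
  moreover have "JJ k = (\<lambda>\<tau>. 1 / 2 * (\<Sum>\<^sub>\<infinity>n\<in>UNIV - {0}. f n \<tau>))"
    by (rule ext) (simp add: JJ_def f_def)
  ultimately show ?thesis by simp
qed

text \<open>
  An Appell function: its Taylor coefficients of odd order at the origin are the values \<open>JJ k \<tau>\<close>. The
  summand \<open>1 / 2\<close> contributes to the coefficients of even order only.
\<close>

definition appell_term :: "complex \<Rightarrow> complex \<Rightarrow> int \<Rightarrow> complex" where
  "appell_term \<tau> w n = qpow ((of_int n)\<^sup>2) \<tau> * exp (2 * of_real pi * \<i> * of_int n * w) * (1 / (1 - qpow (of_int n) \<tau>) - 1 / 2)"

definition appell :: "complex \<Rightarrow> complex \<Rightarrow> complex" where
  "appell \<tau> w = (\<Sum>\<^sub>\<infinity>n\<in>UNIV - {0}. appell_term \<tau> w n)"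

lemma normally_summable_appell:
  assumes "Im \<tau> > 0"
  shows "normally_summable_on (\<lambda>n w. appell_term \<tau> w n) (UNIV - {0}) UNIV"
proof (rule normally_summable_onI)
  fix z :: complex
  define v where "v = Im \<tau>"
  have v: "v > 0" using assms by (simp add: v_def)
  define \<rho> where "\<rho> = norm z + 1"
  define K where "K = 1 / (1 - exp (- (2 * pi * v))) + 1 / 2"
  have d: "1 - exp (- (2 * pi * v)) > 0" using v by simp
  have K: "K \<ge> 0" using d by (simp add: K_def)
  obtain M where M: "M summable_on (UNIV :: int set)" "\<And>n. exp (- (2 * pi * v) * (real_of_int n)\<^sup>2 + (2 * pi * \<rho>) * \<bar>real_of_int n\<bar>) \<le> M n"
    using gaussian_majorant[of "2 * pi * v" 0 0 "2 * pi * \<rho>"] v by auto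
  have "norm (appell_term \<tau> w n) \<le> M n * K" if "n \<noteq> 0" "w \<in> cball z 1" for n w
  proof -
    have "norm w \<le> \<rho>" using that(2) norm_triangle_ineq4[of z "z - w"] by (simp add: \<rho>_def dist_norm)
    then have "\<bar>Im w\<bar> \<le> \<rho>" using abs_Im_le_cmod[of w] by linarith
    then have "\<bar>real_of_int n\<bar> * \<bar>Im w\<bar> \<le> \<bar>real_of_int n\<bar> * \<rho>" by (intro mult_left_mono) auto
    then have "- (real_of_int n * Im w) \<le> \<bar>real_of_int n\<bar> * \<rho>" by (metis abs_ge_minus_self abs_mult order.trans)
    then have "2 * pi * - (real_of_int n * Im w) \<le> 2 * pi * (\<bar>real_of_int n\<bar> * \<rho>)" by (intro mult_left_mono) auto
    then have "norm (qpow ((of_int n)\<^sup>2) \<tau> * exp (2 * of_real pi * \<i> * of_int n * w)) \<le> exp (- (2 * pi * v) * (real_of_int n)\<^sup>2 + (2 * pi * \<rho>) * \<bar>real_of_int n\<bar>)"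
      unfolding norm_mult norm_qpow norm_exp_eq_Re exp_add[symmetric] by (simp add: v_def algebra_simps)
    also have "\<dots> \<le> M n" by (rule M)
    finally have 1: "norm (qpow ((of_int n)\<^sup>2) \<tau> * exp (2 * of_real pi * \<i> * of_int n * w)) \<le> M n" .
    have "norm (1 / (1 - qpow (of_int n) \<tau>)) \<le> 1 / (1 - exp (- (2 * pi * v)))"
    proof -
      have ge: "1 - exp (- (2 * pi * v)) \<le> norm (1 - qpow (of_int n) \<tau>)"
        using norm_one_minus_qpow_ge[OF that(1), of v \<tau>] v by (simp add: v_def)
      show ?thesis
        unfolding norm_divide norm_one by (intro divide_left_mono[OF ge] mult_pos_pos) (use d ge in linarith)+
    qed
    then have 2: "norm (1 / (1 - qpow (of_int n) \<tau>) - 1 / 2) \<le> K"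
      using norm_triangle_ineq4[of "1 / (1 - qpow (of_int n) \<tau>)" "1 / 2"] by (simp add: K_def)
    show ?thesis
      unfolding appell_term_def norm_mult[of "_ * _"] using 1 2
      by (intro mult_mono order.trans[OF norm_ge_zero 1]) auto
  qed
  then show "\<exists>r>0. \<exists>M. M summable_on (UNIV - {0})
      \<and> (\<forall>i\<in>UNIV - {0}. \<forall>w\<in>cball z r \<inter> UNIV. norm (appell_term \<tau> w i) \<le> (M i :: real))"
    using summable_on_subset_banach[OF summable_on_cmult_left[OF M(1), of K], of "UNIV - {0}"]
    by (intro exI[of _ 1] conjI exI[of _ "\<lambda>n. M n * K"]) auto
qed simp

lemma holomorphic_on_appell_term: "(\<lambda>w. appell_term \<tau> w n) holomorphic_on UNIV"
  unfolding appell_term_def by (intro holomorphic_intros)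

lemma holomorphic_on_appell:
  assumes "Im \<tau> > 0"
  shows "appell \<tau> holomorphic_on UNIV"
  unfolding appell_def[abs_def]
  by (intro holomorphic_infsum normally_summable_appell assms holomorphic_on_appell_term) auto

lemma appell_shift_1: "appell \<tau> (w + 1) = appell \<tau> w"
proof -
  have "exp (2 * of_real pi * \<i> * of_int n * (w + 1)) = exp (2 * of_real pi * \<i> * of_int n * w)" for n :: int
    using exp_integer_2pi[of "of_int n"] by (simp add: distrib_left exp_add mult_ac)
  then show ?thesis by (simp add: appell_def appell_term_def)
qed

text \<open>The shift multiplies the n-th term by q^n, and q^n (1 / (1 - q^n) - 1/2) falls short of
  the bracket itself by (1 + q^n) / 2. Summed up, these corrections are half the theta series at w
  and at w + tau; both lack their term n = 0, which equals 1, and this produces the summand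
  1.\<close>

lemma appell_shift_tau:
  assumes "Im \<tau> > 0"
  shows "appell \<tau> (w + \<tau>) = appell \<tau> w + 1
    - (gauss_theta 0 0 (theta_exponent \<tau>) (2 * of_real pi * \<i> * w) + gauss_theta 0 0 (theta_exponent \<tau>) (2 * of_real pi * \<i> * (w + \<tau>))) / 2"
proof -
  have summ: "(\<lambda>n. appell_term \<tau> w n) summable_on UNIV - {0}" for w
    using normally_summable_on_imp_abs_summable[OF normally_summable_appell[OF assms], of w]
    by (rule abs_summable_summable) simp
  have th: "((\<lambda>n::int. gauss_term 0 (of_int n) (theta_exponent \<tau>) (2 * of_real pi * \<i> * w)) has_sum
      gauss_theta 0 0 (theta_exponent \<tau>) (2 * of_real pi * \<i> * w) - 1) (UNIV - {0})" for w
  proof -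
    have "((\<lambda>n::int. gauss_term 0 (of_int n + 0) (theta_exponent \<tau>) (2 * of_real pi * \<i> * w)) has_sum
        gauss_theta 0 0 (theta_exponent \<tau>) (2 * of_real pi * \<i> * w)) UNIV"
      using assms by (intro gauss_theta_has_sum) simp
    from has_sum_Diff[OF this has_sum_finite[of "{0}"]] show ?thesis
      by (simp add: gauss_term_def)
  qed
  have trm: "appell_term \<tau> (w + \<tau>) n = appell_term \<tau> w n
      + (- 1 / 2) * (gauss_term 0 (of_int n) (theta_exponent \<tau>) (2 * of_real pi * \<i> * w)
         + gauss_term 0 (of_int n) (theta_exponent \<tau>) (2 * of_real pi * \<i> * (w + \<tau>)))" if "n \<in> UNIV - {0}" for n :: int
  proof -
    define Q where "Q = qpow (of_int n) \<tau>"
    define A where "A = gauss_term 0 (of_int n) (theta_exponent \<tau>) (2 * of_real pi * \<i> * w)"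
    have Q: "1 - Q \<noteq> 0" using qpow_neq_1[OF assms, of n] that by (simp add: Q_def)
    have A': "gauss_term 0 (of_int n) (theta_exponent \<tau>) (2 * of_real pi * \<i> * (w + \<tau>)) = A * Q"
      unfolding A_def Q_def gauss_term_def qpow_def power_0 mult_1 exp_add[symmetric]
      by (rule arg_cong[of _ _ exp]) (simp add: algebra_simps)
    have "appell_term \<tau> z n = gauss_term 0 (of_int n) (theta_exponent \<tau>) (2 * of_real pi * \<i> * z) * (1 / (1 - Q) - 1 / 2)" for z
      unfolding appell_term_def gauss_term_def qpow_def Q_def power_0 mult_1 exp_add[symmetric]
      by (simp add: mult_ac)
    then show ?thesis
      using Q by (simp add: A' A_def[symmetric]) (simp add: field_simps)
  qed
  have "((\<lambda>n. appell_term \<tau> w n + (- 1 / 2) * (gauss_term 0 (of_int n) (theta_exponent \<tau>) (2 * of_real pi * \<i> * w)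
         + gauss_term 0 (of_int n) (theta_exponent \<tau>) (2 * of_real pi * \<i> * (w + \<tau>)))) has_sum
      appell \<tau> w + (- 1 / 2) * ((gauss_theta 0 0 (theta_exponent \<tau>) (2 * of_real pi * \<i> * w) - 1)
         + (gauss_theta 0 0 (theta_exponent \<tau>) (2 * of_real pi * \<i> * (w + \<tau>)) - 1))) (UNIV - {0})"
    unfolding appell_def by (intro has_sum_add has_sum_cmult_right th has_sum_infsum summ)
  moreover have "appell \<tau> (w + \<tau>) = (\<Sum>\<^sub>\<infinity>n\<in>UNIV - {0}. appell_term \<tau> w n
      + (- 1 / 2) * (gauss_term 0 (of_int n) (theta_exponent \<tau>) (2 * of_real pi * \<i> * w)
         + gauss_term 0 (of_int n) (theta_exponent \<tau>) (2 * of_real pi * \<i> * (w + \<tau>))))"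
    unfolding appell_def by (intro infsum_cong trm)
  ultimately have "appell \<tau> (w + \<tau>) = appell \<tau> w + (- 1 / 2) * ((gauss_theta 0 0 (theta_exponent \<tau>) (2 * of_real pi * \<i> * w) - 1)
         + (gauss_theta 0 0 (theta_exponent \<tau>) (2 * of_real pi * \<i> * (w + \<tau>)) - 1))"
    using infsumI by fastforce
  then show ?thesis by (simp add: field_simps)
qed

lemma higher_deriv_appell:
  assumes "Im \<tau> > 0" "odd N"
  shows "(deriv ^^ N) (appell \<tau>) 0 = 2 * (2 * of_real pi * \<i>) ^ N * JJ (N + 1) \<tau>"
proof -
  define c where "c = 2 * of_real pi * \<i>"
  have d: "(deriv ^^ N) (\<lambda>w. appell_term \<tau> w n) 0 = c ^ N * (of_int n ^ N * qpow ((of_int n)\<^sup>2) \<tau> * (1 / (1 - qpow (of_int n) \<tau>) - 1 / 2))" for n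
  proof -
    have "(\<lambda>w. appell_term \<tau> w n) = (\<lambda>w. (qpow ((of_int n)\<^sup>2) \<tau> * (1 / (1 - qpow (of_int n) \<tau>) - 1 / 2)) * exp (0 + (c * of_int n) * w))"
      by (simp add: appell_term_def c_def mult_ac)
    moreover have "(deriv ^^ N) (\<lambda>w. (qpow ((of_int n)\<^sup>2) \<tau> * (1 / (1 - qpow (of_int n) \<tau>) - 1 / 2)) * exp (0 + (c * of_int n) * w)) 0
      = (qpow ((of_int n)\<^sup>2) \<tau> * (1 / (1 - qpow (of_int n) \<tau>) - 1 / 2)) * (deriv ^^ N) (\<lambda>w. exp (0 + (c * of_int n) * w)) 0"
      by (rule higher_deriv_cmult[of _ UNIV]) (auto intro!: holomorphic_intros)
    ultimately show ?thesis
      unfolding higher_deriv_exp_linear by (simp add: power_mult_distrib mult_ac)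
  qed
  have 1: "((\<lambda>n. c ^ N * (of_int n ^ N * qpow ((of_int n)\<^sup>2) \<tau> * (1 / (1 - qpow (of_int n) \<tau>) - 1 / 2))) has_sum (deriv ^^ N) (appell \<tau>) 0) (UNIV - {0})"
    unfolding d[symmetric] appell_def[abs_def]
    by (intro has_sum_higher_deriv[of UNIV] normally_summable_appell holomorphic_on_appell_term assms) auto
  have 2: "((\<lambda>n::int. of_int n ^ N * qpow ((of_int n)\<^sup>2) \<tau>) has_sum 0) (UNIV - {0})"
  proof -
    have "((\<lambda>n::int. gauss_term N (of_int n + 0) (theta_exponent \<tau>) 0) has_sum gauss_theta N 0 (theta_exponent \<tau>) 0) UNIV"
      using assms by (intro gauss_theta_has_sum) simp
    moreover have "gauss_theta N 0 (theta_exponent \<tau>) 0 = 0"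
      using gauss_theta_minus[of 0 N "theta_exponent \<tau>" 0] assms(2) by simp
    moreover have "N > 0" using assms(2) odd_pos by blast
    ultimately have "((\<lambda>n::int. of_int n ^ N * qpow ((of_int n)\<^sup>2) \<tau>) has_sum 0) UNIV"
      by (simp add: gauss_term_def qpow_def mult_ac)
    from has_sum_Diff[OF this has_sum_finite[of "{0}"]] show ?thesis
      using \<open>N > 0\<close> by (simp add: zero_power)
  qed
  from has_sum_add[OF has_sum_cmult_right[OF 1, of "1 / c ^ N"] has_sum_cmult_right[OF 2, of "1 / 2"]]
  have "((\<lambda>n. of_int n ^ N * qpow ((of_int n)\<^sup>2) \<tau> / (1 - qpow (of_int n) \<tau>)) has_sum (deriv ^^ N) (appell \<tau>) 0 / c ^ N) (UNIV - {0})"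
    by (simp add: c_def algebra_simps)
  then have "JJ (N + 1) \<tau> = 1 / 2 * ((deriv ^^ N) (appell \<tau>) 0 / c ^ N)"
    unfolding JJ_def by (simp add: infsumI)
  then show ?thesis by (simp add: c_def field_simps)
qed


subsection \<open>Doubly periodic entire functions\<close>

lemma periodic_int:
  fixes f :: "complex \<Rightarrow> complex"
  assumes "\<And>w. f (w + c) = f w"
  shows "f (w + of_int n * c) = f w"
proof (induction n rule: int_induct[where k = 0])
  case (step1 i)
  then show ?case using assms[of "w + of_int i * c"] by (simp add: algebra_simps)
next
  case (step2 i)
  then show ?case using assms[of "w + of_int (i - 1) * c"] by (simp add: algebra_simps)
qed simp

text \<open>All values are taken on the compact image of the unit square under (a, b) -> a + b
  tau.\<close>

lemma entire_doubly_periodic_constant: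
  assumes hol: "f holomorphic_on UNIV" and tau: "Im \<tau> > 0"
    and per: "\<And>w. f (w + 1) = f w" "\<And>w. f (w + \<tau>) = f w"
  shows "f constant_on UNIV"
proof -
  define g where "g = (\<lambda>p::real \<times> real. of_real (fst p) + of_real (snd p) * \<tau>)"
  have "compact (f ` g ` ({0..1} \<times> {0..1}))"
    unfolding g_def using hol
    by (intro compact_continuous_image compact_Times continuous_intros)
      (auto intro: continuous_on_subset holomorphic_on_imp_continuous_on)
  then have "bounded (f ` g ` ({0..1} \<times> {0..1}))" by (rule compact_imp_bounded)
  moreover have "range f \<subseteq> f ` g ` ({0..1} \<times> {0..1})"
  proof safe
    fix w
    define b where "b = Im w / Im \<tau>"
    define a where "a = Re w - b * Re \<tau>"
    have w: "w = of_real a + of_real b * \<tau>"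
      using tau by (simp add: complex_eq_iff a_def b_def)
    have "f w = f (g (a - of_int \<lfloor>a\<rfloor>, b - of_int \<lfloor>b\<rfloor>))"
      using periodic_int[of f \<tau>, OF per(2), of "g (a - of_int \<lfloor>a\<rfloor>, b - of_int \<lfloor>b\<rfloor>)" "\<lfloor>b\<rfloor>"]
        periodic_int[of f 1, OF per(1), of "g (a - of_int \<lfloor>a\<rfloor>, b - of_int \<lfloor>b\<rfloor>) + of_int \<lfloor>b\<rfloor> * \<tau>" "\<lfloor>a\<rfloor>"]
      unfolding w by (simp add: g_def algebra_simps)
    moreover have "a - of_int \<lfloor>a\<rfloor> \<in> {0..1}" "b - of_int \<lfloor>b\<rfloor> \<in> {0..1}"
      by (simp_all; linarith)+
    ultimately show "f w \<in> f ` g ` ({0..1} \<times> {0..1})" by blast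
  qed
  ultimately have "bounded (range f)" by (rule bounded_subset)
  from Liouville_theorem[OF hol this] show ?thesis .
qed

subsection \<open>The lattice sum\<close>

text \<open>Division by lambda makes this a primitive in w': its derivative is pi / v times the
  Gaussian lattice sum without the origin.\<close>

definition lattice_sum :: "complex \<Rightarrow> complex \<Rightarrow> complex \<Rightarrow> complex" where
  "lattice_sum \<tau> w w' = (\<Sum>\<^sub>\<infinity>p\<in>UNIV - {(0, 0)}. lattice_term \<tau> w w' p / lattice_point \<tau> p)"

lemma normally_summable_lattice_term:
  assumes tau: "Im \<tau> > 0" and "continuous_on UNIV f" "continuous_on UNIV g"
    and c: "\<And>p. p \<noteq> (0, 0) \<Longrightarrow> norm (c p) \<le> K"
  shows "normally_summable_on (\<lambda>p z. lattice_term \<tau> (f z) (g z) p * c p) (UNIV - {(0, 0)}) UNIV"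
  unfolding normally_summable_on_def
proof
  fix z :: complex
  have "compact (f ` cball z 1)" "compact (g ` cball z 1)"
    by (auto intro!: compact_continuous_image intro: continuous_on_subset[OF assms(2)] continuous_on_subset[OF assms(3)])
  then have "bounded (f ` cball z 1)" "bounded (g ` cball z 1)" by (auto intro: compact_imp_bounded)
  then obtain a b where ab: "\<And>w. w \<in> cball z 1 \<Longrightarrow> norm (f w) \<le> a" "\<And>w. w \<in> cball z 1 \<Longrightarrow> norm (g w) \<le> b"
    unfolding bounded_iff by blast
  obtain M where M: "M summable_on (UNIV :: (int \<times> int) set)"
    "\<And>p. exp (- (pi / Im \<tau>) * (norm (lattice_point \<tau> p))\<^sup>2 + pi / Im \<tau> * (a + b) * norm (lattice_point \<tau> p)) \<le> (M p :: real)"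
    using lattice_majorant[OF tau, of 0 "pi / Im \<tau> * (a + b)"] by auto
  have "norm (lattice_term \<tau> (f w) (g w) p * c p) \<le> M p * K" if p: "p \<noteq> (0, 0)" and w: "w \<in> cball z 1" for p w
  proof -
    have "norm (lattice_term \<tau> (f w) (g w) p) \<le> M p"
      using norm_lattice_term_le[OF tau add_mono[OF ab(1)[OF w] ab(2)[OF w]]] M(2) by (rule order.trans)
    then show ?thesis
      unfolding norm_mult using c[OF p] by (intro mult_mono) (auto intro: order.trans[OF norm_ge_zero])
  qed
  then show "\<exists>r>0. \<exists>M. cball z r \<subseteq> UNIV \<and> M summable_on (UNIV - {(0, 0)})
      \<and> (\<forall>i\<in>UNIV - {(0, 0)}. \<forall>w\<in>cball z r. norm (lattice_term \<tau> (f w) (g w) i * c i) \<le> (M i :: real))"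
    using summable_on_subset_banach[OF summable_on_cmult_left[OF M(1), of K], of "UNIV - {(0, 0)}"]
    by (intro exI[of _ 1] conjI exI[of _ "\<lambda>p. M p * K"]) auto
qed

lemma normally_summable_lattice_sum:
  assumes tau: "Im \<tau> > 0" and "continuous_on UNIV f" "continuous_on UNIV g"
  shows "normally_summable_on (\<lambda>p z. lattice_term \<tau> (f z) (g z) p / lattice_point \<tau> p) (UNIV - {(0, 0)}) UNIV"
proof -
  obtain K where K: "\<And>p. p \<noteq> (0, 0) \<Longrightarrow> 1 / norm (lattice_point \<tau> p) \<le> K"
    using norm_lattice_point_lower_bound[OF tau] by metis
  then have "norm (1 / lattice_point \<tau> p) \<le> K" if "p \<noteq> (0, 0)" for p
    using that by (simp add: norm_divide)
  from normally_summable_lattice_term[OF assms this] show ?thesis by simp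
qed

text \<open>The invariance is termwise: lambda - cnj lambda = 2 i v m for lambda = m tau + n, so the
  exponent changes by 2 pi i m. Under the shift by (tau, cnj tau) it changes by - 2 pi i n in the
  same way.\<close>

lemma lattice_term_shift_1: 
  assumes "Im \<tau> > 0"
  shows "lattice_term \<tau> (w + 1) (w' + 1) p = lattice_term \<tau> w w' p"
proof -
  define l where "l = lattice_point \<tau> p"
  have "l - cnj l = 2 * \<i> * of_real (Im \<tau>) * of_int (fst p)"
    by (simp add: l_def lattice_point_def complex_eq_iff)
  then have e: "of_real (pi / Im \<tau>) * (l - cnj l) = 2 * of_int (fst p) * of_real pi * \<i>"
    using assms by simp
  have "of_real (pi / Im \<tau>) * (l * (w' + 1) - cnj l * (w + 1) - l * cnj l)
    = of_real (pi / Im \<tau>) * (l * w' - cnj l * w - l * cnj l) + of_real (pi / Im \<tau>) * (l - cnj l)"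
    by (simp add: algebra_simps del: of_real_divide)
  then show ?thesis
    unfolding lattice_term_def l_def[symmetric] e using exp_integer_2pi[of "of_int (fst p)"]
    by (simp add: exp_add del: of_real_divide)
qed

lemma lattice_term_shift_tau:
  assumes "Im \<tau> > 0"
  shows "lattice_term \<tau> (w + \<tau>) (w' + cnj \<tau>) p = lattice_term \<tau> w w' p"
proof -
  define l where "l = lattice_point \<tau> p"
  have "l * cnj \<tau> - cnj l * \<tau> = 2 * \<i> * of_real (Im \<tau>) * of_int (- snd p)"
    by (simp add: l_def lattice_point_def complex_eq_iff algebra_simps)
  then have e: "of_real (pi / Im \<tau>) * (l * cnj \<tau> - cnj l * \<tau>) = 2 * of_int (- snd p) * of_real pi * \<i>"
    using assms by simp
  have "of_real (pi / Im \<tau>) * (l * (w' + cnj \<tau>) - cnj l * (w + \<tau>) - l * cnj l)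
    = of_real (pi / Im \<tau>) * (l * w' - cnj l * w - l * cnj l) + of_real (pi / Im \<tau>) * (l * cnj \<tau> - cnj l * \<tau>)"
    by (simp add: algebra_simps del: of_real_divide)
  then show ?thesis
    unfolding lattice_term_def l_def[symmetric] e using exp_integer_2pi[of "of_int (- snd p)"]
    by (simp add: exp_add del: of_real_divide of_int_minus)
qed

lemma
  assumes tau: "Im \<tau> > 0"
  shows lattice_sum_derivative_snd: "((\<lambda>w'. lattice_sum \<tau> w w') has_field_derivative
      of_real (pi / Im \<tau>) * ((\<Sum>\<^sub>\<infinity>p. lattice_term \<tau> w w' p) - 1)) (at w')"
    and holomorphic_on_lattice_sum: "(\<lambda>w. lattice_sum \<tau> w 0) holomorphic_on UNIV"
    and higher_deriv_lattice_sum: "(deriv ^^ N) (\<lambda>w. lattice_sum \<tau> w 0) 0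
      = (\<Sum>\<^sub>\<infinity>p\<in>UNIV - {(0, 0)}. (- of_real (pi / Im \<tau>) * cnj (lattice_point \<tau> p)) ^ N * lattice_term \<tau> 0 0 p / lattice_point \<tau> p)"
proof -
  have nz: "lattice_point \<tau> p \<noteq> 0" if "p \<noteq> (0, 0)" for p
    using norm_lattice_point_lower_bound[OF tau] that by metis
  have ns: "normally_summable_on (\<lambda>p w'. lattice_term \<tau> w w' p / lattice_point \<tau> p) (UNIV - {(0, 0)}) UNIV"
    "normally_summable_on (\<lambda>p w. lattice_term \<tau> w 0 p / lattice_point \<tau> p) (UNIV - {(0, 0)}) UNIV"
    using tau by (auto intro!: normally_summable_lattice_sum)
  have hol: "(\<lambda>w'. lattice_term \<tau> w w' p / lattice_point \<tau> p) holomorphic_on UNIV"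
    "(\<lambda>w. lattice_term \<tau> w 0 p / lattice_point \<tau> p) holomorphic_on UNIV" if "p \<in> UNIV - {(0, 0)}" for p
    using nz[of p] that unfolding lattice_term_def by (auto intro!: holomorphic_intros)
  have hs: "(\<lambda>w'. lattice_sum \<tau> w w') holomorphic_on UNIV"
    unfolding lattice_sum_def by (intro holomorphic_infsum ns hol) auto
  show "(\<lambda>w. lattice_sum \<tau> w 0) holomorphic_on UNIV"
    unfolding lattice_sum_def by (intro holomorphic_infsum ns hol) auto
  have "((\<lambda>p. (deriv ^^ 1) (\<lambda>w'. lattice_term \<tau> w w' p / lattice_point \<tau> p) w') has_sum (deriv ^^ 1) (\<lambda>w'. lattice_sum \<tau> w w') w') (UNIV - {(0, 0)})"
    unfolding lattice_sum_def by (intro has_sum_higher_deriv[of UNIV] ns hol) auto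
  moreover have "(deriv ^^ 1) (\<lambda>w'. lattice_term \<tau> w w' p / lattice_point \<tau> p) w' = of_real (pi / Im \<tau>) * lattice_term \<tau> w w' p"
    if "p \<in> UNIV - {(0, 0)}" for p
  proof -
    define l where "l = lattice_point \<tau> p"
    have l: "l \<noteq> 0" using nz that by (simp add: l_def)
    have "((\<lambda>w'. lattice_term \<tau> w w' p / l) has_field_derivative (lattice_term \<tau> w w' p * (of_real (pi / Im \<tau>) * l)) / l) (at w')"
      unfolding lattice_term_def l_def[symmetric] by (intro DERIV_cdivide) (use tau in \<open>auto intro!: derivative_eq_intros\<close>)
    then show ?thesis unfolding l_def[symmetric] using l by (simp add: DERIV_imp_deriv mult_ac)
  qed
  ultimately have "((\<lambda>p. of_real (pi / Im \<tau>) * lattice_term \<tau> w w' p) has_sum deriv (\<lambda>w'. lattice_sum \<tau> w w') w') (UNIV - {(0, 0)})"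
    by (subst (asm) has_sum_cong) auto
  \<comment> \<open>The omitted term at the origin has the value 1 for all w and w', hence the -
    1.\<close>
  moreover have "((\<lambda>p. of_real (pi / Im \<tau>) * lattice_term \<tau> w w' p) has_sum of_real (pi / Im \<tau>) * ((\<Sum>\<^sub>\<infinity>p. lattice_term \<tau> w w' p) - 1)) (UNIV - {(0, 0)})"
  proof (rule has_sum_cmult_right)
    have "normally_summable_on (\<lambda>p z. lattice_term \<tau> w w' p * 1) (UNIV - {(0, 0)}) UNIV"
      by (rule normally_summable_lattice_term[OF tau, of _ _ _ 1]) auto
    from normally_summable_on_imp_abs_summable[OF this, of 0]
    have "(\<lambda>p. norm (lattice_term \<tau> w w' p)) summable_on (UNIV - {(0, 0)})"
      by simp
    then have "lattice_term \<tau> w w' summable_on (UNIV - {(0, 0)})"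
      by (rule abs_summable_summable)
    then have "lattice_term \<tau> w w' summable_on insert (0, 0) (UNIV - {(0, 0)})"
      by (subst summable_on_insert_iff)
    then have "(lattice_term \<tau> w w' has_sum (\<Sum>\<^sub>\<infinity>p. lattice_term \<tau> w w' p)) UNIV"
      by (intro has_sum_infsum) (simp add: insert_UNIV)
    from has_sum_Diff[OF this has_sum_finite[of "{(0, 0)}"]]
    show "(lattice_term \<tau> w w' has_sum (\<Sum>\<^sub>\<infinity>p. lattice_term \<tau> w w' p) - 1) (UNIV - {(0, 0)})"
      by (simp add: lattice_term_def lattice_point_def)
  qed
  ultimately have "deriv (\<lambda>w'. lattice_sum \<tau> w w') w' = of_real (pi / Im \<tau>) * ((\<Sum>\<^sub>\<infinity>p. lattice_term \<tau> w w' p) - 1)"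
    by (rule has_sum_unique)
  then show "((\<lambda>w'. lattice_sum \<tau> w w') has_field_derivative
      of_real (pi / Im \<tau>) * ((\<Sum>\<^sub>\<infinity>p. lattice_term \<tau> w w' p) - 1)) (at w')"
    using holomorphic_derivI[OF hs, of w'] by simp
  have "((\<lambda>p. (deriv ^^ N) (\<lambda>w. lattice_term \<tau> w 0 p / lattice_point \<tau> p) 0) has_sum (deriv ^^ N) (\<lambda>w. lattice_sum \<tau> w 0) 0) (UNIV - {(0, 0)})"
    unfolding lattice_sum_def by (intro has_sum_higher_deriv[of UNIV] ns hol) auto
  moreover have "(deriv ^^ N) (\<lambda>w. lattice_term \<tau> w 0 p / lattice_point \<tau> p) 0
     = (- of_real (pi / Im \<tau>) * cnj (lattice_point \<tau> p)) ^ N * lattice_term \<tau> 0 0 p / lattice_point \<tau> p" for p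
  proof -
    define l where "l = lattice_point \<tau> p"
    define a where "a = - of_real (pi / Im \<tau>) * (l * cnj l)"
    define b where "b = - of_real (pi / Im \<tau>) * cnj l"
    have "(\<lambda>w. lattice_term \<tau> w 0 p / l) = (\<lambda>w. (1 / l) * exp (a + b * w))"
      by (simp add: lattice_term_def l_def[symmetric] a_def b_def algebra_simps del: of_real_divide)
    moreover have "(deriv ^^ N) (\<lambda>w. (1 / l) * exp (a + b * w)) 0 = (1 / l) * (deriv ^^ N) (\<lambda>w. exp (a + b * w)) 0"
      by (rule higher_deriv_cmult[of _ UNIV]) (auto intro!: holomorphic_intros)
    moreover have "exp a = lattice_term \<tau> 0 0 p"
      by (simp add: a_def lattice_term_def l_def)
    ultimately show ?thesis
      unfolding higher_deriv_exp_linear l_def[symmetric] b_def[symmetric] by simp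
  qed
  ultimately show "(deriv ^^ N) (\<lambda>w. lattice_sum \<tau> w 0) 0
      = (\<Sum>\<^sub>\<infinity>p\<in>UNIV - {(0, 0)}. (- of_real (pi / Im \<tau>) * cnj (lattice_point \<tau> p)) ^ N * lattice_term \<tau> 0 0 p / lattice_point \<tau> p)"
    by (simp add: infsumI)
qed

subsection \<open>The completed Appell function as a lattice sum\<close>

text \<open>The shift by tau exchanges the two cosets, so the sum over both is taken in order to
  have simple quasi-periods.\<close>

definition theta_err_product :: "complex \<Rightarrow> complex \<Rightarrow> complex \<Rightarrow> complex" where
  "theta_err_product \<tau> w w' = (\<Sum>h\<in>{0, 1/2}. gauss_theta 0 h (theta_exponent \<tau>) (2 * of_real pi * \<i> * w) * err_theta \<tau> h w w')"

text \<open>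
  On the slice \<open>w' = cnj w\<close> the difference of the two completions is doubly periodic in \<open>w\<close>; as
  it does not depend on \<open>w'\<close>, it is an entire elliptic function, hence constant.
\<close>

definition completion_diff :: "complex \<Rightarrow> complex \<Rightarrow> complex \<Rightarrow> complex" where
  "completion_diff \<tau> w w' = appell \<tau> w - theta_err_product \<tau> w w' / 2
    + (of_real (Im \<tau> / pi) * lattice_sum \<tau> w w' + w' - w) / (2 * \<i> * of_real (Im \<tau>))"

text \<open>Let S be the full Gaussian lattice sum. The w'-derivative of the theta product
  contributes - S / (2 i v), that of the lattice sum (S - 1) / (2 i v), and the linear term supplies
  the missing 1 / (2 i v).\<close>

lemma completion_diff_snd:
  assumes tau: "Im \<tau> > 0"
  shows "completion_diff \<tau> w w' = completion_diff \<tau> w w''"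
proof -
  define v where "v = Im \<tau>"
  have v: "v > 0" using tau by (simp add: v_def)
  have "((\<lambda>w'. completion_diff \<tau> w w') has_field_derivative 0) (at w' within UNIV)" for w'
  proof -
    define S where "S = (\<Sum>\<^sub>\<infinity>p. lattice_term \<tau> w w' p)"
    define E where "E = exp (of_real pi * (w - w')\<^sup>2 / (4 * of_real (Im \<tau>)))"
    have d0: "((\<lambda>w'. theta_err_product \<tau> w w') has_field_derivative
        (\<Sum>h\<in>{0, 1/2}. gauss_theta 0 h (theta_exponent \<tau>) (2 * of_real pi * \<i> * w)
          * (1 / (\<i> * of_real (sqrt (Im \<tau>))) * E * gauss_theta 0 h (2 * of_real pi * \<i> * cnj \<tau>) (- (2 * of_real pi * \<i> * w'))))) (at w')"
      unfolding theta_err_product_def E_def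
      by (intro DERIV_sum DERIV_cmult err_theta_derivative_snd tau)
    have "(\<Sum>h\<in>{0, 1/2}. gauss_theta 0 h (theta_exponent \<tau>) (2 * of_real pi * \<i> * w)
          * (1 / (\<i> * of_real (sqrt (Im \<tau>))) * E * gauss_theta 0 h (2 * of_real pi * \<i> * cnj \<tau>) (- (2 * of_real pi * \<i> * w'))))
        = 1 / (\<i> * of_real (sqrt v)) * (E * (\<Sum>h\<in>{0, 1/2}. gauss_theta 0 h (theta_exponent \<tau>) (2 * of_real pi * \<i> * w)
           * gauss_theta 0 h (2 * of_real pi * \<i> * cnj \<tau>) (- (2 * of_real pi * \<i> * w'))))"
      unfolding sum_distrib_left v_def by (intro sum.cong) (auto simp: mult_ac)
    also have "\<dots> = 1 / (\<i> * of_real (sqrt v)) * (S / of_real (sqrt v))"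
      unfolding E_def S_def theta_product_eq_lattice_sum[OF tau] v_def ..
    also have "\<dots> = S / (\<i> * of_real v)"
    proof -
      have "complex_of_real (sqrt v) * of_real (sqrt v) = of_real v" using v by (simp flip: of_real_mult)
      then show ?thesis by (simp add: mult.assoc)
    qed
    finally have d1: "((\<lambda>w'. theta_err_product \<tau> w w') has_field_derivative S / (\<i> * of_real v)) (at w')"
      using d0 by (simp only:)
    have d2: "((\<lambda>w'. lattice_sum \<tau> w w') has_field_derivative of_real (pi / v) * (S - 1)) (at w')"
      using lattice_sum_derivative_snd[OF tau] by (simp add: S_def v_def)
    have "((\<lambda>w'. appell \<tau> w - theta_err_product \<tau> w w' / 2
      + (of_real (v / pi) * lattice_sum \<tau> w w' + w' - w) / (2 * \<i> * of_real v)) has_field_derivative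
        0 - S / (\<i> * of_real v) / 2 + (of_real (v / pi) * (of_real (pi / v) * (S - 1)) + 1 - 0) / (2 * \<i> * of_real v)) (at w')"
      by (intro DERIV_add DERIV_diff DERIV_cdivide DERIV_cmult d1 d2 DERIV_const DERIV_ident)
    moreover have "0 - S / (\<i> * of_real v) / 2 + (of_real (v / pi) * (of_real (pi / v) * (S - 1)) + 1 - 0) / (2 * \<i> * of_real v) = 0"
      using v by (simp add: field_simps)
    ultimately show ?thesis by (simp add: completion_diff_def v_def)
  qed
  from has_field_derivative_zero_constant[OF convex_UNIV this]
  obtain c where "\<And>w'. completion_diff \<tau> w w' = c" by auto
  then show ?thesis by simp
qed

lemma theta_err_product_shift_1: "theta_err_product \<tau> (w + 1) (w' + 1) = theta_err_product \<tau> w w'"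
  by (simp add: theta_err_product_def gauss_theta_shift_1 err_theta_shift_1)

text \<open>The exponential factors of the theta and error-function series cancel. The sign defects
  leave behind the theta series at w and at w + tau, precisely twice the corrections in
  \<open>appell_shift_tau\<close>.\<close>

lemma theta_err_product_shift_tau:
  assumes "Im \<tau> > 0"
  shows "theta_err_product \<tau> (w + \<tau>) (w' + cnj \<tau>) = theta_err_product \<tau> w w'
    - (gauss_theta 0 0 (theta_exponent \<tau>) (2 * of_real pi * \<i> * w) + gauss_theta 0 0 (theta_exponent \<tau>) (2 * of_real pi * \<i> * (w + \<tau>)))"
proof -
  define c where "c = exp (of_real pi * \<i> * (\<tau> / 2 + w))"
  define t0 where "t0 = gauss_theta 0 0 (theta_exponent \<tau>) (2 * of_real pi * \<i> * w)"
  define t1 where "t1 = gauss_theta 0 (1/2) (theta_exponent \<tau>) (2 * of_real pi * \<i> * w)"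
  have c: "c \<noteq> 0" by (simp add: c_def)
  have g0: "gauss_theta 0 0 (theta_exponent \<tau>) (2 * of_real pi * \<i> * (w + \<tau>)) = t1 / c"
    unfolding gauss_theta_shift_tau t1_def c_def exp_minus by (simp add: field_simps)
  have "gauss_theta 0 1 \<alpha> \<beta> = gauss_theta 0 0 \<alpha> \<beta>" for \<alpha> \<beta>
    using gauss_theta_add_int[of 0 0 1] by simp
  then have g1: "gauss_theta 0 (1/2) (theta_exponent \<tau>) (2 * of_real pi * \<i> * (w + \<tau>)) = t0 / c"
    unfolding gauss_theta_shift_tau t0_def c_def exp_minus by (simp add: field_simps)
  show ?thesis
    using c unfolding theta_err_product_def
    by (simp add: g0 g1 err_theta_shift_tau[OF assms] c_def[symmetric] t0_def[symmetric] t1_def[symmetric])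
      (simp add: field_simps)
qed

text \<open>Independence of w' lets the second argument be moved from 0 to 1 or to cnj tau, where
  the simultaneous shift formulas apply. In the second case cnj tau - tau = - 2 i v turns the linear
  term into - 1, which cancels the + 1 of the Appell function.\<close>

lemma completion_diff_periodic:
  assumes tau: "Im \<tau> > 0"
  shows "completion_diff \<tau> (w + 1) 0 = completion_diff \<tau> w 0"
    and "completion_diff \<tau> (w + \<tau>) 0 = completion_diff \<tau> w 0"
proof -
  have "completion_diff \<tau> (w + 1) 0 = completion_diff \<tau> (w + 1) (0 + 1)"
    by (rule completion_diff_snd[OF tau])
  also have "lattice_sum \<tau> (w + 1) (0 + 1) = lattice_sum \<tau> w 0"
    unfolding lattice_sum_def lattice_term_shift_1[OF tau] ..
  then have "completion_diff \<tau> (w + 1) (0 + 1) = completion_diff \<tau> w 0"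
    unfolding completion_diff_def theta_err_product_shift_1 by (simp add: appell_shift_1)
  finally show "completion_diff \<tau> (w + 1) 0 = completion_diff \<tau> w 0" .
  have \<tau>: "cnj \<tau> = \<tau> - 2 * \<i> * of_real (Im \<tau>)" by (simp add: complex_eq_iff)
  have V: "complex_of_real (Im \<tau>) \<noteq> 0" using tau by simp
  have "completion_diff \<tau> (w + \<tau>) 0 = completion_diff \<tau> (w + \<tau>) (0 + cnj \<tau>)"
    by (rule completion_diff_snd[OF tau])
  also have l: "lattice_sum \<tau> (w + \<tau>) (0 + cnj \<tau>) = lattice_sum \<tau> w 0"
    unfolding lattice_sum_def lattice_term_shift_tau[OF tau] ..
  have "(of_real (Im \<tau> / pi) * lattice_sum \<tau> w 0 + (0 + cnj \<tau>) - (w + \<tau>)) / (2 * \<i> * of_real (Im \<tau>))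
    = (of_real (Im \<tau> / pi) * lattice_sum \<tau> w 0 + 0 - w) / (2 * \<i> * of_real (Im \<tau>)) - 1"
    unfolding \<tau> using V by (simp add: field_simps)
  then have "completion_diff \<tau> (w + \<tau>) (0 + cnj \<tau>) = completion_diff \<tau> w 0"
    unfolding completion_diff_def theta_err_product_shift_tau[OF tau] l appell_shift_tau[OF tau]
    by (simp only:) (simp add: field_simps)
  finally show "completion_diff \<tau> (w + \<tau>) 0 = completion_diff \<tau> w 0" .
qed

lemma holomorphic_on_gauss_theta_exponential:
  assumes "Im \<tau> > 0"
  shows "(\<lambda>w. gauss_theta N h (theta_exponent \<tau>) (c * w)) holomorphic_on UNIV"
  using assms by (intro holomorphic_on_gauss_theta holomorphic_intros) auto

lemma holomorphic_on_theta_err_product: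
  assumes "Im \<tau> > 0"
  shows "(\<lambda>w. theta_err_product \<tau> w 0) holomorphic_on UNIV"
  unfolding theta_err_product_def
  by (intro holomorphic_on_sum holomorphic_on_mult holomorphic_on_gauss_theta_exponential holomorphic_on_err_theta assms)

lemma higher_deriv_add_cmult:
  fixes f g :: "complex \<Rightarrow> complex"
  assumes "f holomorphic_on UNIV" "g holomorphic_on UNIV"
  shows "(deriv ^^ n) (\<lambda>w. f w + c * g w) z = (deriv ^^ n) f z + c * (deriv ^^ n) g z"
proof -
  have "(deriv ^^ n) (\<lambda>w. f w + c * g w) z = (deriv ^^ n) f z + (deriv ^^ n) (\<lambda>w. c * g w) z"
    by (rule higher_deriv_add[of _ UNIV]) (use assms in \<open>auto intro!: holomorphic_intros\<close>)
  also have "(deriv ^^ n) (\<lambda>w. c * g w) z = c * (deriv ^^ n) g z"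
    by (rule higher_deriv_cmult[of _ UNIV]) (use assms in auto)
  finally show ?thesis .
qed

text \<open>Constancy on the slice w' = 0, read off in the derivative of order N at the origin; the
  linear term survives only for N = 1.\<close>

lemma completion_diff_higher_deriv:
  assumes tau: "Im \<tau> > 0" and N: "N > 0"
  shows "(deriv ^^ N) (appell \<tau>) 0 - (deriv ^^ N) (\<lambda>w. theta_err_product \<tau> w 0) 0 / 2
     + (of_real (Im \<tau> / pi) * (deriv ^^ N) (\<lambda>w. lattice_sum \<tau> w 0) 0 - of_bool (N = 1)) / (2 * \<i> * of_real (Im \<tau>)) = 0"
proof -
  define b where "b = 1 / (2 * \<i> * of_real (Im \<tau>))"
  define a where "a = of_real (Im \<tau> / pi) * b"
  have K: "(\<lambda>w. completion_diff \<tau> w 0) = (\<lambda>w. ((appell \<tau> w + (- 1 / 2) * theta_err_product \<tau> w 0) + a * lattice_sum \<tau> w 0) + (- b) * w)"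
    by (rule ext) (simp add: completion_diff_def a_def b_def add_divide_distrib diff_divide_distrib)
  have hols: "appell \<tau> holomorphic_on UNIV" "(\<lambda>w. theta_err_product \<tau> w 0) holomorphic_on UNIV"
    "(\<lambda>w. lattice_sum \<tau> w 0) holomorphic_on UNIV" "(\<lambda>w::complex. w) holomorphic_on UNIV"
    by (intro holomorphic_on_appell holomorphic_on_theta_err_product holomorphic_on_lattice_sum tau holomorphic_intros)+
  have hol: "(\<lambda>w. completion_diff \<tau> w 0) holomorphic_on UNIV"
    unfolding K by (intro holomorphic_intros hols)
  obtain c where c: "(\<lambda>w. completion_diff \<tau> w 0) = (\<lambda>w. c)"
    using entire_doubly_periodic_constant[OF hol tau completion_diff_periodic[OF tau]]
    unfolding constant_on_def by auto
  have "(deriv ^^ N) (\<lambda>w. completion_diff \<tau> w 0) 0 = 0"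
    unfolding c using N by (simp add: higher_deriv_const)
  moreover have "(deriv ^^ N) (\<lambda>w. completion_diff \<tau> w 0) 0
    = (((deriv ^^ N) (appell \<tau>) 0 + (- 1 / 2) * (deriv ^^ N) (\<lambda>w. theta_err_product \<tau> w 0) 0)
       + a * (deriv ^^ N) (\<lambda>w. lattice_sum \<tau> w 0) 0) + (- b) * (deriv ^^ N) (\<lambda>w. w) 0"
    unfolding K by (subst higher_deriv_add_cmult, (intro holomorphic_intros hols)+)+ (rule refl)
  moreover have "(deriv ^^ N) (\<lambda>w::complex. w) 0 = of_bool (N = 1)"
    using N by (simp add: higher_deriv_ident)
  ultimately have "((deriv ^^ N) (appell \<tau>) 0 + (- 1 / 2) * (deriv ^^ N) (\<lambda>w. theta_err_product \<tau> w 0) 0)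
       + a * (deriv ^^ N) (\<lambda>w. lattice_sum \<tau> w 0) 0 + (- b) * of_bool (N = 1) = 0"
    by (simp only:)
  moreover have "P + (- 1 / 2) * T + a * L + (- b) * d = P - T / 2 + (of_real (Im \<tau> / pi) * L - d) / (2 * \<i> * of_real (Im \<tau>))" for P T L d
    by (simp add: a_def b_def diff_divide_distrib)
  ultimately show ?thesis by (simp only:)
qed

subsection \<open>Taylor coefficients\<close>

lemma higher_deriv_ident_mult:
  fixes g :: "complex \<Rightarrow> complex"
  assumes "g holomorphic_on UNIV"
  shows "(deriv ^^ n) (\<lambda>z. z * g z) 0 = of_nat n * (deriv ^^ (n - 1)) g 0"
proof -
  have "(deriv ^^ n) (\<lambda>z. z * g z) 0
     = (\<Sum>i=0..n. of_nat (n choose i) * (deriv ^^ i) (\<lambda>z. z) 0 * (deriv ^^ (n - i)) g 0)"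
    by (rule higher_deriv_mult[of _ UNIV]) (use assms in \<open>auto intro: holomorphic_intros\<close>)
  also have "\<dots> = (\<Sum>i=0..n. if i = 1 then of_nat n * (deriv ^^ (n - 1)) g 0 else 0)"
    by (intro sum.cong) (auto simp: higher_deriv_ident)
  also have "\<dots> = of_nat n * (deriv ^^ (n - 1)) g 0"
    by (cases n) auto
  finally show ?thesis .
qed

text \<open>The differential equation f' = 2 c z f links the derivatives of order n and n - 2 at
  0.\<close>

lemma higher_deriv_exp_square:
  "(deriv ^^ n) (\<lambda>z::complex. exp (c * z\<^sup>2)) 0 = (if even n then fact n / fact (n div 2) * c ^ (n div 2) else 0)"
proof (induction n rule: less_induct)
  case (less n)
  show ?case
  proof (cases "n = 0")
    case False
    then obtain m where n: "n = Suc m" by (cases n) auto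
    have hol: "(\<lambda>z. 2 * c * exp (c * z\<^sup>2)) holomorphic_on UNIV" by (intro holomorphic_intros)
    have "deriv (\<lambda>z. exp (c * z\<^sup>2)) = (\<lambda>z. z * (2 * c * exp (c * z\<^sup>2)))"
      by (rule ext, rule DERIV_imp_deriv) (auto intro!: derivative_eq_intros)
    then have "(deriv ^^ n) (\<lambda>z. exp (c * z\<^sup>2)) 0 = of_nat m * (deriv ^^ (m - 1)) (\<lambda>z. 2 * c * exp (c * z\<^sup>2)) 0"
      unfolding n funpow_Suc_right o_apply using higher_deriv_ident_mult[OF hol] by simp
    also have "(deriv ^^ (m - 1)) (\<lambda>z. 2 * c * exp (c * z\<^sup>2)) 0 = 2 * c * (deriv ^^ (m - 1)) (\<lambda>z. exp (c * z\<^sup>2)) 0"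
      by (rule higher_deriv_cmult[of _ UNIV]) (auto intro!: holomorphic_intros)
    finally have rec: "(deriv ^^ n) (\<lambda>z. exp (c * z\<^sup>2)) 0 = of_nat m * (2 * c * (deriv ^^ (m - 1)) (\<lambda>z. exp (c * z\<^sup>2)) 0)" .
    show ?thesis
    proof (cases m)
      case 0
      then show ?thesis using rec n by simp
    next
      case (Suc l)
      have IH: "(deriv ^^ l) (\<lambda>z. exp (c * z\<^sup>2)) 0 = (if even l then fact l / fact (l div 2) * c ^ (l div 2) else 0)"
        by (rule less.IH) (simp add: n Suc)
      show ?thesis
      proof (cases "even l")
        case True
        then obtain r where r: "l = 2 * r" by (elim evenE)
        have "fact (2 * r + 2) / fact (r + 1) = (2 * of_nat (Suc r) * (of_nat (2 * r + 1) * fact (2 * r))) / (of_nat (Suc r) * fact r :: complex)"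
          by (simp add: algebra_simps)
        also have "\<dots> = 2 * of_nat (2 * r + 1) * (fact (2 * r) / fact r)"
          using of_nat_neq_0[of r, where 'a = complex] by (simp del: of_nat_Suc)
        finally have "fact (2 * r + 2) / fact (r + 1) * c ^ (r + 1) = of_nat (2 * r + 1) * (2 * c * (fact (2 * r) / fact r * c ^ r))"
          by (simp only: power_add power_one_right mult_ac)
        moreover have "n = 2 * r + 2" "n div 2 = r + 1" "m = 2 * r + 1" "m - 1 = l" by (simp_all add: n Suc r)
        ultimately show ?thesis
          using rec IH r by (simp only:) simp
      next
        case False
        then show ?thesis using rec IH by (simp add: n Suc)
      qed
    qed
  qed simp
qed

text \<open>By the differential equation in \<open>err_term_derivative_fst\<close>, two further
  derivatives multiply by (- 2 pi i x)^2 and add an even Taylor coefficient of exp (pi w^2 / (4 v)).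
  Up to powers of 4 pi^2 this is the recursion of \<open>s_term\<close>.\<close>

lemma higher_deriv_err_term:
  assumes tau: "Im \<tau> > 0"
  shows "(deriv ^^ (2 * s + 1)) (\<lambda>w. err_term \<tau> x w 0) 0 = \<i> * of_real ((4 * pi\<^sup>2) ^ s) * s_term s x \<tau>"
proof -
  define v where "v = Im \<tau>"
  have v: "v > 0" using tau by (simp add: v_def)
  define f where "f = (\<lambda>w. err_term \<tau> x w 0)"
  define c where "c = complex_of_real pi / (4 * of_real v)"
  define Q where "Q = cnj (qpow (x\<^sup>2) \<tau>)"
  define a where "a = - 2 * of_real pi * \<i> * of_real x"
  define b where "b = \<i> / of_real (sqrt v) * Q"
  have df: "deriv f = (\<lambda>w. a * f w + b * exp (c * w\<^sup>2))"
    unfolding f_def a_def b_def c_def Q_def v_def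
    by (rule ext, rule DERIV_imp_deriv, rule err_term_derivative_fst[OF tau])
  have hol: "f holomorphic_on UNIV" "(\<lambda>w. exp (c * w\<^sup>2)) holomorphic_on UNIV"
    unfolding f_def by (intro holomorphic_on_err_term tau holomorphic_intros)+
  have rec: "(deriv ^^ Suc n) f 0 = a * (deriv ^^ n) f 0 + b * (deriv ^^ n) (\<lambda>w. exp (c * w\<^sup>2)) 0" for n
    unfolding funpow_Suc_right o_apply df
    using hol by (subst higher_deriv_add[of _ UNIV] higher_deriv_cmult[of _ UNIV]; (intro holomorphic_intros)?; simp?)+
  have a2: "a * a = - (of_real (4 * pi\<^sup>2) * of_real (x\<^sup>2))"
    by (simp add: a_def power2_eq_square)
  have "(deriv ^^ (2 * s + 1)) f 0 = \<i> * of_real ((4 * pi\<^sup>2) ^ s) * s_term s x \<tau>"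
  proof (induction s)
    case 0
    have "(deriv ^^ Suc 0) f 0 = a * f 0 + b"
      using rec[of 0] by simp
    also have "f 0 = qpow (- (x\<^sup>2)) \<tau> * of_real (sgn x - rerf (sqrt (4 * pi * v) * x))"
    proof -
      have "cerf (of_real (sqrt (4 * pi * v)) * of_real x) = of_real (rerf (sqrt (4 * pi * v) * x))"
        using cerf_of_real[of "sqrt (4 * pi * v) * x"] by simp
      then show ?thesis by (simp add: f_def err_term_def v_def qpow_def mult_ac)
    qed
    also have "a * (qpow (- (x\<^sup>2)) \<tau> * of_real (sgn x - rerf (sqrt (4 * pi * v) * x))) + b
       = \<i> * (of_real (s_coeff v x) * qpow (- (x\<^sup>2)) \<tau>)"
    proof -
      have Q: "Q = qpow (- (x\<^sup>2)) \<tau> * of_real (exp (- (4 * pi * x\<^sup>2 * v)))"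
        using qpow_minus_mult_exp[of "x\<^sup>2" \<tau>] by (simp add: Q_def v_def exp_of_real[symmetric])
      have rerf_minus: "rerf (- t) = - rerf t" for t
        by (simp add: rerf_def)
      have "\<bar>x\<bar> * (1 - rerf (sqrt (4 * pi * v) * \<bar>x\<bar>)) = x * (sgn x - rerf (sqrt (4 * pi * v) * x))"
        by (cases "x = 0"; cases "x > 0") (auto simp: rerf_minus algebra_simps)
      then have s: "s_coeff v x = exp (- (4 * pi * x\<^sup>2 * v)) / sqrt v - 2 * pi * (x * (sgn x - rerf (sqrt (4 * pi * v) * x)))"
        unfolding s_coeff_eq[OF v] by (simp add: mult.assoc)
      show ?thesis
        unfolding s b_def Q a_def by (simp add: algebra_simps)
    qed
    finally show ?case by (simp add: v_def)
  next
    case (Suc s)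
    have odd0: "(deriv ^^ (2 * s + 1)) (\<lambda>w. exp (c * w\<^sup>2)) 0 = 0"
      unfolding higher_deriv_exp_square by simp
    have ev: "(deriv ^^ (2 * s + 2)) (\<lambda>w. exp (c * w\<^sup>2)) 0 = of_real (fact (2 * s + 2) / fact (s + 1) * (pi / (4 * v)) ^ (s + 1))"
      unfolding higher_deriv_exp_square c_def by simp
    have "(deriv ^^ (2 * Suc s + 1)) f 0 = a * (a * (deriv ^^ (2 * s + 1)) f 0) + b * (deriv ^^ (2 * s + 2)) (\<lambda>w. exp (c * w\<^sup>2)) 0"
      using rec[of "2 * s + 2"] rec[of "2 * s + 1"] odd0 by simp
    also have "\<dots> = (a * a) * (\<i> * of_real ((4 * pi\<^sup>2) ^ s) * s_term s x \<tau>)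
        + b * of_real (fact (2 * s + 2) / fact (s + 1) * (pi / (4 * v)) ^ (s + 1))"
      unfolding Suc.IH ev by simp
    also have "fact (2 * s + 2) / fact (s + 1) * (pi / (4 * v)) ^ (s + 1) = (4 * pi\<^sup>2) ^ (s + 1) * (s_const s / v ^ (s + 1))"
    proof -
      have "pi / (4 * v) = (4 * pi\<^sup>2) / (16 * pi * v)" by (simp add: power2_eq_square)
      then have "(pi / (4 * v)) ^ (s + 1) = (4 * pi\<^sup>2) ^ (s + 1) / ((16 * pi) ^ (s + 1) * v ^ (s + 1))"
        by (simp only: power_divide power_mult_distrib)
      moreover have "F / G * (P / (X * V)) = P * (F / (G * X) / V)" for F G P X V :: real
        by (simp add: mult_ac)
      ultimately show ?thesis by (simp only: s_const_def)
    qed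
    also have "(a * a) * (\<i> * of_real ((4 * pi\<^sup>2) ^ s) * s_term s x \<tau>) + b * of_real ((4 * pi\<^sup>2) ^ (s + 1) * (s_const s / v ^ (s + 1)))
       = \<i> * of_real ((4 * pi\<^sup>2) ^ Suc s) * s_term (Suc s) x \<tau>"
      unfolding a2 b_def s_term.simps v_def[symmetric] Q_def[symmetric]
      by (simp add: algebra_simps)
    finally show ?case .
  qed
  then show ?thesis by (simp add: f_def)
qed

lemma higher_deriv_err_theta:
  assumes tau: "Im \<tau> > 0"
  shows "(deriv ^^ (2 * s + 1)) (\<lambda>w. err_theta \<tau> h w 0) 0
    = \<i> * of_real ((4 * pi\<^sup>2) ^ s) * (\<Sum>\<^sub>\<infinity>n::int. s_term s (of_int n + h) \<tau>)"
proof -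
  have "((\<lambda>n::int. (deriv ^^ (2 * s + 1)) (\<lambda>w. err_term \<tau> (of_int n + h) w 0) 0) has_sum
      (deriv ^^ (2 * s + 1)) (\<lambda>w. err_theta \<tau> h w 0) 0) UNIV"
    unfolding err_theta_def
    by (intro has_sum_higher_deriv[of UNIV] normally_summable_err_term holomorphic_on_err_term tau) auto
  from infsumI[OF this] show ?thesis
    unfolding higher_deriv_err_term[OF tau] infsum_cmult_right' by simp
qed

lemma sum_even_only:
  fixes f :: "nat \<Rightarrow> 'a :: comm_monoid_add"
  assumes "\<And>i. odd i \<Longrightarrow> f i = 0"
  shows "(\<Sum>i=0..2 * m. f i) = (\<Sum>j=0..m. f (2 * j))" "(\<Sum>i=0..2 * m + 1. f i) = (\<Sum>j=0..m. f (2 * j))"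
proof -
  show *: "(\<Sum>i=0..2 * m. f i) = (\<Sum>j=0..m. f (2 * j))"
    by (induction m) (simp_all add: assms)
  show "(\<Sum>i=0..2 * m + 1. f i) = (\<Sum>j=0..m. f (2 * j))"
    using * by (simp add: assms)
qed

lemma gauss_theta_odd_zero: "h \<in> {0, 1/2} \<Longrightarrow> odd N \<Longrightarrow> gauss_theta N h \<alpha> 0 = 0"
  using gauss_theta_minus[of h N \<alpha> 0] by simp

text \<open>In the Leibniz rule of odd order 2 m + 1 the odd derivatives of the even theta factor
  vanish at 0. Its even derivatives are iterates of \<open>D_op\<close> on \<open>theta_nu\<close>,
  and the complementary odd derivatives of the error-function series are iterates of
  \<open>D_op\<close> on \<open>s_nu\<close>.\<close>

lemma higher_deriv_theta_err_product:
  assumes tau: "Im \<tau> > 0"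
  shows "(deriv ^^ (2 * m + 1)) (\<lambda>w. theta_err_product \<tau> w 0) 0
    = - \<i> * of_real ((4 * pi\<^sup>2) ^ m) * (\<Sum>\<nu>\<in>{- 1, 0}. \<Sum>j=0..m. (- 1) ^ j * of_nat ((2 * m + 1) choose (2 * j))
        * (D_op ^^ j) (theta_nu \<nu>) \<tau> * (D_op ^^ (m - j)) (s_nu \<nu>) \<tau>)"
proof -
  define A where "A = (\<lambda>h w. gauss_theta 0 h (theta_exponent \<tau>) (2 * of_real pi * \<i> * w))"
  define B where "B = (\<lambda>h w. err_theta \<tau> h w 0)"
  define N where "N = 2 * m + 1"
  have hol: "A h holomorphic_on UNIV" "B h holomorphic_on UNIV" for h
    unfolding A_def B_def by (intro holomorphic_on_gauss_theta_exponential holomorphic_on_err_theta tau)+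
  have Re: "Re (theta_exponent \<tau>) > 0" using tau by simp
  have main: "(deriv ^^ N) (\<lambda>w. A h w * B h w) 0 = - \<i> * of_real ((4 * pi\<^sup>2) ^ m) * (\<Sum>j=0..m. (- 1) ^ j * of_nat (N choose (2 * j))
        * (D_op ^^ j) (theta_nu \<nu>) \<tau> * (D_op ^^ (m - j)) (s_nu \<nu>) \<tau>)" if h: "h = coset_shift \<nu>" "\<nu> \<in> {- 1, 0}" for h \<nu>
  proof -
    have h': "h \<in> {0, 1/2}" using h by (auto simp: coset_shift_def)
    have A0: "(deriv ^^ i) (A h) 0 = (2 * of_real pi * \<i>) ^ i * gauss_theta i h (theta_exponent \<tau>) 0" for i
      unfolding A_def using higher_deriv_gauss_theta[OF Re, of i 0 h "2 * of_real pi * \<i>" 0] by simp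
    have "(deriv ^^ N) (\<lambda>w. A h w * B h w) 0 = (\<Sum>i=0..N. of_nat (N choose i) * (deriv ^^ i) (A h) 0 * (deriv ^^ (N - i)) (B h) 0)"
      by (rule higher_deriv_mult[of _ UNIV]) (auto intro: hol)
    also have "\<dots> = (\<Sum>j=0..m. of_nat (N choose (2 * j)) * (deriv ^^ (2 * j)) (A h) 0 * (deriv ^^ (N - 2 * j)) (B h) 0)"
      unfolding N_def by (rule sum_even_only(2)) (simp add: A0 gauss_theta_odd_zero[OF h'])
    also have "\<dots> = (\<Sum>j=0..m. - \<i> * of_real ((4 * pi\<^sup>2) ^ m) * ((- 1) ^ j * of_nat (N choose (2 * j))
        * (D_op ^^ j) (theta_nu \<nu>) \<tau> * (D_op ^^ (m - j)) (s_nu \<nu>) \<tau>))"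
    proof (rule sum.cong)
      fix j assume "j \<in> {0..m}"
      then have j: "j \<le> m" by simp
      then have Nj: "N - 2 * j = 2 * (m - j) + 1" by (simp add: N_def)
      have p: "(2 * of_real pi * \<i>) ^ (2 * j) = (- 1) ^ j * complex_of_real ((4 * pi\<^sup>2) ^ j)"
      proof -
        have "(2 * of_real pi * \<i>)\<^sup>2 = - complex_of_real (4 * pi\<^sup>2)" by (simp add: power_mult_distrib)
        then have "(2 * of_real pi * \<i>) ^ (2 * j) = (- complex_of_real (4 * pi\<^sup>2)) ^ j" unfolding power_mult by (simp only:)
        also have "\<dots> = (- 1) ^ j * complex_of_real (4 * pi\<^sup>2) ^ j" by (rule power_minus)
        finally show ?thesis by (simp only: of_real_power)
      qed
      have q: "complex_of_real ((4 * pi\<^sup>2) ^ m) = of_real ((4 * pi\<^sup>2) ^ j) * of_real ((4 * pi\<^sup>2) ^ (m - j))"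
        unfolding of_real_mult[symmetric] power_add[symmetric] using j by simp
      have th: "gauss_theta (2 * j) h (theta_exponent \<tau>) 0 = - (D_op ^^ j) (theta_nu \<nu>) \<tau>"
        using D_op_iterate_theta_nu(1)[OF tau] h by simp
      have sn: "(\<Sum>\<^sub>\<infinity>n::int. s_term (m - j) (of_int n + h) \<tau>) = (D_op ^^ (m - j)) (s_nu \<nu>) \<tau>"
        using D_op_iterate_s_nu[OF tau] h by simp
      show "of_nat (N choose (2 * j)) * (deriv ^^ (2 * j)) (A h) 0 * (deriv ^^ (N - 2 * j)) (B h) 0
        = - \<i> * of_real ((4 * pi\<^sup>2) ^ m) * ((- 1) ^ j * of_nat (N choose (2 * j))
          * (D_op ^^ j) (theta_nu \<nu>) \<tau> * (D_op ^^ (m - j)) (s_nu \<nu>) \<tau>)"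
        unfolding A0 Nj B_def higher_deriv_err_theta[OF tau] p q th sn by (simp add: mult_ac)
    qed simp
    finally show ?thesis by (simp only: sum_distrib_left)
  qed
  have "(\<lambda>w. theta_err_product \<tau> w 0) = (\<lambda>w. A 0 w * B 0 w + A (1/2) w * B (1/2) w)"
    by (simp add: theta_err_product_def A_def B_def)
  moreover have "(deriv ^^ N) (\<lambda>w. A 0 w * B 0 w + A (1/2) w * B (1/2) w) 0
      = (deriv ^^ N) (\<lambda>w. A 0 w * B 0 w) 0 + (deriv ^^ N) (\<lambda>w. A (1/2) w * B (1/2) w) 0"
    by (rule higher_deriv_add[of _ UNIV]) (auto intro!: holomorphic_intros hol)
  moreover have c: "0 = coset_shift (- 1)" "1/2 = coset_shift 0" by (simp_all add: coset_shift_def)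
  have "(deriv ^^ N) (\<lambda>w. A 0 w * B 0 w) 0 + (deriv ^^ N) (\<lambda>w. A (1/2) w * B (1/2) w) 0
    = - \<i> * of_real ((4 * pi\<^sup>2) ^ m) * (\<Sum>\<nu>\<in>{- 1, 0}. \<Sum>j=0..m. (- 1) ^ j * of_nat (N choose (2 * j))
        * (D_op ^^ j) (theta_nu \<nu>) \<tau> * (D_op ^^ (m - j)) (s_nu \<nu>) \<tau>)"
    unfolding main[OF c(1), simplified] main[OF c(2), simplified] by (simp add: distrib_left)
  ultimately show ?thesis unfolding N_def by (simp only:)
qed

subsection \<open>Rankin--Cohen brackets\<close>

lemma pos_notin_nonpos_Ints: "x > 0 \<Longrightarrow> x \<notin> \<int>\<^sub>\<le>\<^sub>0" for x :: real
  using nonpos_Ints_nonpos[of x] by auto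

lemma Gamma_of_nat_plus_half: "Gamma (real j + 1 / 2) = sqrt pi * fact (2 * j) / (4 ^ j * fact j)"
proof (induction j)
  case (Suc j)
  have "real j + 1 / 2 \<notin> \<int>\<^sub>\<le>\<^sub>0"
    by (rule pos_notin_nonpos_Ints) simp
  from Gamma_plus1[OF this] have "Gamma (real (Suc j) + 1 / 2) = (real j + 1 / 2) * Gamma (real j + 1 / 2)"
    by (simp add: algebra_simps)
  also have "\<dots> = (real j + 1 / 2) * (sqrt pi * fact (2 * j) / (4 ^ j * fact j))" unfolding Suc.IH ..
  also have "\<dots> = sqrt pi * ((2 * real j + 2) * ((2 * real j + 1) * fact (2 * j))) / (4 ^ Suc j * ((real j + 1) * fact j))"
  proof -
    have "(t - 1 / 2) * (p * F / (q * f)) = p * (2 * t * ((2 * t - 1) * F)) / (4 * q * (t * f))"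
      if "t \<noteq> 0" "q \<noteq> 0" "f \<noteq> 0" for t p F q f :: real
      using that by (simp add: field_simps)
    from this[of "real j + 1" "4 ^ j" "fact j" "sqrt pi" "fact (2 * j)"] show ?thesis
      by (simp add: algebra_simps)
  qed
  also have "(2 * real j + 2) * ((2 * real j + 1) * fact (2 * j)) = fact (2 * Suc j)"
    by (simp add: algebra_simps)
  also have "(real j + 1) * fact j = fact (Suc j)" by simp
  finally show ?case .
qed (simp add: Gamma_one_half_real)

text \<open>Both generalized binomials are Gamma quotients with numerators built from Gamma (m +
  1/2), which cancel the square in the prefactor. The half-integral Gamma values in the denominators
  turn the rest into an ordinary binomial; their two factors sqrt pi give 1 / pi, and 2^(2 m + 3) =
  8 * 4^m gives the 8.\<close>

lemma rankin_cohen_coefficient: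
  assumes j: "j \<le> m"
  shows "fact (2 * m) / ((Gamma (real m + 1 / 2))\<^sup>2 * 2 ^ (2 * m + 3))
     * (((1 / 2 + real m - 1) gchoose (m - j)) * ((3 / 2 + real m - 1) gchoose j))
    = of_nat ((2 * m + 1) choose (2 * j)) / (8 * pi)"
proof -
  define r where "r = m - j"
  have m: "m = j + r" using j by (simp add: r_def)
  define G where "G = Gamma (real m + 1 / 2)"
  note npos = pos_notin_nonpos_Ints
  have G: "G > 0" unfolding G_def by (rule Gamma_real_pos) simp
  have g1: "((1 / 2 + real m - 1) gchoose (m - j)) = G / (fact r * Gamma (real j + 1 / 2))"
  proof -
    have e: "1 / 2 + real m - 1 + 1 = real m + 1 / 2" "1 / 2 + real m - 1 - of_nat r + 1 = real j + 1 / 2"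
      by (simp_all add: m)
    show ?thesis
      unfolding r_def[symmetric] using gbinomial_Gamma[of "1 / 2 + real m - 1" r] npos unfolding e G_def by simp
  qed
  have g2: "((3 / 2 + real m - 1) gchoose j) = (real m + 1 / 2) * G / (fact j * ((real r + 1 / 2) * Gamma (real r + 1 / 2)))"
  proof -
    have e: "3 / 2 + real m - 1 + 1 = (real m + 1 / 2) + 1" "3 / 2 + real m - 1 - of_nat j + 1 = (real r + 1 / 2) + 1"
      by (simp_all add: m)
    have "((3 / 2 + real m - 1) gchoose j) = Gamma ((real m + 1 / 2) + 1) / (fact j * Gamma ((real r + 1 / 2) + 1))"
      using gbinomial_Gamma[of "3 / 2 + real m - 1" j] npos[of "(real m + 1 / 2) + 1"] unfolding e by simp
    then show ?thesis
      using Gamma_plus1[OF npos[of "real m + 1 / 2"]] Gamma_plus1[OF npos[of "real r + 1 / 2"]] by (simp add: G_def)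
  qed
  have four: "(2::real) ^ (2 * m + 3) = 4 ^ j * 4 ^ r * 8"
    by (simp add: m power_add power_mult)
  have "real ((2 * m + 1) choose (2 * j)) = fact (2 * m + 1) / (fact (2 * j) * fact (2 * m + 1 - 2 * j))"
    using j by (intro binomial_fact) simp
  also have "2 * m + 1 - 2 * j = Suc (2 * r)" by (simp add: m)
  finally have b: "real ((2 * m + 1) choose (2 * j)) = (2 * real m + 1) * fact (2 * m) / (fact (2 * j) * ((2 * real r + 1) * fact (2 * r)))"
    by (simp add: algebra_simps)
  have r1: "real r + 1 / 2 = (2 * real r + 1) / 2" "real m + 1 / 2 = (2 * real m + 1) / 2" by simp_all
  have gen: "F / (G\<^sup>2 * (q * q' * 8)) * (G / (fr * (p * F2j / (q * fj))) * (M / 2 * G / (fj * (R / 2 * (p * F2r / (q' * fr))))))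
      = M * F / (F2j * (R * F2r)) / (8 * p\<^sup>2)"
    if "q \<noteq> 0" "q' \<noteq> 0" "fr \<noteq> 0" "fj \<noteq> 0" "F2j \<noteq> 0" "F2r \<noteq> 0" "R \<noteq> 0" "p \<noteq> 0"
    for F q q' fr fj F2j F2r M R p :: real
    using that G by (simp add: field_simps power2_eq_square)
  show ?thesis
    unfolding G_def[symmetric]
    unfolding g1 g2 b four Gamma_of_nat_plus_half
    unfolding r1 using gen[of "4 ^ j" "4 ^ r" "fact r" "fact j" "fact (2 * j)" "fact (2 * r)" "2 * real r + 1" "sqrt pi" "fact (2 * m)" "2 * real m + 1"]
    by simp
qed

text \<open>In terms of m = k / 2 - 1 the exponent k / 2 + 1 of the sign is m + 2, and the brackets
  become the Leibniz sums of \<open>higher_deriv_theta_err_product\<close>.\<close>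

lemma JJ_hat_eq_brackets:
  "JJ_hat (2 * m + 2) \<tau> = JJ (2 * m + 2) \<tau> + of_real (of_bool (m = 0) / (8 * pi * Im \<tau>))
    + (- 1) ^ m / (8 * of_real pi) * (\<Sum>\<nu>\<in>{- 1, 0}. \<Sum>j=0..m. (- 1) ^ j * of_nat ((2 * m + 1) choose (2 * j))
        * (D_op ^^ j) (theta_nu \<nu>) \<tau> * (D_op ^^ (m - j)) (s_nu \<nu>) \<tau>)"
proof -
  define C where "C = fact (2 * m) / ((Gamma (real m + 1 / 2))\<^sup>2 * 2 ^ (2 * m + 3))"
  have C: "complex_of_real C * rankin_cohen (1 / 2) (3 / 2) m (theta_nu \<nu>) (s_nu \<nu>) \<tau>
    = 1 / (8 * of_real pi) * (\<Sum>j=0..m. (- 1) ^ j * of_nat ((2 * m + 1) choose (2 * j))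
        * (D_op ^^ j) (theta_nu \<nu>) \<tau> * (D_op ^^ (m - j)) (s_nu \<nu>) \<tau>)" for \<nu>
    unfolding rankin_cohen_def sum_distrib_left
  proof (rule sum.cong)
    fix j assume "j \<in> {0..m}"
    then have "j \<le> m" by simp
    define g1 where "g1 = ((1 / 2 + real m - 1) gchoose (m - j))"
    define g2 where "g2 = ((3 / 2 + real m - 1) gchoose j)"
    have "C * (g1 * g2) = of_nat ((2 * m + 1) choose (2 * j)) / (8 * pi)"
      unfolding C_def g1_def g2_def by (rule rankin_cohen_coefficient[OF \<open>j \<le> m\<close>])
    from arg_cong[OF this, of complex_of_real]
    have g: "of_real C * (of_real g1 * of_real g2) = complex_of_nat ((2 * m + 1) choose (2 * j)) / (8 * of_real pi)"
      by simp
    have "of_real C * ((- 1) ^ j * of_real g1 * of_real g2 * (D_op ^^ j) (theta_nu \<nu>) \<tau> * (D_op ^^ (m - j)) (s_nu \<nu>) \<tau>)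
      = (of_real C * (of_real g1 * of_real g2)) * ((- 1) ^ j * ((D_op ^^ j) (theta_nu \<nu>) \<tau> * (D_op ^^ (m - j)) (s_nu \<nu>) \<tau>))"
      by (simp only: mult_ac)
    also have "\<dots> = 1 / (8 * of_real pi) * ((- 1) ^ j * of_nat ((2 * m + 1) choose (2 * j))
        * (D_op ^^ j) (theta_nu \<nu>) \<tau> * (D_op ^^ (m - j)) (s_nu \<nu>) \<tau>)"
      unfolding g by (simp add: mult_ac)
    finally show "of_real C * ((- 1) ^ j * of_real ((1 / 2 + real m - 1) gchoose (m - j)) * of_real ((3 / 2 + real m - 1) gchoose j)
        * (D_op ^^ j) (theta_nu \<nu>) \<tau> * (D_op ^^ (m - j)) (s_nu \<nu>) \<tau>)
      = 1 / (8 * of_real pi) * ((- 1) ^ j * of_nat ((2 * m + 1) choose (2 * j))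
        * (D_op ^^ j) (theta_nu \<nu>) \<tau> * (D_op ^^ (m - j)) (s_nu \<nu>) \<tau>)"
      unfolding g1_def g2_def .
  qed simp
  have k: "2 * m + 2 - 2 = 2 * m" "(2 * m + 2) div 2 + 1 = m + 2" "(2 * m + 2) div 2 - 1 = m" "2 * m + 2 + 1 = 2 * m + 3"
    by simp_all
  have h: "(real (2 * m + 2) - 1) / 2 = real m + 1 / 2" by simp
  have "fact (2 * m) * (- 1) ^ (m + 2) / (of_real ((Gamma (real m + 1 / 2))\<^sup>2) * 2 ^ (2 * m + 3)) = (- 1) ^ m * complex_of_real C"
    by (simp add: C_def)
  then have "JJ_hat (2 * m + 2) \<tau> = JJ (2 * m + 2) \<tau> + of_real (of_bool (m = 0) / (8 * pi * Im \<tau>))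
    + (- 1) ^ m * of_real C * (\<Sum>\<nu>\<in>{- 1, 0}. rankin_cohen (1 / 2) (3 / 2) m (theta_nu \<nu>) (s_nu \<nu>) \<tau>)"
    unfolding JJ_hat_def k h by simp
  then show ?thesis
    by (simp add: mult.assoc sum_distrib_left C del: sum.insert)
qed

text \<open>The vanishing derivative of order 2 m + 1 of \<open>completion_diff\<close> is solved
  for the holomorphic part. The brackets and the weight 2 correction that appear there are the
  negatives of those in the definition, so only the lattice sum remains.\<close>

theorem JJ_hat_eq_lattice_sum:
  assumes tau: "Im \<tau> > 0"
  shows "JJ_hat (2 * m + 2) \<tau> = 1 / (4 * of_real pi * \<i> * (2 * \<i> * of_real (Im \<tau>)) ^ (2 * m + 1))
    * (\<Sum>\<^sub>\<infinity>p\<in>UNIV - {(0, 0)}. cnj (lattice_point \<tau> p) ^ (2 * m + 1) / lattice_point \<tau> p * lattice_term \<tau> 0 0 p)"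
proof -
  define N where "N = 2 * m + 1"
  define v where "v = Im \<tau>"
  have v: "v > 0" using tau by (simp add: v_def)
  define P where "P = (\<Sum>\<nu>\<in>{- 1, 0}. \<Sum>j=0..m. (- 1) ^ j * of_nat ((2 * m + 1) choose (2 * j))
        * (D_op ^^ j) (theta_nu \<nu>) \<tau> * (D_op ^^ (m - j)) (s_nu \<nu>) \<tau>)"
  define S where "S = (\<Sum>\<^sub>\<infinity>p\<in>UNIV - {(0, 0)}. cnj (lattice_point \<tau> p) ^ N / lattice_point \<tau> p * lattice_term \<tau> 0 0 p)"
  have N: "odd N" "N > 0" by (simp_all add: N_def)
  have L: "(deriv ^^ N) (\<lambda>w. lattice_sum \<tau> w 0) 0 = - (of_real (pi / v) ^ N) * S"
    unfolding higher_deriv_lattice_sum[OF tau] S_def infsum_cmult_right'[symmetric] v_def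
    by (intro infsum_cong) (simp add: N(1) power_mult_distrib mult_ac del: of_real_divide)
  have A: "(deriv ^^ N) (appell \<tau>) 0 = 2 * (2 * of_real pi * \<i>) ^ N * JJ (2 * m + 2) \<tau>"
    using higher_deriv_appell[OF tau N(1)] by (simp add: N_def)
  have B: "(deriv ^^ N) (\<lambda>w. theta_err_product \<tau> w 0) 0 = - \<i> * of_real ((4 * pi\<^sup>2) ^ m) * P"
    unfolding N_def P_def by (rule higher_deriv_theta_err_product[OF tau])
  define c where "c = 2 * (2 * of_real pi * \<i>) ^ N"
  have c: "c = 4 * of_real pi * \<i> * ((- 1) ^ m * of_real ((4 * pi\<^sup>2) ^ m))"
  proof -
    have "(2 * of_real pi * \<i>)\<^sup>2 = - complex_of_real (4 * pi\<^sup>2)" by (simp add: power_mult_distrib)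
    then have "(2 * of_real pi * \<i>) ^ (2 * m) = (- complex_of_real (4 * pi\<^sup>2)) ^ m" unfolding power_mult by (simp only:)
    also have "\<dots> = (- 1) ^ m * complex_of_real (4 * pi\<^sup>2) ^ m" by (rule power_minus)
    finally have "(2 * of_real pi * \<i>) ^ (2 * m) = (- 1) ^ m * complex_of_real ((4 * pi\<^sup>2) ^ m)" by (simp only: of_real_power)
    then show ?thesis unfolding c_def N_def power_add power_one_right by simp
  qed
  have c0: "c \<noteq> 0" by (simp add: c_def)
  have "c * JJ (2 * m + 2) \<tau> - - \<i> * of_real ((4 * pi\<^sup>2) ^ m) * P / 2
     + (of_real (v / pi) * (- (of_real (pi / v) ^ N) * S) - of_bool (N = 1)) / (2 * \<i> * of_real v) = 0" (is ?eq)
    using completion_diff_higher_deriv[OF tau N(2)] unfolding A B L c_def v_def .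
  then have J: "JJ (2 * m + 2) \<tau> = - (\<i> * of_real ((4 * pi\<^sup>2) ^ m) * P / 2) / c
     + (of_real (v / pi) * (of_real (pi / v) ^ N * S) + of_bool (N = 1)) / (2 * \<i> * of_real v) / c"
  proof -
    have "c * J - - \<i> * U * P / 2 + (q * (- n * S) - t) / D = 0 \<Longrightarrow> J = - (\<i> * U * P / 2) / c + (q * (n * S) + t) / D / c"
      if "D \<noteq> 0" for J U q n t D
    proof -
      assume eq: "c * J - - \<i> * U * P / 2 + (q * (- n * S) - t) / D = 0"
      have "c * J = (c * J - - \<i> * U * P / 2 + (q * (- n * S) - t) / D) + (- \<i> * U * P / 2 + (q * (n * S) + t) / D)"
        by (simp add: add_divide_distrib diff_divide_distrib)
      also have "\<dots> = - (\<i> * U * P / 2) + (q * (n * S) + t) / D"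
        unfolding eq by simp
      finally have "c * J / c = (- (\<i> * U * P / 2) + (q * (n * S) + t) / D) / c" by (simp only:)
      then show ?thesis using c0 by (simp only: add_divide_distrib nonzero_mult_div_cancel_left) simp
    qed
    from this[OF _ \<open>?eq\<close>] show ?thesis using v by simp
  qed
  have 1: "- (\<i> * of_real ((4 * pi\<^sup>2) ^ m) * P / 2) / c = - ((- 1) ^ m / (8 * of_real pi) * P)"
    unfolding c by (cases "even m") (simp_all add: field_simps)
  have 2: "of_bool (N = 1) / (2 * \<i> * of_real v) / c = - complex_of_real (of_bool (m = 0) / (8 * pi * v))"
    using v by (cases "m = 0") (simp_all add: N_def c field_simps)
  have 3: "of_real (v / pi) * (of_real (pi / v) ^ N * S) / (2 * \<i> * of_real v) / c
     = 1 / (4 * of_real pi * \<i> * (2 * \<i> * of_real v) ^ N) * S"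
  proof -
    have "(2 * of_real pi * \<i>) ^ N = of_real (pi / v) ^ N * (2 * \<i> * of_real v) ^ N"
      unfolding power_mult_distrib[symmetric] using v by (simp add: mult_ac)
    then show ?thesis
      unfolding c_def using v by (simp add: field_simps del: of_real_power)
  qed
  have "JJ (2 * m + 2) \<tau> = - ((- 1) ^ m / (8 * of_real pi) * P) - complex_of_real (of_bool (m = 0) / (8 * pi * v))
     + 1 / (4 * of_real pi * \<i> * (2 * \<i> * of_real v) ^ N) * S"
    unfolding J add_divide_distrib 1 2 3 by simp
  then show ?thesis
    unfolding JJ_hat_eq_brackets P_def[symmetric] S_def N_def v_def by simp
qed

subsection \<open>Modularity of the completed generating function\<close>

lemma linear_ne_0:
  assumes "Im \<tau> > 0" "c \<noteq> 0 \<or> d \<noteq> 0"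
  shows "of_int c * \<tau> + of_int d \<noteq> (0::complex)"
  using assms by (auto simp: complex_eq_iff)

lemma Im_moebius_int:
  fixes a b c d :: int
  assumes "Im \<tau> > 0" "a * d - b * c = 1"
  shows "Im ((of_int a * \<tau> + of_int b) / (of_int c * \<tau> + of_int d)) = Im \<tau> / (norm (of_int c * \<tau> + of_int d))\<^sup>2"
proof -
  define j where "j = of_int c * \<tau> + of_int d"
  have "Im ((of_int a * \<tau> + of_int b) * cnj j) = of_int (a * d - b * c) * Im \<tau>"
    by (simp add: j_def algebra_simps)
  then show ?thesis
    unfolding j_def[symmetric] complex_div_cnj[of _ j] assms(2) by (simp flip: of_real_power)
qed

text \<open>Put j = c tau + d. Lattice points for the image of tau are lattice points for tau
  divided by j, and the Gaussian is unchanged. The factor cnj lambda^N / lambda contributes j / cnj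
  j^N and v^(- N) contributes (j cnj j)^N, in total j^(N + 1) with N + 1 = k.\<close>

theorem JJ_hat_modular:
  fixes a b c d :: int
  assumes tau: "Im \<tau> > 0" and det: "a * d - b * c = 1"
  shows "JJ_hat (2 * m + 2) ((of_int a * \<tau> + of_int b) / (of_int c * \<tau> + of_int d))
    = (of_int c * \<tau> + of_int d) ^ (2 * m + 2) * JJ_hat (2 * m + 2) \<tau>"
proof -
  define N where "N = 2 * m + 1"
  define j where "j = of_int c * \<tau> + of_int d"
  define \<tau>' where "\<tau>' = (of_int a * \<tau> + of_int b) / j"
  have j: "j \<noteq> 0" unfolding j_def by (rule linear_ne_0[OF tau]) (use det in auto)
  have Im: "Im \<tau>' = Im \<tau> / (norm j)\<^sup>2"
    unfolding \<tau>'_def j_def by (rule Im_moebius_int[OF tau det])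
  have tau': "Im \<tau>' > 0" unfolding Im using tau j by simp
  \<comment> \<open>The coordinates of x (a tau + b) + y (c tau + d) with respect to tau and 1: the
    transposed matrix acts on the index set.\<close>
  define g where "g = (\<lambda>(x, y). (a * x + c * y, b * x + d * y))"
  define g' where "g' = (\<lambda>(x, y). (d * x - c * y, a * y - b * x))"
  have gg: "g (g' p) = p" "g' (g p) = p" for p
  proof -
    obtain x y where p: "p = (x, y)" by (cases p)
    have "a * (d * x - c * y) + c * (a * y - b * x) = (a * d - b * c) * x"
      "b * (d * x - c * y) + d * (a * y - b * x) = (a * d - b * c) * y"
      "d * (a * x + c * y) - c * (b * x + d * y) = (a * d - b * c) * x"
      "a * (b * x + d * y) - b * (a * x + c * y) = (a * d - b * c) * y"
      by (simp_all add: algebra_simps)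
    then show "g (g' p) = p" "g' (g p) = p" by (simp_all add: g_def g'_def p det)
  qed
  have bij: "bij_betw g (UNIV - {(0, 0)}) (UNIV - {(0, 0)})"
  proof (rule bij_betwI[where g = g'])
    have g0: "g (0, 0) = (0, 0)" "g' (0, 0) = (0, 0)" by (simp_all add: g_def g'_def)
    show "g \<in> UNIV - {(0, 0)} \<rightarrow> UNIV - {(0, 0)}"
    proof (rule Pi_I)
      fix p :: "int \<times> int" assume "p \<in> UNIV - {(0, 0)}"
      then show "g p \<in> UNIV - {(0, 0)}" using gg(2)[of p] g0(2) by auto
    qed
    show "g' \<in> UNIV - {(0, 0)} \<rightarrow> UNIV - {(0, 0)}"
    proof (rule Pi_I)
      fix p :: "int \<times> int" assume "p \<in> UNIV - {(0, 0)}"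
      then show "g' p \<in> UNIV - {(0, 0)}" using gg(1)[of p] g0(1) by auto
    qed
  qed (simp_all add: gg)
  have lp: "lattice_point \<tau>' p = lattice_point \<tau> (g p) / j" for p
    using j by (cases p) (simp add: lattice_point_def \<tau>'_def g_def j_def field_simps)
  have jn: "complex_of_real ((norm j)\<^sup>2) = j * cnj j" by (rule complex_norm_square)
  have lt: "lattice_term \<tau>' 0 0 p = lattice_term \<tau> 0 0 (g p)" for p
    unfolding lattice_term_def lp Im
    using j tau by (simp add: jn[unfolded of_real_power] field_simps)
  have t: "cnj (lattice_point \<tau>' p) ^ N / lattice_point \<tau>' p * lattice_term \<tau>' 0 0 p
     = j / cnj j ^ N * (cnj (lattice_point \<tau> (g p)) ^ N / lattice_point \<tau> (g p) * lattice_term \<tau> 0 0 (g p))" for p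
    unfolding lt lp by (simp add: power_divide)
  define S where "S = (\<Sum>\<^sub>\<infinity>p\<in>UNIV - {(0, 0)}. cnj (lattice_point \<tau> p) ^ N / lattice_point \<tau> p * lattice_term \<tau> 0 0 p)"
  have "(\<Sum>\<^sub>\<infinity>p\<in>UNIV - {(0, 0)}. cnj (lattice_point \<tau>' p) ^ N / lattice_point \<tau>' p * lattice_term \<tau>' 0 0 p) = j / cnj j ^ N * S"
    unfolding t infsum_cmult_right' S_def
    using infsum_reindex_bij_betw[OF bij, of "\<lambda>p. cnj (lattice_point \<tau> p) ^ N / lattice_point \<tau> p * lattice_term \<tau> 0 0 p"] by simp
  then have "JJ_hat (2 * m + 2) \<tau>' = 1 / (4 * of_real pi * \<i> * (2 * \<i> * of_real (Im \<tau>')) ^ N) * (j / cnj j ^ N * S)"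
    unfolding JJ_hat_eq_lattice_sum[OF tau'] N_def by simp
  also have "(2 * \<i> * of_real (Im \<tau>')) ^ N = (2 * \<i> * of_real (Im \<tau>)) ^ N / (j ^ N * cnj j ^ N)"
    unfolding Im of_real_divide jn power_divide[symmetric] power_mult_distrib[symmetric] by simp
  also have "1 / (4 * of_real pi * \<i> * ((2 * \<i> * of_real (Im \<tau>)) ^ N / (j ^ N * cnj j ^ N))) * (j / cnj j ^ N * S)
    = j ^ (N + 1) * (1 / (4 * of_real pi * \<i> * (2 * \<i> * of_real (Im \<tau>)) ^ N) * S)"
    using j tau by (simp add: field_simps)
  also have "1 / (4 * of_real pi * \<i> * (2 * \<i> * of_real (Im \<tau>)) ^ N) * S = JJ_hat (2 * m + 2) \<tau>"
    unfolding JJ_hat_eq_lattice_sum[OF tau] S_def N_def ..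
  finally show ?thesis by (simp add: N_def \<tau>'_def j_def)
qed

subsection \<open>The lowering operator\<close>

lemma theta_l_nu_expansion:
  assumes tau: "Im \<tau> > 0"
  shows "theta_l_nu l \<nu> \<tau> = - (\<Sum>i=0..l - 1. of_nat ((l - 1) choose i)
     * ((2 * of_real pi * \<i>) ^ i * gauss_theta i (coset_shift \<nu>) (theta_exponent \<tau>) 0)
     * (if even (l - 1 - i) then fact (l - 1 - i) / fact ((l - 1 - i) div 2) * (of_real pi / (4 * of_real (Im \<tau>))) ^ ((l - 1 - i) div 2) else 0))"
proof -
  define g where "g = (\<lambda>z. gauss_theta 0 (coset_shift \<nu>) (theta_exponent \<tau>) (2 * of_real pi * \<i> * z))"
  define E where "E = (\<lambda>z::complex. exp (of_real pi / (4 * of_real (Im \<tau>)) * z\<^sup>2))"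
  have hol: "g holomorphic_on UNIV" "E holomorphic_on UNIV"
    unfolding g_def E_def by (intro holomorphic_on_gauss_theta_exponential tau holomorphic_intros)+
  have "theta_l_nu l \<nu> \<tau> = (deriv ^^ (l - 1)) (\<lambda>z. (- 1) * (g z * E z)) 0"
    by (simp add: theta_l_nu_eq g_def E_def)
  also have "\<dots> = - 1 * (deriv ^^ (l - 1)) (\<lambda>z. g z * E z) 0"
    by (rule higher_deriv_cmult[of _ UNIV]) (auto intro!: holomorphic_intros hol)
  also have "(deriv ^^ (l - 1)) (\<lambda>z. g z * E z) 0
     = (\<Sum>i=0..l - 1. of_nat ((l - 1) choose i) * (deriv ^^ i) g 0 * (deriv ^^ (l - 1 - i)) E 0)"
    by (rule higher_deriv_mult[of _ UNIV]) (auto intro: hol)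
  finally have expand: "theta_l_nu l \<nu> \<tau> = - 1 * (\<Sum>i=0..l - 1. of_nat ((l - 1) choose i) * (deriv ^^ i) g 0 * (deriv ^^ (l - 1 - i)) E 0)" .
  have "(deriv ^^ i) g 0 = (2 * of_real pi * \<i>) ^ i * gauss_theta i (coset_shift \<nu>) (theta_exponent \<tau>) 0" for i
    unfolding g_def using higher_deriv_gauss_theta[of "theta_exponent \<tau>" i 0 "coset_shift \<nu>" "2 * of_real pi * \<i>" 0] tau by simp
  then show ?thesis
    unfolding expand E_def higher_deriv_exp_square by (simp only: mult_minus_left mult_1)
qed

lemma two_pi_i_power_even: "(2 * of_real pi * \<i>) ^ (2 * j) = (- 1) ^ j * complex_of_real ((4 * pi\<^sup>2) ^ j)"
proof -
  have "(2 * of_real pi * \<i>)\<^sup>2 = - complex_of_real (4 * pi\<^sup>2)" by (simp add: power_mult_distrib)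
  then have "(2 * of_real pi * \<i>) ^ (2 * j) = (- complex_of_real (4 * pi\<^sup>2)) ^ j" unfolding power_mult by (simp only:)
  also have "\<dots> = (- 1) ^ j * complex_of_real (4 * pi\<^sup>2) ^ j" by (rule power_minus)
  finally show ?thesis by (simp only: of_real_power)
qed

lemma theta_l_nu_odd_expansion:
  assumes tau: "Im \<tau> > 0" and \<nu>: "\<nu> \<in> {- 1, 0}"
  shows "theta_l_nu (2 * m + 1) \<nu> \<tau> = (\<Sum>j=0..m. of_nat ((2 * m) choose (2 * j)) * ((- 1) ^ j * of_real ((4 * pi\<^sup>2) ^ j)
     * (D_op ^^ j) (theta_nu \<nu>) \<tau>) * of_real (fact (2 * (m - j)) / fact (m - j) * (pi / (4 * Im \<tau>)) ^ (m - j)))"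
proof -
  have h: "coset_shift \<nu> \<in> {0, 1/2}" using \<nu> by (auto simp: coset_shift_def)
  have e: "2 * m + 1 - 1 = 2 * m" by simp
  have "theta_l_nu (2 * m + 1) \<nu> \<tau> = - (\<Sum>i=0..2 * m. of_nat ((2 * m) choose i)
     * ((2 * of_real pi * \<i>) ^ i * gauss_theta i (coset_shift \<nu>) (theta_exponent \<tau>) 0)
     * (if even (2 * m - i) then fact (2 * m - i) / fact ((2 * m - i) div 2) * (of_real pi / (4 * of_real (Im \<tau>))) ^ ((2 * m - i) div 2) else 0))"
    using theta_l_nu_expansion[OF tau, of "2 * m + 1" \<nu>] unfolding e .
  also have "\<dots> = - (\<Sum>j=0..m. of_nat ((2 * m) choose (2 * j))
     * ((2 * of_real pi * \<i>) ^ (2 * j) * gauss_theta (2 * j) (coset_shift \<nu>) (theta_exponent \<tau>) 0)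
     * (if even (2 * m - 2 * j) then fact (2 * m - 2 * j) / fact ((2 * m - 2 * j) div 2) * (of_real pi / (4 * of_real (Im \<tau>))) ^ ((2 * m - 2 * j) div 2) else 0))"
    by (subst sum_even_only(1)) (simp_all add: gauss_theta_odd_zero[OF h])
  also have "\<dots> = (\<Sum>j=0..m. of_nat ((2 * m) choose (2 * j)) * ((- 1) ^ j * of_real ((4 * pi\<^sup>2) ^ j)
     * (D_op ^^ j) (theta_nu \<nu>) \<tau>) * of_real (fact (2 * (m - j)) / fact (m - j) * (pi / (4 * Im \<tau>)) ^ (m - j)))"
    unfolding sum_negf[symmetric]
  proof (rule sum.cong)
    fix j assume "j \<in> {0..m}"
    have e: "2 * m - 2 * j = 2 * (m - j)" by simp
    have e2: "fact (2 * (m - j)) / fact (m - j) * (of_real pi / (4 * of_real (Im \<tau>))) ^ (m - j)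
       = complex_of_real (fact (2 * (m - j)) / fact (m - j) * (pi / (4 * Im \<tau>)) ^ (m - j))" by simp
    have e3: "even (2 * (m - j))" "2 * (m - j) div 2 = m - j" by simp_all
    show "- (of_nat ((2 * m) choose (2 * j))
     * ((2 * of_real pi * \<i>) ^ (2 * j) * gauss_theta (2 * j) (coset_shift \<nu>) (theta_exponent \<tau>) 0)
     * (if even (2 * m - 2 * j) then fact (2 * m - 2 * j) / fact ((2 * m - 2 * j) div 2) * (of_real pi / (4 * of_real (Im \<tau>))) ^ ((2 * m - 2 * j) div 2) else 0))
     = of_nat ((2 * m) choose (2 * j)) * ((- 1) ^ j * of_real ((4 * pi\<^sup>2) ^ j)
     * (D_op ^^ j) (theta_nu \<nu>) \<tau>) * of_real (fact (2 * (m - j)) / fact (m - j) * (pi / (4 * Im \<tau>)) ^ (m - j))"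
      unfolding e e3 D_op_iterate_theta_nu(1)[OF tau] two_pi_i_power_even e2 if_P[OF e3(1)]
      by (simp only: mult_minus_left mult_minus_right minus_minus mult.assoc)
  qed simp
  finally show ?thesis .
qed

text \<open>This matches the two sides of the lowering formula term by term. With r = m - j,
  absorption gives (2 r + 1) (2 m + 1 choose 2 j) = (2 m + 1) (2 m choose 2 j), and the same factor
  2 r + 1 sits inside the factorial of \<open>s_const r\<close>.\<close>

lemma s_const_binomial:
  assumes "j \<le> m"
  shows "s_const (m - j) * real ((2 * m + 1) choose (2 * j))
    = 2 * (real (2 * m + 1) * real ((2 * m) choose (2 * j)) * (fact (2 * (m - j)) / fact (m - j) / (16 * pi) ^ (m - j + 1)))"
proof -
  define r where "r = m - j"
  have r: "2 * m + 1 - 2 * j = 2 * r + 1" using assms by (simp add: r_def)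
  have "(2 * m + 1 - 2 * j) * ((2 * m + 1) choose (2 * j)) = (2 * m + 1) * ((2 * m + 1 - 1) choose (2 * j))"
    by (rule binomial_absorb_comp)
  then have "(2 * r + 1) * ((2 * m + 1) choose (2 * j)) = (2 * m + 1) * ((2 * m) choose (2 * j))"
    unfolding r by simp
  from arg_cong[OF this, of real]
  have b: "real (2 * m + 1) * real ((2 * m) choose (2 * j)) = (2 * real r + 1) * real ((2 * m + 1) choose (2 * j))"
    by (simp only: of_nat_mult[of "2 * r + 1"] of_nat_mult[of "2 * m + 1"]) (simp add: add.commute)
  have "(fact (2 * r + 2) :: real) = 2 * (real r + 1) * ((2 * real r + 1) * fact (2 * r))"
    by (simp add: algebra_simps)
  moreover have "(fact (r + 1) :: real) = (real r + 1) * fact r" by simp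
  moreover have "2 * t * X / (t * f * P) = 2 * (X / f / P)" if "t \<noteq> 0" for t X f P :: real
    using that by (simp add: field_simps)
  from this[of "real r + 1" "(2 * real r + 1) * fact (2 * r)" "fact r" "(16 * pi) ^ (r + 1)"]
  have "2 * (real r + 1) * ((2 * real r + 1) * fact (2 * r)) / ((real r + 1) * fact r * (16 * pi) ^ (r + 1))
     = 2 * ((2 * real r + 1) * fact (2 * r) / fact r / (16 * pi) ^ (r + 1))" by linarith
  ultimately have "s_const r = 2 * ((2 * real r + 1) * (fact (2 * r) / fact r / (16 * pi) ^ (r + 1)))"
    unfolding s_const_def by (simp only: times_divide_eq_right)
  then show ?thesis unfolding r_def[symmetric] b by (simp only: mult_ac)
qed

text \<open>The conjugate derivative meets only 1 / v and the iterated derivatives of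
  \<open>s_nu\<close>; the latter give a conjugate theta constant times powers of 1 / v. Summed over
  j, these powers are Taylor coefficients of exp (pi w^2 / (4 v)), and the sum is the Leibniz
  expansion of the derivative of order 2 m of the completed theta function.\<close>

lemma L_op_JJ_hat:
  assumes tau: "Im \<tau> > 0"
  shows "L_op (JJ_hat (2 * m + 2)) \<tau> = - of_bool (m = 0) / (8 * of_real pi)
    - \<i> * of_nat (2 * m + 1) / (8 * (2 * of_real pi * \<i>) ^ (2 * m + 1)) * of_real (sqrt (Im \<tau>))
      * (cnj (theta1 (2 * \<tau>)) * theta_l_nu (2 * m + 1) (- 1) \<tau> + cnj (theta3 (2 * \<tau>)) * theta_l_nu (2 * m + 1) 0 \<tau>)"
proof -
  define v where "v = Im \<tau>"
  have v: "v > 0" using tau by (simp add: v_def)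
  define C where "C = (- 1) ^ m / (8 * complex_of_real pi)"
  define T where "T = (\<lambda>\<nu>. cnj (gauss_theta 0 (coset_shift \<nu>) (theta_exponent \<tau>) 0))"
  define q where "q = (\<lambda>s \<nu>. - 2 * of_real pi * \<i> * of_real (s_const s / (sqrt v * v ^ (s + 1))) * T \<nu>)"
  define \<theta> where "\<theta> = (\<lambda>j \<nu>. (D_op ^^ j) (theta_nu \<nu>) \<tau>)"
  have dJJ: "has_wirtinger_derivs (JJ (2 * m + 2)) (deriv (JJ (2 * m + 2)) \<tau>) 0 \<tau>"
    using holomorphic_derivI[OF JJ_holomorphic open_upper_half_plane] tau
    by (intro has_wirtinger_derivs_of_field_derivative) auto
  define d where "d = - (of_bool (m = 0) / (8 * pi * v\<^sup>2))"
  have "((\<lambda>v. of_bool (m = 0) / (8 * pi * v)) has_real_derivative d) (at (Im \<tau>))"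
    unfolding d_def v_def[symmetric] using v by (auto intro!: derivative_eq_intros simp: power2_eq_square)
  from has_wirtinger_derivs_Im[OF this]
  have dv: "has_wirtinger_derivs (\<lambda>\<tau>. of_real (of_bool (m = 0) / (8 * pi * Im \<tau>))) (- \<i> / 2 * of_real d) (\<i> / 2 * of_real d) \<tau>" .
  have dth: "\<exists>p. has_wirtinger_derivs ((D_op ^^ j) (theta_nu \<nu>)) p 0 \<tau>" for j \<nu>
    using D_op_iterate_theta_nu(2)[OF tau] by blast
  have ds: "\<exists>p. has_wirtinger_derivs ((D_op ^^ s) (s_nu \<nu>)) p (q s \<nu>) \<tau>" for s \<nu>
    using has_wirtinger_derivs_D_op_iterate_s_nu[OF tau] unfolding q_def T_def v_def by blast
  have "\<exists>p. has_wirtinger_derivs (\<lambda>\<tau>. (- 1) ^ j * of_nat ((2 * m + 1) choose (2 * j)) * (D_op ^^ j) (theta_nu \<nu>) \<tau> * (D_op ^^ (m - j)) (s_nu \<nu>) \<tau>)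
      p ((- 1) ^ j * of_nat ((2 * m + 1) choose (2 * j)) * \<theta> j \<nu> * q (m - j) \<nu>) \<tau>" for j \<nu>
  proof -
    obtain p1 p2 where "has_wirtinger_derivs ((D_op ^^ j) (theta_nu \<nu>)) p1 0 \<tau>" "has_wirtinger_derivs ((D_op ^^ (m - j)) (s_nu \<nu>)) p2 (q (m - j) \<nu>) \<tau>"
      using dth ds by blast
    from has_wirtinger_derivs_cmult[OF has_wirtinger_derivs_mult[OF this], of "(- 1) ^ j * of_nat ((2 * m + 1) choose (2 * j))"]
    show ?thesis by (auto simp: \<theta>_def mult.assoc)
  qed
  note ex = this
  \<comment> \<open>Only the conjugate linear component enters \<open>L_op\<close>; the linear one
    is carried along as a choice.\<close>
  define p where "p = (\<lambda>j \<nu>. SOME p. has_wirtinger_derivs (\<lambda>\<tau>. (- 1) ^ j * of_nat ((2 * m + 1) choose (2 * j)) * (D_op ^^ j) (theta_nu \<nu>) \<tau> * (D_op ^^ (m - j)) (s_nu \<nu>) \<tau>)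
      p ((- 1) ^ j * of_nat ((2 * m + 1) choose (2 * j)) * \<theta> j \<nu> * q (m - j) \<nu>) \<tau>)"
  have p: "has_wirtinger_derivs (\<lambda>\<tau>. (- 1) ^ j * of_nat ((2 * m + 1) choose (2 * j)) * (D_op ^^ j) (theta_nu \<nu>) \<tau> * (D_op ^^ (m - j)) (s_nu \<nu>) \<tau>)
      (p j \<nu>) ((- 1) ^ j * of_nat ((2 * m + 1) choose (2 * j)) * \<theta> j \<nu> * q (m - j) \<nu>) \<tau>" for j \<nu>
    unfolding p_def by (rule someI_ex) (rule ex)
  have "has_wirtinger_derivs (\<lambda>\<tau>. JJ (2 * m + 2) \<tau> + of_real (of_bool (m = 0) / (8 * pi * Im \<tau>))
    + C * (\<Sum>\<nu>\<in>{- 1, 0}. \<Sum>j=0..m. (- 1) ^ j * of_nat ((2 * m + 1) choose (2 * j))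
        * (D_op ^^ j) (theta_nu \<nu>) \<tau> * (D_op ^^ (m - j)) (s_nu \<nu>) \<tau>))
     (deriv (JJ (2 * m + 2)) \<tau> + - \<i> / 2 * of_real d + C * (\<Sum>\<nu>\<in>{- 1, 0}. \<Sum>j=0..m. p j \<nu>))
     (0 + \<i> / 2 * of_real d + C * (\<Sum>\<nu>\<in>{- 1, 0}. \<Sum>j=0..m. (- 1) ^ j * of_nat ((2 * m + 1) choose (2 * j)) * \<theta> j \<nu> * q (m - j) \<nu>)) \<tau>"
    by (intro has_wirtinger_derivs_add has_wirtinger_derivs_cmult has_wirtinger_derivs_sum dJJ dv p)
  then have "has_wirtinger_derivs (JJ_hat (2 * m + 2))
     (deriv (JJ (2 * m + 2)) \<tau> + - \<i> / 2 * of_real d + C * (\<Sum>\<nu>\<in>{- 1, 0}. \<Sum>j=0..m. p j \<nu>))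
     (0 + \<i> / 2 * of_real d + C * (\<Sum>\<nu>\<in>{- 1, 0}. \<Sum>j=0..m. (- 1) ^ j * of_nat ((2 * m + 1) choose (2 * j)) * \<theta> j \<nu> * q (m - j) \<nu>)) \<tau>"
    unfolding C_def JJ_hat_eq_brackets[symmetric] by simp
  then have L: "L_op (JJ_hat (2 * m + 2)) \<tau> = - 2 * \<i> * of_real (v\<^sup>2) * (\<i> / 2 * of_real d)
     + (\<Sum>\<nu>\<in>{- 1, 0}. - 2 * \<i> * of_real (v\<^sup>2) * C * (\<Sum>j=0..m. (- 1) ^ j * of_nat ((2 * m + 1) choose (2 * j)) * \<theta> j \<nu> * q (m - j) \<nu>))"
    unfolding L_op_def v_def[symmetric] by (subst wirtinger_dbar_eq) (auto simp: algebra_simps)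
  have delta: "- 2 * \<i> * of_real (v\<^sup>2) * (\<i> / 2 * of_real d) = - of_bool (m = 0) / (8 * of_real pi)"
    using v by (simp add: d_def power2_eq_square)
  define K where "K = - \<i> * of_nat (2 * m + 1) / (8 * (2 * of_real pi * \<i>) ^ (2 * m + 1)) * of_real (sqrt v)"
  have main: "- 2 * \<i> * of_real (v\<^sup>2) * C * (\<Sum>j=0..m. (- 1) ^ j * of_nat ((2 * m + 1) choose (2 * j)) * \<theta> j \<nu> * q (m - j) \<nu>)
     = K * (T \<nu> * theta_l_nu (2 * m + 1) \<nu> \<tau>)" if "\<nu> \<in> {- 1, 0}" for \<nu>
    unfolding theta_l_nu_odd_expansion[OF tau that] sum_distrib_left
  proof (rule sum.cong)
    fix j assume "j \<in> {0..m}"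
    then have j: "j \<le> m" by simp
    define r where "r = m - j"
    define b where "b = real (2 * m + 1) * real ((2 * m) choose (2 * j)) * (fact (2 * r) / fact r)"
    have sb: "s_const r * real ((2 * m + 1) choose (2 * j)) = 2 * (b / (16 * pi) ^ (r + 1))"
      using s_const_binomial[OF j] by (simp add: r_def b_def)
    have sign: "(- 1) ^ m * (- 1) ^ j = (- 1) ^ r * (1::real)"
      using j by (simp add: r_def power_add[symmetric] minus_one_power_iff)
    have th: "(D_op ^^ j) (theta_nu \<nu>) \<tau> = \<theta> j \<nu>" by (simp add: \<theta>_def)
    have v2: "v\<^sup>2 / (sqrt v * v ^ (r + 1)) = sqrt v / v ^ r"
    proof -
      have "v\<^sup>2 = (sqrt v * sqrt v) * v" using v by (simp add: power2_eq_square)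
      then show ?thesis using v by (simp add: field_simps)
    qed
    have lhs: "- 2 * \<i> * of_real (v\<^sup>2) * C * ((- 1) ^ j * of_nat ((2 * m + 1) choose (2 * j)) * \<theta> j \<nu> * q r \<nu>)
       = complex_of_real (- ((- 1) ^ r * (s_const r * real ((2 * m + 1) choose (2 * j))) * (v\<^sup>2 / (sqrt v * v ^ (r + 1))) / 2)) * (\<theta> j \<nu> * T \<nu>)"
    proof -
      have "- 2 * \<i> * of_real (v\<^sup>2) * C * ((- 1) ^ j * of_nat ((2 * m + 1) choose (2 * j)) * \<theta> j \<nu> * q r \<nu>)
        = of_real (((- 1) ^ m * (- 1) ^ j) * (s_const r * real ((2 * m + 1) choose (2 * j))) * (v\<^sup>2 / (sqrt v * v ^ (r + 1))) / (8 * pi))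
           * ((- 2 * \<i>) * (- 2 * of_real pi * \<i>)) * (\<theta> j \<nu> * T \<nu>)"
        by (simp add: C_def q_def mult_ac)
      also have "(- 2 * \<i>) * (- 2 * of_real pi * \<i>) = complex_of_real (- 4 * pi)" by simp
      finally show ?thesis unfolding sign by (simp add: mult_ac)
    qed
    have rhs: "K * (T \<nu> * (of_nat ((2 * m) choose (2 * j)) * ((- 1) ^ j * of_real ((4 * pi\<^sup>2) ^ j) * \<theta> j \<nu>) * of_real (fact (2 * r) / fact r * (pi / (4 * v)) ^ r)))
       = complex_of_real (- ((- 1) ^ r * (b / (16 * pi) ^ (r + 1)) * (sqrt v / v ^ r))) * (\<theta> j \<nu> * T \<nu>)"
    proof -
      have "(2 * of_real pi * \<i>) ^ (2 * m + 1) = (2 * of_real pi * \<i>) * ((- 1) ^ m * complex_of_real ((4 * pi\<^sup>2) ^ m))"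
        unfolding power_add power_one_right two_pi_i_power_even by simp
      then have K: "K = - complex_of_real ((- 1) ^ m * real (2 * m + 1) / (16 * pi * (4 * pi\<^sup>2) ^ m) * sqrt v)"
        unfolding K_def by (cases "even m") (simp_all add: field_simps)
      have "(4 * pi\<^sup>2) ^ m = (4 * pi\<^sup>2) ^ j * (4 * pi\<^sup>2) ^ r"
        using j by (simp only: r_def power_add[symmetric] le_add_diff_inverse)
      moreover have "(4 * pi\<^sup>2) * (4 / pi) = 16 * pi" by (simp add: power2_eq_square)
      then have "(16 * pi) ^ r = (4 * pi\<^sup>2) ^ r * (4 / pi) ^ r" by (simp only: power_mult_distrib[symmetric])
      moreover have "(pi / (4 * v)) ^ r = 1 / ((4 / pi) ^ r * v ^ r)"
        by (simp add: power_divide power_mult_distrib)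
      ultimately have "(4 * pi\<^sup>2) ^ j / (16 * pi * (4 * pi\<^sup>2) ^ m) * (pi / (4 * v)) ^ r = 1 / ((16 * pi) ^ (r + 1) * v ^ r)"
        by simp
      then have "((- 1) ^ m * (- 1) ^ j) * b * sqrt v * ((4 * pi\<^sup>2) ^ j / (16 * pi * (4 * pi\<^sup>2) ^ m) * (pi / (4 * v)) ^ r)
         = (- 1) ^ r * (b / (16 * pi) ^ (r + 1)) * (sqrt v / v ^ r)"
        unfolding sign by simp
      from arg_cong[OF this, of "\<lambda>x. complex_of_real (- x) * (\<theta> j \<nu> * T \<nu>)"]
      show ?thesis
        unfolding K b_def by (simp add: mult_ac)
    qed
    show "- 2 * \<i> * of_real (v\<^sup>2) * C * ((- 1) ^ j * of_nat ((2 * m + 1) choose (2 * j)) * \<theta> j \<nu> * q (m - j) \<nu>)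
      = K * (T \<nu> * (of_nat ((2 * m) choose (2 * j)) * ((- 1) ^ j * of_real ((4 * pi\<^sup>2) ^ j)
         * (D_op ^^ j) (theta_nu \<nu>) \<tau>) * of_real (fact (2 * (m - j)) / fact (m - j) * (pi / (4 * Im \<tau>)) ^ (m - j))))"
      unfolding r_def[symmetric] v_def[symmetric] th lhs rhs sb v2 by simp
  qed simp
  have T: "T (- 1) = cnj (theta1 (2 * \<tau>))" "T 0 = cnj (theta3 (2 * \<tau>))"
    by (simp_all add: T_def theta1_eq theta3_eq coset_shift_def)
  have "L_op (JJ_hat (2 * m + 2)) \<tau> = - of_bool (m = 0) / (8 * of_real pi)
     + K * (T (- 1) * theta_l_nu (2 * m + 1) (- 1) \<tau> + T 0 * theta_l_nu (2 * m + 1) 0 \<tau>)"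
    unfolding L delta using main[of "- 1"] main[of 0] by (simp add: distrib_left)
  moreover have "K = - (\<i> * of_nat (2 * m + 1) / (8 * (2 * of_real pi * \<i>) ^ (2 * m + 1)) * of_real (sqrt v))"
    by (simp only: K_def mult_minus_left minus_divide_left[symmetric])
  ultimately show ?thesis
    unfolding T v_def by (simp only: mult_minus_left add_uminus_conv_diff)
qed

subsection \<open>Transformation of the completed theta functions\<close>

text \<open>The Gaussian in w absorbs the factor exp (pi i w^2 / (2 tau)) of the inversion formula,
  so w transforms to w / (c tau + d) without an extra exponential.\<close>

definition theta_completed :: "real \<Rightarrow> complex \<Rightarrow> complex \<Rightarrow> complex" where
  "theta_completed h w \<tau> = gauss_theta 0 h (theta_exponent \<tau>) (2 * of_real pi * \<i> * w)
     * exp (of_real pi / (4 * of_real (Im \<tau>)) * w\<^sup>2)"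

lemma theta_l_nu_eq_completed:
  "theta_l_nu l \<nu> \<tau> = (deriv ^^ (l - 1)) (\<lambda>w. - theta_completed (coset_shift \<nu>) w \<tau>) 0"
  by (simp add: theta_l_nu_eq theta_completed_def)

lemma theta_completed_minus:
  assumes "h \<in> {0, 1/2}"
  shows "theta_completed h (- w) \<tau> = theta_completed h w \<tau>"
  using gauss_theta_minus[OF assms, of 0 "theta_exponent \<tau>" "2 * of_real pi * \<i> * w"]
  by (simp add: theta_completed_def)

lemma exp_two_pi_i_int: "exp (2 * of_real pi * \<i> * of_int n) = 1"
  using exp_integer_2pi[of "of_int n"] by (simp add: mult_ac)

text \<open>Translations act diagonally on the two cosets because (m + h)^2 - h^2 is an integer in
  either of them.\<close>

lemma theta_completed_translate:
  assumes "h \<in> {0, 1/2}"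
  shows "theta_completed h w (\<tau> + of_int n) = exp (2 * of_real pi * \<i> * of_real (h\<^sup>2) * of_int n) * theta_completed h w \<tau>"
proof -
  have "gauss_term 0 (of_int m + h) (theta_exponent (\<tau> + of_int n)) \<beta>
      = exp (2 * of_real pi * \<i> * of_real (h\<^sup>2) * of_int n) * gauss_term 0 (of_int m + h) (theta_exponent \<tau>) \<beta>" for m \<beta>
  proof -
    define k where "k = m\<^sup>2 + (if h = 0 then 0 else m)"
    have k: "complex_of_real (of_int m + h) ^ 2 = of_real (h\<^sup>2) + of_int k"
    proof (cases "h = 0")
      case False
      then have h: "h = 1 / 2" using assms by simp
      show ?thesis unfolding k_def h by (simp add: power2_eq_square field_simps)
    qed (simp add: k_def)
    have "gauss_term 0 (of_int m + h) (theta_exponent (\<tau> + of_int n)) \<beta>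
      = exp (2 * of_real pi * \<i> * of_int (n * k)) * (exp (2 * of_real pi * \<i> * of_real (h\<^sup>2) * of_int n)
        * gauss_term 0 (of_int m + h) (theta_exponent \<tau>) \<beta>)"
      unfolding gauss_term_def power_0 mult_1 exp_add[symmetric] k
      by (rule arg_cong[of _ _ exp]) (simp add: algebra_simps)
    then show ?thesis by (simp only: exp_two_pi_i_int mult_1)
  qed
  then have "gauss_theta 0 h (theta_exponent (\<tau> + of_int n)) \<beta>
      = exp (2 * of_real pi * \<i> * of_real (h\<^sup>2) * of_int n) * gauss_theta 0 h (theta_exponent \<tau>) \<beta>" for \<beta>
    unfolding gauss_theta_def by (simp only: infsum_cmult_right')
  then show ?thesis by (simp add: theta_completed_def)
qed

lemma infsum_int_parity:
  fixes f :: "int \<Rightarrow> complex"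
  assumes "(\<lambda>n. norm (f n)) summable_on UNIV"
  shows "(\<Sum>\<^sub>\<infinity>n. f n) = (\<Sum>\<^sub>\<infinity>n. f (2 * n)) + (\<Sum>\<^sub>\<infinity>n. f (2 * n + 1))"
proof -
  have f: "f summable_on A" for A
    using summable_on_subset_banach[OF abs_summable_summable[OF assms], of A] by simp
  have U: "(UNIV :: int set) = range (\<lambda>n. 2 * n) \<union> range (\<lambda>n. 2 * n + 1)"
    by (auto simp: image_iff) (metis evenE oddE)
  have "(\<Sum>\<^sub>\<infinity>n. f n) = infsum f (range (\<lambda>n. 2 * n)) + infsum f (range (\<lambda>n. 2 * n + 1))"
    by (subst U, rule infsum_Un_disjoint[OF f f]) (auto, presburger)
  then show ?thesis
    by (simp add: infsum_reindex inj_on_def o_def)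
qed

text \<open>Poisson summation at s = - i t / 2 and z = h - w / 2. Splitting the index by parity
  produces the two cosets, and the sign in front of the second is exp (2 pi i (2 n + 1) h).\<close>

lemma theta_completed_inversion:
  assumes t: "Im t > 0" and h: "h \<in> {0, 1/2}"
  shows "theta_completed h (w / t) (- 1 / t)
    = csqrt (- \<i> * t / 2) * (theta_completed 0 w t + (if h = 0 then 1 else - 1) * theta_completed (1/2) w t)"
proof -
  define s where "s = - \<i> * t / 2"
  define z where "z = of_real h - w / 2"
  have s: "Re s > 0" using t by (simp add: s_def)
  then have s0: "s \<noteq> 0" by auto
  have t0: "t \<noteq> 0" using t by auto
  let ?\<sigma> = "if h = 0 then 1 else - 1 :: complex"
  have alpha: "of_real pi * s = theta_exponent t / 4" "of_real pi / s = theta_exponent (- 1 / t)"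
    using t0 by (simp_all add: s_def field_simps)
  have par: "gauss_theta 0 0 (of_real pi * s) (2 * of_real pi * \<i> * z)
     = gauss_theta 0 0 (theta_exponent t) (- (2 * of_real pi * \<i> * w))
       + ?\<sigma> * gauss_theta 0 (1/2) (theta_exponent t) (- (2 * of_real pi * \<i> * w))"
  proof -
    have "Re (of_real pi * s) > 0" using s by simp
    from infsum_int_parity[OF gauss_term_abs_summable[OF this, of 0 0 "2 * of_real pi * \<i> * z"]]
    have "gauss_theta 0 0 (of_real pi * s) (2 * of_real pi * \<i> * z)
      = (\<Sum>\<^sub>\<infinity>n. gauss_term 0 (of_int (2 * n) + 0) (of_real pi * s) (2 * of_real pi * \<i> * z))
        + (\<Sum>\<^sub>\<infinity>n. gauss_term 0 (of_int (2 * n + 1) + 0) (of_real pi * s) (2 * of_real pi * \<i> * z))"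
      unfolding gauss_theta_def .
    moreover have "gauss_term 0 (of_int (2 * n) + 0) (of_real pi * s) (2 * of_real pi * \<i> * z)
       = gauss_term 0 (of_int n + 0) (theta_exponent t) (- (2 * of_real pi * \<i> * w))" for n
    proof -
      define k where "k = (if h = 0 then 0 else n)"
      have k: "2 * of_int n * complex_of_real h = of_int k"
      proof (cases "h = 0")
        case False
        then have h': "h = 1 / 2" using h by simp
        show ?thesis unfolding k_def h' by simp
      qed (simp add: k_def)
      have "gauss_term 0 (of_int (2 * n) + 0) (of_real pi * s) (2 * of_real pi * \<i> * z)
        = exp (2 * of_real pi * \<i> * (2 * of_int n * complex_of_real h)) * gauss_term 0 (of_int n + 0) (theta_exponent t) (- (2 * of_real pi * \<i> * w))"
        unfolding gauss_term_def power_0 mult_1 exp_add[symmetric] alpha z_def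
        by (rule arg_cong[of _ _ exp]) (simp add: algebra_simps power2_eq_square)
      then show ?thesis by (simp only: k exp_two_pi_i_int mult_1)
    qed
    moreover have "gauss_term 0 (of_int (2 * n + 1) + 0) (of_real pi * s) (2 * of_real pi * \<i> * z)
       = ?\<sigma> * gauss_term 0 (of_int n + 1/2) (theta_exponent t) (- (2 * of_real pi * \<i> * w))" for n
    proof -
      have e: "exp (2 * of_real pi * \<i> * ((2 * of_int n + 1) * complex_of_real h)) = ?\<sigma>"
      proof (cases "h = 0")
        case False
        then have h': "h = 1/2" using h by simp
        have "(2 * of_int n + 1) * complex_of_real h = of_real (of_int n + h)"
          unfolding h' by (simp add: field_simps)
        then show ?thesis using False by (simp only: exp_coset(1)[OF h] if_False)
      qed simp
      have "gauss_term 0 (of_int (2 * n + 1) + 0) (of_real pi * s) (2 * of_real pi * \<i> * z)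
        = exp (2 * of_real pi * \<i> * ((2 * of_int n + 1) * complex_of_real h)) * gauss_term 0 (of_int n + 1/2) (theta_exponent t) (- (2 * of_real pi * \<i> * w))"
        unfolding gauss_term_def power_0 mult_1 exp_add[symmetric] alpha z_def
        by (rule arg_cong[of _ _ exp]) (simp add: algebra_simps power2_eq_square)
      then show ?thesis unfolding e .
    qed
    ultimately show ?thesis
      unfolding gauss_theta_def by (simp only: infsum_cmult_right')
  qed
  define G where "G = gauss_theta 0 0 (of_real pi / s) (- 2 * of_real pi * z / s)"
  have inv: "gauss_theta 0 0 (of_real pi * s) (2 * of_real pi * \<i> * z) = exp (- of_real pi * z\<^sup>2 / s) / csqrt s * G"
    unfolding G_def using gauss_theta_inversion[OF s, of z] by simp
  have "gauss_theta 0 h (theta_exponent (- 1 / t)) (2 * of_real pi * \<i> * (w / t))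
     = exp (2 * of_real pi * \<i> * of_real h * (w - of_real h) / t) * G"
  proof -
    have "gauss_term 0 (of_int n + h) (theta_exponent (- 1 / t)) (2 * of_real pi * \<i> * (w / t))
       = exp (2 * of_real pi * \<i> * of_real h * (w - of_real h) / t) * gauss_term 0 (of_int n + 0) (of_real pi / s) (- 2 * of_real pi * z / s)" for n
    proof -
      have zs: "- 2 * of_real pi * z / s = (2 * of_real pi * \<i> / t) * (w - 2 * of_real h)"
        using t0 by (simp add: s_def z_def field_simps)
      show ?thesis
        unfolding gauss_term_def power_0 mult_1 exp_add[symmetric] zs alpha
        using t0 by (intro arg_cong[of _ _ exp]) (simp add: field_simps power2_eq_square)
    qed
    then show ?thesis unfolding G_def gauss_theta_def by (simp only: infsum_cmult_right')
  qed
  also have "G = csqrt s * exp (of_real pi * z\<^sup>2 / s) * gauss_theta 0 0 (of_real pi * s) (2 * of_real pi * \<i> * z)"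
    unfolding inv using s0 by (simp add: exp_minus)
  finally have "gauss_theta 0 h (theta_exponent (- 1 / t)) (2 * of_real pi * \<i> * (w / t))
     = csqrt s * (exp (2 * of_real pi * \<i> * of_real h * (w - of_real h) / t) * exp (of_real pi * z\<^sup>2 / s))
       * gauss_theta 0 0 (of_real pi * s) (2 * of_real pi * \<i> * z)" by (simp only: mult_ac)
  also have "exp (2 * of_real pi * \<i> * of_real h * (w - of_real h) / t) * exp (of_real pi * z\<^sup>2 / s)
     = exp (of_real pi * \<i> * w\<^sup>2 / (2 * t))"
    unfolding exp_add[symmetric] s_def z_def using t0
    by (intro arg_cong[of _ _ exp]) (simp add: field_simps power2_eq_square)
  finally have main: "gauss_theta 0 h (theta_exponent (- 1 / t)) (2 * of_real pi * \<i> * (w / t))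
     = csqrt s * exp (of_real pi * \<i> * w\<^sup>2 / (2 * t)) * gauss_theta 0 0 (of_real pi * s) (2 * of_real pi * \<i> * z)" .
  \<comment> \<open>Since cnj t = t - 2 i Im t, the exponential left by Poisson summation turns the
    completing factor at - 1 / t into the one at t.\<close>
  have "exp (of_real pi * \<i> * w\<^sup>2 / (2 * t)) * exp (of_real pi / (4 * of_real (Im (- 1 / t))) * (w / t)\<^sup>2)
     = exp (of_real pi / (4 * of_real (Im t)) * w\<^sup>2)"
  proof -
    have I: "complex_of_real (Im (- 1 / t)) = of_real (Im t) / (t * cnj t)"
      unfolding complex_norm_square[symmetric] by (simp add: Im_divide cmod_power2)
    have ct: "cnj t = t - 2 * \<i> * of_real (Im t)" by (simp add: complex_eq_iff)
    have "of_real pi * \<i> * w\<^sup>2 / (2 * t) + of_real pi * (t * cnj t) / (4 * of_real (Im t)) * (w / t)\<^sup>2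
        = of_real pi / (4 * of_real (Im t)) * w\<^sup>2"
      unfolding ct using t t0 by (simp add: field_simps power2_eq_square)
    then show ?thesis unfolding exp_add[symmetric] I by simp
  qed
  then have "theta_completed h (w / t) (- 1 / t) = csqrt s * exp (of_real pi / (4 * of_real (Im t)) * w\<^sup>2)
      * gauss_theta 0 0 (of_real pi * s) (2 * of_real pi * \<i> * z)"
    unfolding theta_completed_def main by (simp only: mult_ac)
  then show ?thesis
    unfolding par by (simp add: gauss_theta_minus[of 0] gauss_theta_minus[of "1/2"] theta_completed_def s_def algebra_simps)
qed

text \<open>Apart from a phase, the multiplier of a lattice shift depends only on (2 w cnj lam +
  |lam|^2) / v, which is unchanged when tau, w and lam are transformed together. Shifts at tau and
  at its image can thus be compared directly.\<close>

lemma theta_completed_shift: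
  assumes tau: "Im \<tau> > 0" and lam_def: "lam = of_int x * \<tau> + of_int y"
  shows "theta_completed h (w + lam) \<tau>
    = exp (of_real pi / (4 * of_real (Im \<tau>)) * (2 * w * cnj lam + lam * cnj lam))
      * exp (2 * of_real pi * \<i> * of_int y * (of_real h + of_int x / 4)) * theta_completed (h + of_int x / 2) w \<tau>"
proof -
  define K where "K = complex_of_real pi / (4 * of_real (Im \<tau>))"
  define A where "A = - (of_real pi * \<i> * \<tau> * (of_int x)\<^sup>2 / 2) - of_real pi * \<i> * of_int x * w
     + 2 * of_real pi * \<i> * of_int y * of_real h"
  have "gauss_term 0 (of_int n + h) (theta_exponent \<tau>) (2 * of_real pi * \<i> * (w + lam))
      = exp A * gauss_term 0 (of_int n + (h + of_int x / 2)) (theta_exponent \<tau>) (2 * of_real pi * \<i> * w)" for n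
  proof -
    have "gauss_term 0 (of_int n + h) (theta_exponent \<tau>) (2 * of_real pi * \<i> * (w + lam))
      = exp (2 * of_real pi * \<i> * of_int (y * n)) * (exp A * gauss_term 0 (of_int n + (h + of_int x / 2)) (theta_exponent \<tau>) (2 * of_real pi * \<i> * w))"
      unfolding gauss_term_def power_0 mult_1 exp_add[symmetric] A_def lam_def
      by (rule arg_cong[of _ _ exp]) (simp add: field_simps power2_eq_square)
    then show ?thesis by (simp only: exp_two_pi_i_int mult_1)
  qed
  then have g: "gauss_theta 0 h (theta_exponent \<tau>) (2 * of_real pi * \<i> * (w + lam))
     = exp A * gauss_theta 0 (h + of_int x / 2) (theta_exponent \<tau>) (2 * of_real pi * \<i> * w)"
    unfolding gauss_theta_def by (simp only: infsum_cmult_right')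
  have cnj: "cnj lam = lam - 2 * \<i> * of_int x * of_real (Im \<tau>)" by (simp add: lam_def complex_eq_iff)
  have Kv: "K * (of_real (Im \<tau>) * z) = of_real pi * z / 4" for z using tau by (simp add: K_def)
  have e1: "of_real pi * (2 * \<i> * of_int x * (2 * w + lam)) / 4 = of_real pi * \<i> * of_int x * w + of_real pi * \<i> * of_int x * lam / 2"
    by (simp add: field_simps)
  have "K * (2 * w * cnj lam + lam * cnj lam) = K * (2 * w * lam + lam\<^sup>2) - K * (of_real (Im \<tau>) * (2 * \<i> * of_int x * (2 * w + lam)))"
    unfolding cnj by (simp add: algebra_simps power2_eq_square)
  also have "\<dots> = K * (2 * w * lam + lam\<^sup>2) - of_real pi * \<i> * of_int x * w - of_real pi * \<i> * of_int x * lam / 2"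
    unfolding Kv e1 by (simp only: diff_diff_eq)
  finally have N: "K * (2 * w * cnj lam + lam * cnj lam)
     = K * (2 * w * lam + lam\<^sup>2) - of_real pi * \<i> * of_int x * w - of_real pi * \<i> * of_int x * lam / 2" .
  have "A = 2 * of_real pi * \<i> * of_int y * (of_real h + of_int x / 4) - of_real pi * \<i> * of_int x * w - of_real pi * \<i> * of_int x * lam / 2"
    unfolding A_def lam_def by (simp add: field_simps power2_eq_square)
  moreover have "K * (w + lam)\<^sup>2 = K * (2 * w * lam + lam\<^sup>2) + K * w\<^sup>2"
    by (simp add: algebra_simps power2_eq_square)
  ultimately have "A + K * (w + lam)\<^sup>2 = K * (2 * w * cnj lam + lam * cnj lam)
     + 2 * of_real pi * \<i> * of_int y * (of_real h + of_int x / 4) + K * w\<^sup>2"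
    unfolding N by simp
  then have e: "exp A * exp (K * (w + lam)\<^sup>2) = exp (K * (2 * w * cnj lam + lam * cnj lam))
     * exp (2 * of_real pi * \<i> * of_int y * (of_real h + of_int x / 4)) * exp (K * w\<^sup>2)"
    unfolding exp_add[symmetric] by (rule arg_cong[of _ _ exp])
  have "theta_completed h (w + lam) \<tau> = exp A * exp (K * (w + lam)\<^sup>2) * gauss_theta 0 (h + of_int x / 2) (theta_exponent \<tau>) (2 * of_real pi * \<i> * w)"
    unfolding theta_completed_def g K_def by (simp only: mult_ac)
  then show ?thesis unfolding e unfolding theta_completed_def K_def by (simp only: mult_ac)
qed

section \<open>Square roots of automorphy factors and the action of the modular group\<close>

lemma continuous_on_csqrt_linear:
  "continuous_on upper_half_plane (\<lambda>\<tau>. csqrt (of_int c * \<tau> + of_int d))"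
proof (cases "c = 0")
  case False
  show ?thesis
    by (rule continuous_on_compose2[OF continuous_on_csqrt])
      (use False in \<open>auto intro!: continuous_intros simp: complex_nonpos_Reals_iff\<close>)
qed simp

text \<open>A continuous quotient with values in {1, - 1} is constant on a connected set. Cocycle
  relations between principal roots follow from their squares, without any discussion of
  arguments.\<close>

lemma continuous_square_eq_imp_sign:
  fixes f g :: "complex \<Rightarrow> complex"
  assumes "connected S" "continuous_on S f" "continuous_on S g"
    and sq: "\<And>z. z \<in> S \<Longrightarrow> (f z)\<^sup>2 = (g z)\<^sup>2" and nz: "\<And>z. z \<in> S \<Longrightarrow> g z \<noteq> 0"
  shows "\<exists>\<epsilon>\<in>{1, - 1}. \<forall>z\<in>S. f z = \<epsilon> * g z"
proof (cases "S = {}")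
  case False
  have r: "f z / g z \<in> {1, - 1}" if "z \<in> S" for z
    using sq[OF that] nz[OF that] by (auto simp: power2_eq_iff)
  have "(\<lambda>z. f z / g z) ` S \<subseteq> {1, - 1}" using r by blast
  then have fin: "finite ((\<lambda>z. f z / g z) ` S)" by (rule finite_subset) simp
  have "(\<lambda>z. f z / g z) constant_on S"
    by (rule continuous_finite_range_constant[OF assms(1)])
      (use assms(2,3) nz fin in \<open>auto intro!: continuous_intros\<close>)
  then obtain \<epsilon> where \<epsilon>: "\<And>z. z \<in> S \<Longrightarrow> f z / g z = \<epsilon>" by (auto simp: constant_on_def)
  show ?thesis
    by (rule bexI[of _ \<epsilon>]) (use \<epsilon> nz r False in \<open>auto simp: field_simps\<close>)
qed auto

lemma connected_upper_half_plane: "connected upper_half_plane"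
  by (intro convex_connected convex_halfspace_Im_gt)

text \<open>Euclid's algorithm on the bottom row: induction on |c|, with c = 0 as the base and one
  translation and inversion per step. The modulus of the determinant is carried along because it
  later shows that the scalar attached to an element of Gamma(4) has modulus 1.\<close>

lemma theta_completed_modular:
  assumes "a * d - b * c = 1"
  shows "\<exists>p q r s. norm (p * s - q * r) = 1 \<and> (\<forall>\<tau>\<in>upper_half_plane. \<forall>w.
     theta_completed 0 (w / (of_int c * \<tau> + of_int d)) ((of_int a * \<tau> + of_int b) / (of_int c * \<tau> + of_int d))
       = csqrt (of_int c * \<tau> + of_int d) * (p * theta_completed 0 w \<tau> + q * theta_completed (1/2) w \<tau>) \<and>
     theta_completed (1/2) (w / (of_int c * \<tau> + of_int d)) ((of_int a * \<tau> + of_int b) / (of_int c * \<tau> + of_int d))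
       = csqrt (of_int c * \<tau> + of_int d) * (r * theta_completed 0 w \<tau> + s * theta_completed (1/2) w \<tau>))"
  using assms
proof (induction "nat \<bar>c\<bar>" arbitrary: a b c d rule: less_induct)
  case less
  show ?case
  proof (cases "c = 0")
    case True
    \<comment> \<open>If c = 0 then d is 1 or - 1, and for d = - 1 the principal root is i; dividing
      by \<open>\<mu>\<close> compensates for it.\<close>
    define \<mu> where "\<mu> = csqrt (of_int d)"
    define e where "e = exp (2 * of_real pi * \<i> * of_real ((1/2)\<^sup>2) * of_int (b * d))"
    have "a * d = 1" using less.prems True by simp
    then have ad: "a = d" "d = 1 \<or> d = - 1" by (auto simp: zmult_eq_1_iff)
    have "norm \<mu> = 1" "\<mu> \<noteq> 0" using ad(2) by (auto simp: \<mu>_def)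
    moreover have "norm e = 1" unfolding e_def norm_exp_eq_Re by simp
    ultimately have n: "norm (1 / \<mu> * (e / \<mu>) - 0 * 0) = 1" by (simp add: norm_divide norm_mult)
    have t: "(of_int a * \<tau> + of_int b) / (of_int c * \<tau> + of_int d) = \<tau> + of_int (b * d)" for \<tau> :: complex
      using ad True by auto
    have w: "theta_completed h (w / (of_int c * \<tau> + of_int d)) \<sigma> = theta_completed h w \<sigma>" if "h \<in> {0, 1/2}" for h w \<tau> \<sigma>
      using theta_completed_minus[OF that] ad True by auto
    have base: "theta_completed h (w / (of_int c * \<tau> + of_int d)) ((of_int a * \<tau> + of_int b) / (of_int c * \<tau> + of_int d))
       = csqrt (of_int c * \<tau> + of_int d) * (exp (2 * of_real pi * \<i> * of_real (h\<^sup>2) * of_int (b * d)) / \<mu> * theta_completed h w \<tau>)"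
      if "h \<in> {0, 1/2}" for h w \<tau>
      unfolding w[OF that] t theta_completed_translate[OF that] using \<open>\<mu> \<noteq> 0\<close> by (simp add: \<mu>_def True)
    show ?thesis
    proof (intro exI conjI ballI allI)
      show "norm (1 / \<mu> * (e / \<mu>) - 0 * 0) = 1" by (fact n)
    qed (subst base; simp add: e_def)+
  next
    case False
    \<comment> \<open>The matrix factors as (- b', a; - d', c) times the inversion times the
      translation by n. As d' is the remainder of d modulo c, the lower left entry of the first
      factor is smaller than c in absolute value.\<close>
    define n where "n = d div c"
    define b' d' where "b' = b - n * a" and "d' = d - n * c"
    have d': "d' = d mod c" by (simp add: d'_def n_def minus_div_mult_eq_mod)
    have lt: "nat \<bar>- d'\<bar> < nat \<bar>c\<bar>" unfolding d' using False abs_mod_less[of c d] by simp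
    have "(- b') * c - a * (- d') = 1"
      using less.prems by (simp add: b'_def d'_def algebra_simps)
    from less.hyps[OF lt this] obtain p q r s where det: "norm (p * s - q * r) = 1"
      and IH: "\<And>\<sigma> w. \<sigma> \<in> upper_half_plane \<Longrightarrow>
         theta_completed 0 (w / (of_int (- d') * \<sigma> + of_int c)) ((of_int (- b') * \<sigma> + of_int a) / (of_int (- d') * \<sigma> + of_int c))
           = csqrt (of_int (- d') * \<sigma> + of_int c) * (p * theta_completed 0 w \<sigma> + q * theta_completed (1/2) w \<sigma>)"
        "\<And>\<sigma> w. \<sigma> \<in> upper_half_plane \<Longrightarrow>
         theta_completed (1/2) (w / (of_int (- d') * \<sigma> + of_int c)) ((of_int (- b') * \<sigma> + of_int a) / (of_int (- d') * \<sigma> + of_int c))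
           = csqrt (of_int (- d') * \<sigma> + of_int c) * (r * theta_completed 0 w \<sigma> + s * theta_completed (1/2) w \<sigma>)"
      by blast
    define \<sigma> :: "complex \<Rightarrow> complex" where "\<sigma> = (\<lambda>\<tau>. - 1 / (\<tau> + of_int n))"
    have \<sigma>: "\<sigma> \<tau> \<in> upper_half_plane" if "\<tau> \<in> upper_half_plane" for \<tau>
    proof -
      have "(Re \<tau> + of_int n)\<^sup>2 + (Im \<tau>)\<^sup>2 > 0" using that by (intro add_nonneg_pos) auto
      then show ?thesis using that by (simp add: \<sigma>_def Im_divide)
    qed
    have nz: "\<tau> + of_int n \<noteq> 0" "of_int c * \<tau> + of_int d \<noteq> 0" if "\<tau> \<in> upper_half_plane" for \<tau> :: complex
      using linear_ne_0[of \<tau> 1 n] linear_ne_0[of \<tau> c d] that False by auto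
    have j: "of_int (- d') * \<sigma> \<tau> + of_int c = (of_int c * \<tau> + of_int d) / (\<tau> + of_int n)" if "\<tau> \<in> upper_half_plane" for \<tau>
      using nz[OF that] by (simp add: \<sigma>_def d'_def field_simps)
    have jb: "of_int (- b') * \<sigma> \<tau> + of_int a = (of_int a * \<tau> + of_int b) / (\<tau> + of_int n)" if "\<tau> \<in> upper_half_plane" for \<tau>
      using nz[OF that] by (simp add: \<sigma>_def b'_def field_simps)
    \<comment> \<open>This constant relates the root csqrt (- i t / 2) of the inversion to csqrt t.
      Its square has modulus 1/2, which balances the determinant - 2 of the matrix with rows (1, 1)
      and (1, - 1).\<close>
    define \<kappa> where "\<kappa> = csqrt (- \<i> / 2)"
    have "\<exists>\<epsilon>\<in>{1, - 1}. \<forall>\<tau>\<in>upper_half_plane. csqrt (of_int (- d') * \<sigma> \<tau> + of_int c) * csqrt (- \<i> * (\<tau> + of_int n) / 2)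
       = \<epsilon> * (\<kappa> * csqrt (of_int c * \<tau> + of_int d))"
    proof (rule continuous_square_eq_imp_sign[OF connected_upper_half_plane])
      have "continuous_on upper_half_plane \<sigma>"
        unfolding \<sigma>_def by (intro continuous_intros) (use nz in auto)
      then have "continuous_on upper_half_plane (\<lambda>\<tau>. csqrt (of_int (- d') * \<sigma> \<tau> + of_int c))"
        by (rule continuous_on_compose2[OF continuous_on_csqrt_linear]) (use \<sigma> in auto)
      moreover have "continuous_on upper_half_plane (\<lambda>\<tau>. csqrt (- \<i> * (\<tau> + of_int n) / 2))"
        by (rule continuous_on_compose2[OF continuous_on_csqrt])
          (auto intro!: continuous_intros simp: complex_nonpos_Reals_iff)
      ultimately show "continuous_on upper_half_plane (\<lambda>\<tau>. csqrt (of_int (- d') * \<sigma> \<tau> + of_int c) * csqrt (- \<i> * (\<tau> + of_int n) / 2))"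
        by (rule continuous_on_mult)
      show "continuous_on upper_half_plane (\<lambda>\<tau>. \<kappa> * csqrt (of_int c * \<tau> + of_int d))"
        by (intro continuous_on_mult continuous_on_const continuous_on_csqrt_linear)
    next
      fix \<tau> :: complex assume tau: "\<tau> \<in> upper_half_plane"
      show "(csqrt (of_int (- d') * \<sigma> \<tau> + of_int c) * csqrt (- \<i> * (\<tau> + of_int n) / 2))\<^sup>2 = (\<kappa> * csqrt (of_int c * \<tau> + of_int d))\<^sup>2"
        unfolding power_mult_distrib power2_csqrt \<kappa>_def j[OF tau] using nz(1)[OF tau] by simp
      show "\<kappa> * csqrt (of_int c * \<tau> + of_int d) \<noteq> 0" using nz[OF tau] by (simp add: \<kappa>_def)
    qed
    then obtain \<epsilon> where \<epsilon>: "\<epsilon> \<in> {1, - 1}" and cocycle: "\<And>\<tau>. \<tau> \<in> upper_half_plane \<Longrightarrow>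
        csqrt (of_int (- d') * \<sigma> \<tau> + of_int c) * csqrt (- \<i> * (\<tau> + of_int n) / 2) = \<epsilon> * (\<kappa> * csqrt (of_int c * \<tau> + of_int d))"
      by blast
    define e where "e = exp (2 * of_real pi * \<i> * of_real ((1/2)\<^sup>2) * of_int n)"
    have inv: "theta_completed h (w / (\<tau> + of_int n)) (\<sigma> \<tau>) = csqrt (- \<i> * (\<tau> + of_int n) / 2)
        * (theta_completed 0 w \<tau> + (if h = 0 then 1 else - 1) * (e * theta_completed (1/2) w \<tau>))"
      if "\<tau> \<in> upper_half_plane" "h \<in> {0, 1/2}" for \<tau> w h
      unfolding \<sigma>_def using that
      by (subst theta_completed_inversion) (simp_all add: theta_completed_translate e_def)
    have args: "theta_completed h (w / (of_int c * \<tau> + of_int d)) ((of_int a * \<tau> + of_int b) / (of_int c * \<tau> + of_int d))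
      = theta_completed h (w / (\<tau> + of_int n) / (of_int (- d') * \<sigma> \<tau> + of_int c)) ((of_int (- b') * \<sigma> \<tau> + of_int a) / (of_int (- d') * \<sigma> \<tau> + of_int c))"
      if "\<tau> \<in> upper_half_plane" for \<tau> w h
    proof -
      have "x / (\<tau> + of_int n) / (y / (\<tau> + of_int n)) = x / y" for x y using nz(1)[OF that] by simp
      then show ?thesis unfolding j[OF that] jb[OF that] by (simp only:)
    qed
    have step: "csqrt (of_int (- d') * \<sigma> \<tau> + of_int c) * (x * theta_completed 0 (w / (\<tau> + of_int n)) (\<sigma> \<tau>) + y * theta_completed (1/2) (w / (\<tau> + of_int n)) (\<sigma> \<tau>))
       = csqrt (of_int c * \<tau> + of_int d) * (\<epsilon> * \<kappa> * (x + y) * theta_completed 0 w \<tau> + \<epsilon> * \<kappa> * e * (x - y) * theta_completed (1/2) w \<tau>)"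
      if "\<tau> \<in> upper_half_plane" for \<tau> w x y
    proof -
      let ?C = "csqrt (- \<i> * (\<tau> + of_int n) / 2)"
      have i0: "theta_completed 0 (w / (\<tau> + of_int n)) (\<sigma> \<tau>) = ?C * (theta_completed 0 w \<tau> + e * theta_completed (1/2) w \<tau>)"
        using inv[OF that, of 0 w] by simp
      have i1: "theta_completed (1/2) (w / (\<tau> + of_int n)) (\<sigma> \<tau>) = ?C * (theta_completed 0 w \<tau> - e * theta_completed (1/2) w \<tau>)"
        using inv[OF that, of "1/2" w] by simp
      have "csqrt (of_int (- d') * \<sigma> \<tau> + of_int c) * (x * theta_completed 0 (w / (\<tau> + of_int n)) (\<sigma> \<tau>) + y * theta_completed (1/2) (w / (\<tau> + of_int n)) (\<sigma> \<tau>))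
        = (csqrt (of_int (- d') * \<sigma> \<tau> + of_int c) * csqrt (- \<i> * (\<tau> + of_int n) / 2))
           * ((x + y) * theta_completed 0 w \<tau> + e * (x - y) * theta_completed (1/2) w \<tau>)"
        unfolding i0 i1 by (simp add: algebra_simps)
      then show ?thesis unfolding cocycle[OF that] by (simp add: algebra_simps)
    qed
    have "norm \<epsilon> = 1" using \<epsilon> by auto
    moreover have "norm e = 1" unfolding e_def norm_exp_eq_Re by simp
    moreover have "norm (\<kappa> * \<kappa>) = 1 / 2" unfolding \<kappa>_def power2_eq_square[symmetric] power2_csqrt by simp
    moreover have "(\<epsilon> * \<kappa> * (p + q)) * (\<epsilon> * \<kappa> * e * (r - s)) - (\<epsilon> * \<kappa> * e * (p - q)) * (\<epsilon> * \<kappa> * (r + s))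
       = \<epsilon> * \<epsilon> * (\<kappa> * \<kappa>) * e * (- 2) * (p * s - q * r)" by (simp add: algebra_simps)
    ultimately have "norm ((\<epsilon> * \<kappa> * (p + q)) * (\<epsilon> * \<kappa> * e * (r - s)) - (\<epsilon> * \<kappa> * e * (p - q)) * (\<epsilon> * \<kappa> * (r + s))) = 1"
      using det by (simp add: norm_mult)
    moreover have "theta_completed 0 (w / (of_int c * \<tau> + of_int d)) ((of_int a * \<tau> + of_int b) / (of_int c * \<tau> + of_int d))
       = csqrt (of_int c * \<tau> + of_int d) * (\<epsilon> * \<kappa> * (p + q) * theta_completed 0 w \<tau> + \<epsilon> * \<kappa> * e * (p - q) * theta_completed (1/2) w \<tau>)"
      "theta_completed (1/2) (w / (of_int c * \<tau> + of_int d)) ((of_int a * \<tau> + of_int b) / (of_int c * \<tau> + of_int d))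
       = csqrt (of_int c * \<tau> + of_int d) * (\<epsilon> * \<kappa> * (r + s) * theta_completed 0 w \<tau> + \<epsilon> * \<kappa> * e * (r - s) * theta_completed (1/2) w \<tau>)"
      if "\<tau> \<in> upper_half_plane" for \<tau> w
      unfolding args[OF that] IH[OF \<sigma>[OF that]] step[OF that] by (rule refl)+
    ultimately show ?thesis by blast
  qed
qed

text \<open>At tau = i and w = 0 all summands are positive reals. A point where the theta functions
  do not vanish is what permits coefficients to be compared.\<close>

lemma theta_completed_i_ne_0: "theta_completed h 0 \<i> \<noteq> 0"
proof -
  define f where "f = (\<lambda>n::int. gauss_term 0 (of_int n + h) (theta_exponent \<i>) 0)"
  have f: "f n = of_real (exp (- (2 * pi * (of_int n + h)\<^sup>2)))" for n
    by (simp add: f_def gauss_term_def mult.assoc flip: exp_of_real)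
  have "(f has_sum gauss_theta 0 h (theta_exponent \<i>) 0) UNIV"
    unfolding f_def by (rule gauss_theta_has_sum) simp
  then have s: "((\<lambda>n. Re (f n)) has_sum Re (gauss_theta 0 h (theta_exponent \<i>) 0)) UNIV"
    by (rule has_sum_Re)
  have "sum (\<lambda>n. Re (f n)) {0} \<le> Re (gauss_theta 0 h (theta_exponent \<i>) 0)"
    by (rule finite_sum_le_has_sum[OF s]) (auto simp: f)
  moreover have "sum (\<lambda>n. Re (f n)) {0} > 0" by (simp add: f)
  ultimately have "Re (gauss_theta 0 h (theta_exponent \<i>) 0) > 0" by linarith
  then show ?thesis by (auto simp: theta_completed_def)
qed

lemma theta_completed_add_int: "theta_completed (h + of_int k) w \<tau> = theta_completed h w \<tau>"
  by (simp add: theta_completed_def gauss_theta_add_int)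

text \<open>The shifts \<open>w \<mapsto> w + 1\<close> and \<open>w \<mapsto> w + \<tau>\<close> act on the pair of theta functions by Pauli matrices. An
  element of \<open>\<Gamma>(4)\<close> carries them to shifts acting by the same matrices, so its transformation
  matrix commutes with both and is scalar.\<close>

lemma theta_completed_modular_scalar:
  assumes det: "a * d - b * c = 1" and c: "4 dvd c" and b: "4 dvd b"
  shows "\<exists>p. norm p = 1 \<and> (\<forall>h\<in>{0, 1/2}. \<forall>\<tau>\<in>upper_half_plane. \<forall>w.
     theta_completed h (w / (of_int c * \<tau> + of_int d)) ((of_int a * \<tau> + of_int b) / (of_int c * \<tau> + of_int d))
       = csqrt (of_int c * \<tau> + of_int d) * (p * theta_completed h w \<tau>))"
proof -
  from theta_completed_modular[OF det] obtain p q r s where n: "norm (p * s - q * r) = 1"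
    and M0: "\<And>\<tau> w. \<tau> \<in> upper_half_plane \<Longrightarrow>
      theta_completed 0 (w / (of_int c * \<tau> + of_int d)) ((of_int a * \<tau> + of_int b) / (of_int c * \<tau> + of_int d))
       = csqrt (of_int c * \<tau> + of_int d) * (p * theta_completed 0 w \<tau> + q * theta_completed (1/2) w \<tau>)"
    and M1: "\<And>\<tau> w. \<tau> \<in> upper_half_plane \<Longrightarrow>
      theta_completed (1/2) (w / (of_int c * \<tau> + of_int d)) ((of_int a * \<tau> + of_int b) / (of_int c * \<tau> + of_int d))
       = csqrt (of_int c * \<tau> + of_int d) * (r * theta_completed 0 w \<tau> + s * theta_completed (1/2) w \<tau>)"
    by blast
  define j where "j = of_int c * \<i> + complex_of_int d"
  define \<sigma> where "\<sigma> = (of_int a * \<i> + of_int b) / j"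
  define T where "T = (\<lambda>h. theta_completed h 0 \<i>)"
  have T: "T h \<noteq> 0" for h by (simp add: T_def theta_completed_i_ne_0)
  have "c \<noteq> 0 \<or> d \<noteq> 0" using det by auto
  then have j: "j \<noteq> 0" unfolding j_def by (intro linear_ne_0) auto
  have Im\<sigma>: "Im \<sigma> = 1 / (norm j)\<^sup>2" using Im_moebius_int[OF _ det, of \<i>] by (simp add: \<sigma>_def j_def)
  have \<sigma>: "Im \<sigma> > 0" unfolding Im\<sigma> using j by simp
  \<comment> \<open>Since Im sigma = 1 / |j|^2, the quotient |l / j|^2 / Im sigma is |l|^2: the
    shift by l at i and the shift by l / j at sigma carry the same factor.\<close>
  define N where "N = (\<lambda>l. exp (of_real pi / 4 * (l * cnj l)))"
  have N: "N l \<noteq> 0" for l by (simp add: N_def)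
  have I: "complex_of_real (Im \<sigma>) = 1 / (j * cnj j)"
    unfolding Im\<sigma> complex_norm_square[symmetric] by simp
  have N\<sigma>: "exp (of_real pi / (4 * of_real (Im \<sigma>)) * (2 * 0 * cnj (l / j) + (l / j) * cnj (l / j))) = N l" for l
  proof -
    have "of_real pi / (4 * of_real (Im \<sigma>)) * (2 * 0 * cnj (l / j) + (l / j) * cnj (l / j)) = of_real pi / 4 * (l * cnj l)"
      unfolding I using j by (simp add: field_simps)
    then show ?thesis unfolding N_def by (rule arg_cong[of _ _ exp])
  qed
  have "even b" using b by (rule dvd_trans[rotated]) simp
  moreover have "a * d = 1 + b * c" using det by simp
  ultimately have "odd (a * d)" by simp
  then have "odd a" "odd d" by simp_all
  then obtain a' d' where ad: "a = 2 * a' + 1" "d = 2 * d' + 1" by (auto elim!: oddE)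
  obtain b' c' where bc: "b = 4 * b'" "c = 4 * c'" using b c by (auto elim!: dvdE)
  define sg where "sg = (\<lambda>h::real. if h = 0 then 1 else - 1 :: complex)"
  have one: "theta_completed h (0 + 1) \<i> = N 1 * sg h * T h" if h: "h \<in> {0, 1/2}" for h
  proof -
    have "exp (2 * of_real pi * \<i> * of_int 1 * (of_real h + of_int 0 / 4)) = sg h"
      using exp_coset(1)[OF h, of 0] by (simp add: sg_def)
    then show ?thesis
      using theta_completed_shift[of \<i> 1 0 1 h 0] by (simp add: N_def T_def)
  qed
  have tau: "theta_completed h (0 + \<i>) \<i> = N \<i> * T (h + 1/2)" for h
    using theta_completed_shift[of \<i> \<i> 1 0 h 0] by (simp add: N_def T_def)
  have one': "theta_completed h (0 + 1 / j) \<sigma> = N 1 * sg h * theta_completed h 0 \<sigma>" if h: "h \<in> {0, 1/2}" for h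
  proof -
    have l: "1 / j = of_int (- c) * \<sigma> + of_int a"
    proof -
      have "of_int a * j - of_int c * (of_int a * \<i> + of_int b) = complex_of_int (a * d - b * c)"
        by (simp add: j_def algebra_simps)
      then show ?thesis unfolding det \<sigma>_def using j by (simp add: field_simps)
    qed
    have "of_int a * (of_real h + of_int (- c) / 4) = complex_of_real (of_int ((if h = 0 then 0 else a') - a * c') + h)"
    proof (cases "h = 0")
      case False
      then have h': "h = 1/2" using h by simp
      show ?thesis unfolding h' by (simp add: ad(1) bc field_simps)
    qed (simp add: bc)
    then have e: "exp (2 * of_real pi * \<i> * of_int a * (of_real h + of_int (- c) / 4)) = sg h"
      unfolding mult.assoc[of _ "of_int a"] by (simp only: exp_coset(1)[OF h] sg_def)
    have "h + of_int (- c) / 2 = h + of_int (- 2 * c')" by (simp add: bc)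
    then show ?thesis
      using theta_completed_shift[OF \<sigma> l, of h 0] unfolding e N\<sigma> by (simp only: theta_completed_add_int)
  qed
  \<comment> \<open>The number i / j has coordinates (d, - b) at sigma. The odd d exchanges the
    cosets, and the phase - b d / 4 is an integer because 4 divides b.\<close>
  have tau': "theta_completed 0 (0 + \<i> / j) \<sigma> = N \<i> * theta_completed (1/2) 0 \<sigma>"
  proof -
    have l: "\<i> / j = of_int d * \<sigma> + of_int (- b)"
    proof -
      have "of_int d * (of_int a * \<i> + of_int b) - of_int b * j = complex_of_int (a * d - b * c) * \<i>"
        by (simp add: j_def algebra_simps)
      then show ?thesis unfolding det \<sigma>_def using j by (simp add: field_simps)
    qed
    have "of_int (- b) * (of_real 0 + of_int d / 4) = complex_of_int (- b' * d)"
      by (simp add: bc)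
    then have e: "exp (2 * of_real pi * \<i> * of_int (- b) * (of_real 0 + of_int d / 4)) = 1"
      unfolding mult.assoc[of _ "of_int (- b)"] by (simp only: exp_two_pi_i_int)
    have "0 + of_int d / 2 = 1/2 + real_of_int d'" by (simp add: ad field_simps)
    then show ?thesis
      using theta_completed_shift[OF \<sigma> l, of 0 0] unfolding e N\<sigma> by (simp only: theta_completed_add_int mult_1_right)
  qed
  define \<mu> where "\<mu> = csqrt j"
  have \<mu>: "\<mu> \<noteq> 0" using j by (simp add: \<mu>_def)
  have A0: "theta_completed 0 (w / j) \<sigma> = \<mu> * (p * theta_completed 0 w \<i> + q * theta_completed (1/2) w \<i>)"
    and A1: "theta_completed (1/2) (w / j) \<sigma> = \<mu> * (r * theta_completed 0 w \<i> + s * theta_completed (1/2) w \<i>)" for w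
    using M0[of \<i> w] M1[of \<i> w] by (simp_all add: j_def \<sigma>_def \<mu>_def)
  \<comment> \<open>The shift by 1 acts on the two cosets with opposite signs, and in the same way
    at i and at sigma, so no off-diagonal entry can mix them.\<close>
  have q: "q = 0"
  proof -
    have "N 1 * theta_completed 0 0 \<sigma> = \<mu> * (p * (N 1 * T 0) + q * (N 1 * (- 1) * T (1/2)))"
      using A0[of 1] one'[of 0] one[of 0] one[of "1/2"] by (simp add: sg_def)
    also have "theta_completed 0 0 \<sigma> = \<mu> * (p * T 0 + q * T (1/2))"
      using A0[of 0] by (simp add: T_def)
    finally have "2 * (N 1 * \<mu> * T (1/2)) * q = 0" by (simp add: algebra_simps)
    then show ?thesis using N[of 1] \<mu> T[of "1/2"] by simp
  qed
  have r: "r = 0"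
  proof -
    have "N 1 * (- 1) * theta_completed (1/2) 0 \<sigma> = \<mu> * (r * (N 1 * T 0) + s * (N 1 * (- 1) * T (1/2)))"
      using A1[of 1] one'[of "1/2"] one[of 0] one[of "1/2"] by (simp add: sg_def)
    also have "theta_completed (1/2) 0 \<sigma> = \<mu> * (r * T 0 + s * T (1/2))"
      using A1[of 0] by (simp add: T_def)
    finally have "2 * (N 1 * \<mu> * T 0) * r = 0" by (simp add: algebra_simps)
    then show ?thesis using N[of 1] \<mu> T[of 0] by simp
  qed
  \<comment> \<open>The shift by i exchanges the two cosets at both points and so identifies the
    diagonal entries.\<close>
  have s: "s = p"
  proof -
    have "N \<i> * theta_completed (1/2) 0 \<sigma> = \<mu> * (p * (N \<i> * T (1/2)))"
    proof -
      have "N \<i> * theta_completed (1/2) 0 \<sigma> = theta_completed 0 (\<i> / j) \<sigma>" using tau' by simp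
      also have "\<dots> = \<mu> * (p * theta_completed 0 \<i> \<i>)" using A0[of \<i>] by (simp add: q)
      also have "theta_completed 0 \<i> \<i> = N \<i> * T (1/2)" using tau[of 0] by simp
      finally show ?thesis .
    qed
    also have "theta_completed (1/2) 0 \<sigma> = \<mu> * (s * T (1/2))"
      using A1[of 0] by (simp add: T_def r)
    finally have "(N \<i> * \<mu> * T (1/2)) * s = (N \<i> * \<mu> * T (1/2)) * p" by (simp only: mult_ac)
    then show ?thesis using N[of \<i>] \<mu> T[of "1/2"] by simp
  qed
  have "(norm p)\<^sup>2 = 1" using n by (simp add: q s norm_mult power2_eq_square)
  then have "norm p = 1" by (simp add: power2_eq_1_iff) (smt (verit) norm_ge_zero)
  then show ?thesis using M0 M1 by (intro exI[of _ p]) (auto simp: q r s)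
qed

subsection \<open>Congruence subgroups and multipliers\<close>

lemma SL2Z_carrier_iff: "A \<in> carrier SL2Z \<longleftrightarrow> A $ 1 $ 1 * A $ 2 $ 2 - A $ 1 $ 2 * A $ 2 $ 1 = 1"
  by (simp add: SL2Z_def det_2)

lemma matrix_mult_2_entries:
  fixes A B :: "int ^ 2 ^ 2"
  shows "(A ** B) $ i $ k = A $ i $ 1 * B $ 1 $ k + A $ i $ 2 * B $ 2 $ k"
  by (simp add: matrix_matrix_mult_def sum_2)

lemma congruence_subgroup_principal:
  assumes "N \<ge> 1"
  shows "congruence_subgroup (principal_congruence_subgroup N)"
proof -
  interpret group SL2Z by (rule group_SL2Z)
  have "subgroup (principal_congruence_subgroup N) SL2Z"
  proof (rule subgroupI)
    show "principal_congruence_subgroup N \<subseteq> carrier SL2Z"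
      by (auto simp: principal_congruence_subgroup_def)
    have "mat 1 \<in> principal_congruence_subgroup N"
      by (simp add: principal_congruence_subgroup_def SL2Z_carrier_iff mat_def)
    then show "principal_congruence_subgroup N \<noteq> {}" by blast
  next
    fix A B assume AB: "A \<in> principal_congruence_subgroup N" "B \<in> principal_congruence_subgroup N"
    have "A ** B \<in> carrier SL2Z"
      using AB by (simp add: principal_congruence_subgroup_def SL2Z_def det_mul)
    moreover have "[(A ** B) $ 1 $ 1 = 1 * 1 + 0 * 0] (mod int N)" "[(A ** B) $ 1 $ 2 = 1 * 0 + 0 * 1] (mod int N)"
      "[(A ** B) $ 2 $ 1 = 0 * 1 + 1 * 0] (mod int N)" "[(A ** B) $ 2 $ 2 = 0 * 0 + 1 * 1] (mod int N)"
      unfolding matrix_mult_2_entries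
      by (intro cong_add cong_mult; use AB in \<open>simp add: principal_congruence_subgroup_def\<close>)+
    ultimately show "A \<otimes>\<^bsub>SL2Z\<^esub> B \<in> principal_congruence_subgroup N"
      by (simp add: principal_congruence_subgroup_def SL2Z_def)
  next
    fix A assume A: "A \<in> principal_congruence_subgroup N"
    define B :: "int ^ 2 ^ 2" where "B = vector [vector [A $ 2 $ 2, - A $ 1 $ 2], vector [- A $ 2 $ 1, A $ 1 $ 1]]"
    have A': "A \<in> carrier SL2Z" using A by (simp add: principal_congruence_subgroup_def)
    then have B: "B \<in> carrier SL2Z" "B ** A = mat 1"
      unfolding SL2Z_carrier_iff
      by (simp_all add: B_def matrix_mult_2_entries mat_def vec_eq_iff forall_2 algebra_simps)
    then have "inv\<^bsub>SL2Z\<^esub> A = B" using A' by (intro inv_equality) (simp_all add: SL2Z_def)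
    moreover have "[- A $ 1 $ 2 = - 0] (mod int N)" "[- A $ 2 $ 1 = - 0] (mod int N)"
      using A by (simp_all add: principal_congruence_subgroup_def cong_minus_minus_iff del: minus_zero)
    ultimately show "inv\<^bsub>SL2Z\<^esub> A \<in> principal_congruence_subgroup N"
      using A B by (simp add: principal_congruence_subgroup_def B_def)
  qed
  then show ?thesis using assms by (auto simp: congruence_subgroup_def)
qed

section \<open>Automorphy factors and the multiplier system\<close>

lemma SL2Z_denominator_ne_0:
  fixes A :: "int ^ 2 ^ 2" and \<tau> :: complex
  assumes "A \<in> carrier SL2Z" "\<tau> \<in> upper_half_plane"
  shows "of_int (A $ 2 $ 1) * \<tau> + of_int (A $ 2 $ 2) \<noteq> (0::complex)"
  using assms by (intro linear_ne_0) (auto simp: SL2Z_carrier_iff)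

lemma moebius_upper_half_plane:
  fixes A :: "int ^ 2 ^ 2" and \<tau> :: complex
  assumes "A \<in> carrier SL2Z" "\<tau> \<in> upper_half_plane"
  shows "moebius A \<tau> \<in> upper_half_plane"
  using Im_moebius_int[of \<tau>] SL2Z_denominator_ne_0[OF assms] assms
  by (simp add: moebius_def SL2Z_carrier_iff)

lemma denominator_mult:
  fixes A B :: "int ^ 2 ^ 2" and \<tau> :: complex
  assumes "B \<in> carrier SL2Z" "\<tau> \<in> upper_half_plane"
  shows "of_int ((A ** B) $ 2 $ 1) * \<tau> + of_int ((A ** B) $ 2 $ 2)
    = (of_int (A $ 2 $ 1) * moebius B \<tau> + of_int (A $ 2 $ 2)) * (of_int (B $ 2 $ 1) * \<tau> + of_int (B $ 2 $ 2))"
proof -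
  define J where "J = of_int (B $ 2 $ 1) * \<tau> + of_int (B $ 2 $ 2)"
  have "moebius B \<tau> * J = of_int (B $ 1 $ 1) * \<tau> + of_int (B $ 1 $ 2)"
    using SL2Z_denominator_ne_0[OF assms] by (simp add: moebius_def J_def)
  then have "(of_int (A $ 2 $ 1) * moebius B \<tau> + of_int (A $ 2 $ 2)) * J
     = of_int (A $ 2 $ 1) * (of_int (B $ 1 $ 1) * \<tau> + of_int (B $ 1 $ 2)) + of_int (A $ 2 $ 2) * J"
    by (simp add: distrib_right mult.assoc)
  then show ?thesis unfolding J_def by (simp add: matrix_mult_2_entries algebra_simps)
qed

lemma moebius_mult:
  assumes "A \<in> carrier SL2Z" "B \<in> carrier SL2Z" "\<tau> \<in> upper_half_plane"
  shows "moebius (A ** B) \<tau> = moebius A (moebius B \<tau>)"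
proof -
  define J where "J = of_int (B $ 2 $ 1) * \<tau> + of_int (B $ 2 $ 2)"
  have J: "J \<noteq> 0" using SL2Z_denominator_ne_0[OF assms(2,3)] by (simp add: J_def)
  have *: "moebius B \<tau> * J = of_int (B $ 1 $ 1) * \<tau> + of_int (B $ 1 $ 2)"
    using J by (simp add: moebius_def J_def)
  then have "(of_int (A $ 1 $ 1) * moebius B \<tau> + of_int (A $ 1 $ 2)) * J
     = of_int (A $ 1 $ 1) * (of_int (B $ 1 $ 1) * \<tau> + of_int (B $ 1 $ 2)) + of_int (A $ 1 $ 2) * J"
    by (simp add: distrib_right mult.assoc)
  then have "of_int ((A ** B) $ 1 $ 1) * \<tau> + of_int ((A ** B) $ 1 $ 2) = (of_int (A $ 1 $ 1) * moebius B \<tau> + of_int (A $ 1 $ 2)) * J"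
    by (simp add: matrix_mult_2_entries J_def algebra_simps)
  then show ?thesis
    unfolding moebius_def[of "A ** B"] denominator_mult[OF assms(2,3)] J_def[symmetric] using J by (simp add: moebius_def[of A])
qed

text \<open>The integral power satisfies the cocycle rule exactly, so only the square root can
  violate it, by a sign.\<close>

lemma autom_factor_half_integral:
  assumes "A \<in> carrier SL2Z" "\<tau> \<in> upper_half_plane" "l \<ge> 1"
  shows "autom_factor (real l - 1 / 2) A \<tau> = csqrt (of_int (A $ 2 $ 1) * \<tau> + of_int (A $ 2 $ 2))
    * (of_int (A $ 2 $ 1) * \<tau> + of_int (A $ 2 $ 2)) ^ (l - 1)"
proof -
  have "complex_of_real (real l - 1 / 2) = 1 / 2 + of_nat (l - 1)" using assms(3) by simp
  then show ?thesis
    unfolding autom_factor_def using SL2Z_denominator_ne_0[OF assms(1,2)]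
    by (simp add: powr_add csqrt_conv_powr powr_nat')
qed

text \<open>One scalar serves both cosets, all tau and all w. Hence the same multiplier works for
  every l and for both values of nu.\<close>

definition theta_multiplier :: "int ^ 2 ^ 2 \<Rightarrow> complex" where
  "theta_multiplier A = (SOME p. norm p = 1 \<and> (\<forall>h\<in>{0, 1/2}. \<forall>\<tau>\<in>upper_half_plane. \<forall>w.
     theta_completed h (w / (of_int (A $ 2 $ 1) * \<tau> + of_int (A $ 2 $ 2))) (moebius A \<tau>)
       = csqrt (of_int (A $ 2 $ 1) * \<tau> + of_int (A $ 2 $ 2)) * (p * theta_completed h w \<tau>)))"

lemma theta_multiplier:
  assumes "A \<in> principal_congruence_subgroup 4"
  shows "norm (theta_multiplier A) = 1"
    and "\<lbrakk>h \<in> {0, 1/2}; \<tau> \<in> upper_half_plane\<rbrakk> \<Longrightarrow>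
      theta_completed h (w / (of_int (A $ 2 $ 1) * \<tau> + of_int (A $ 2 $ 2))) (moebius A \<tau>)
       = csqrt (of_int (A $ 2 $ 1) * \<tau> + of_int (A $ 2 $ 2)) * (theta_multiplier A * theta_completed h w \<tau>)"
proof -
  have "A $ 1 $ 1 * A $ 2 $ 2 - A $ 1 $ 2 * A $ 2 $ 1 = 1" "4 dvd A $ 2 $ 1" "4 dvd A $ 1 $ 2"
    using assms by (auto simp: principal_congruence_subgroup_def SL2Z_carrier_iff cong_0_iff)
  from someI_ex[OF theta_completed_modular_scalar[OF this]]
  have *: "norm (theta_multiplier A) = 1 \<and> (\<forall>h\<in>{0, 1/2}. \<forall>\<tau>\<in>upper_half_plane. \<forall>w.
     theta_completed h (w / (of_int (A $ 2 $ 1) * \<tau> + of_int (A $ 2 $ 2))) (moebius A \<tau>)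
       = csqrt (of_int (A $ 2 $ 1) * \<tau> + of_int (A $ 2 $ 2)) * (theta_multiplier A * theta_completed h w \<tau>))"
    unfolding theta_multiplier_def moebius_def .
  show "norm (theta_multiplier A) = 1" using * by blast
  show "\<lbrakk>h \<in> {0, 1/2}; \<tau> \<in> upper_half_plane\<rbrakk> \<Longrightarrow>
      theta_completed h (w / (of_int (A $ 2 $ 1) * \<tau> + of_int (A $ 2 $ 2))) (moebius A \<tau>)
       = csqrt (of_int (A $ 2 $ 1) * \<tau> + of_int (A $ 2 $ 2)) * (theta_multiplier A * theta_completed h w \<tau>)"
    using * by blast
qed

text \<open>The root of the product differs from the product of the roots by a constant sign.
  Evaluating the theta transformation of A B in two ways at tau = i and w = 0 shows that the
  multipliers have the same defect, and the two signs cancel.\<close>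

lemma multiplier_system_theta:
  assumes "l \<ge> 1"
  shows "multiplier_system (principal_congruence_subgroup 4) (real l - 1 / 2) theta_multiplier"
  unfolding multiplier_system_def
proof (intro conjI ballI)
  fix A assume "A \<in> principal_congruence_subgroup 4"
  then show "norm (theta_multiplier A) = 1" by (rule theta_multiplier)
next
  fix A B and \<tau> :: complex
  assume A: "A \<in> principal_congruence_subgroup 4" and B: "B \<in> principal_congruence_subgroup 4" and tau: "\<tau> \<in> upper_half_plane"
  interpret subgroup "principal_congruence_subgroup 4" SL2Z
    using congruence_subgroup_principal[of 4] by (simp add: congruence_subgroup_def)
  have AB: "A ** B \<in> principal_congruence_subgroup 4" using m_closed[OF A B] by (simp add: SL2Z_def)
  have c: "A \<in> carrier SL2Z" "B \<in> carrier SL2Z" "A ** B \<in> carrier SL2Z" using A B AB mem_carrier by blast+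
  define J where "J = (\<lambda>A::int^2^2. \<lambda>\<tau>::complex. of_int (A $ 2 $ 1) * \<tau> + of_int (A $ 2 $ 2))"
  have Jm: "J (A ** B) \<tau> = J A (moebius B \<tau>) * J B \<tau>" if "\<tau> \<in> upper_half_plane" for \<tau>
    unfolding J_def by (rule denominator_mult[OF c(2) that])
  have J0: "J A \<tau> \<noteq> 0" if "A \<in> carrier SL2Z" "\<tau> \<in> upper_half_plane" for A \<tau>
    unfolding J_def by (rule SL2Z_denominator_ne_0[OF that])
  have J: "of_int (A $ 2 $ 1) * \<tau> + of_int (A $ 2 $ 2) = J A \<tau>" for A \<tau> by (simp add: J_def)
  note mB = moebius_upper_half_plane[OF c(2)]
  have "\<exists>\<epsilon>\<in>{1, - 1}. \<forall>\<tau>\<in>upper_half_plane. csqrt (J (A ** B) \<tau>) = \<epsilon> * (csqrt (J A (moebius B \<tau>)) * csqrt (J B \<tau>))"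
  proof (rule continuous_square_eq_imp_sign[OF connected_upper_half_plane])
    have cJ: "continuous_on upper_half_plane (\<lambda>\<tau>. csqrt (J A \<tau>))" for A
      unfolding J_def by (rule continuous_on_csqrt_linear)
    have "continuous_on upper_half_plane (moebius B)"
      unfolding moebius_def using J0[OF c(2)] by (intro continuous_intros) (auto simp: J_def)
    then have "continuous_on upper_half_plane (\<lambda>\<tau>. csqrt (J A (moebius B \<tau>)))"
      by (rule continuous_on_compose2[OF cJ]) (use mB in auto)
    then show "continuous_on upper_half_plane (\<lambda>\<tau>. csqrt (J A (moebius B \<tau>)) * csqrt (J B \<tau>))"
      by (intro continuous_on_mult cJ)
    show "continuous_on upper_half_plane (\<lambda>\<tau>. csqrt (J (A ** B) \<tau>))" by (rule cJ)
    fix \<tau> :: complex assume tau: "\<tau> \<in> upper_half_plane"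
    show "(csqrt (J (A ** B) \<tau>))\<^sup>2 = (csqrt (J A (moebius B \<tau>)) * csqrt (J B \<tau>))\<^sup>2"
      unfolding power_mult_distrib power2_csqrt by (rule Jm[OF tau])
    show "csqrt (J A (moebius B \<tau>)) * csqrt (J B \<tau>) \<noteq> 0"
      using J0[OF c(2) tau] J0[OF c(1) mB[OF tau]] by simp
  qed
  then obtain \<epsilon> where \<epsilon>: "\<And>\<tau>. \<tau> \<in> upper_half_plane \<Longrightarrow> csqrt (J (A ** B) \<tau>) = \<epsilon> * (csqrt (J A (moebius B \<tau>)) * csqrt (J B \<tau>))"
    by blast
  have i: "\<i> \<in> upper_half_plane" by simp
  define t where "t = theta_completed 0 0 \<i>"
  have "theta_completed 0 0 (moebius (A ** B) \<i>) = csqrt (J (A ** B) \<i>) * (theta_multiplier (A ** B) * t)"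
    using theta_multiplier(2)[OF AB _ i, of 0 0] by (simp add: t_def J_def)
  moreover have "theta_completed 0 0 (moebius A (moebius B \<i>)) = csqrt (J A (moebius B \<i>)) * (theta_multiplier A * (csqrt (J B \<i>) * (theta_multiplier B * t)))"
    using theta_multiplier(2)[OF A _ mB[OF i], of 0 0] theta_multiplier(2)[OF B _ i, of 0 0] by (simp add: t_def J_def)
  ultimately have "(csqrt (J A (moebius B \<i>)) * csqrt (J B \<i>) * t) * (\<epsilon> * theta_multiplier (A ** B))
     = (csqrt (J A (moebius B \<i>)) * csqrt (J B \<i>) * t) * (theta_multiplier A * theta_multiplier B)"
    unfolding moebius_mult[OF c(1,2) i] \<epsilon>[OF i] by (simp only: mult_ac)
  then have e: "\<epsilon> * theta_multiplier (A ** B) = theta_multiplier A * theta_multiplier B"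
    using J0[OF c(2) i] J0[OF c(1) mB[OF i]] theta_completed_i_ne_0[of 0] by (simp add: t_def)
  have "theta_multiplier (A ** B) * autom_factor (real l - 1 / 2) (A ** B) \<tau>
     = (\<epsilon> * theta_multiplier (A ** B)) * (csqrt (J A (moebius B \<tau>)) * J A (moebius B \<tau>) ^ (l - 1)) * (csqrt (J B \<tau>) * J B \<tau> ^ (l - 1))"
    unfolding autom_factor_half_integral[OF c(3) tau assms] J \<epsilon>[OF tau] unfolding Jm[OF tau] power_mult_distrib
    by (simp only: mult_ac)
  then show "theta_multiplier (A ** B) * autom_factor (real l - 1 / 2) (A ** B) \<tau>
     = theta_multiplier A * theta_multiplier B * autom_factor (real l - 1 / 2) A (moebius B \<tau>) * autom_factor (real l - 1 / 2) B \<tau>"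
    unfolding e autom_factor_half_integral[OF c(1) mB[OF tau] assms] autom_factor_half_integral[OF c(2) tau assms] J .
qed

subsection \<open>Almost holomorphic modularity of the theta derivatives\<close>

text \<open>Replacing w by j w contributes j^(l - 1) to the derivative of order l - 1 at 0. No lower
  derivatives appear, since the completed function transforms without an exponential in w.\<close>

lemma theta_l_nu_transform:
  assumes tau: "Im \<tau> > 0" and j: "j \<noteq> 0" and \<nu>: "\<nu> \<in> {- 1, 0}"
    and T: "\<And>w. theta_completed (coset_shift \<nu>) (w / j) \<sigma> = \<mu> * (p * theta_completed 0 w \<tau> + q * theta_completed (1/2) w \<tau>)"
  shows "theta_l_nu l \<nu> \<sigma> = \<mu> * j ^ (l - 1) * (p * theta_l_nu l (- 1) \<tau> + q * theta_l_nu l 0 \<tau>)"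
proof -
  define f where "f = (\<lambda>h w. - theta_completed h w \<tau>)"
  have f: "f h holomorphic_on UNIV" for h
    unfolding f_def theta_completed_def
    by (intro holomorphic_on_minus holomorphic_on_mult holomorphic_on_gauss_theta_exponential tau holomorphic_intros) auto
  have "theta_completed (coset_shift \<nu>) w \<sigma> = \<mu> * (p * theta_completed 0 (j * w) \<tau> + q * theta_completed (1/2) (j * w) \<tau>)" for w
    using T[of "j * w"] j by simp
  then have "theta_l_nu l \<nu> \<sigma> = (deriv ^^ (l - 1)) (\<lambda>w. (\<lambda>w. \<mu> * p * f 0 w + \<mu> * q * f (1/2) w) (j * w)) 0"
    unfolding theta_l_nu_eq_completed f_def by (simp add: algebra_simps)
  also have "\<dots> = j ^ (l - 1) * (deriv ^^ (l - 1)) (\<lambda>w. \<mu> * p * f 0 w + \<mu> * q * f (1/2) w) (j * 0)"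
    by (rule higher_deriv_compose_linear[of _ UNIV UNIV]) (auto intro!: holomorphic_intros f)
  also have "(deriv ^^ (l - 1)) (\<lambda>w. \<mu> * p * f 0 w + \<mu> * q * f (1/2) w) (j * 0)
      = (deriv ^^ (l - 1)) (\<lambda>w. \<mu> * p * f 0 w) 0 + \<mu> * q * (deriv ^^ (l - 1)) (f (1/2)) 0"
    by (subst higher_deriv_add_cmult) (auto intro!: holomorphic_intros f)
  also have "(deriv ^^ (l - 1)) (\<lambda>w. \<mu> * p * f 0 w) 0 = \<mu> * p * (deriv ^^ (l - 1)) (f 0) 0"
    by (rule higher_deriv_cmult[of _ UNIV]) (auto intro: f)
  finally show ?thesis
    by (simp add: theta_l_nu_eq_completed f_def coset_shift_def algebra_simps)
qed

text \<open>The fixed denominator 4 without a shift makes this class closed under linear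
  combinations; the exponents (m + h)^2 of the theta series are quarters of squares.\<close>

definition quarter_q_series :: "(complex \<Rightarrow> complex) \<Rightarrow> bool" where
  "quarter_q_series g \<longleftrightarrow> (\<exists>a::nat \<Rightarrow> complex. \<forall>\<tau>\<in>upper_half_plane. (\<lambda>n. a n * qpow (real n / 4) \<tau>) sums g \<tau>)"

lemma quarter_q_series_imp_meromorphic: "quarter_q_series g \<Longrightarrow> meromorphic_at_ii_inf g"
  unfolding quarter_q_series_def meromorphic_at_ii_inf_def
  by (intro exI[of _ "4::nat"] conjI exI[of _ "0::real"]) auto

lemma quarter_q_series_add:
  assumes "quarter_q_series f" "quarter_q_series g"
  shows "quarter_q_series (\<lambda>\<tau>. f \<tau> + g \<tau>)"
proof -
  obtain a b where ab: "\<And>\<tau>. \<tau> \<in> upper_half_plane \<Longrightarrow> (\<lambda>n. a n * qpow (real n / 4) \<tau>) sums f \<tau>"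
    "\<And>\<tau>. \<tau> \<in> upper_half_plane \<Longrightarrow> (\<lambda>n. b n * qpow (real n / 4) \<tau>) sums g \<tau>"
    using assms unfolding quarter_q_series_def by blast
  have "(\<lambda>n. (a n + b n) * qpow (real n / 4) \<tau>) sums (f \<tau> + g \<tau>)" if "\<tau> \<in> upper_half_plane" for \<tau>
    unfolding distrib_right by (intro sums_add ab that)
  then show ?thesis unfolding quarter_q_series_def by (intro exI[of _ "\<lambda>n. a n + b n"]) blast
qed

lemma quarter_q_series_cmult:
  assumes "quarter_q_series f"
  shows "quarter_q_series (\<lambda>\<tau>. c * f \<tau>)"
proof -
  obtain a where a: "\<And>\<tau>. \<tau> \<in> upper_half_plane \<Longrightarrow> (\<lambda>n. a n * qpow (real n / 4) \<tau>) sums f \<tau>"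
    using assms unfolding quarter_q_series_def by blast
  have "(\<lambda>n. (c * a n) * qpow (real n / 4) \<tau>) sums (c * f \<tau>)" if "\<tau> \<in> upper_half_plane" for \<tau>
    unfolding mult.assoc by (intro sums_mult a that)
  then show ?thesis unfolding quarter_q_series_def by (intro exI[of _ "\<lambda>n. c * a n"]) blast
qed

lemma quarter_q_series_sum:
  assumes "\<And>i. i \<in> I \<Longrightarrow> quarter_q_series (f i)"
  shows "quarter_q_series (\<lambda>\<tau>. \<Sum>i\<in>I. f i \<tau>)"
  using assms
proof (induction I rule: infinite_finite_induct)
  case (insert i I)
  then show ?case by (simp add: quarter_q_series_add)
qed (auto simp: quarter_q_series_def intro!: exI[of _ "\<lambda>_. 0"])

lemma quarter_q_series_gauss_theta:
  assumes h: "h \<in> {0, 1/2}"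
  shows "quarter_q_series (\<lambda>\<tau>. gauss_theta i h (theta_exponent \<tau>) 0)"
proof -
  define e :: int where "e = (if h = 0 then 0 else 1)"
  have he: "2 * h = of_int e" using h by (auto simp: e_def)
  \<comment> \<open>This is 4 (m + h)^2 as a natural number. Its fibres are finite, so the theta
    series can be regrouped into a power series in q^(1/4).\<close>
  define \<phi> where "\<phi> = (\<lambda>m::int. nat ((2 * m + e)\<^sup>2))"
  have \<phi>: "(of_int m + h)\<^sup>2 = real (\<phi> m) / 4" for m
  proof -
    have "real (\<phi> m) = real_of_int ((2 * m + e)\<^sup>2)" by (simp add: \<phi>_def)
    also have "\<dots> = (2 * of_int m + 2 * h)\<^sup>2" by (simp add: he)
    also have "\<dots> = 4 * (of_int m + h)\<^sup>2" by (simp add: power2_eq_square algebra_simps)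
    finally show ?thesis by simp
  qed
  define F where "F = (\<lambda>n. {m. \<phi> m = n})"
  have fin: "finite (F n)" for n
  proof (rule finite_subset)
    show "F n \<subseteq> {- int n - 1..int n + 1}"
    proof
      fix m assume "m \<in> F n"
      then have "(2 * m + e)\<^sup>2 = int n" by (auto simp: F_def \<phi>_def)
      moreover have "\<bar>2 * m + e\<bar> \<le> (2 * m + e)\<^sup>2"
        using self_le_power[of "\<bar>2 * m + e\<bar>" 2] by (cases "2 * m + e = 0") auto
      ultimately have "\<bar>2 * m + e\<bar> \<le> int n" by simp
      then show "m \<in> {- int n - 1..int n + 1}" by (auto simp: e_def split: if_splits)
    qed
  qed simp
  define a where "a = (\<lambda>n. \<Sum>m\<in>F n. complex_of_real (of_int m + h) ^ i)"
  have "(\<lambda>n. a n * qpow (real n / 4) \<tau>) sums gauss_theta i h (theta_exponent \<tau>) 0" if tau: "\<tau> \<in> upper_half_plane" for \<tau>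
  proof -
    define f where "f = (\<lambda>m::int. gauss_term i (of_int m + h) (theta_exponent \<tau>) 0)"
    have f: "f m = complex_of_real (of_int m + h) ^ i * qpow (real (\<phi> m) / 4) \<tau>" for m
      unfolding f_def gauss_term_def qpow_def \<phi>[symmetric] by (simp add: mult_ac)
    have "(f has_sum gauss_theta i h (theta_exponent \<tau>) 0) UNIV"
      unfolding f_def using tau by (intro gauss_theta_has_sum) simp
    moreover have "bij_betw snd (Sigma UNIV F) UNIV"
      by (rule bij_betwI[of _ _ _ "\<lambda>m. (\<phi> m, m)"]) (auto simp: F_def)
    ultimately have "((\<lambda>x. f (snd x)) has_sum gauss_theta i h (theta_exponent \<tau>) 0) (Sigma UNIV F)"
      by (simp add: has_sum_reindex_bij_betw)
    then have "((\<lambda>n. \<Sum>m\<in>F n. f m) has_sum gauss_theta i h (theta_exponent \<tau>) 0) UNIV"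
      by (rule has_sum_SigmaD) (use fin in \<open>auto intro: has_sum_finiteI\<close>)
    moreover have "(\<Sum>m\<in>F n. f m) = a n * qpow (real n / 4) \<tau>" for n
      unfolding a_def sum_distrib_right by (rule sum.cong) (auto simp: f F_def)
    ultimately show ?thesis by (simp add: has_sum_imp_sums)
  qed
  then show ?thesis unfolding quarter_q_series_def by blast
qed

text \<open>For an arbitrary A in the modular group the slashed function is a linear combination of
  the two theta derivatives. Their Leibniz expansions are polynomials in 1 / v with theta series as
  coefficients, which settles all cusps at once.\<close>

lemma theta_l_nu_almost_holomorphic:
  assumes l: "l \<ge> 1" and \<nu>: "\<nu> \<in> {- 1, 0}"
  shows "almost_holomorphic_modular_form (principal_congruence_subgroup 4) theta_multiplier (real l - 1 / 2) (theta_l_nu l \<nu>)"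
  unfolding almost_holomorphic_modular_form_def
proof (intro conjI ballI)
  show "multiplier_system (principal_congruence_subgroup 4) (real l - 1 / 2) theta_multiplier"
    by (rule multiplier_system_theta[OF l])
  have h: "coset_shift \<nu> \<in> {0, 1/2}" using \<nu> by (auto simp: coset_shift_def)
next
  fix A and \<tau> :: complex
  assume A: "A \<in> principal_congruence_subgroup 4" and tau: "\<tau> \<in> upper_half_plane"
  have c: "A \<in> carrier SL2Z" using A by (simp add: principal_congruence_subgroup_def)
  have T: "theta_completed (coset_shift \<nu>) (w / (of_int (A $ 2 $ 1) * \<tau> + of_int (A $ 2 $ 2))) (moebius A \<tau>)
     = csqrt (of_int (A $ 2 $ 1) * \<tau> + of_int (A $ 2 $ 2)) * ((if \<nu> = - 1 then theta_multiplier A else 0) * theta_completed 0 w \<tau>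
       + (if \<nu> = - 1 then 0 else theta_multiplier A) * theta_completed (1/2) w \<tau>)" for w
    using theta_multiplier(2)[OF A _ tau, of "coset_shift \<nu>" w] \<nu> by (auto simp: coset_shift_def)
  have "theta_l_nu l \<nu> (moebius A \<tau>) = csqrt (of_int (A $ 2 $ 1) * \<tau> + of_int (A $ 2 $ 2)) * (of_int (A $ 2 $ 1) * \<tau> + of_int (A $ 2 $ 2)) ^ (l - 1)
     * ((if \<nu> = - 1 then theta_multiplier A else 0) * theta_l_nu l (- 1) \<tau> + (if \<nu> = - 1 then 0 else theta_multiplier A) * theta_l_nu l 0 \<tau>)"
    by (rule theta_l_nu_transform[OF _ SL2Z_denominator_ne_0[OF c tau] \<nu> T]) (use tau in simp)
  then show "theta_l_nu l \<nu> (moebius A \<tau>) = theta_multiplier A * autom_factor (real l - 1 / 2) A \<tau> * theta_l_nu l \<nu> \<tau>"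
    unfolding autom_factor_half_integral[OF c tau l] using \<nu> by auto
next
  fix A assume c: "A \<in> carrier SL2Z"
  define J where "J = (\<lambda>\<tau>::complex. of_int (A $ 2 $ 1) * \<tau> + of_int (A $ 2 $ 2))"
  have J: "of_int (A $ 2 $ 1) * \<tau> + of_int (A $ 2 $ 2) = J \<tau>" for \<tau> by (simp add: J_def)
  from theta_completed_modular[of "A $ 1 $ 1" "A $ 2 $ 2" "A $ 1 $ 2" "A $ 2 $ 1"] c
  obtain p q where T: "\<And>\<tau> w. \<tau> \<in> upper_half_plane \<Longrightarrow> theta_completed (coset_shift \<nu>) (w / J \<tau>) (moebius A \<tau>)
      = csqrt (J \<tau>) * (p * theta_completed 0 w \<tau> + q * theta_completed (1/2) w \<tau>)"
    using \<nu> unfolding SL2Z_carrier_iff moebius_def J_def coset_shift_def by fastforce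
  \<comment> \<open>\<open>C i\<close> is 0 when l - 1 - i is odd; these are the indices at which
    the division in the exponent \<open>e i\<close> below rounds.\<close>
  define C where "C = (\<lambda>i. if even (l - 1 - i) then - (of_nat ((l - 1) choose i) * (2 * of_real pi * \<i>) ^ i
     * (fact (l - 1 - i) / fact ((l - 1 - i) div 2) * (of_real pi / 4) ^ ((l - 1 - i) div 2))) else 0 :: complex)"
  define e where "e = (\<lambda>i. (l - 1 - i) div 2)"
  have exp: "theta_l_nu l \<nu> \<tau> = (\<Sum>i=0..l - 1. C i * gauss_theta i (coset_shift \<nu>) (theta_exponent \<tau>) 0 / of_real (Im \<tau>) ^ e i)"
    if "\<tau> \<in> upper_half_plane" for \<tau> \<nu>
  proof -
    have "Im \<tau> > 0" using that by simp
    show ?thesis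
      unfolding theta_l_nu_expansion[OF \<open>Im \<tau> > 0\<close>] sum_negf[symmetric] C_def e_def
      by (rule sum.cong) (simp_all add: power_divide power_mult_distrib mult_ac)
  qed
  define X where "X = (\<lambda>i \<tau>. C i * (p * gauss_theta i 0 (theta_exponent \<tau>) 0 + q * gauss_theta i (1/2) (theta_exponent \<tau>) 0))"
  define g where "g = (\<lambda>t \<tau>. \<Sum>i\<in>{i\<in>{0..l - 1}. e i = t}. X i \<tau>)"
  have hol: "(\<lambda>\<tau>. gauss_theta i h (theta_exponent \<tau>) 0) holomorphic_on upper_half_plane" for i h
    by (intro holomorphic_on_gauss_theta open_upper_half_plane holomorphic_intros) auto
  show "\<exists>(P::nat) g. (\<forall>j\<le>P. g j holomorphic_on upper_half_plane \<and> meromorphic_at_ii_inf (g j)) \<and>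
      (\<forall>\<tau>\<in>upper_half_plane. theta_l_nu l \<nu> (moebius A \<tau>) / autom_factor (real l - 1 / 2) A \<tau> = (\<Sum>j\<le>P. g j \<tau> / of_real (Im \<tau>) ^ j))"
  \<comment> \<open>No exponent \<open>e i\<close> exceeds l, so the degree bound l accommodates all
    groups of equal exponent.\<close>
  proof (intro exI[of _ l] exI[of _ g] conjI allI impI ballI)
    fix t
    show "g t holomorphic_on upper_half_plane"
      unfolding g_def X_def by (intro holomorphic_on_sum holomorphic_on_mult holomorphic_on_add holomorphic_on_const hol)
    show "meromorphic_at_ii_inf (g t)"
      unfolding g_def X_def
      by (intro quarter_q_series_imp_meromorphic quarter_q_series_sum quarter_q_series_cmult quarter_q_series_add quarter_q_series_gauss_theta) auto
  next
    fix \<tau> :: complex assume tau: "\<tau> \<in> upper_half_plane"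
    note J0 = SL2Z_denominator_ne_0[OF c tau, unfolded J]
    have "theta_l_nu l \<nu> (moebius A \<tau>) = csqrt (J \<tau>) * J \<tau> ^ (l - 1) * (p * theta_l_nu l (- 1) \<tau> + q * theta_l_nu l 0 \<tau>)"
      by (rule theta_l_nu_transform[OF _ J0 \<nu> T[OF tau]]) (use tau in simp)
    then have "theta_l_nu l \<nu> (moebius A \<tau>) / autom_factor (real l - 1 / 2) A \<tau> = p * theta_l_nu l (- 1) \<tau> + q * theta_l_nu l 0 \<tau>"
      unfolding autom_factor_half_integral[OF c tau l] J using J0 by simp
    also have "\<dots> = (\<Sum>i=0..l - 1. X i \<tau> / of_real (Im \<tau>) ^ e i)"
      unfolding exp[OF tau] sum_distrib_left sum.distrib[symmetric] X_def
      by (rule sum.cong) (simp_all add: coset_shift_def add_divide_distrib distrib_left mult_ac)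
    also have "\<dots> = (\<Sum>t\<le>l. \<Sum>i\<in>{i\<in>{0..l - 1}. e i = t}. X i \<tau> / of_real (Im \<tau>) ^ e i)"
      by (rule sum.group[symmetric]) (auto simp: e_def)
    also have "\<dots> = (\<Sum>t\<le>l. g t \<tau> / of_real (Im \<tau>) ^ t)"
      unfolding g_def sum_divide_distrib by (intro sum.cong) auto
    finally show "theta_l_nu l \<nu> (moebius A \<tau>) / autom_factor (real l - 1 / 2) A \<tau> = (\<Sum>t\<le>l. g t \<tau> / of_real (Im \<tau>) ^ t)" .
  qed
qed

theorem theorem1p3:
  fixes k :: nat
  assumes "even k" and "k > 0"
  shows "(\<forall>a b c d :: int. a * d - b * c = 1 \<longrightarrow>
            (\<forall>\<tau>\<in>upper_half_plane.
               JJ_hat k ((of_int a * \<tau> + of_int b) / (of_int c * \<tau> + of_int d))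
                 = (of_int c * \<tau> + of_int d) ^ k * JJ_hat k \<tau>))
       \<and> (\<forall>\<tau>\<in>upper_half_plane.
            L_op (JJ_hat k) \<tau>
              = - of_bool (k = 2) / (8 * of_real pi)
                - \<i> * of_nat (k - 1) / (8 * (2 * of_real pi * \<i>) ^ (k - 1)) * of_real (sqrt (Im \<tau>))
                  * (cnj (theta1 (2 * \<tau>)) * theta_l_nu (k - 1) (- 1) \<tau>
                     + cnj (theta3 (2 * \<tau>)) * theta_l_nu (k - 1) 0 \<tau>))
       \<and> (\<forall>l\<ge>1. \<forall>\<nu>\<in>{- 1, 0}. \<exists>G \<psi>.
            congruence_subgroup G
            \<and> almost_holomorphic_modular_form G \<psi> (real l - 1 / 2) (theta_l_nu l \<nu>))"
proof -
  obtain n where "k = 2 * n" using assms(1) by blast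
  then obtain m where k: "k = 2 * m + 2" using assms(2) by (cases n) auto
  have k1: "k - 1 = 2 * m + 1" and k2: "k = 2 \<longleftrightarrow> m = 0" using k by simp_all
  show ?thesis
  proof (intro conjI allI ballI impI)
    fix a b c d :: int and \<tau> :: complex
    assume "a * d - b * c = 1" "\<tau> \<in> upper_half_plane"
    then show "JJ_hat k ((of_int a * \<tau> + of_int b) / (of_int c * \<tau> + of_int d)) = (of_int c * \<tau> + of_int d) ^ k * JJ_hat k \<tau>"
      unfolding k by (intro JJ_hat_modular) auto
  next
    fix \<tau> :: complex assume "\<tau> \<in> upper_half_plane"
    then show "L_op (JJ_hat k) \<tau>
              = - of_bool (k = 2) / (8 * of_real pi)
                - \<i> * of_nat (k - 1) / (8 * (2 * of_real pi * \<i>) ^ (k - 1)) * of_real (sqrt (Im \<tau>))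
                  * (cnj (theta1 (2 * \<tau>)) * theta_l_nu (k - 1) (- 1) \<tau>
                     + cnj (theta3 (2 * \<tau>)) * theta_l_nu (k - 1) 0 \<tau>)"
      unfolding k1 k2 unfolding k by (intro L_op_JJ_hat) auto
  next
    fix l :: nat and \<nu> :: int assume "l \<ge> 1" "\<nu> \<in> {- 1, 0}"
    then show "\<exists>G \<psi>. congruence_subgroup G \<and> almost_holomorphic_modular_form G \<psi> (real l - 1 / 2) (theta_l_nu l \<nu>)"
      using theta_l_nu_almost_holomorphic congruence_subgroup_principal[of 4] by auto
  qed
qed

end
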